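(* Let $G$ be a ribbon graph, $D=D(G)=(E,\mathcal{F})$, and $e\in E(G)$. Then (1) $e$ is a loop in $G$ if and only if $e$ is a ribbon loop in $D(G)$; (2) $e$ is an orientable loop in $G$ if and only if $e$ is an orientable ribbon loop in $D(G)$; (3) $e$ is a trivial loop in $G$ if and only if $e$ is a trivial ribbon loop in $D(G)$.
   Context: A ribbon graph $G=(V,E)$ is a surface with boundary, represented as the union of two finite sets of discs, the vertices $V$ and the edges $E$, such that: the vertices and edges intersect in disjoint line segments; each such line segment lies on the boundary of precisely one vertex and precisely one edge; every edge contains exactly two such line segments. For $A\subseteq E$, $f(A)$ is the number of boundary components of the spanning ribbon subgraph $(V,A)$; $k(G)$ is the number of connected components of $G$. The delta-matroid $D(G)$ has ground set $E$ and feasible sets the $A\subseteq E$ with $f(A)=k(G)$ (the edge sets of spanning quasi-trees). Loops in ribbon graphs: an edge $e$ is a loop if it is incident with exactly one vertex (the term is also used for the ribbon subgraph consisting of $e$ and that vertex). A loop or cycle is non-orientable if it is homeomorphic to a Möbius band, and orientable otherwise. Two cycles $C_1,C_2$ of $G$ are interlaced if there is a vertex $v$ with $V(C_1)\cap V(C_2)=\{v\}$ and $C_1$ and $C_2$ are met in the cyclic order $C_1\,C_2\,C_1\,C_2$ when travelling around the boundary of $v$. A loop is non-trivial if it is interlaced with some cycle of $G$, and trivial otherwise. Ribbon loops in a delta-matroid $D=(E,\mathcal{F})$: $D_{\min}$ is the matroid on $E$ whose bases are the feasible sets of minimum cardinality; $D*e=(E,\{F\bigtriangleup\{e\}\mid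 F\in\mathcal{F}\})$. An element $e$ is a ribbon loop of $D$ if $e$ is a loop of $D_{\min}$ (that is, in no basis of $D_{\min}$). A ribbon loop $e$ is non-orientable if $e$ is a ribbon loop in $D*e$, and orientable otherwise. An orientable ribbon loop $e$ is trivial if $e$ is in no feasible set of $D$, and non-trivial otherwise. A non-orientable ribbon loop $e$ is trivial if $F\bigtriangleup\{e\}\in\mathcal{F}$ for every $F\in\mathcal{F}$, and non-trivial otherwise. *)

theory Defs
  imports "HOL-Analysis.Analysis"
begin

section \<open>Surfaces with boundary\<close>

text \<open>Surfaces are subsets of an arbitrary Hausdorff space with the subspace topology.
  Second countability need not be required: all surfaces below are finite unions of discs.\<close>

definition surface_with_boundary :: "'a::t2_space set \<Rightarrow> bool" where
  "surface_with_boundary S \<longleftrightarrow>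
     (\<forall>x\<in>S. \<exists>U W. openin (top_of_set S) U \<and> x \<in> U \<and>
        openin (top_of_set {z::complex. 0 \<le> Im z}) W \<and> U homeomorphic W)"

text \<open>The manifold boundary, i.e. the points without a neighbourhood that is an open disc;
  not the topological frontier in the ambient space.\<close>

definition surface_boundary :: "'a::t2_space set \<Rightarrow> 'a set" where
  "surface_boundary S =
     {x \<in> S. \<not> (\<exists>U. openin (top_of_set S) U \<and> x \<in> U \<and> U homeomorphic ball (0::complex) 1)}"

text \<open>The rectangle \<open>[0,1] \<times> [-1,1]\<close> with \<open>(0,y)\<close> and \<open>(1,-y)\<close> identified, and no other
  identifications: the points \<open>(u, w)\<close> over \<open>u\<close> in the unit circle have \<open>w\<close> on the segment
  joining the two square roots of \<open>u\<close>.\<close>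

definition moebius_band :: "(complex \<times> complex) set" where
  "moebius_band =
     (\<lambda>(x, y). (cis (2 * pi * x), of_real y * cis (pi * x))) ` ({0..1} \<times> {-1..1})"

section \<open>Ribbon graphs\<close>

record 'a ribbon_rep =
  verts :: "'a set set"
  edges :: "'a set set"

definition surface_of :: "'a ribbon_rep \<Rightarrow> 'a set" where
  "surface_of G = \<Union>(verts G \<union> edges G)"

definition line_segments :: "'a::t2_space ribbon_rep \<Rightarrow> 'a set set" where
  "line_segments G = (\<Union>v\<in>verts G. \<Union>e\<in>edges G. components (v \<inter> e))"

definition ribbon_graph :: "'a::t2_space ribbon_rep \<Rightarrow> bool" where
  "ribbon_graph G \<longleftrightarrow>
     surface_with_boundary (surface_of G) \<and>
     finite (verts G) \<and> finite (edges G) \<and>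
     (\<forall>d \<in> verts G \<union> edges G. d homeomorphic cball (0::complex) 1) \<and>
     pairwise disjnt (verts G) \<and> pairwise disjnt (edges G) \<and>
     pairwise disjnt (line_segments G) \<and>
     (\<forall>s \<in> line_segments G. s homeomorphic {0..1::real} \<and>
        (\<exists>!v. v \<in> verts G \<and> s \<subseteq> surface_boundary v) \<and>
        (\<exists>!e. e \<in> edges G \<and> s \<subseteq> surface_boundary e)) \<and>
     (\<forall>e \<in> edges G. card {s \<in> line_segments G. s \<subseteq> e} = 2)"

definition num_components :: "'a::t2_space ribbon_rep \<Rightarrow> nat" where
  "num_components G = card (components (surface_of G))"

definition spanning_subgraph :: "'a ribbon_rep \<Rightarrow> 'a set set \<Rightarrow> 'a ribbon_rep" where
  "spanning_subgraph G A = \<lparr>verts = verts G, edges = A\<rparr>"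

definition num_boundary_components :: "'a::t2_space ribbon_rep \<Rightarrow> nat" where
  "num_boundary_components G = card (components (surface_boundary (surface_of G)))"

definition ends :: "'a ribbon_rep \<Rightarrow> 'a set \<Rightarrow> 'a set set" where
  "ends G e = {v \<in> verts G. v \<inter> e \<noteq> {}}"

definition loop_in :: "'a ribbon_rep \<Rightarrow> 'a set \<Rightarrow> bool" where
  "loop_in G e \<longleftrightarrow> e \<in> edges G \<and> card (ends G e) = 1"

definition loop_subgraph :: "'a ribbon_rep \<Rightarrow> 'a set \<Rightarrow> 'a ribbon_rep" where
  "loop_subgraph G e = \<lparr>verts = ends G e, edges = {e}\<rparr>"

definition nonorientable_loop :: "'a::t2_space ribbon_rep \<Rightarrow> 'a set \<Rightarrow> bool" where
  "nonorientable_loop G e \<longleftrightarrow>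
     loop_in G e \<and> surface_of (loop_subgraph G e) homeomorphic moebius_band"

definition orientable_loop :: "'a::t2_space ribbon_rep \<Rightarrow> 'a set \<Rightarrow> bool" where
  "orientable_loop G e \<longleftrightarrow> loop_in G e \<and> \<not> nonorientable_loop G e"

text \<open>Cycles are ribbon subgraphs. Length 1 (a loop) and length 2 (two parallel edges) are
  allowed.\<close>

definition cycle_of :: "'a ribbon_rep \<Rightarrow> 'a ribbon_rep \<Rightarrow> bool" where
  "cycle_of G C \<longleftrightarrow>
     (\<exists>vs es. vs \<noteq> [] \<and> length es = length vs \<and> distinct vs \<and> distinct es \<and>
        set vs = verts C \<and> set es = edges C \<and> verts C \<subseteq> verts G \<and> edges C \<subseteq> edges G \<and>
        (\<forall>i < length vs. ends G (es ! i) = {vs ! i, vs ! (Suc i mod length vs)}))"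

text \<open>Travelling once around the boundary of \<open>v\<close> is a simple closed path onto it. A cycle
  through \<open>v\<close> is met there in the two line segments in which its edges are attached to \<open>v\<close>;
  taking four distinct segments prevents a cycle from being interlaced with itself.\<close>

definition interlaced :: "'a::t2_space ribbon_rep \<Rightarrow> 'a ribbon_rep \<Rightarrow> bool" where
  "interlaced C1 C2 \<longleftrightarrow>
     (\<exists>v. verts C1 \<inter> verts C2 = {v} \<and>
        (\<exists>\<gamma> t1 t2 t3 t4 s1 s2 s3 s4.
           simple_path \<gamma> \<and> pathfinish \<gamma> = pathstart \<gamma> \<and> path_image \<gamma> = surface_boundary v \<and>
           0 \<le> t1 \<and> t1 < t2 \<and> t2 < t3 \<and> t3 < t4 \<and> t4 < 1 \<and>
           s1 \<in> components (v \<inter> \<Union>(edges C1)) \<and> s3 \<in> components (v \<inter> \<Union>(edges C1)) \<and>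
           s2 \<in> components (v \<inter> \<Union>(edges C2)) \<and> s4 \<in> components (v \<inter> \<Union>(edges C2)) \<and>
           distinct [s1, s2, s3, s4] \<and>
           \<gamma> t1 \<in> s1 \<and> \<gamma> t2 \<in> s2 \<and> \<gamma> t3 \<in> s3 \<and> \<gamma> t4 \<in> s4))"

definition trivial_loop :: "'a::t2_space ribbon_rep \<Rightarrow> 'a set \<Rightarrow> bool" where
  "trivial_loop G e \<longleftrightarrow>
     loop_in G e \<and> \<not> (\<exists>C. cycle_of G C \<and> interlaced (loop_subgraph G e) C)"

section \<open>Delta-matroids\<close>

text \<open>Set systems \<open>(E, \<F>)\<close>; the notions below do not depend on the exchange axiom.\<close>

type_synonym 'b set_system = "'b set \<times> 'b set set"

definition delta_matroid_of :: "'a::t2_space ribbon_rep \<Rightarrow> 'a set set_system" where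
  "delta_matroid_of G =
     (edges G, {A. A \<subseteq> edges G \<and>
        num_boundary_components (spanning_subgraph G A) = num_components G})"

definition min_matroid :: "'b set_system \<Rightarrow> 'b set_system" where
  "min_matroid D = (fst D, {B \<in> snd D. \<forall>F \<in> snd D. card B \<le> card F})"

text \<open>Here the second component of \<open>M\<close> is the set of bases.\<close>

definition matroid_loop :: "'b set_system \<Rightarrow> 'b \<Rightarrow> bool" where
  "matroid_loop M e \<longleftrightarrow> e \<in> fst M \<and> (\<forall>B \<in> snd M. e \<notin> B)"

definition twist :: "'b set_system \<Rightarrow> 'b \<Rightarrow> 'b set_system" where
  "twist D e = (fst D, (\<lambda>F. sym_diff F {e}) ` snd D)"

definition ribbon_loop :: "'b set_system \<Rightarrow> 'b \<Rightarrow> bool" where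
  "ribbon_loop D e \<longleftrightarrow> matroid_loop (min_matroid D) e"

definition nonorientable_ribbon_loop :: "'b set_system \<Rightarrow> 'b \<Rightarrow> bool" where
  "nonorientable_ribbon_loop D e \<longleftrightarrow> ribbon_loop D e \<and> ribbon_loop (twist D e) e"

definition orientable_ribbon_loop :: "'b set_system \<Rightarrow> 'b \<Rightarrow> bool" where
  "orientable_ribbon_loop D e \<longleftrightarrow> ribbon_loop D e \<and> \<not> nonorientable_ribbon_loop D e"

definition trivial_ribbon_loop :: "'b set_system \<Rightarrow> 'b \<Rightarrow> bool" where
  "trivial_ribbon_loop D e \<longleftrightarrow>
     (orientable_ribbon_loop D e \<and> (\<forall>F \<in> snd D. e \<notin> F)) \<or>
     (nonorientable_ribbon_loop D e \<and> (\<forall>F \<in> snd D. sym_diff F {e} \<in> snd D))"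

end

theory Submission
  imports Defs
begin

text \<open>
  The four corners at which an edge is attached to its vertices are called flags. Three
  involutions act on them: \<open>\<tau>\<close> moves along a common line segment, \<open>\<sigma>\<close> along a free side of an
  edge, and \<open>\<alpha>\<close> along an arc of a vertex boundary between two consecutive line segments. The
  boundary of the spanning subgraph \<open>(V, A)\<close> is followed by alternating \<open>\<alpha>\<close> with \<open>\<sigma>\<close> at edges in
  \<open>A\<close> and with \<open>\<tau>\<close> at the other edges. Hence \<open>A\<close> is feasible exactly if the orbits of this walk are
  as large as the connected components of the graph
  (\<open>feasible_iff_card_components\<close>), and everything about \<open>D(G)\<close> becomes a statement about orbits.

  The key to the combinatorics is \<open>matching_exists\<close>. If every other edge is traversed in a fixed way and
  the walk is stopped at \<open>e\<close>, the four flags of \<open>e\<close> are joined in two pairs, and there are three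
  ways to pair them: along \<open>\<tau>\<close>, along \<open>\<sigma>\<close>, or along \<open>\<tau>\<sigma>\<close>. Traversing \<open>e\<close> according to the
  pairing leaves two orbits at \<open>e\<close>; each of the two other ways unites them. The feasible sets of minimum
  size are the spanning forests, built by adding edges that join two different orbits, and an element
  is a ribbon loop exactly if all its flags already lie on one vertex. For such an \<open>e\<close>, every
  spanning forest pairs the flags of \<open>e\<close> just as the empty edge set does
  (\<open>forest_matching\<close>), by the arcs of the vertex boundary. The pairing along \<open>\<tau>\<sigma>\<close> is the
  non-orientable case (\<open>nonorientable_ribbon_loop_iff\<close>), the one along \<open>\<sigma>\<close> the orientable case. The
  loop is trivial as a ribbon loop exactly if no walk in the graph without \<open>e\<close> leads from one pair to
  the other (\<open>trivial_ribbon_loop_iff\<close>).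

  On the side of the surface, the flags are obtained as follows. Invariance of domain identifies the
  boundary of a planar region, and charts obtained by gluing two rectangles show that the boundary of
  the surface consists of the boundaries of its discs without the relatively open line segments
  (\<open>boundary_surface\<close>). A loop with its vertex is two rectangles glued along two opposite sides; it
  is a Moebius band exactly if the gluing reverses one side, which is the pairing along \<open>\<tau>\<sigma>\<close>
  (\<open>loop_moebius_iff\<close>). Finally the loop cuts the vertex boundary into two gaps. A
  cycle is interlaced with the loop exactly if it leaves the vertex through one gap and returns through the other,
  so interlaced cycles correspond to walks that avoid \<open>e\<close> and connect the two gaps
  (\<open>alternating_imp_crossing\<close>, \<open>crossing_imp_alternating\<close>).
\<close>

section \<open>Orbits of two involutions\<close>

text \<open>The orbit of two involutions is a path or a cycle, and a fixed point of one of them is an end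
  of a path. The sequence that starts at \<open>x0\<close> and iterates \<open>\<rho> \<circ> \<alpha>\<close> returns to \<open>x0\<close> after some
  minimal \<open>N\<close>; the involutions act on it as reflections \<open>k \<mapsto> N - 1 - k\<close> and \<open>k \<mapsto> N - k\<close>. As the
  first one has no fixed point, \<open>N\<close> is even, and the second one fixes only \<open>0\<close> and \<open>N div 2\<close>.\<close>

lemma dihedral_orbit_ends:
  assumes fin: "finite X" and x0: "x0 \<in> X" and fix0: "\<rho> x0 = x0"
    and a: "\<And>x. x \<in> X \<Longrightarrow> \<alpha> x \<in> X \<and> \<alpha> (\<alpha> x) = x \<and> \<alpha> x \<noteq> x"
    and r: "\<And>x. x \<in> X \<Longrightarrow> \<rho> x \<in> X \<and> \<rho> (\<rho> x) = x"
  shows "\<exists>!y. y \<noteq> x0 \<and> \<rho> y = y \<and> (x0, y) \<in> ({(x, \<alpha> x) | x. x \<in> X} \<union> {(x, \<rho> x) | x. x \<in> X})\<^sup>*"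
proof -
  let ?R = "{(x, \<alpha> x) | x. x \<in> X} \<union> {(x, \<rho> x) | x. x \<in> X}"
  define \<pi> where "\<pi> = \<rho> \<circ> \<alpha>"
  define p where "p n = (\<pi> ^^ n) x0" for n
  have p0: "p 0 = x0" by (simp add: p_def)
  have pS: "p (Suc n) = \<rho> (\<alpha> (p n))" for n by (simp add: p_def \<pi>_def)
  have pX: "p n \<in> X" for n by (induction n) (auto simp: p0 pS x0 a r)
  have cancel: "p i = p j" if "p (Suc i) = p (Suc j)" for i j
    using that a r pX by (metis pS)
  have shift: "p (j - i) = x0" if "p i = p j" "i \<le> j" for i j
    using that
  proof (induction i arbitrary: j)
    case 0 then show ?case by (simp add: p0)
  next
    case (Suc i) then show ?case by (cases j) (auto dest: cancel)
  qed
  have "\<not> inj p" using fin pX by (meson finite_imageD finite_subset image_subsetI infinite_UNIV_nat)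
  then obtain i j where "p i = p j" "i < j" by (metis injI linorder_neqE_nat)
  then have ex: "\<exists>n>0. p n = x0" using shift by (intro exI[of _ "j - i"]) auto
  define N where "N = (LEAST n. 0 < n \<and> p n = x0)"
  have N: "0 < N" "p N = x0" using LeastI_ex[OF ex] by (auto simp: N_def)
  have least: "n = 0" if "n < N" "p n = x0" for n
    using that not_less_Least[of n "\<lambda>n. 0 < n \<and> p n = x0"] by (auto simp: N_def)
  have inj: "i = j" if "p i = p j" "i < N" "j < N" for i j
  proof (rule ccontr)
    assume "i \<noteq> j"
    then show False
      using shift[of i j] shift[of j i] that least[of "j - i"] least[of "i - j"]
      by (cases "i \<le> j") (metis diff_is_0_eq less_imp_diff_less nat_le_linear le_antisym)+
  qed
  (* the reflections alpha and rho reverse the cyclic sequence p *)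
  have alpha_p: "\<alpha> (p (N - 1 - k)) = p k" if "k < N" for k
    using that
  proof (induction k)
    case 0
    have "\<rho> (\<alpha> (p (N - 1))) = x0" using N pS[of "N - 1"] by simp
    then show ?case using a r pX fix0 p0 by (metis diff_zero)
  next
    case (Suc k)
    then have e: "N - 1 - k = Suc (N - 1 - Suc k)" by auto
    have "\<alpha> (p (N - 1 - k)) = p k" using Suc by auto
    then have "\<alpha> (p k) = p (N - 1 - k)" using a pX by metis
    then have "p (Suc k) = \<rho> (p (N - 1 - k))" by (simp add: pS)
    also have "\<dots> = \<alpha> (p (N - 1 - Suc k))" using e pS r a pX by metis
    finally show ?case by simp
  qed
  have alpha_p': "\<alpha> (p k) = p (N - 1 - k)" if "k < N" for k
    using alpha_p[OF that] a pX by metis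
  have rho_p: "\<rho> (p k) = p (N - k)" if "k < N" for k
  proof (cases k)
    case 0 then show ?thesis using N fix0 p0 by simp
  next
    case (Suc j)
    then show ?thesis using alpha_p'[of j] that a r pX pS
      by (metis Suc_lessD diff_Suc_eq_diff_pred diff_commute)
  qed
  have reach: "(x0, p n) \<in> ?R\<^sup>*" for n
  proof (induction n)
    case 0 then show ?case by (simp add: p0)
  next
    case (Suc n)
    have 1: "(p n, \<alpha> (p n)) \<in> ?R" and 2: "(\<alpha> (p n), \<rho> (\<alpha> (p n))) \<in> ?R"
      using pX a by blast+
    show ?case unfolding pS
      by (rule rtrancl.rtrancl_into_rtrancl[OF rtrancl.rtrancl_into_rtrancl[OF Suc 1] 2])
  qed
  have cls: "y \<in> p ` {..<N}" if "(x0, y) \<in> ?R\<^sup>*" for y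
    using that
  proof induction
    case base then show ?case using imageI[of 0 "{..<N}" p] N(1) p0 by simp
  next
    case (step y z)
    then obtain k where k: "k < N" "y = p k" by blast
    from step(2) have "z = \<alpha> y \<or> z = \<rho> y" by blast
    then show ?case
    proof
      assume "z = \<alpha> y"
      then have "z = p (N - 1 - k)" using k alpha_p' by simp
      then show ?thesis using N(1) by (intro image_eqI[of _ _ "N - 1 - k"]) simp_all
    next
      assume "z = \<rho> y"
      then have z: "z = p (N - k)" using k rho_p by simp
      show ?thesis
      proof (cases "k = 0")
        case True
        then have "z = p 0" using z N p0 by simp
        then show ?thesis using N(1) by (intro image_eqI[of _ _ 0]) simp_all
      next
        case False
        then show ?thesis using z N(1) by (intro image_eqI[of _ _ "N - k"]) simp_all
      qed
    qed
  qed
  have odd: "N \<noteq> 2 * k + 1" for k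
  proof
    assume "N = 2 * k + 1"
    then have "k < N" "N - 1 - k = k" by simp_all
    then show False using alpha_p'[of k] a[OF pX[of k]] by simp
  qed
  then have "even N" by (metis oddE)
  then obtain h where h: "N = 2 * h" by (rule evenE)
  then have hN: "0 < h" "h < N" using N by auto
  show ?thesis
  proof (rule ex1I[of _ "p h"])
    show "p h \<noteq> x0 \<and> \<rho> (p h) = p h \<and> (x0, p h) \<in> ?R\<^sup>*"
    proof (intro conjI)
      show "p h \<noteq> x0" using least[OF hN(2)] hN(1) by auto
      have "N - h = h" using h by simp
      then show "\<rho> (p h) = p h" using rho_p[OF hN(2)] by simp
      show "(x0, p h) \<in> ?R\<^sup>*" by (rule reach)
    qed
  next
    fix y assume y: "y \<noteq> x0 \<and> \<rho> y = y \<and> (x0, y) \<in> ?R\<^sup>*"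
    then obtain k where k: "k < N" "y = p k" using cls by blast
    have "k \<noteq> 0" using y k p0 by metis
    have "p (N - k) = p k" using rho_p[OF k(1)] k(2) y by simp
    then have "N - k = k" using inj[of "N-k" k] k(1) \<open>k \<noteq> 0\<close> by simp
    then have "k = h" using h by simp
    then show "y = p h" using k by simp
  qed
qed

section \<open>Flag systems and matchings\<close>

text \<open>The three ways in which a boundary walk can pass an edge: along the line segment, as if the edge
  were deleted; along the free side of the edge; or diagonally, as if the edge were present with a
  further half-twist. They are the three fixed-point free involutions in the Klein four-group that acts
  on the flags of the edge.\<close>

datatype mode = Seg | Side | Diag

text \<open>Every nonempty fibre of \<open>ed\<close> consists of four flags, on which \<open>\<tau>\<close> and \<open>\<sigma>\<close> generate a Klein four-group.\<close>

locale flag_system =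
  fixes X :: "'x set" and \<alpha> \<tau> \<sigma> :: "'x \<Rightarrow> 'x" and ed :: "'x \<Rightarrow> 'e"
  assumes finite_X: "finite X"
    and alpha: "x \<in> X \<Longrightarrow> \<alpha> x \<in> X \<and> \<alpha> (\<alpha> x) = x \<and> \<alpha> x \<noteq> x"
    and tau: "x \<in> X \<Longrightarrow> \<tau> x \<in> X \<and> \<tau> (\<tau> x) = x \<and> \<tau> x \<noteq> x \<and> ed (\<tau> x) = ed x"
    and sigma: "x \<in> X \<Longrightarrow> \<sigma> x \<in> X \<and> \<sigma> (\<sigma> x) = x \<and> \<sigma> x \<noteq> x \<and> ed (\<sigma> x) = ed x"
    and tau_sigma: "x \<in> X \<Longrightarrow> \<tau> (\<sigma> x) = \<sigma> (\<tau> x) \<and> \<sigma> x \<noteq> \<tau> x"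
    and ed_eq: "x \<in> X \<Longrightarrow> y \<in> X \<Longrightarrow> ed x = ed y \<Longrightarrow> y \<in> {x, \<tau> x, \<sigma> x, \<tau> (\<sigma> x)}"
begin

fun act :: "mode \<Rightarrow> 'x \<Rightarrow> 'x" where
  "act Seg x = \<tau> x"
| "act Side x = \<sigma> x"
| "act Diag x = \<tau> (\<sigma> x)"

text \<open>A state prescribes for every edge the set of ways in which it may be passed: no way stops all
  walks at the edge, and several ways make all of them available.\<close>

definition step :: "('e \<Rightarrow> mode set) \<Rightarrow> ('x \<times> 'x) set" where
  "step st = {(x, \<alpha> x) | x. x \<in> X} \<union> {(x, act m x) | x m. x \<in> X \<and> m \<in> st (ed x)}"

abbreviation joined :: "('e \<Rightarrow> mode set) \<Rightarrow> ('x \<times> 'x) set" where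
  "joined st \<equiv> (step st)\<^sup>*"

lemma act_props:
  assumes "x \<in> X"
  shows "act m x \<in> X" "act m (act m x) = x" "act m x \<noteq> x" "ed (act m x) = ed x"
    "act m x = act m' x \<longleftrightarrow> m = m'"
proof -
  note t = tau[OF assms] and s = sigma[OF assms] and ts = tau_sigma[OF assms]
  have t': "\<tau> (\<sigma> x) \<in> X" "\<tau> (\<tau> (\<sigma> x)) = \<sigma> x" "ed (\<tau> (\<sigma> x)) = ed x" "\<tau> (\<sigma> x) \<noteq> \<sigma> x"
    using tau[of "\<sigma> x"] s by auto
  have s': "\<sigma> (\<tau> x) \<in> X" "\<sigma> (\<sigma> (\<tau> x)) = \<tau> x" "\<sigma> (\<tau> x) \<noteq> \<tau> x"
    using sigma[of "\<tau> x"] t by auto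
  have ne: "\<tau> (\<sigma> x) \<noteq> x" using t' ts t by metis
  show "act m x \<in> X" using t s t' by (cases m) auto
  show "ed (act m x) = ed x" using t s t' by (cases m) auto
  show "act m x \<noteq> x" using t s ne by (cases m) auto
  have "\<tau> (\<sigma> (\<tau> (\<sigma> x))) = x" using tau_sigma[of "\<tau> (\<sigma> x)"] tau_sigma[of "\<sigma> x"] s t' ts t
    by metis
  then show "act m (act m x) = x" using t s by (cases m) auto
  show "act m x = act m' x \<longleftrightarrow> m = m'"
    using t s t' s' ts by (cases m; cases m'; simp; metis)
qed

lemma act_third:
  assumes "x \<in> X" "distinct [m, m', m'']"
  shows "act m (act m' x) = act m'' x"
proof -
  have t: "\<tau> x \<in> X" "\<sigma> x \<in> X" using tau sigma assms by auto
  show ?thesis using assms(2) tau[OF assms(1)] sigma[OF assms(1)] tau_sigma[OF assms(1)] tau[OF t(2)] sigma[OF t(1)]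
    by (cases m; cases m'; cases m'') auto
qed

lemma same_edge:
  assumes "x \<in> X" "y \<in> X" "ed x = ed y"
  obtains "y = x" | m where "y = act m x"
  using ed_eq[OF assms] that(1) that(2)[of Seg] that(2)[of Side] that(2)[of Diag] by auto

lemma step_X: "(x, y) \<in> step st \<Longrightarrow> x \<in> X \<and> y \<in> X"
  using alpha act_props by (auto simp: step_def)

lemma sym_step: "sym (step st)"
proof (rule symI)
  fix x y assume "(x, y) \<in> step st"
  then consider "x \<in> X" "y = \<alpha> x" | m where "x \<in> X" "y = act m x" "m \<in> st (ed x)"
    by (auto simp: step_def)
  then show "(y, x) \<in> step st"
  proof cases
    case 1 then show ?thesis using alpha by (force simp: step_def)
  next
    case (2 m) then show ?thesis using act_props[of x m]
      unfolding step_def by (intro UnI2 CollectI exI[of _ y] exI[of _ m]) auto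
  qed
qed

lemma joined_sym: "(x, y) \<in> joined st \<Longrightarrow> (y, x) \<in> joined st"
  using sym_step sym_rtrancl symD by metis

lemma joined_trans: "(x, y) \<in> joined st \<Longrightarrow> (y, z) \<in> joined st \<Longrightarrow> (x, z) \<in> joined st"
  by (rule rtrancl_trans)

lemma joined_X: "(x, y) \<in> joined st \<Longrightarrow> x \<in> X \<longleftrightarrow> y \<in> X"
  by (induction rule: rtrancl_induct) (auto dest: step_X)

lemma joined_alpha: "x \<in> X \<Longrightarrow> (x, \<alpha> x) \<in> joined st"
  by (auto simp: step_def)

lemma joined_act: "x \<in> X \<Longrightarrow> m \<in> st (ed x) \<Longrightarrow> (x, act m x) \<in> joined st"
  by (rule r_into_rtrancl) (auto simp: step_def)

lemma joined_subset:
  assumes "\<And>x m. x \<in> X \<Longrightarrow> m \<in> st (ed x) \<Longrightarrow> (x, act m x) \<in> joined st'"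
  shows "joined st \<subseteq> joined st'"
proof -
  have "step st \<subseteq> joined st'" using assms joined_alpha by (auto simp: step_def)
  then show ?thesis using rtrancl_subset_rtrancl by blast
qed

lemma joined_mono: "(\<And>g. g \<in> ed ` X \<Longrightarrow> st g \<subseteq> st' g) \<Longrightarrow> joined st \<subseteq> joined st'"
  by (rule joined_subset) (meson image_eqI joined_act subsetD)

lemma joined_cong: "(\<And>g. g \<in> ed ` X \<Longrightarrow> st g = st' g) \<Longrightarrow> joined st = joined st'"
  by (simp add: joined_mono subset_antisym)

definition all_joined :: "('e \<Rightarrow> mode set) \<Rightarrow> 'e \<Rightarrow> bool" where
  "all_joined st e \<longleftrightarrow> (\<forall>x\<in>X. \<forall>y\<in>X. ed x = e \<longrightarrow> ed y = e \<longrightarrow> (x, y) \<in> joined st)"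

lemma all_joined_mono:
  "joined st \<subseteq> joined st' \<Longrightarrow> all_joined st e \<Longrightarrow> all_joined st' e"
  by (auto simp: all_joined_def)

text \<open>Two different non-trivial elements generate the Klein four-group, so one pairing of all four flags
  and a single connection across it suffice.\<close>

lemma all_joinedI2:
  assumes x: "x \<in> X" and m: "m \<noteq> m'"
    and 1: "\<And>z. z \<in> X \<Longrightarrow> ed z = ed x \<Longrightarrow> (z, act m z) \<in> joined st" and 2: "(x, act m' x) \<in> joined st"
  shows "all_joined st (ed x)"
proof -
  obtain m'' where m'': "distinct [m, m', m'']"
    using m by (cases m; cases m') (auto intro: mode.exhaust)
  have "(x, act k x) \<in> joined st" for k
  proof -
    have "k = m \<or> k = m' \<or> k = m''" using m'' by (cases m; cases m'; cases m''; cases k) auto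
    moreover have "(x, act m'' x) \<in> joined st"
      using 1[of "act m' x"] 2 act_third[OF x m''] act_props[OF x] joined_trans by metis
    ultimately show ?thesis using 1 2 x by auto
  qed
  then have "(x, y) \<in> joined st" if "y \<in> X" "ed x = ed y" for y
    using same_edge[OF x that] by (metis rtrancl.rtrancl_refl)
  then show ?thesis unfolding all_joined_def by (metis joined_sym joined_trans)
qed

text \<open>In a smooth state every edge is passed in one way; its walks are the boundary components of the
  corresponding surface, possibly with some edges twisted.\<close>

definition smooth :: "('e \<Rightarrow> mode set) \<Rightarrow> bool" where
  "smooth st \<longleftrightarrow> (\<forall>g. \<exists>m. st g = {m})"

text \<open>Stopping the walk at \<open>e\<close> makes the flags of \<open>e\<close> the fixed points of an involution, so each of them
  is joined with exactly one other. A partition of the four flags in two pairs is given by one element of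
  the Klein four-group.\<close>

lemma matching_exists:
  assumes st: "smooth st" and e: "e \<in> ed ` X"
  obtains M where "\<And>x m. x \<in> X \<Longrightarrow> ed x = e \<Longrightarrow> (x, act m x) \<in> joined (st(e := {})) \<longleftrightarrow> m = M"
proof -
  define \<mu> where "\<mu> g = (THE m. st g = {m})" for g
  have mu: "st g = {\<mu> g}" for g
    using st unfolding smooth_def \<mu>_def by (metis (mono_tags, lifting) singleton_inject theI)
  define \<rho> where "\<rho> x = (if ed x = e then x else act (\<mu> (ed x)) x)" for x
  let ?S = "{(x, \<alpha> x) | x. x \<in> X} \<union> {(x, \<rho> x) | x. x \<in> X}"
  have rho: "\<rho> x \<in> X \<and> \<rho> (\<rho> x) = x" if "x \<in> X" for x
    using act_props[OF that] that by (auto simp: \<rho>_def)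
  have rho_fix: "\<rho> x = x \<longleftrightarrow> ed x = e" if "x \<in> X" for x
    using act_props[OF that] by (auto simp: \<rho>_def)
  have "step (st(e := {})) \<subseteq> ?S"
    by (auto simp: step_def mu \<rho>_def split: if_splits)
  moreover have "?S \<subseteq> (step (st(e := {})))\<^sup>="
    by (auto simp: step_def mu \<rho>_def)
  ultimately have S: "?S\<^sup>* = joined (st(e := {}))"
    using rtrancl_mono[of "step (st(e := {}))" ?S] rtrancl_mono[of ?S "(step (st(e := {})))\<^sup>="]
    unfolding rtrancl_reflcl by blast
  have unique: "\<exists>!m. (x, act m x) \<in> joined (st(e := {}))" if x: "x \<in> X" "ed x = e" for x
  proof -
    have "\<rho> x = x" using rho_fix x by simp
    then have "\<exists>!y. y \<noteq> x \<and> \<rho> y = y \<and> (x, y) \<in> ?S\<^sup>*"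
      by (rule dihedral_orbit_ends[OF finite_X x(1) _ alpha rho])
    then obtain y where y: "y \<noteq> x" "\<rho> y = y" "(x, y) \<in> joined (st(e := {}))"
      and uniq: "\<And>z. z \<noteq> x \<Longrightarrow> \<rho> z = z \<Longrightarrow> (x, z) \<in> joined (st(e := {})) \<Longrightarrow> z = y"
      unfolding S by blast
    have "y \<in> X" "ed y = e" using y joined_X x rho_fix by metis+
    then obtain m where m: "y = act m x" using same_edge[OF x(1)] x y(1) by metis
    show ?thesis
    proof (rule ex1I[of _ m])
      show "(x, act m x) \<in> joined (st(e := {}))" using y m by simp
    next
      fix k assume "(x, act k x) \<in> joined (st(e := {}))"
      then have "act k x = y" using uniq act_props[OF x(1)] x rho_fix by metis
      then show "k = m" using m act_props(5)[OF x(1)] by simp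
    qed
  qed
  obtain x where x: "x \<in> X" "ed x = e" using e by auto
  obtain M where M: "(x, act M x) \<in> joined (st(e := {}))"
    "\<And>m. (x, act m x) \<in> joined (st(e := {})) \<Longrightarrow> m = M" using unique[OF x] by metis
  have step: "(act M x, act M (act M x)) \<in> joined (st(e := {}))"
    using M(1) joined_sym act_props(2)[OF x(1)] by simp
  have "(y, act M y) \<in> joined (st(e := {}))" if y: "y \<in> X" "ed y = e" for y
  proof -
    consider "y = x" | "y = act M x" | m where "y = act m x" "m \<noteq> M"
      using same_edge[OF x(1) y(1)] x y by metis
    then show ?thesis
    proof cases
      case 3
      obtain k where k: "(y, act k y) \<in> joined (st(e := {}))" using unique[OF y] by blast
      show ?thesis
      proof (rule ccontr)
        assume "\<not> ?thesis"
        then have "k \<noteq> M" using k by auto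
        (* y would be matched with x or with act M x *)
        have "act k y = x \<or> act k y = act M x"
        proof (cases "k = m")
          case True then show ?thesis using 3 act_props(2)[OF x(1)] by simp
        next
          case False
          then have "distinct [k, m, M]" using 3 \<open>k \<noteq> M\<close> by simp
          then show ?thesis using act_third[OF x(1), of k m M] 3 by simp
        qed
        then have "(y, x) \<in> joined (st(e := {}))" using k M(1) by (metis joined_sym joined_trans)
        then show False using M(2)[of m] 3 joined_sym by blast
      qed
    next
      case 1 then show ?thesis using M(1) by simp
    next
      case 2 then show ?thesis using step by simp
    qed
  qed
  note M' = this
  show ?thesis
  proof (rule that[of M])
    fix x m assume x: "x \<in> X" "ed x = e"
    show "(x, act m x) \<in> joined (st(e := {})) \<longleftrightarrow> m = M"
      using M'[OF x] unique[OF x] by (auto elim: ex1E)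
  qed
qed

definition matching :: "('e \<Rightarrow> mode set) \<Rightarrow> 'e \<Rightarrow> mode" where
  "matching st e = (THE M. \<forall>x\<in>X. \<forall>m. ed x = e \<longrightarrow> (x, act m x) \<in> joined (st(e := {})) \<longleftrightarrow> m = M)"

lemma matching:
  assumes "smooth st" "x \<in> X" "ed x = e"
  shows "(x, act m x) \<in> joined (st(e := {})) \<longleftrightarrow> m = matching st e"
proof -
  obtain M where M: "\<And>x m. x \<in> X \<Longrightarrow> ed x = e \<Longrightarrow> (x, act m x) \<in> joined (st(e := {})) \<longleftrightarrow> m = M"
    using matching_exists[OF assms(1), of e] assms by blast
  have "matching st e = M" unfolding matching_def
    by (rule the_equality) (use M assms in blast)+
  then show ?thesis using M assms by auto
qed

lemma matching_upd [simp]: "matching (st(e := S)) e = matching st e"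
  by (simp add: matching_def)

lemma joined_matching:
  assumes "smooth st"
  shows "joined (st(e := {matching st e})) = joined (st(e := {}))"
proof
  show "joined (st(e := {matching st e})) \<subseteq> joined (st(e := {}))"
  proof (rule joined_subset)
    fix x m assume "x \<in> X" "m \<in> (st(e := {matching st e})) (ed x)"
    then show "(x, act m x) \<in> joined (st(e := {}))"
      using matching[OF assms, of x e m] joined_act[of x m "st(e := {})"] by (auto split: if_splits)
  qed
qed (rule joined_mono, auto)

lemma not_all_joined_matching:
  assumes "smooth st" "e \<in> ed ` X"
  shows "\<not> all_joined (st(e := {matching st e})) e"
proof
  assume *: "all_joined (st(e := {matching st e})) e"
  obtain x where x: "x \<in> X" "ed x = e" using assms by auto
  have "(x, act m x) \<in> joined (st(e := {}))" for m
    using * x act_props[OF x(1)] unfolding joined_matching[OF assms(1)] all_joined_def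
    by (auto simp: all_joined_def joined_matching[OF assms(1)])
  then have "m = matching st e" for m using matching[OF assms(1) x, of m] by blast
  from this[of Seg] this[of Side] show False by simp
qed

lemma all_joined_other:
  assumes "smooth st" "e \<in> ed ` X" "m \<noteq> matching st e"
  shows "all_joined (st(e := {m})) e"
proof -
  obtain x where x: "x \<in> X" "ed x = e" using assms by auto
  have "(z, act m z) \<in> joined (st(e := {m}))" if "z \<in> X" "ed z = e" for z
    using that by (intro joined_act) auto
  moreover have "(x, act (matching st e) x) \<in> joined (st(e := {m}))"
    using matching[OF assms(1) x, of "matching st e"] subsetD[OF joined_mono[of "st(e := {})" "st(e := {m})"]]
    by simp
  ultimately show ?thesis using all_joinedI2[OF x(1) assms(3)] x by metis
qed

text \<open>When all flags of \<open>e\<close> are already in one class, any way of passing \<open>e\<close> stays in that class.\<close>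

lemma joined_all_joined:
  assumes "all_joined st e"
  shows "joined (st(e := S)) \<subseteq> joined st"
proof (rule joined_subset)
  fix x m assume "x \<in> X" "m \<in> (st(e := S)) (ed x)"
  then show "(x, act m x) \<in> joined st"
    using assms act_props[of x m] joined_act by (auto simp: all_joined_def split: if_splits)
qed

lemma joined_others_eq:
  assumes "all_joined (st(e := S)) e" "all_joined (st(e := S')) e"
  shows "joined (st(e := S)) = joined (st(e := S'))"
  using joined_all_joined[OF assms(1), of S'] joined_all_joined[OF assms(2), of S] by auto

section \<open>Spanning forests and counting classes\<close>

text \<open>Adding the side at an edge of \<open>A\<close> while keeping the segment connects everything at that edge: the
  classes become connected components instead of boundary components. Taking the side replaces the
  segment by it, which attaches the edge to the surface.\<close>

definition add_sides :: "('e \<Rightarrow> mode set) \<Rightarrow> 'e set \<Rightarrow> 'e \<Rightarrow> mode set" where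
  "add_sides st A = (\<lambda>g. if g \<in> A then insert Side (st g) else st g)"

definition take_sides :: "('e \<Rightarrow> mode set) \<Rightarrow> 'e set \<Rightarrow> 'e \<Rightarrow> mode set" where
  "take_sides st A = (\<lambda>g. if g \<in> A then {Side} else st g)"

text \<open>No side of \<open>g\<close> joins flags of one class, that is, \<open>g\<close> connects two different classes.\<close>

definition bridging :: "('e \<Rightarrow> mode set) \<Rightarrow> 'e \<Rightarrow> bool" where
  "bridging st g \<longleftrightarrow> (\<forall>x\<in>X. ed x = g \<longrightarrow> (x, \<sigma> x) \<notin> joined st)"

inductive forest :: "('e \<Rightarrow> mode set) \<Rightarrow> 'e set \<Rightarrow> bool" for st where
  empty: "forest st {}"
| insert: "forest st T \<Longrightarrow> g \<in> ed ` X \<Longrightarrow> g \<notin> T \<Longrightarrow> st g = {Seg} \<Longrightarrow>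
    bridging (add_sides st T) g \<Longrightarrow> forest st (insert g T)"

lemma smooth_take: "smooth st \<Longrightarrow> smooth (take_sides st A)"
  by (auto simp: smooth_def take_sides_def)

lemma smooth_upd: "smooth st \<Longrightarrow> smooth (st(e := {m}))"
  by (auto simp: smooth_def)

lemma add_sides_insert: "add_sides st (insert g A) = (add_sides st A)(g := insert Side (st g))"
  by (simp add: add_sides_def fun_eq_iff)

lemma take_sides_insert: "take_sides st (insert g A) = (take_sides st A)(g := {Side})"
  by (simp add: take_sides_def fun_eq_iff)

lemma joined_upd_subset:
  assumes "joined st \<subseteq> joined st'" "\<And>x m. x \<in> X \<Longrightarrow> ed x = g \<Longrightarrow> m \<in> S \<Longrightarrow> (x, act m x) \<in> joined st'"
  shows "joined (st(g := S)) \<subseteq> joined st'"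
proof (rule joined_subset)
  fix x m assume "x \<in> X" "m \<in> (st(g := S)) (ed x)"
  then show "(x, act m x) \<in> joined st'"
    using assms(2) subsetD[OF assms(1) joined_act[of x m st]] by (auto split: if_splits)
qed

lemma forest_ed: "forest st T \<Longrightarrow> T \<subseteq> ed ` X"
  by (induction rule: forest.induct) auto

lemma forest_finite: "forest st T \<Longrightarrow> finite T"
  using forest_ed finite_X by (meson finite_imageI finite_subset)

text \<open>Attaching a band between two different boundary components merges them into one. Hence, along
  a forest, boundary components and connected components agree: at each new edge the matching is along the
  segments, because any other one would join the two sides of the edge beforehand.\<close>

lemma forest_joined:
  assumes "forest st T" "smooth st"
  shows "joined (take_sides st T) = joined (add_sides st T)"
  using assms(1)
proof induction
  case empty then show ?case by (simp add: take_sides_def add_sides_def)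
next
  case (insert T g)
  let ?b = "take_sides st T" and ?c = "add_sides st T"
  have sm: "smooth ?b" using assms(2) smooth_take by blast
  have bg: "?b g = {Seg}" "?c g = {Seg}" using insert by (auto simp: take_sides_def add_sides_def)
  have "matching ?b g = Seg"
  proof (rule ccontr)
    assume "matching ?b g \<noteq> Seg"
    then have "all_joined (?b(g := {Seg})) g" using all_joined_other[OF sm insert(2)] by auto
    then have "all_joined ?c g" using bg insert.IH by (metis fun_upd_triv all_joined_mono order_refl)
    moreover obtain x where "x \<in> X" "ed x = g" using insert(2) by blast
    ultimately have "x \<in> X" "ed x = g" "(x, \<sigma> x) \<in> joined ?c"
      using sigma[of x] unfolding all_joined_def by simp_all
    then show False using insert(5) unfolding bridging_def by blast
  qed
  then have al: "all_joined (?b(g := {Side})) g" using all_joined_other[OF sm insert(2)] by auto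
  show ?case unfolding add_sides_insert take_sides_insert
  proof
    show "joined (?b(g := {Side})) \<subseteq> joined (?c(g := insert Side (st g)))"
    proof (rule joined_upd_subset)
      have "joined ?c \<subseteq> joined (?c(g := insert Side (st g)))"
        by (rule joined_mono) (use insert bg in auto)
      then show "joined ?b \<subseteq> joined (?c(g := insert Side (st g)))" using insert.IH by simp
    next
      fix x m assume "x \<in> X" "ed x = g" "m \<in> {Side}"
      then show "(x, act m x) \<in> joined (?c(g := insert Side (st g)))" by (intro joined_act) auto
    qed
    show "joined (?c(g := insert Side (st g))) \<subseteq> joined (?b(g := {Side}))"
    proof (rule joined_upd_subset)
      have "joined ?b \<subseteq> joined (?b(g := {Side}))"
        using joined_all_joined[OF al, of "{Seg}"] bg by (metis fun_upd_triv fun_upd_upd)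
      then show "joined ?c \<subseteq> joined (?b(g := {Side}))" using insert.IH by simp
    next
      fix x m assume "x \<in> X" "ed x = g" "m \<in> insert Side (st g)"
      then show "(x, act m x) \<in> joined (?b(g := {Side}))" using al act_props unfolding all_joined_def by auto
    qed
  qed
qed

definition classes :: "('e \<Rightarrow> mode set) \<Rightarrow> nat" where
  "classes st = card ((\<lambda>x. joined st `` {x}) ` X)"

lemma joined_class_eq: "joined st `` {x} = joined st `` {y} \<longleftrightarrow> (x, y) \<in> joined st"
  by (auto dest: joined_sym intro: joined_trans)

lemma classes_eq_iff:
  assumes "joined st \<subseteq> joined st'"
  shows "classes st = classes st' \<longleftrightarrow> joined st = joined st'"
proof
  assume eq: "classes st = classes st'"
  let ?f = "\<lambda>C. joined st' `` C"
  let ?A = "(\<lambda>x. joined st `` {x}) ` X" and ?B = "(\<lambda>x. joined st' `` {x}) ` X"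
  have f: "?f (joined st `` {x}) = joined st' `` {x}" for x
    using assms joined_trans by blast
  then have im: "?f ` ?A = ?B" by (simp add: image_image)
  have "inj_on ?f ?A"
    using eq im finite_X by (intro eq_card_imp_inj_on) (auto simp: classes_def)
  then have "(x, y) \<in> joined st" if "(x, y) \<in> joined st'" "x \<in> X" "y \<in> X" for x y
  proof -
    have "?f (joined st `` {x}) = ?f (joined st `` {y})"
      using that(1) joined_class_eq[of st' x y] by (simp only: f)
    then have "joined st `` {x} = joined st `` {y}" using that(2,3) by (rule inj_onD[OF \<open>inj_on ?f ?A\<close> _ imageI imageI])
    then show ?thesis using joined_class_eq[of st x y] by simp
  qed
  moreover have "(x, y) \<in> joined st" if "(x, y) \<in> joined st'" "x \<notin> X" for x y
    using that by (cases rule: converse_rtranclE) (auto dest: step_X)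
  ultimately have "joined st' \<subseteq> joined st" using joined_X by (meson subrelI)
  then show "joined st = joined st'" using assms by blast
qed (simp add: classes_def)

text \<open>The map from old to new classes is onto and identifies only the classes of \<open>x\<close> and \<open>y\<close>, because
  every new step connects these two or stays in an old class.\<close>

lemma classes_merge:
  assumes sub: "joined st \<subseteq> joined st'" and xy: "x \<in> X" "y \<in> X" "(x, y) \<notin> joined st" "(x, y) \<in> joined st'"
    and gen: "step st' \<subseteq> joined st \<union> {(u, w). (u, x) \<in> joined st \<and> (w, y) \<in> joined st} \<union> {(u, w). (u, y) \<in> joined st \<and> (w, x) \<in> joined st}"
  shows "classes st = Suc (classes st')"
proof -
  let ?A = "(\<lambda>x. joined st `` {x}) ` X" and ?B = "(\<lambda>x. joined st' `` {x}) ` X"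
  let ?f = "\<lambda>C. joined st' `` C"
  have f: "?f (joined st `` {x}) = joined st' `` {x}" for x
    using sub joined_trans by blast
  define q where "q u = (if (u, y) \<in> joined st then x else u)" for u
  have K: "(q u, q w) \<in> joined st" if "(u, w) \<in> joined st'" for u w
    using that
  proof induction
    case (step w z)
    from step(2) gen consider "(w, z) \<in> joined st" | "(w, x) \<in> joined st" "(z, y) \<in> joined st"
      | "(w, y) \<in> joined st" "(z, x) \<in> joined st" by auto
    then have "(q w, q z) \<in> joined st"
    proof cases
      case 1
      then have "(w, y) \<in> joined st \<longleftrightarrow> (z, y) \<in> joined st" by (metis joined_sym joined_trans)
      with 1 show ?thesis by (simp add: q_def)
    next
      case 2
      then show ?thesis by (simp add: q_def)
    next
      case 3
      then show ?thesis using joined_sym by (simp add: q_def)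
    qed
    then show ?case using step(3) joined_trans by blast
  qed auto
  define A' where "A' = ?A - {joined st `` {y}}"
  have "inj_on ?f A'"
  proof (rule inj_onI)
    fix C D assume "C \<in> A'" "D \<in> A'" and eq: "?f C = ?f D"
    then obtain u w where u: "u \<in> X" "C = joined st `` {u}" "(u, y) \<notin> joined st"
      and w: "w \<in> X" "D = joined st `` {w}" "(w, y) \<notin> joined st"
      unfolding A'_def using joined_class_eq by blast
    then have "(u, w) \<in> joined st'" using eq f joined_class_eq by metis
    then have "(u, w) \<in> joined st" using K[of u w] u w by (simp add: q_def)
    then show "C = D" using u w joined_class_eq by metis
  qed
  moreover have "?f ` A' = ?B"
  proof
    show "?f ` A' \<subseteq> ?B" unfolding A'_def using f by blast
    show "?B \<subseteq> ?f ` A'"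
    proof
      fix D assume "D \<in> ?B"
      then obtain u where u: "u \<in> X" "D = joined st' `` {u}" by auto
      show "D \<in> ?f ` A'"
      proof (cases "(u, y) \<in> joined st")
        case True
        then have "D = joined st' `` {x}" using u sub xy joined_class_eq by (metis joined_sym joined_trans subsetD)
        moreover have "joined st `` {x} \<in> A'" unfolding A'_def using xy joined_class_eq by blast
        ultimately show ?thesis using f by (metis image_eqI)
      next
        case False
        then have "joined st `` {u} \<in> A'" unfolding A'_def using u joined_class_eq by blast
        then show ?thesis using f u by (metis image_eqI)
      qed
    qed
  qed
  ultimately have "card A' = card ?B" by (metis card_image)
  moreover have "card ?A = Suc (card A')" unfolding A'_def
    using xy finite_X by (intro card.remove) auto
  ultimately show ?thesis by (simp add: classes_def)
qed

lemma joined_commutes: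
  assumes x: "x \<in> X" "y \<in> X" "ed x = ed y" and m: "m \<noteq> m'"
    and j: "\<And>z. z \<in> X \<Longrightarrow> ed z = ed x \<Longrightarrow> (z, act m' z) \<in> joined st"
  shows "(y, x) \<in> joined st \<and> (act m y, act m x) \<in> joined st \<or>
         (y, act m x) \<in> joined st \<and> (act m y, x) \<in> joined st"
proof -
  obtain m'' where m'': "distinct [m, m', m'']"
    using m by (cases m; cases m') (auto intro: mode.exhaust)
  have act_cover: "k = m \<or> k = m' \<or> k = m''" for k
    using m'' by (cases m; cases m'; cases m''; cases k) auto
  consider "y = x" | "y = act m x" | "y = act m' x" | "y = act m'' x"
    using same_edge[OF x] act_cover by metis
  then show ?thesis
  proof cases
    case 3
    have "(act m' x, x) \<in> joined st" using j x joined_sym by blast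
    moreover have "act m (act m' x) = act m' (act m x)" using act_third[OF x(1), of m m' m''] act_third[OF x(1), of m' m m''] m'' by auto
    moreover have "(act m' (act m x), act m x) \<in> joined st"
      using joined_sym[OF j[of "act m x"]] act_props[OF x(1), of m] by simp
    ultimately show ?thesis using 3 by simp
  next
    case 4
    have "act m'' x = act m' (act m x)" "act m (act m'' x) = act m' x" using act_third[OF x(1), of m m'' m'] act_third[OF x(1), of m' m m''] m'' by auto
    moreover have "(act m' x, x) \<in> joined st" using j x joined_sym by blast
    moreover have "(act m' (act m x), act m x) \<in> joined st"
      using joined_sym[OF j[of "act m x"]] act_props[OF x(1), of m] by simp
    ultimately show ?thesis using 4 by simp
  qed (use act_props[OF x(1)] in auto)
qed

lemma classes_add_mode:
  assumes x: "x \<in> X" "ed x = e" and m: "m \<noteq> m'"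
    and j: "\<And>z. z \<in> X \<Longrightarrow> ed z = e \<Longrightarrow> (z, act m' z) \<in> joined st"
    and nj: "(x, act m x) \<notin> joined st"
  shows "classes st = Suc (classes (st(e := insert m (st e))))"
proof (rule classes_merge)
  let ?st' = "st(e := insert m (st e))"
  show "joined st \<subseteq> joined ?st'" by (rule joined_mono) auto
  show "x \<in> X" "act m x \<in> X" "(x, act m x) \<notin> joined st" using x nj act_props by auto
  show "(x, act m x) \<in> joined ?st'" using x by (intro joined_act) auto
  show "step ?st' \<subseteq> joined st \<union> {(u, w). (u, x) \<in> joined st \<and> (w, act m x) \<in> joined st} \<union>
      {(u, w). (u, act m x) \<in> joined st \<and> (w, x) \<in> joined st}"
  proof
    fix p assume "p \<in> step ?st'"
    then consider "p \<in> step st" | u where "p = (u, act m u)" "u \<in> X" "ed u = e"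
      by (auto simp: step_def split: if_splits)
    then show "p \<in> joined st \<union> {(u, w). (u, x) \<in> joined st \<and> (w, act m x) \<in> joined st} \<union>
      {(u, w). (u, act m x) \<in> joined st \<and> (w, x) \<in> joined st}"
    proof cases
      case 2
      then show ?thesis using joined_commutes[OF x(1) \<open>u \<in> X\<close> _ m, of st] j x by auto
    qed auto
  qed
qed

text \<open>Each edge of a forest merges exactly two classes.\<close>

lemma classes_forest: "forest st T \<Longrightarrow> classes st = classes (add_sides st T) + card T"
proof (induction rule: forest.induct)
  case empty then show ?case by (simp add: add_sides_def)
next
  case (insert T g)
  obtain x where x: "x \<in> X" "ed x = g" using insert by auto
  have g: "add_sides st T g = {Seg}" using insert by (simp add: add_sides_def)
  have "classes (add_sides st T) = Suc (classes ((add_sides st T)(g := insert Side (add_sides st T g))))"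
  proof (rule classes_add_mode[OF x, of _ Seg])
    show "(x, act Side x) \<notin> joined (add_sides st T)" using insert x by (auto simp: bridging_def)
    show "(z, act Seg z) \<in> joined (add_sides st T)" if "z \<in> X" "ed z = g" for z
      using that g by (intro joined_act) auto
  qed auto
  then show ?case using insert.IH \<open>g \<notin> T\<close> \<open>st g = {Seg}\<close> g forest_finite[OF insert(1)]
    by (simp add: add_sides_insert fun_upd_def)
qed

text \<open>A maximal forest in \<open>P\<close> already connects everything that \<open>P\<close> connects.\<close>

lemma forest_extend:
  assumes "forest st T" "T \<subseteq> P" "P \<subseteq> ed ` X" "\<And>g. g \<in> P \<Longrightarrow> st g = {Seg}"
  obtains T' where "forest st T'" "T \<subseteq> T'" "T' \<subseteq> P" "joined (add_sides st T') = joined (add_sides st P)"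
proof -
  have finP: "finite P" using finite_subset[OF assms(3)] finite_X by simp
  have "\<exists>T'. forest st T' \<and> T \<subseteq> T' \<and> T' \<subseteq> P \<and> (\<forall>S. forest st S \<and> T \<subseteq> S \<and> S \<subseteq> P \<longrightarrow> card S \<le> card T')"
    using ex_has_greatest_nat[of "\<lambda>S. forest st S \<and> T \<subseteq> S \<and> S \<subseteq> P" T card "Suc (card P)"]
      assms(1,2) card_mono[OF finP] by (simp add: le_imp_less_Suc le_SucI)
  then obtain T' where T': "forest st T'" "T \<subseteq> T'" "T' \<subseteq> P"
    and max: "\<And>S. forest st S \<Longrightarrow> T \<subseteq> S \<Longrightarrow> S \<subseteq> P \<Longrightarrow> card S \<le> card T'" by blast
  have nb: "\<not> bridging (add_sides st T') g" if "g \<in> P" "g \<notin> T'" for g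
  proof
    assume "bridging (add_sides st T') g"
    then have "forest st (insert g T')" using that assms(3,4) by (intro forest.insert[OF T'(1)]) auto
    then have "card (insert g T') \<le> card T'" using that T' by (intro max) auto
    then show False using that forest_finite[OF T'(1)] by simp
  qed
  have side: "(y, \<sigma> y) \<in> joined (add_sides st T')" if y: "y \<in> X" "ed y \<in> P" for y
  proof (cases "ed y \<in> T'")
    case True
    then show ?thesis using joined_act[OF y(1), of Side "add_sides st T'"] by (simp add: add_sides_def)
  next
    case False
    then obtain x where x: "x \<in> X" "ed x = ed y" "(x, \<sigma> x) \<in> joined (add_sides st T')"
      using nb y unfolding bridging_def by blast
    have "add_sides st T' (ed x) = {Seg}" using assms(4) x y False by (auto simp: add_sides_def)
    then have "all_joined (add_sides st T') (ed x)"
      using all_joinedI2[OF x(1), of Seg Side] x(3) joined_act[of _ Seg "add_sides st T'"] by simp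
    then show ?thesis using x(1,2) y sigma[OF y(1)] unfolding all_joined_def by simp
  qed
  have "joined (add_sides st P) \<subseteq> joined (add_sides st T')"
  proof (rule joined_subset)
    fix x m assume x: "x \<in> X" "m \<in> add_sides st P (ed x)"
    show "(x, act m x) \<in> joined (add_sides st T')"
    proof (cases "m \<in> st (ed x)")
      case True then show ?thesis using x by (intro joined_act) (auto simp: add_sides_def)
    next
      case False
      then show ?thesis using x side by (auto simp: add_sides_def split: if_splits)
    qed
  qed
  moreover have "joined (add_sides st T') \<subseteq> joined (add_sides st P)"
    using T' by (intro joined_mono) (auto simp: add_sides_def)
  ultimately show ?thesis using that T' by auto
qed

end

section \<open>Ribbon loops of a flag system\<close>

lemma ribbon_loop_iff_smaller:
  "ribbon_loop (E, \<F>) e \<longleftrightarrow> e \<in> E \<and> (\<forall>B\<in>\<F>. e \<in> B \<longrightarrow> (\<exists>B'\<in>\<F>. card B' < card B))"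
  unfolding ribbon_loop_def matroid_loop_def min_matroid_def fst_conv snd_conv mem_Collect_eq
  unfolding not_le[symmetric] by blast

context flag_system
begin

definition seg_state :: "'e \<Rightarrow> mode set" where "seg_state = (\<lambda>_. {Seg})"
definition graph_state :: "'e \<Rightarrow> mode set" where "graph_state = (\<lambda>_. {Seg, Side})"

definition feasible :: "'e set \<Rightarrow> bool" where
  "feasible A \<longleftrightarrow> A \<subseteq> ed ` X \<and> joined (take_sides seg_state A) = joined graph_state"

lemma smooth_seg [simp]: "smooth seg_state" and smooth_take_seg [simp]: "smooth (take_sides seg_state A)"
  by (simp_all add: smooth_def seg_state_def take_sides_def)

lemma all_joined_graph: "all_joined graph_state e"
proof (cases "e \<in> ed ` X")
  case True
  then obtain x where x: "x \<in> X" "ed x = e" by auto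
  have "all_joined graph_state (ed x)"
    by (rule all_joinedI2[OF x(1), of Seg Side]) (use x(1) in \<open>auto intro: joined_act simp: graph_state_def simp del: act.simps\<close>)
  then show ?thesis using x by simp
qed (auto simp: all_joined_def)

lemma joined_le_graph: "joined st \<subseteq> joined graph_state"
proof (rule joined_subset)
  fix x m assume "x \<in> X"
  then show "(x, act m x) \<in> joined graph_state"
    using all_joined_graph[of "ed x"] act_props[of x m] unfolding all_joined_def by simp
qed

lemma feasibleI: "A \<subseteq> ed ` X \<Longrightarrow> joined graph_state \<subseteq> joined (take_sides seg_state A) \<Longrightarrow> feasible A"
  using joined_le_graph by (auto simp: feasible_def)

lemma loop_iff: "e \<in> ed ` X \<Longrightarrow> bridging seg_state e \<longleftrightarrow> \<not> all_joined seg_state e"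
proof -
  assume e: "e \<in> ed ` X"
  have "all_joined seg_state e" if x: "x \<in> X" "ed x = e" "(x, \<sigma> x) \<in> joined seg_state" for x
  proof -
    have "all_joined seg_state (ed x)"
      by (rule all_joinedI2[OF x(1), of Seg Side])
        (use x in \<open>auto intro: joined_act[where m = Seg, simplified] simp: seg_state_def\<close>)
    then show ?thesis using x by simp
  qed
  moreover have "(x, \<sigma> x) \<in> joined seg_state" if "all_joined seg_state e" "x \<in> X" "ed x = e" for x
    using that sigma[of x] by (simp add: all_joined_def)
  ultimately show ?thesis using e by (auto simp: bridging_def)
qed

lemma joined_seg_add: "joined seg_state \<subseteq> joined (add_sides seg_state T)"
  by (rule joined_mono) (auto simp: add_sides_def)

lemma loop_notin_forest:
  assumes "forest seg_state T" "all_joined seg_state e" shows "e \<notin> T"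
  using assms(1)
proof induction
  case (insert T g)
  have "g \<noteq> e"
  proof
    assume "g = e"
    then obtain x where "x \<in> X" "ed x = e" using insert(2) by auto
    then show False
      using \<open>g = e\<close> insert(5) assms(2) sigma[of x] joined_seg_add[of T]
      unfolding bridging_def all_joined_def by auto
  qed
  then show ?case using insert.IH by simp
qed simp

definition spanning_forest :: "'e set \<Rightarrow> bool" where
  "spanning_forest T \<longleftrightarrow> forest seg_state T \<and> joined (add_sides seg_state T) = joined graph_state"

lemma spanning_forest_feasible: "spanning_forest T \<Longrightarrow> feasible T"
  using forest_ed by (auto simp: spanning_forest_def feasible_def forest_joined)

lemma spanning_forest_card: "spanning_forest T \<Longrightarrow> card T = classes seg_state - classes graph_state"
  using classes_forest[of seg_state T] by (simp add: spanning_forest_def classes_def)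

lemma feasible_contains_forest:
  assumes "feasible A" obtains T where "spanning_forest T" "T \<subseteq> A"
proof -
  have A: "A \<subseteq> ed ` X" using assms by (simp add: feasible_def)
  obtain T where T: "forest seg_state T" "T \<subseteq> A" "joined (add_sides seg_state T) = joined (add_sides seg_state A)"
    using forest_extend[OF forest.empty, of A seg_state] A by (auto simp: seg_state_def)
  have "joined (take_sides seg_state A) \<subseteq> joined (add_sides seg_state A)"
    by (rule joined_mono) (auto simp: add_sides_def take_sides_def)
  then have "joined (add_sides seg_state A) = joined graph_state"
    using assms joined_le_graph[of "add_sides seg_state A"] by (auto simp: feasible_def)
  then show ?thesis using that T by (simp add: spanning_forest_def)
qed

lemma spanning_forest_exists:
  assumes "forest seg_state S" obtains T where "spanning_forest T" "S \<subseteq> T"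
proof -
  obtain T where T: "forest seg_state T" "S \<subseteq> T" "joined (add_sides seg_state T) = joined (add_sides seg_state (ed ` X))"
    by (rule forest_extend[OF assms forest_ed[OF assms] order_refl]) (auto simp: seg_state_def)
  have "joined (add_sides seg_state (ed ` X)) = joined graph_state"
    by (rule joined_cong) (auto simp: add_sides_def seg_state_def graph_state_def)
  then show ?thesis using that T by (simp add: spanning_forest_def)
qed

lemma feasible_finite: "feasible A \<Longrightarrow> finite A"
  using finite_X by (auto simp: feasible_def intro: finite_subset)

lemma feasible_card:
  assumes "feasible A" "spanning_forest T" shows "card T \<le> card A"
proof -
  obtain S where "spanning_forest S" "S \<subseteq> A" using feasible_contains_forest[OF assms(1)] by blast
  then show ?thesis
    using card_mono[OF feasible_finite[OF assms(1)]] spanning_forest_card assms(2) by metis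
qed

abbreviation set_system :: "'e set_system" where
  "set_system \<equiv> (ed ` X, {A. feasible A})"

text \<open>The feasible sets of minimum size are the spanning forests, and a forest may start with any edge that
  joins two different vertices, and with no other.\<close>

theorem ribbon_loop_iff:
  assumes e: "e \<in> ed ` X"
  shows "ribbon_loop set_system e \<longleftrightarrow> all_joined seg_state e"
proof
  assume loop: "all_joined seg_state e"
  have "e \<notin> B" if "feasible B" "\<And>F. feasible F \<Longrightarrow> card B \<le> card F" for B
  proof -
    obtain T where T: "spanning_forest T" "T \<subseteq> B" using feasible_contains_forest \<open>feasible B\<close> by blast
    then have "card B \<le> card T" using that spanning_forest_feasible by blast
    then have "T = B" using T(2) feasible_finite[OF \<open>feasible B\<close>] by (simp add: card_seteq)
    then show ?thesis using T loop_notin_forest loop by (auto simp: spanning_forest_def)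
  qed
  then show "ribbon_loop set_system e" using e by (simp add: ribbon_loop_def matroid_loop_def min_matroid_def)
next
  assume R: "ribbon_loop set_system e"
  show "all_joined seg_state e"
  proof (rule ccontr)
    assume "\<not> all_joined seg_state e"
    then have "forest seg_state (insert e {})"
      by (intro forest.insert[OF forest.empty] e) (use loop_iff[OF e] in \<open>auto simp: seg_state_def add_sides_def\<close>)
    then obtain T where T: "spanning_forest T" "e \<in> T" using spanning_forest_exists by blast
    then show False
      using R feasible_card spanning_forest_feasible
      by (auto simp: ribbon_loop_def matroid_loop_def min_matroid_def)
  qed
qed

lemma take_seg_insert: "take_sides seg_state (insert e A) = (take_sides seg_state A)(e := {Side})"
  by (rule take_sides_insert)

lemma take_seg_notin: "e \<notin> A \<Longrightarrow> (take_sides seg_state A)(e := {Seg}) = take_sides seg_state A"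
  by (auto simp: take_sides_def seg_state_def fun_eq_iff)

text \<open>Passing \<open>e\<close> according to its matching leaves the flags of \<open>e\<close> in two classes and is therefore never
  feasible; the two other ways both connect all of them and have the same classes.\<close>

lemma feasible_matching:
  assumes e: "e \<in> ed ` X" "e \<notin> A" and A: "A \<subseteq> ed ` X"
  shows "feasible A \<Longrightarrow> matching (take_sides seg_state A) e \<noteq> Seg"
    and "feasible (insert e A) \<Longrightarrow> matching (take_sides seg_state A) e \<noteq> Side"
    and "matching (take_sides seg_state A) e = Diag \<Longrightarrow> feasible A \<longleftrightarrow> feasible (insert e A)"
    and "matching (take_sides seg_state A) e = Seg \<Longrightarrow>
      feasible (insert e A) \<longleftrightarrow> joined ((take_sides seg_state A)(e := {Diag})) = joined graph_state"
    and "matching (take_sides seg_state A) e = Side \<Longrightarrow>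
      feasible A \<longleftrightarrow> joined ((take_sides seg_state A)(e := {Diag})) = joined graph_state"
proof -
  let ?b = "take_sides seg_state A"
  have nm: "matching ?b e \<noteq> m" if "joined (?b(e := {m})) = joined graph_state" for m
    using not_all_joined_matching[of ?b e] e(1) that all_joined_graph[of e]
    by (auto simp: all_joined_def)
  show "feasible A \<Longrightarrow> matching ?b e \<noteq> Seg"
    using nm[of Seg] e by (simp add: feasible_def take_seg_notin)
  show "feasible (insert e A) \<Longrightarrow> matching ?b e \<noteq> Side"
    using nm[of Side] by (simp add: feasible_def take_seg_insert)
  have eq: "joined (?b(e := {m})) = joined (?b(e := {m'}))" if "matching ?b e \<noteq> m" "matching ?b e \<noteq> m'" for m m'
    by (rule joined_others_eq) (use that e all_joined_other[of ?b e] in auto)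
  show "matching ?b e = Diag \<Longrightarrow> feasible A \<longleftrightarrow> feasible (insert e A)"
    using eq[of Seg Side] e A by (simp add: feasible_def take_seg_notin take_seg_insert)
  show "matching ?b e = Seg \<Longrightarrow> feasible (insert e A) \<longleftrightarrow> joined (?b(e := {Diag})) = joined graph_state"
    using eq[of Side Diag] e A by (simp add: feasible_def take_seg_insert)
  show "matching ?b e = Side \<Longrightarrow> feasible A \<longleftrightarrow> joined (?b(e := {Diag})) = joined graph_state"
    using eq[of Seg Diag] e A by (simp add: feasible_def take_seg_notin)
qed

text \<open>If the flags of \<open>e\<close> were matched along the segments, then traversing the segments would leave them in
  two classes, but the flags of a loop lie on one vertex.\<close>

lemma matching_seg_loop:
  assumes "all_joined seg_state e" "e \<in> ed ` X" shows "matching seg_state e \<noteq> Seg"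
proof
  assume "matching seg_state e = Seg"
  moreover have "seg_state(e := {Seg}) = seg_state" by (auto simp: seg_state_def)
  ultimately show False using not_all_joined_matching[OF smooth_seg assms(2)] assms(1) by simp
qed

text \<open>Passing a loop \<open>e\<close> in another way can only refine the classes, so edges that were bridging remain so.\<close>

lemma forest_seg_upd:
  assumes loop: "all_joined seg_state e" and T: "forest seg_state T"
  shows "forest (seg_state(e := {m})) T \<and> joined (add_sides (seg_state(e := {m})) T) \<subseteq> joined (add_sides seg_state T)"
proof -
  have upd: "joined (add_sides (seg_state(e := {m})) S) \<subseteq> joined (add_sides seg_state S)" if "e \<notin> S" for S
  proof -
    have "add_sides (seg_state(e := {m})) S = (add_sides seg_state S)(e := {m})"
      using that by (auto simp: add_sides_def fun_eq_iff)
    moreover have "joined ((add_sides seg_state S)(e := {m})) \<subseteq> joined (add_sides seg_state S)"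
      by (rule joined_all_joined, rule all_joined_mono[OF joined_seg_add loop])
    ultimately show ?thesis by simp
  qed
  have "forest (seg_state(e := {m})) T"
    using T
  proof induction
    case (insert S g)
    have "e \<notin> insert g S" using loop_notin_forest[OF forest.insert[OF insert(1-5)] loop] .
    moreover have "bridging (add_sides (seg_state(e := {m})) S) g"
      using insert(5) upd[of S] calculation by (auto simp: bridging_def)
    moreover from calculation have "(seg_state(e := {m})) g = {Seg}" using insert(4) by auto
    ultimately show ?case by (intro forest.insert[OF insert.IH insert(2,3)])
  qed (rule forest.empty)
  then show ?thesis using upd loop_notin_forest[OF T loop] by simp
qed

text \<open>If the matching changed, then in the state that passes \<open>e\<close> according to its original matching the
  forest would join all flags of \<open>e\<close>, and so would lead to as few classes as the forest in the original
  state. Every edge of the forest merges two classes in both states, so the two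
  states would have equally many classes before the forest is added. But the flags of \<open>e\<close> form one class in
  one of them and two classes in the other.\<close>

lemma forest_matching:
  assumes loop: "all_joined seg_state e" and e: "e \<in> ed ` X" and T: "forest seg_state T"
  shows "matching (take_sides seg_state T) e = matching seg_state e"
proof (rule ccontr)
  let ?M = "matching seg_state e"
  let ?st = "seg_state(e := {?M})"
  assume ne: "matching (take_sides seg_state T) e \<noteq> ?M"
  have eT: "e \<notin> T" using loop_notin_forest[OF T loop] .
  have sm: "smooth ?st" using smooth_upd smooth_seg by blast
  have fT: "forest ?st T" and sub: "joined (add_sides ?st T) \<subseteq> joined (add_sides seg_state T)"
    using forest_seg_upd[OF loop T] by auto
  have "take_sides ?st T = (take_sides seg_state T)(e := {?M})" using eT by (auto simp: take_sides_def fun_eq_iff)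
  then have "all_joined (take_sides ?st T) e" using all_joined_other[of "take_sides seg_state T" e ?M] e ne by simp
  then have "all_joined (add_sides ?st T) e" using forest_joined[OF fT sm] by (simp add: all_joined_def)
  then have "joined ((add_sides ?st T)(e := {Seg})) \<subseteq> joined (add_sides ?st T)" by (rule joined_all_joined)
  moreover have "(add_sides ?st T)(e := {Seg}) = add_sides seg_state T" using eT by (auto simp: add_sides_def seg_state_def fun_eq_iff)
  ultimately have "joined (add_sides ?st T) = joined (add_sides seg_state T)" using sub by simp
  (* equal numbers of classes after adding T, which merges card T pairs in either state *)
  then have "classes ?st = classes seg_state"
    using classes_forest[OF fT] classes_forest[OF T] by (simp add: classes_def)
  moreover have "joined ?st \<subseteq> joined seg_state" by (rule joined_all_joined[OF loop])
  ultimately have "joined ?st = joined seg_state" using classes_eq_iff by blast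
  then have "all_joined ?st e" using loop by (simp only: all_joined_def)
  then show False using not_all_joined_matching[OF smooth_seg e] by blast
qed

text \<open>Let \<open>r\<close> be the size of the spanning forests. In the twisted system a feasible \<open>F\<close> with \<open>e \<notin> F\<close> has
  size at least \<open>r + 1\<close>, attained by spanning forests. So \<open>e\<close> is a ribbon loop there exactly if some
  feasible set with \<open>e\<close> has size \<open>r + 1\<close>. Such a set would be a spanning forest together
  with \<open>e\<close>, which is feasible only if the matching at \<open>e\<close> is neither along the segments nor along the sides.\<close>

theorem nonorientable_ribbon_loop_iff:
  assumes loop: "all_joined seg_state e" and e: "e \<in> ed ` X"
  shows "nonorientable_ribbon_loop set_system e \<longleftrightarrow> matching seg_state e = Diag"
proof -
  define r where "r = classes seg_state - classes graph_state"
  obtain T where T: "spanning_forest T" using spanning_forest_exists[OF forest.empty] by blast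
  have eT: "e \<notin> T" "card T = r" "feasible T" "finite T"
    using T loop_notin_forest loop spanning_forest_card spanning_forest_feasible feasible_finite
    by (auto simp: spanning_forest_def r_def)
  have ge: "r \<le> card F" if "feasible F" for F using feasible_card[OF that T] eT by simp
  (* a feasible set that contains e also contains a spanning forest, which does not contain e *)
  have ge': "Suc r \<le> card F" "matching seg_state e \<noteq> Diag \<Longrightarrow> Suc (Suc r) \<le> card F" if F: "feasible F" "e \<in> F" for F
  proof -
    obtain S where S: "spanning_forest S" "S \<subseteq> F" using feasible_contains_forest F by blast
    have eS: "e \<notin> S" using S loop_notin_forest loop by (auto simp: spanning_forest_def)
    have fin: "finite F" using F feasible_finite by blast
    have sub: "insert e S \<subseteq> F" using S F by auto
    have c: "card (insert e S) = Suc r" using spanning_forest_card[OF S(1)] eS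
        feasible_finite[OF spanning_forest_feasible[OF S(1)]] by (simp add: r_def)
    show "Suc r \<le> card F" using card_mono[OF fin sub] c by simp
    assume nd: "matching seg_state e \<noteq> Diag"
    have "F \<noteq> insert e S"
    proof
      assume "F = insert e S"
      moreover have "S \<subseteq> ed ` X" "feasible S" using S spanning_forest_feasible by (auto simp: feasible_def)
      ultimately have "matching (take_sides seg_state S) e \<noteq> Side" "matching (take_sides seg_state S) e \<noteq> Seg"
        using feasible_matching(1,2)[OF e eS, of] F by auto
      then show False using forest_matching[OF loop e] S nd mode.exhaust by (metis spanning_forest_def)
    qed
    then have "insert e S \<subset> F" using sub by blast
    then show "Suc (Suc r) \<le> card F" using psubset_card_mono[OF fin, of "insert e S"] c by simp
  qed
  have sd: "sym_diff F {e} = (if e \<in> F then F - {e} else insert e F)" for F by auto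
  have sd_card: "card (sym_diff F {e}) = (if e \<in> F then card F - 1 else Suc (card F))" if "feasible F" for F
    unfolding sd using feasible_finite[OF that] by auto
  have "ribbon_loop (twist set_system e) e \<longleftrightarrow>
      (\<forall>F. feasible F \<longrightarrow> e \<notin> F \<longrightarrow> (\<exists>F'. feasible F' \<and> card (sym_diff F' {e}) < card (sym_diff F {e})))"
  proof -
    have "twist set_system e = (ed ` X, (\<lambda>F. sym_diff F {e}) ` Collect feasible)"
      by (simp add: twist_def)
    moreover have "e \<in> sym_diff F {e} \<longleftrightarrow> e \<notin> F" for F by auto
    ultimately show ?thesis using e by (simp only: ribbon_loop_iff_smaller ball_simps bex_simps mem_Collect_eq) blast
  qed
  also have "\<dots> \<longleftrightarrow> matching seg_state e = Diag"
  proof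
    assume d: "matching seg_state e = Diag"
    have "matching (take_sides seg_state T) e = Diag" using d forest_matching[OF loop e] T by (simp add: spanning_forest_def)
    then have F': "feasible (insert e T)"
      using feasible_matching(3)[OF e eT(1)] eT(3) by (auto simp: feasible_def)
    have "card (sym_diff (insert e T) {e}) < card (sym_diff F {e})" if "feasible F" "e \<notin> F" for F
      using sd_card[OF F'] sd_card[OF that(1)] that ge[OF that(1)] eT by simp
    then show "\<forall>F. feasible F \<longrightarrow> e \<notin> F \<longrightarrow> (\<exists>F'. feasible F' \<and> card (sym_diff F' {e}) < card (sym_diff F {e}))"
      using F' by blast
  next
    assume "\<forall>F. feasible F \<longrightarrow> e \<notin> F \<longrightarrow> (\<exists>F'. feasible F' \<and> card (sym_diff F' {e}) < card (sym_diff F {e}))"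
    then obtain F' where F': "feasible F'" "card (sym_diff F' {e}) < card (sym_diff T {e})" using eT by blast
    have "e \<in> F'" using F'(2) sd_card[OF F'(1)] sd_card[OF eT(3)] eT(1,2) ge[OF F'(1)] by (cases "e \<in> F'") simp_all
    moreover have "card F' - 1 < Suc r" using calculation F'(2) sd_card[OF F'(1)] sd_card[OF eT(3)] eT(1,2) by simp
    ultimately have "\<not> Suc (Suc r) \<le> card F'" by linarith
    then show "matching seg_state e = Diag" using ge'(2)[OF F'(1) \<open>e \<in> F'\<close>] by blast
  qed
  finally show ?thesis using ribbon_loop_iff[OF e] loop by (simp add: nonorientable_ribbon_loop_def)
qed

text \<open>Both matchings are realised by walks that avoid \<open>e\<close>. If they differed, their composition, or one of
  them, would be a walk along a segment of \<open>e\<close>.\<close>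

lemma separated_matching:
  assumes e: "e \<in> ed ` X"
    and sep: "\<And>x. x \<in> X \<Longrightarrow> ed x = e \<Longrightarrow> (x, \<tau> x) \<notin> joined (graph_state(e := {}))"
  shows "matching (take_sides seg_state A) e = matching seg_state e"
proof (rule ccontr)
  let ?M = "matching (take_sides seg_state A) e" and ?N = "matching seg_state e"
  assume ne: "?M \<noteq> ?N"
  obtain x where x: "x \<in> X" "ed x = e" using e by auto
  have sub: "joined ((take_sides seg_state B)(e := {})) \<subseteq> joined (graph_state(e := {}))" for B
    by (rule joined_mono) (auto simp: take_sides_def seg_state_def graph_state_def)
  have sub0: "joined (seg_state(e := {})) \<subseteq> joined (graph_state(e := {}))"
    by (rule joined_mono) (auto simp: seg_state_def graph_state_def)
  have M: "(z, act ?M z) \<in> joined (graph_state(e := {}))" "(z, act ?N z) \<in> joined (graph_state(e := {}))"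
    if "z \<in> X" "ed z = e" for z
    using matching[OF smooth_take_seg that, of ?M A] matching[OF smooth_seg that, of ?N] sub[of A] sub0 by blast+
  have "?M \<noteq> Seg" "?N \<noteq> Seg" using M[OF x] sep[OF x] by auto
  then have "act ?M (act ?N x) = act Seg x" using act_third[OF x(1)] ne by auto
  then have "(x, \<tau> x) \<in> joined (graph_state(e := {}))"
    using joined_trans[OF M(2)[OF x] M(1)[of "act ?N x"]] act_props[OF x(1), of ?N] x by simp
  then show False using sep x by blast
qed

text \<open>Pass \<open>e\<close> according to its matching and choose a spanning forest of the remaining edges. A walk that avoids
  \<open>e\<close> between the two pairs then joins all flags of \<open>e\<close>, so that the forest connects as much as the whole
  graph.\<close>

lemma crossing_quasi_tree:
  assumes loop: "all_joined seg_state e" and e: "e \<in> ed ` X"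
    and x: "x \<in> X" "ed x = e" "(x, \<tau> x) \<in> joined (graph_state(e := {}))"
  obtains T where "T \<subseteq> ed ` X" "e \<notin> T" "joined ((take_sides seg_state T)(e := {matching seg_state e})) = joined graph_state"
proof -
  let ?M = "matching seg_state e"
  let ?st = "seg_state(e := {?M})" and ?P = "ed ` X - {e}"
  obtain T where T: "forest ?st T" "T \<subseteq> ?P" "joined (add_sides ?st T) = joined (add_sides ?st ?P)"
    using forest_extend[OF forest.empty, of ?P ?st] by (auto simp: seg_state_def)
  have P: "joined (add_sides ?st ?P) = joined (graph_state(e := {?M}))"
    by (rule joined_cong) (auto simp: add_sides_def seg_state_def graph_state_def)
  have "all_joined (graph_state(e := {?M})) (ed x)"
  proof (rule all_joinedI2[OF x(1), of ?M Seg])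
    show "?M \<noteq> Seg" by (rule matching_seg_loop[OF loop e])
    show "(z, act ?M z) \<in> joined (graph_state(e := {?M}))" if "z \<in> X" "ed z = ed x" for z
      using that x by (intro joined_act) auto
    have "joined (graph_state(e := {})) \<subseteq> joined (graph_state(e := {?M}))" by (rule joined_mono) auto
    then show "(x, act Seg x) \<in> joined (graph_state(e := {?M}))" using x by auto
  qed
  then have "joined ((graph_state(e := {?M}))(e := graph_state e)) \<subseteq> joined (graph_state(e := {?M}))"
    using joined_all_joined x by blast
  then have "joined (graph_state(e := {?M})) = joined graph_state" using joined_le_graph by auto
  moreover have "take_sides ?st T = (take_sides seg_state T)(e := {?M})" using T(2) by (auto simp: take_sides_def fun_eq_iff)
  ultimately show ?thesis
    using that[of T] T P forest_joined[OF T(1) smooth_upd[OF smooth_seg]] by auto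
qed

text \<open>If the two pairs are separated, the matching at \<open>e\<close> is the same for all edge sets: a matching along
  the sides excludes \<open>e\<close> from all feasible sets, and a diagonal one makes the presence of \<open>e\<close>
  irrelevant. Otherwise \<open>crossing_quasi_tree\<close> yields a counterexample to triviality: in the first case it is
  a feasible set with \<open>e\<close>; in the second case the matching has changed along \<open>T\<close>, and exactly one of
  \<open>T\<close> and \<open>insert e T\<close> is feasible.\<close>

theorem trivial_ribbon_loop_iff:
  assumes loop: "all_joined seg_state e" and e: "e \<in> ed ` X"
  shows "trivial_ribbon_loop set_system e \<longleftrightarrow>
    (\<forall>x\<in>X. ed x = e \<longrightarrow> (x, \<tau> x) \<notin> joined (graph_state(e := {})))" (is "_ \<longleftrightarrow> ?sep")
proof -
  let ?M = "matching seg_state e"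
  have M: "?M = Side \<or> ?M = Diag" using matching_seg_loop[OF loop e] by (cases ?M) auto
  have non: "nonorientable_ribbon_loop set_system e \<longleftrightarrow> ?M = Diag"
    by (rule nonorientable_ribbon_loop_iff[OF loop e])
  have orient: "orientable_ribbon_loop set_system e \<longleftrightarrow> ?M = Side"
    using non M ribbon_loop_iff[OF e] loop by (auto simp: orientable_ribbon_loop_def)
  have sd: "sym_diff F {e} = (if e \<in> F then F - {e} else insert e F)" for F by auto
  show ?thesis
  proof
    assume ?sep
    then have m: "matching (take_sides seg_state A) e = ?M" for A
      using separated_matching[OF e] \<open>?sep\<close> by blast
    show "trivial_ribbon_loop set_system e"
      using M
    proof
      assume "?M = Side"
      moreover have "e \<notin> F" if "feasible F" for F
      proof
        assume "e \<in> F"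
        then have F: "insert e (F - {e}) = F" by auto
        have "matching (take_sides seg_state (F - {e})) e \<noteq> Side"
          by (rule feasible_matching(2)[OF e]) (use that F in \<open>auto simp: feasible_def\<close>)
        then show False using m[of "F - {e}"] \<open>?M = Side\<close> by simp
      qed
      ultimately show ?thesis using orient by (simp add: trivial_ribbon_loop_def)
    next
      assume D: "?M = Diag"
      have "feasible (sym_diff F {e})" if F: "feasible F" for F
      proof -
        have "F - {e} \<subseteq> ed ` X" using F by (auto simp: feasible_def)
        then have "feasible (F - {e}) \<longleftrightarrow> feasible (insert e (F - {e}))"
          using feasible_matching(3)[OF e, of "F - {e}"] m[of "F - {e}"] D by simp
        then show ?thesis unfolding sd using F by (auto simp: insert_absorb)
      qed
      then show ?thesis using non D by (simp add: trivial_ribbon_loop_def)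
    qed
  next
    assume triv: "trivial_ribbon_loop set_system e"
    show ?sep
    proof (intro ballI impI notI)
      fix x assume x: "x \<in> X" "ed x = e" "(x, \<tau> x) \<in> joined (graph_state(e := {}))"
      obtain T where T: "T \<subseteq> ed ` X" "e \<notin> T" and jT: "joined ((take_sides seg_state T)(e := {?M})) = joined graph_state"
        by (rule crossing_quasi_tree[OF loop e x])
      show False
        using M
      proof
        assume S: "?M = Side"
        then have "feasible (insert e T)" using jT T e by (auto simp: feasible_def take_seg_insert)
        then show False using triv S orient non by (auto simp: trivial_ribbon_loop_def)
      next
        assume D: "?M = Diag"
        then have jD: "joined ((take_sides seg_state T)(e := {Diag})) = joined graph_state" using jT by simp
        have "matching (take_sides seg_state T) e \<noteq> Diag"
          using not_all_joined_matching[of "take_sides seg_state T" e] e jD all_joined_graph[of e]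
          by (auto simp: all_joined_def)
        then consider "matching (take_sides seg_state T) e = Seg" | "matching (take_sides seg_state T) e = Side"
          by (cases "matching (take_sides seg_state T) e") auto
        then have "feasible T \<noteq> feasible (insert e T)"
          using feasible_matching[OF e T(2,1)] jD by cases auto
        moreover have "sym_diff T {e} = insert e T" "sym_diff (insert e T) {e} = T" using T by auto
        ultimately have "\<exists>F. feasible F \<and> \<not> feasible (sym_diff F {e})" by metis
        then show False using triv D orient by (auto simp: trivial_ribbon_loop_def)
      qed
    qed
  qed
qed

end

section \<open>Surfaces, discs, arcs and circles\<close>

lemma homeomorphicD:
  assumes "S homeomorphic T" shows "\<exists>f g. homeomorphism S T f g" "\<exists>f g. homeomorphism T S f g"
  using assms homeomorphism_symD unfolding homeomorphic_def by blast+

lemma homeomorphism_imp_homeomorphic: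
  assumes "homeomorphism S T f g" shows "S homeomorphic T" "T homeomorphic S"
  using assms homeomorphism_symD unfolding homeomorphic_def by blast+

definition ball_chart :: "'a::t2_space set \<Rightarrow> 'a \<Rightarrow> bool" where
  "ball_chart S x \<longleftrightarrow>
     (\<exists>U. openin (top_of_set S) U \<and> x \<in> U \<and> U homeomorphic ball (0::complex) 1)"

lemma surface_boundary_eq: "surface_boundary S = {x \<in> S. \<not> ball_chart S x}"
  by (simp add: surface_boundary_def ball_chart_def)

lemma surface_boundary_subset: "surface_boundary S \<subseteq> S"
  by (auto simp: surface_boundary_eq)

lemma ball_chart_homeomorphism:
  assumes h: "homeomorphism S T f g" and "ball_chart S x"
  shows "ball_chart T (f x)"
proof -
  obtain U where U: "openin (top_of_set S) U" "x \<in> U" "U homeomorphic ball (0::complex) 1"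
    using assms(2) by (auto simp: ball_chart_def)
  have sub: "U \<subseteq> S" using U openin_imp_subset by blast
  have "homeomorphism U (f ` U) f g"
    by (rule homeomorphism_of_subsets[OF h sub order_refl refl])
  then have "f ` U homeomorphic U" by (rule homeomorphism_imp_homeomorphic)
  then have "f ` U homeomorphic ball (0::complex) 1" using U homeomorphic_trans by blast
  moreover have "openin (top_of_set T) (f ` U)" by (rule homeomorphism_imp_open_map[OF h U(1)])
  ultimately show ?thesis using U(2) by (auto simp: ball_chart_def)
qed

lemma surface_boundary_homeomorphism:
  assumes h: "homeomorphism S T f g"
  shows "surface_boundary T = f ` surface_boundary S"
proof -
  have 1: "f x \<in> T" "g (f x) = x" if "x \<in> S" for x using h that by (auto simp: homeomorphism_def)
  have 2: "g y \<in> S" "f (g y) = y" if "y \<in> T" for y using h that by (auto simp: homeomorphism_def)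
  have 3: "ball_chart S x \<longleftrightarrow> ball_chart T (f x)" if "x \<in> S" for x
    using ball_chart_homeomorphism[OF h] ball_chart_homeomorphism[OF homeomorphism_symD[OF h], of "f x"]
      1[OF that] by auto
  show ?thesis unfolding surface_boundary_eq
  proof
    show "{x \<in> T. \<not> ball_chart T x} \<subseteq> f ` {x \<in> S. \<not> ball_chart S x}"
    proof
      fix y assume "y \<in> {x \<in> T. \<not> ball_chart T x}"
      then show "y \<in> f ` {x \<in> S. \<not> ball_chart S x}"
        using 2[of y] 3[of "g y"] by (intro image_eqI[of _ _ "g y"]) auto
    qed
    show "f ` {x \<in> S. \<not> ball_chart S x} \<subseteq> {x \<in> T. \<not> ball_chart T x}" using 1 3 by auto
  qed
qed

text \<open>Being an interior point is a local property: a chart around \<open>x\<close> can be shrunk to a small ball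
  whose image lies in the given neighbourhood.\<close>

lemma ball_chart_openin:
  assumes U: "openin (top_of_set S) U" and x: "x \<in> U"
  shows "ball_chart U x \<longleftrightarrow> ball_chart S x"
proof
  assume "ball_chart U x"
  then show "ball_chart S x" using U openin_trans by (auto simp: ball_chart_def)
next
  assume "ball_chart S x"
  then obtain W where W: "openin (top_of_set S) W" "x \<in> W" "W homeomorphic ball (0::complex) 1"
    by (auto simp: ball_chart_def)
  then obtain k h where kh: "homeomorphism W (ball (0::complex) 1) k h" by (auto simp: homeomorphic_def)
  have "openin (top_of_set W) (W \<inter> U)"
    by (meson U W(1) openin_Int openin_subset_trans openin_imp_subset inf_le1)
  then have "openin (top_of_set (ball (0::complex) 1)) (k ` (W \<inter> U))"
    by (rule homeomorphism_imp_open_map[OF kh])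
  then have op: "open (k ` (W \<inter> U))" using openin_open_eq by blast
  then obtain r where r: "0 < r" "ball (k x) r \<subseteq> k ` (W \<inter> U)"
    using x W(2) by (metis IntI image_eqI open_contains_ball)
  have sub: "ball (k x) r \<subseteq> ball 0 1" using r kh by (force simp: homeomorphism_def)
  define V where "V = h ` ball (k x) r"
  have V: "openin (top_of_set W) V" unfolding V_def
    by (rule homeomorphism_imp_open_map[OF homeomorphism_symD[OF kh]]) (use sub in \<open>simp add: open_openin_trans open_subset\<close>)
  have VU: "V \<subseteq> U"
  proof
    fix v assume "v \<in> V"
    then obtain w where "w \<in> W \<inter> U" "v = h (k w)" using r(2) unfolding V_def by blast
    then show "v \<in> U" using kh by (simp add: homeomorphism_def)
  qed
  have "openin (top_of_set S) V" using V W(1) openin_trans by blast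
  then have "openin (top_of_set U) V" using VU U openin_subset_trans openin_imp_subset by metis
  moreover have "x \<in> V" unfolding V_def
    using r(1) kh W(2) by (intro image_eqI[of _ _ "k x"]) (auto simp: homeomorphism_def)
  moreover have "V homeomorphic ball (0::complex) 1"
  proof -
    have "homeomorphism (ball (k x) r) V h k" unfolding V_def
      by (rule homeomorphism_of_subsets[OF homeomorphism_symD[OF kh] sub order_refl refl])
    then have "V homeomorphic ball (k x) r" by (rule homeomorphism_imp_homeomorphic)
    moreover have "ball (k x) r homeomorphic ball (0::complex) 1" using r(1) by (intro homeomorphic_balls(1)) auto
    ultimately show ?thesis by (rule homeomorphic_trans)
  qed
  ultimately show "ball_chart U x" by (auto simp: ball_chart_def)
qed

lemma surface_boundary_openin:
  assumes "openin (top_of_set S) U"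
  shows "surface_boundary U = surface_boundary S \<inter> U"
  using ball_chart_openin[OF assms] openin_imp_subset[OF assms] by (auto simp: surface_boundary_eq)

lemma closedin_surface_boundary: "closedin (top_of_set S) (surface_boundary S)"
proof -
  have "S - surface_boundary S = \<Union>{U. openin (top_of_set S) U \<and> U homeomorphic ball (0::complex) 1}"
    using openin_imp_subset by (fastforce simp: surface_boundary_def)
  then have "openin (top_of_set S) (S - surface_boundary S)" by (metis (no_types, lifting) mem_Collect_eq openin_Union)
  then show ?thesis using surface_boundary_subset by (simp add: closedin_def)
qed

text \<open>By invariance of domain, a subset of the plane that is homeomorphic to an open disc is open in the plane.\<close>

lemma surface_boundary_planar:
  fixes R :: "complex set"
  shows "surface_boundary R = R - interior R"
proof -
  have "ball_chart R x \<longleftrightarrow> x \<in> interior R" if "x \<in> R" for x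
  proof
    assume "ball_chart R x"
    then obtain U where U: "openin (top_of_set R) U" "x \<in> U" "U homeomorphic ball (0::complex) 1"
      by (auto simp: ball_chart_def)
    then obtain f g where h: "homeomorphism (ball (0::complex) 1) U f g"
      using homeomorphicD(2) by blast
    have "open (f ` ball 0 1)"
      by (rule invariance_of_domain_gen) (use h in \<open>auto simp: homeomorphism_def intro: inj_on_inverseI\<close>)
    moreover have "f ` ball 0 1 = U" using h by (simp add: homeomorphism_def)
    ultimately show "x \<in> interior R" using U openin_imp_subset by (meson interiorI)
  next
    assume "x \<in> interior R"
    then obtain r where r: "0 < r" "ball x r \<subseteq> R" by (auto simp: mem_interior)
    have "openin (top_of_set R) (ball x r)" using r by (simp add: open_subset)
    moreover have "ball x r homeomorphic ball (0::complex) 1" using r by (intro homeomorphic_balls(1)) auto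
    ultimately show "ball_chart R x" using r by (auto simp: ball_chart_def)
  qed
  then show ?thesis by (auto simp: surface_boundary_eq)
qed

subsection \<open>Discs\<close>

definition is_disc :: "'a::t2_space set \<Rightarrow> bool" where
  "is_disc d \<longleftrightarrow> d homeomorphic cball (0::complex) 1"

lemma disc_param:
  assumes "is_disc d"
  obtains f g where "homeomorphism (cball (0::complex) 1) d f g" "surface_boundary d = f ` sphere 0 1"
    "homeomorphism (sphere 0 1) (surface_boundary d) f g"
proof -
  obtain f g where h: "homeomorphism (cball (0::complex) 1) d f g"
    using assms homeomorphicD(2) unfolding is_disc_def by blast
  have "surface_boundary (cball (0::complex) 1) = sphere 0 1"
    unfolding surface_boundary_planar interior_cball by auto
  then have "surface_boundary d = f ` sphere 0 1" using surface_boundary_homeomorphism[OF h] by simp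
  moreover have "homeomorphism (sphere 0 1) (f ` sphere 0 1) f g"
    by (rule homeomorphism_of_subsets[OF h _ order_refl refl]) auto
  ultimately show ?thesis using that h by simp
qed

lemma disc_compact: "is_disc d \<Longrightarrow> compact d"
  unfolding is_disc_def using homeomorphic_compactness compact_cball by blast

lemma disc_closed: "is_disc d \<Longrightarrow> closed (d::'a::t2_space set)"
  using disc_compact compact_imp_closed by blast

lemma disc_connected: "is_disc d \<Longrightarrow> connected d"
  unfolding is_disc_def using homeomorphic_connectedness convex_connected convex_cball by blast

lemma disc_boundary_circle: "is_disc d \<Longrightarrow> surface_boundary d homeomorphic sphere (0::complex) 1"
  by (metis disc_param homeomorphism_imp_homeomorphic(2))

definition is_circle :: "'a::t2_space set \<Rightarrow> bool" where
  "is_circle C \<longleftrightarrow> C homeomorphic sphere (0::complex) 1"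

lemma circle_compact: "is_circle C \<Longrightarrow> compact C"
  unfolding is_circle_def using homeomorphic_compactness compact_sphere by blast

lemma circle_closed: "is_circle (C :: 'a::t2_space set) \<Longrightarrow> closed C"
  using circle_compact compact_imp_closed by blast

lemma circle_connected: "is_circle C \<Longrightarrow> connected C"
  unfolding is_circle_def using homeomorphic_connectedness connected_sphere[of "0::complex" 1] by auto

lemma circle_nonempty: "is_circle C \<Longrightarrow> C \<noteq> {}"
  unfolding is_circle_def by (auto simp: homeomorphic_empty)

subsection \<open>Components of finite unions\<close>

lemma components_Union_disjoint:
  fixes \<P> :: "'a::topological_space set set"
  assumes fin: "finite \<P>" and P: "\<And>P. P \<in> \<P> \<Longrightarrow> closed P \<and> connected P \<and> P \<noteq> {}"
    and disj: "pairwise disjnt \<P>"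
  shows "components (\<Union>\<P>) = \<P>"
proof -
  have maxi: "d \<subseteq> P" if "P \<in> \<P>" "connected d" "d \<subseteq> \<Union>\<P>" "d \<inter> P \<noteq> {}" for d P
  proof -
    have "closed (\<Union>(\<P> - {P}))" using fin P by (intro closed_Union) auto
    moreover have "P \<inter> \<Union>(\<P> - {P}) = {}" using disj that(1) by (auto simp: pairwise_def disjnt_def)
    moreover have "d \<subseteq> P \<union> \<Union>(\<P> - {P})" using that(3) by blast
    ultimately have "d \<inter> \<Union>(\<P> - {P}) = {}"
      using connected_closedD[OF that(2), of P "\<Union>(\<P> - {P})"] P[OF that(1)] that(4) by blast
    then show ?thesis using that(3) by blast
  qed
  have sub: "P \<in> components (\<Union>\<P>)" if "P \<in> \<P>" for P
    unfolding in_components_maximal using P[OF that] that maxi[OF that] by blast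
  moreover have "C \<in> \<P>" if C: "C \<in> components (\<Union>\<P>)" for C
  proof -
    obtain P where "P \<in> \<P>" "C \<inter> P \<noteq> {}"
      using in_components_nonempty[OF C] in_components_subset[OF C] by blast
    then show ?thesis using sub components_eq[OF C, of P] by metis
  qed
  ultimately show ?thesis by blast
qed

text \<open>The pieces that a chain of common points of \<open>X\<close> leads to, and the remaining ones, form two disjoint closed
  sets. Therefore topological connectivity of a finite union of closed connected pieces is
  reachability from piece to piece.\<close>

lemma connected_component_Union_iff:
  fixes \<P> :: "'a::topological_space set set"
  assumes fin: "finite \<P>" and P: "\<And>P. P \<in> \<P> \<Longrightarrow> closed P \<and> connected P"
    and meet: "\<And>P Q. P \<in> \<P> \<Longrightarrow> Q \<in> \<P> \<Longrightarrow> P \<inter> Q \<noteq> {} \<Longrightarrow> P \<noteq> Q \<Longrightarrow> P \<inter> Q \<inter> X \<noteq> {}"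
    and x: "x \<in> X" "x \<in> \<Union>\<P>" and y: "y \<in> X"
  shows "connected_component (\<Union>\<P>) x y \<longleftrightarrow>
    (x, y) \<in> {(u, w). u \<in> X \<and> w \<in> X \<and> (\<exists>P\<in>\<P>. u \<in> P \<and> w \<in> P)}\<^sup>*" (is "_ \<longleftrightarrow> _ \<in> ?R\<^sup>*")
proof
  assume "(x, y) \<in> ?R\<^sup>*"
  then show "connected_component (\<Union>\<P>) x y"
  proof induction
    case base show ?case using x by (simp add: connected_component_refl_eq)
  next
    case (step u w)
    then obtain Q where "Q \<in> \<P>" "u \<in> Q" "w \<in> Q" by blast
    then have "connected_component (\<Union>\<P>) u w" using P by (intro connected_componentI[of Q]) auto
    then show ?case using step.IH connected_component_trans by metis
  qed
next
  assume "connected_component (\<Union>\<P>) x y"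
  then obtain T where T: "connected T" "T \<subseteq> \<Union>\<P>" "x \<in> T" "y \<in> T" by (auto simp: connected_component_def)
  define A where "A = {Q \<in> \<P>. \<exists>w\<in>Q \<inter> X. (x, w) \<in> ?R\<^sup>*}"
  have cl: "closed (\<Union>A)" "closed (\<Union>(\<P> - A))" using fin P by (auto intro!: closed_Union simp: A_def)
  have "\<Union>A \<inter> \<Union>(\<P> - A) = {}"
  proof (rule ccontr)
    assume "\<Union>A \<inter> \<Union>(\<P> - A) \<noteq> {}"
    then obtain Q S where QS: "Q \<in> A" "S \<in> \<P>" "S \<notin> A" "Q \<inter> S \<noteq> {}" by blast
    then obtain w where w: "w \<in> Q \<inter> X" "(x, w) \<in> ?R\<^sup>*" by (auto simp: A_def)
    obtain z where z: "z \<in> Q \<inter> S \<inter> X" using meet[of Q S] QS by (auto simp: A_def)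
    have "(w, z) \<in> ?R" using w z QS by (auto simp: A_def)
    then have "(x, z) \<in> ?R\<^sup>*" by (rule rtrancl.rtrancl_into_rtrancl[OF w(2)])
    then have "S \<in> A" using z QS(2) unfolding A_def by blast
    then show False using QS by simp
  qed
  moreover have "T \<subseteq> \<Union>A \<union> \<Union>(\<P> - A)" using T(2) by blast
  moreover have "x \<in> \<Union>A"
  proof -
    obtain Q where "Q \<in> \<P>" "x \<in> Q" using x(2) by blast
    then have "Q \<in> A" using x(1) unfolding A_def by blast
    then show ?thesis using \<open>x \<in> Q\<close> by blast
  qed
  ultimately have "y \<in> \<Union>A" using connected_closedD[OF T(1), of "\<Union>A" "\<Union>(\<P> - A)"] cl T by blast
  then obtain Q w where Q: "Q \<in> \<P>" "y \<in> Q" "w \<in> Q" "w \<in> X" "(x, w) \<in> ?R\<^sup>*"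
    unfolding A_def by blast
  then have "(w, y) \<in> ?R" using y by auto
  then show "(x, y) \<in> ?R\<^sup>*" by (rule rtrancl.rtrancl_into_rtrancl[OF Q(5)])
qed

subsection \<open>Arcs\<close>

definition is_arc :: "'a::t2_space set \<Rightarrow> bool" where
  "is_arc s \<longleftrightarrow> (\<exists>g. arc g \<and> path_image g = s)"

definition arc_ends :: "'a::t2_space set \<Rightarrow> 'a set" where
  "arc_ends s = {p \<in> s. connected (s - {p})}"

lemma is_arc_iff: "is_arc (s :: 'a::t2_space set) \<longleftrightarrow> s homeomorphic {0..1::real}"
proof
  assume "is_arc s"
  then obtain g where g: "arc g" "path_image g = s" by (auto simp: is_arc_def)
  then have "\<exists>h. homeomorphism {0..1::real} s g h"
    by (intro homeomorphism_compact) (auto simp: arc_def path_def path_image_def)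
  then show "s homeomorphic {0..1::real}" using homeomorphism_imp_homeomorphic(2) by blast
next
  assume "s homeomorphic {0..1::real}"
  then obtain g h where "homeomorphism {0..1::real} s g h" using homeomorphicD(2) by blast
  then show "is_arc s" unfolding is_arc_def
    by (intro exI[of _ g]) (auto simp: homeomorphism_def arc_def path_def path_image_def intro: inj_on_inverseI)
qed

lemma arc_ends_path_image:
  fixes g :: "real \<Rightarrow> 'a::t2_space"
  assumes g: "arc g"
  shows "arc_ends (path_image g) = {pathstart g, pathfinish g}"
proof -
  obtain h where h: "homeomorphism {0..1::real} (path_image g) g h"
    using homeomorphism_compact[of "{0..1::real}" g "path_image g"] g by (auto simp: arc_def path_def path_image_def)
  have con: "connected (path_image g - {g t}) \<longleftrightarrow> t = 0 \<or> t = 1" if t: "t \<in> {0..1}" for t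
  proof -
    have eq: "g ` ({0..1} - {t}) = path_image g - {g t}"
      using g t unfolding arc_def path_image_def by (auto simp: inj_on_def)
    have "homeomorphism ({0..1} - {t}) (path_image g - {g t}) g h"
      by (rule homeomorphism_of_subsets[OF h Diff_subset order_refl eq])
    then have "connected (path_image g - {g t}) \<longleftrightarrow> connected ({0..1} - {t})"
      using homeomorphic_connectedness homeomorphism_imp_homeomorphic(2) by blast
    also have "\<dots> \<longleftrightarrow> t = 0 \<or> t = 1"
    proof
      assume *: "connected ({0..1} - {t})"
      show "t = 0 \<or> t = 1"
      proof (rule ccontr)
        assume "\<not> (t = 0 \<or> t = 1)"
        then have "t \<in> {0..1} - {t}"
          using connectedD_interval[OF *, of 0 1 t] t by auto
        then show False by simp
      qed
    next
      assume "t = 0 \<or> t = 1"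
      moreover have "{0..1} - {0::real} = {0<..1}" "{0..1} - {1::real} = {0..<1}" by auto
      ultimately show "connected ({0..1} - {t})" by auto
    qed
    finally show ?thesis .
  qed
  show ?thesis
  proof
    show "arc_ends (path_image g) \<subseteq> {pathstart g, pathfinish g}"
      using con by (auto simp: arc_ends_def path_image_def pathstart_def pathfinish_def)
    show "{pathstart g, pathfinish g} \<subseteq> arc_ends (path_image g)"
      using con[of 0] con[of 1] by (auto simp: arc_ends_def pathstart_def pathfinish_def path_image_def)
  qed
qed

lemma is_arcE:
  assumes "is_arc s"
  obtains g where "arc g" "path_image g = s" "arc_ends s = {pathstart g, pathfinish g}"
  using assms arc_ends_path_image unfolding is_arc_def by metis

lemma is_arcE':
  assumes "is_arc s" "p \<in> arc_ends s"
  obtains g where "arc g" "path_image g = s" "pathstart g = p" "arc_ends s = {p, pathfinish g}"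
proof -
  obtain g where g: "arc g" "path_image g = s" "arc_ends s = {pathstart g, pathfinish g}"
    using is_arcE[OF assms(1)] .
  show ?thesis
  proof (cases "p = pathstart g")
    case True then show ?thesis using that g by metis
  next
    case False
    then have "p = pathfinish g" using assms(2) g by auto
    then show ?thesis using that[of "reversepath g"] g by (simp add: arc_reversepath insert_commute)
  qed
qed

lemma arc_ends_card: "is_arc s \<Longrightarrow> card (arc_ends s) = 2"
  by (metis arc_distinct_ends card_2_iff is_arcE)

lemma arc_ends_subset: "arc_ends s \<subseteq> s" by (auto simp: arc_ends_def)

lemma arc_compact: "is_arc s \<Longrightarrow> compact s"
  by (metis arc_imp_path compact_path_image is_arc_def)

lemma arc_closed: "is_arc (s::'a::t2_space set) \<Longrightarrow> closed s"
  using arc_compact compact_imp_closed by blast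

lemma arc_connected: "is_arc s \<Longrightarrow> connected s"
  by (metis arc_imp_path connected_path_image is_arc_def)

lemma arc_nonempty: "is_arc s \<Longrightarrow> s \<noteq> {}"
  using arc_ends_card[of s] arc_ends_subset[of s] by auto

lemma arc_subset_closed:
  fixes s :: "'a::t2_space set"
  assumes s: "is_arc s" and K: "closed K" and sub: "s - arc_ends s \<subseteq> K"
  shows "s \<subseteq> K"
proof -
  obtain g where g: "arc g" "path_image g = s" "arc_ends s = {pathstart g, pathfinish g}"
    using is_arcE[OF s] .
  have ne: "g t \<notin> arc_ends s" if "t \<in> {0<..<1}" for t
    using g that unfolding arc_def inj_on_def pathstart_def pathfinish_def by force
  have cont: "continuous_on {0..1} g" using g by (simp add: arc_def path_def)
  then have cl: "closed ({0..1} \<inter> g -` K)" using K by (simp add: continuous_closed_preimage)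
  have "{0<..<1} \<subseteq> {0..1} \<inter> g -` K"
    using ne sub g(2) by (force simp: path_image_def)
  then have "closure {0<..<1::real} \<subseteq> {0..1} \<inter> g -` K" using cl closure_minimal by blast
  then show ?thesis using g(2) by (auto simp: path_image_def)
qed

lemma arc_relint_connected:
  assumes "is_arc s" shows "connected (s - arc_ends s)" "s - arc_ends s \<noteq> {}"
proof -
  obtain g where g: "arc g" "path_image g = s" "arc_ends s = {pathstart g, pathfinish g}"
    using is_arcE[OF assms] .
  have "s - arc_ends s = g ` {0<..<1}"
  proof
    show "s - arc_ends s \<subseteq> g ` {0<..<1}"
    proof
      fix x assume "x \<in> s - arc_ends s"
      then obtain t where "t \<in> {0..1}" "x = g t" "x \<noteq> g 0" "x \<noteq> g 1"
        using g by (auto simp: path_image_def pathstart_def pathfinish_def)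
      then show "x \<in> g ` {0<..<1}" by (intro image_eqI[of _ _ t]) (auto simp: less_le)
    qed
    show "g ` {0<..<1} \<subseteq> s - arc_ends s"
      using g unfolding arc_def inj_on_def pathstart_def pathfinish_def path_image_def by force
  qed
  moreover have "continuous_on {0<..<1} g"
    using g by (auto simp: arc_def path_def intro: continuous_on_subset)
  ultimately show "connected (s - arc_ends s)" "s - arc_ends s \<noteq> {}"
    using connected_continuous_image[of "{0<..<1}" g] by auto
qed

lemma connected_subset_arc:
  assumes s: "is_arc s" and t: "connected t" "t \<subseteq> s" "arc_ends s \<subseteq> t"
  shows "t = s"
proof -
  obtain g where g: "arc g" "path_image g = s" "arc_ends s = {pathstart g, pathfinish g}"
    using is_arcE[OF s] .
  obtain h where h: "homeomorphism {0..1::real} s g h"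
    using homeomorphism_compact[of "{0..1::real}" g s] g by (auto simp: arc_def path_def path_image_def)
  have "connected (h ` t)"
    using t h by (meson connected_continuous_image continuous_on_subset homeomorphism_def)
  moreover have "0 \<in> h ` t" "1 \<in> h ` t"
    using g t(3) h unfolding pathstart_def pathfinish_def
    by (force simp: homeomorphism_def intro: image_eqI[of _ _ "g 0"] image_eqI[of _ _ "g 1"])+
  ultimately have "{0..1} \<subseteq> h ` t" using connected_contains_Icc by blast
  then have "g ` {0..1} \<subseteq> g ` h ` t" by blast
  moreover have "g ` h ` t = t" using h t(2) by (force simp: homeomorphism_def image_image)
  ultimately show ?thesis using t(2) g(2) by (auto simp: path_image_def)
qed

subsection \<open>Circles\<close>

lemma inj_on_Un_meet:
  assumes "inj_on f A" "inj_on f B" "f ` A \<inter> f ` B \<subseteq> f ` (A \<inter> B)"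
  shows "inj_on f (A \<union> B)"
proof -
  have *: "x = y" if "x \<in> A" "y \<in> B" "f x = f y" for x y
  proof -
    have "f x \<in> f ` A \<inter> f ` B" using imageI[OF that(1), of f] imageI[OF that(2), of f] that(3) by simp
    then obtain z where z: "z \<in> A \<inter> B" "f x = f z" using assms(3) by blast
    then have "x = z" "y = z" using assms(1,2) that by (auto dest: inj_onD)
    then show ?thesis by simp
  qed
  show ?thesis
  proof (rule inj_onI)
    fix x y assume "x \<in> A \<union> B" "y \<in> A \<union> B" "f x = f y"
    then show "x = y" using *[of x y] *[of y x] assms(1,2) by (auto dest: inj_onD)
  qed
qed

lemma cis_2pi_eq:
  assumes "x \<in> {0..1}" "y \<in> {0..1}" "cis (2 * pi * x) = cis (2 * pi * y)"
  shows "x = y \<or> x = 0 \<and> y = 1 \<or> x = 1 \<and> y = 0"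
proof -
  have "sin (2 * pi * x) = sin (2 * pi * y) \<and> cos (2 * pi * x) = cos (2 * pi * y)"
    using assms(3) by (simp add: complex_eq_iff)
  then obtain n :: int where "2 * pi * x = 2 * pi * y + 2 * pi * n" using sin_cos_eq_iff by blast
  then have "2 * pi * x = 2 * pi * (y + n)" by (simp add: algebra_simps)
  then have n: "x = y + n" by simp
  then have "- 1 \<le> real_of_int n" "real_of_int n \<le> 1" using assms(1,2) by auto
  then have "n = -1 \<or> n = 0 \<or> n = 1" by linarith
  then show ?thesis using n assms(1,2) by auto
qed

lemma unit_circle_path:
  obtains \<gamma> where "simple_path \<gamma>" "pathfinish \<gamma> = pathstart \<gamma>" "path_image \<gamma> = sphere (0::complex) 1"
proof
  let ?\<gamma> = "\<lambda>t::real. cis (2 * pi * t)"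
  show "simple_path ?\<gamma>" unfolding simple_path_def
  proof
    show "path ?\<gamma>" unfolding path_def cis_conv_exp by (intro continuous_intros)
    have "x = y \<or> x = 0 \<and> y = 1 \<or> x = 1 \<and> y = 0"
      if "x \<in> {0..1}" "y \<in> {0..1}" "cis (2 * pi * x) = cis (2 * pi * y)" for x y :: real
      by (rule cis_2pi_eq[OF that])
    then show "loop_free ?\<gamma>" by (auto simp: loop_free_def)
  qed
  show "pathfinish ?\<gamma> = pathstart ?\<gamma>" by (simp add: pathfinish_def pathstart_def complex_eq_iff)
  show "path_image ?\<gamma> = sphere 0 1"
  proof
    show "path_image ?\<gamma> \<subseteq> sphere 0 1" by (auto simp: path_image_def)
    show "sphere 0 1 \<subseteq> path_image ?\<gamma>"
    proof
      fix z :: complex assume "z \<in> sphere 0 1"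
      then have "norm z = 1" by simp
      then obtain t where t: "0 \<le> t" "t < 2 * pi" "z = cis t"
        using complex_norm_eq_1_exp_eq[of z] by (metis cis_conv_exp complex_unimodular_polar cis.ctr)
      then show "z \<in> path_image ?\<gamma>" unfolding path_image_def
        by (intro image_eqI[of _ _ "t / (2 * pi)"]) (auto simp: field_simps)
    qed
  qed
qed

lemma arc_homeomorphism:
  assumes h: "homeomorphism S T f g" and s: "s \<subseteq> S" "is_arc s"
  shows "is_arc (f ` s)" "arc_ends (f ` s) = f ` arc_ends s"
proof -
  obtain p where p: "arc p" "path_image p = s" "arc_ends s = {pathstart p, pathfinish p}"
    using is_arcE[OF s(2)] .
  have "arc (f \<circ> p)" unfolding arc_def
  proof
    show "path (f \<circ> p)" using p s h
      by (intro path_continuous_image) (auto simp: arc_def homeomorphism_def intro: continuous_on_subset)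
    have "inj_on f S" using h by (auto simp: homeomorphism_def intro: inj_on_inverseI)
    then have "inj_on f (p ` {0..1})" using inj_on_subset p(2) s(1) unfolding path_image_def by blast
    then show "inj_on (f \<circ> p) {0..1}" using p(1) by (simp add: arc_def comp_inj_on)
  qed
  moreover have im: "path_image (f \<circ> p) = f ` s" using p(2) by (simp add: path_image_compose)
  ultimately show "is_arc (f ` s)" "arc_ends (f ` s) = f ` arc_ends s"
    using arc_ends_path_image[of "f \<circ> p"] p(3)
    by (auto simp: is_arc_def pathstart_def pathfinish_def)
qed

lemma circle_double_arc:
  fixes C :: "'a::t2_space set"
  assumes C: "is_circle C" and ab: "a \<in> C" "b \<in> C" "a \<noteq> b"
  obtains u d where "is_arc u" "is_arc d" "arc_ends u = {a, b}" "arc_ends d = {a, b}" "u \<inter> d = {a, b}" "u \<union> d = C"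
proof -
  obtain f g where h: "homeomorphism (sphere (0::complex) 1) C f g"
    using C homeomorphicD(2) unfolding is_circle_def by blast
  have inj: "inj_on f (sphere 0 1)" using h by (auto simp: homeomorphism_def intro: inj_on_inverseI)
  obtain \<gamma> where \<gamma>: "simple_path \<gamma>" "pathfinish \<gamma> = pathstart \<gamma>" "path_image \<gamma> = sphere (0::complex) 1"
    using unit_circle_path .
  have gab: "g a \<in> path_image \<gamma>" "g b \<in> path_image \<gamma>" "g a \<noteq> g b" "f (g a) = a" "f (g b) = b"
    using ab h unfolding \<gamma> by (auto simp: homeomorphism_def)
  obtain u d where ud: "arc u" "arc d" "pathstart u = g a" "pathfinish u = g b"
      "pathstart d = g b" "pathfinish d = g a"
      "path_image u \<inter> path_image d = {g a, g b}" "path_image u \<union> path_image d = path_image \<gamma>"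
    using exists_double_arc[OF \<gamma>(1,2) gab(1,2,3)] by metis
  have sub: "path_image u \<subseteq> sphere 0 1" "path_image d \<subseteq> sphere 0 1" using ud(8) \<gamma>(3) by auto
  have arcs: "is_arc (path_image u)" "is_arc (path_image d)" using ud by (auto simp: is_arc_def)
  show ?thesis
  proof (rule that[of "f ` path_image u" "f ` path_image d"])
    show "is_arc (f ` path_image u)" "is_arc (f ` path_image d)"
      using arc_homeomorphism(1)[OF h] sub arcs by auto
    show "arc_ends (f ` path_image u) = {a, b}" "arc_ends (f ` path_image d) = {a, b}"
      using arc_homeomorphism(2)[OF h sub(1) arcs(1)] arc_homeomorphism(2)[OF h sub(2) arcs(2)]
        arc_ends_path_image[OF ud(1)] arc_ends_path_image[OF ud(2)] ud(3-6) gab(4,5)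
      by (simp_all add: insert_commute)
    show "f ` path_image u \<inter> f ` path_image d = {a, b}"
      using inj_on_image_Int[OF inj sub] ud(7) gab by simp
    show "f ` path_image u \<union> f ` path_image d = C"
      using ud(8) \<gamma>(3) h by (simp add: image_Un[symmetric] homeomorphism_def)
  qed
qed

lemma circle_arc_complement:
  fixes C :: "'a::t2_space set"
  assumes C: "is_circle C" and s: "is_arc s" "s \<subseteq> C"
  obtains d where "is_arc d" "arc_ends d = arc_ends s" "s \<union> d = C" "s \<inter> d = arc_ends s"
proof -
  obtain a b where ab: "arc_ends s = {a, b}" "a \<noteq> b"
    using arc_ends_card[OF s(1)] card_2_iff by metis
  then have "a \<in> C" "b \<in> C" using s arc_ends_subset by blast+
  then obtain u d where ud: "is_arc u" "is_arc d" "arc_ends u = {a, b}" "arc_ends d = {a, b}" "u \<inter> d = {a, b}" "u \<union> d = C"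
    using circle_double_arc[OF C _ _ ab(2)] by blast
  have con: "connected (s - arc_ends s)" by (rule arc_relint_connected[OF s(1)])
  have cl: "closed u" "closed d" using ud arc_closed by blast+
  have "(s - arc_ends s) \<inter> u = {} \<or> (s - arc_ends s) \<inter> d = {}"
    using connected_closedD[OF con, of u d] cl ud(5,6) s(2) ab by auto
  moreover have "{a, b} \<subseteq> u" "{a, b} \<subseteq> d" "s \<subseteq> u \<union> d" using ud(5,6) s(2) by auto
  ultimately have "s \<subseteq> d \<or> s \<subseteq> u" unfolding ab(1) by auto
  moreover have "s = u" if "s \<subseteq> u"
    using connected_subset_arc[OF ud(1) arc_connected[OF s(1)] that] ud(3) ab(1) arc_ends_subset[of s] by simp
  moreover have "s = d" if "s \<subseteq> d"
    using connected_subset_arc[OF ud(2) arc_connected[OF s(1)] that] ud(4) ab(1) arc_ends_subset[of s] by simp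
  ultimately consider "s = u" | "s = d" by blast
  then show thesis
  proof cases
    case 1 then show ?thesis using ud ab by (intro that[of d]) auto
  next
    case 2 then show ?thesis using ud ab by (intro that[of u]) auto
  qed
qed

lemma is_arc_interval:
  assumes "p < (q::real)" shows "is_arc {p..q}" "arc_ends {p..q} = {p, q}"
proof -
  have "arc (linepath p q)" "path_image (linepath p q) = {p..q}"
    using assms by (auto simp: closed_segment_eq_real_ivl)
  then show "is_arc {p..q}" "arc_ends {p..q} = {p, q}"
    using arc_ends_path_image[of "linepath p q"] by (auto simp: is_arc_def)
qed

lemma arc_split:
  fixes g :: "'a::t2_space set"
  assumes g: "is_arc g" and s: "is_arc s" "s \<subseteq> g" "s \<inter> arc_ends g = {}"
  obtains g1 g2 where "is_arc g1" "is_arc g2" "g1 \<inter> g2 = {}" "g1 \<union> g2 = g - (s - arc_ends s)"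
    "arc_ends g1 \<union> arc_ends g2 = arc_ends g \<union> arc_ends s"
proof -
  obtain h where h: "arc h" "path_image h = g" "arc_ends g = {pathstart h, pathfinish h}" using is_arcE[OF g] .
  obtain k where k: "homeomorphism {0..1::real} g h k"
    using homeomorphism_compact[of "{0..1::real}" h g] h by (auto simp: arc_def path_def path_image_def)
  have "continuous_on s k" using homeomorphism_cont2[OF k] s(2) continuous_on_subset by blast
  then have "connected (k ` s)" "compact (k ` s)"
    using arc_connected[OF s(1)] arc_compact[OF s(1)]
    by (simp_all add: connected_continuous_image compact_continuous_image)
  then have "\<exists>p q. k ` s = {p..q}" by (simp add: connected_compact_interval_1[symmetric])
  then obtain p q where pq: "k ` s = {p..q}" by (elim exE)
  have "h (k x) = x" if "x \<in> s" for x using homeomorphism_apply2[OF k] that s(2) by blast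
  then have "h ` k ` s = s" unfolding image_image by simp
  then have hs: "h ` {p..q} = s" using pq by simp
  have "{p..q} \<subseteq> {0..1}" using image_mono[OF s(2), of k] homeomorphism_image2[OF k] pq by simp
  moreover have "p \<le> q" using pq arc_nonempty[OF s(1)] by auto
  ultimately have pq01: "0 \<le> p" "q \<le> 1" "p \<le> q" by auto
  have "p \<noteq> q"
  proof
    assume "p = q"
    then have "s = {h p}" using hs by auto
    then show False using arc_ends_card[OF s(1)] arc_ends_subset[of s] card_mono[of "{h p}" "arc_ends s"] by simp
  qed
  moreover have "0 \<noteq> p" "q \<noteq> 1" using s(3) hs h(3) pq01(3) by (auto simp: pathstart_def pathfinish_def)
  ultimately have lt: "0 < p" "p < q" "q < 1" using pq01 by auto
  have sub: "{0..p} \<subseteq> {0..1}" "{p..q} \<subseteq> {0..1}" "{q..1} \<subseteq> {0..1}" using lt by auto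
  have es: "arc_ends s = {h p, h q}"
    using arc_homeomorphism(2)[OF k sub(2)] is_arc_interval[OF lt(2)] hs by simp
  have inj: "h x = h y \<longleftrightarrow> x = y" if "x \<in> {0..1}" "y \<in> {0..1}" for x y
    using h(1) that by (auto simp: arc_def inj_on_def)
  show thesis
  proof (rule that[of "h ` {0..p}" "h ` {q..1}"])
    show "is_arc (h ` {0..p})" "is_arc (h ` {q..1})"
      using arc_homeomorphism(1)[OF k sub(1)] arc_homeomorphism(1)[OF k sub(3)] is_arc_interval lt by simp_all
    show "h ` {0..p} \<inter> h ` {q..1} = {}" using inj lt by auto
    show "arc_ends (h ` {0..p}) \<union> arc_ends (h ` {q..1}) = arc_ends g \<union> arc_ends s"
      using arc_homeomorphism(2)[OF k sub(1)] arc_homeomorphism(2)[OF k sub(3)] is_arc_interval lt es h(3)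
      by (auto simp: pathstart_def pathfinish_def)
    have "h ` {0..p} \<union> h ` {q..1} = h ` ({0..1} - {p<..<q})" using lt by (auto simp: image_Un[symmetric])
    also have "\<dots> = h ` {0..1} - h ` {p<..<q}" using lt inj by (intro inj_on_image_set_diff[of _ "{0..1}"]) (auto simp: inj_on_def)
    also have "h ` {p<..<q} = s - arc_ends s"
    proof -
      have "{p<..<q} = {p..q} - {p, q}" by auto
      moreover have "h ` ({p..q} - {p, q}) = h ` {p..q} - h ` {p, q}"
        using lt inj by (intro inj_on_image_set_diff[of _ "{0..1}"]) (auto simp: inj_on_def)
      ultimately show ?thesis using hs es by simp
    qed
    finally show "h ` {0..p} \<union> h ` {q..1} = g - (s - arc_ends s)" using h(2) by (simp add: path_image_def)
  qed
qed

definition relint :: "'a::t2_space set \<Rightarrow> 'a set" where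
  "relint s = s - arc_ends s"

definition gaps :: "'a::t2_space set \<Rightarrow> 'a set set \<Rightarrow> 'a set set" where
  "gaps C \<S> = components (C - \<Union>(relint ` \<S>))"

lemma components_arcs:
  assumes "finite \<G>" "\<And>g. g \<in> \<G> \<Longrightarrow> is_arc g" "pairwise disjnt \<G>"
  shows "components (\<Union>\<G>) = \<G>"
  using assms(1) _ assms(3)
proof (rule components_Union_disjoint)
  fix P assume "P \<in> \<G>"
  then have "is_arc P" by (rule assms(2))
  then show "closed P \<and> connected P \<and> P \<noteq> {}"
    using arc_closed[of P] arc_connected[of P] arc_nonempty[of P] by blast
qed

text \<open>A first arc leaves one complementary arc. Each further arc lies in one gap and splits it in two.\<close>

lemma circle_gaps_exist:
  fixes C :: "'a::t2_space set"
  assumes C: "is_circle C" and S: "finite \<S>" "\<S> \<noteq> {}" "\<forall>s\<in>\<S>. is_arc s \<and> s \<subseteq> C" "pairwise disjnt \<S>"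
  shows "\<exists>\<G>. finite \<G> \<and> (\<forall>g\<in>\<G>. is_arc g) \<and> pairwise disjnt \<G> \<and>
    \<Union>(arc_ends ` \<G>) = \<Union>(arc_ends ` \<S>) \<and> \<Union>\<G> = C - \<Union>(relint ` \<S>)"
  using S
proof (induction \<S> rule: finite_ne_induct)
  case (singleton s)
  then obtain d where "is_arc d" "arc_ends d = arc_ends s" "s \<union> d = C" "s \<inter> d = arc_ends s"
    using circle_arc_complement[OF C, of s] by auto
  then show ?case by (intro exI[of _ "{d}"]) (auto simp: relint_def)
next
  case (insert s \<S>)
  have "\<forall>s\<in>\<S>. is_arc s \<and> s \<subseteq> C" "pairwise disjnt \<S>" using insert.prems by (auto simp: pairwise_insert)
  then have "\<exists>\<G>. finite \<G> \<and> (\<forall>g\<in>\<G>. is_arc g) \<and> pairwise disjnt \<G> \<and>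
      \<Union>(arc_ends ` \<G>) = \<Union>(arc_ends ` \<S>) \<and> \<Union>\<G> = C - \<Union>(relint ` \<S>)" by (rule insert.IH)
  then obtain \<G> where G0: "finite \<G>" "\<forall>g\<in>\<G>. is_arc g" "pairwise disjnt \<G>"
    "\<Union>(arc_ends ` \<G>) = \<Union>(arc_ends ` \<S>)" "\<Union>\<G> = C - \<Union>(relint ` \<S>)"
    by (elim exE conjE)
  have G2: "is_arc g" if "g \<in> \<G>" for g using G0(2) that by blast
  note G = G0(1) G2 G0(3-5)
  have s: "is_arc s" "s \<subseteq> C" using insert by auto
  have dis: "s \<inter> t = {}" if "t \<in> \<S>" for t
    using insert.prems(2) that insert.hyps(3) by (auto simp: pairwise_insert disjnt_def)
  have sG: "s \<subseteq> \<Union>\<G>" unfolding G(5) using s(2) dis by (auto simp: relint_def)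
  have comp: "components (\<Union>\<G>) = \<G>"
    by (rule components_arcs[OF G(1,2,3)])
  obtain x where x: "x \<in> s" using arc_nonempty[OF s(1)] by blast
  then obtain g where g: "g \<in> \<G>" "x \<in> g" using sG by blast
  have "g \<in> components (\<Union>\<G>)" "g \<inter> s \<noteq> {}" using comp g x by auto
  then have sg: "s \<subseteq> g" using components_maximal arc_connected[OF s(1)] sG by blast
  have eg: "s \<inter> arc_ends g = {}"
  proof -
    have "arc_ends g \<subseteq> \<Union>(arc_ends ` \<S>)" using G(4) g(1) by blast
    also have "\<dots> \<subseteq> \<Union>\<S>" using arc_ends_subset by blast
    finally have "arc_ends g \<subseteq> \<Union>\<S>" .
    then show ?thesis using dis by blast
  qed
  obtain g1 g2 where gg: "is_arc g1" "is_arc g2" "g1 \<inter> g2 = {}" "g1 \<union> g2 = g - (s - arc_ends s)"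
    "arc_ends g1 \<union> arc_ends g2 = arc_ends g \<union> arc_ends s"
    using arc_split[OF G(2)[OF g(1)] s(1) sg eg] .
  let ?G = "insert g1 (insert g2 (\<G> - {g}))"
  have other: "t \<inter> g = {}" if "t \<in> \<G> - {g}" for t using G(3) g that by (auto simp: pairwise_def disjnt_def)
  have sub: "g1 \<subseteq> g" "g2 \<subseteq> g" using gg(4) by auto
  have "pairwise disjnt ?G"
    using other sub gg(3) G(3) unfolding pairwise_insert
    using disjnt_subset2[OF _ sub(1)] disjnt_subset2[OF _ sub(2)]
    by (auto simp: disjnt_def pairwise_def)
  moreover have "\<Union>(arc_ends ` ?G) = \<Union>(arc_ends ` insert s \<S>)"
  proof -
    have "\<Union>(arc_ends ` \<G>) = arc_ends g \<union> \<Union>(arc_ends ` (\<G> - {g}))" using g by auto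
    then show ?thesis using gg(5) G(4) by auto
  qed
  moreover have "\<Union>?G = C - \<Union>(relint ` insert s \<S>)"
  proof -
    have "\<Union>?G = \<Union>\<G> - relint s" using gg(4) g other sg unfolding relint_def by auto
    then show ?thesis unfolding G(5) by auto
  qed
  moreover have "finite ?G" using G(1) by simp
  moreover have "\<forall>t\<in>?G. is_arc t"
  proof
    fix t assume "t \<in> ?G"
    then show "is_arc t" using G(2)[of t] gg(1,2) by auto
  qed
  ultimately show ?case by (intro exI[of _ ?G] conjI)
qed

lemma circle_gaps:
  fixes C :: "'a::t2_space set"
  assumes "is_circle C" "finite \<S>" "\<S> \<noteq> {}" "\<And>s. s \<in> \<S> \<Longrightarrow> is_arc s \<and> s \<subseteq> C" "pairwise disjnt \<S>"
  shows "finite (gaps C \<S>)" "\<And>g. g \<in> gaps C \<S> \<Longrightarrow> is_arc g" "pairwise disjnt (gaps C \<S>)"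
    "\<Union>(arc_ends ` gaps C \<S>) = \<Union>(arc_ends ` \<S>)" "\<Union>(gaps C \<S>) = C - \<Union>(relint ` \<S>)"
proof -
  have S: "\<forall>s\<in>\<S>. is_arc s \<and> s \<subseteq> C" using assms(4) by (intro ballI)
  obtain \<G> where G: "finite \<G>" "\<forall>g\<in>\<G>. is_arc g" "pairwise disjnt \<G>"
    "\<Union>(arc_ends ` \<G>) = \<Union>(arc_ends ` \<S>)" "\<Union>\<G> = C - \<Union>(relint ` \<S>)"
    using circle_gaps_exist[OF assms(1-3) S assms(5)] by (elim exE conjE)
  have "components (\<Union>\<G>) = \<G>"
    by (rule components_arcs[OF G(1) _ G(3)]) (rule bspec[OF G(2)])
  then have "gaps C \<S> = \<G>" by (simp add: gaps_def G(5))
  then show "finite (gaps C \<S>)" "\<And>g. g \<in> gaps C \<S> \<Longrightarrow> is_arc g" "pairwise disjnt (gaps C \<S>)"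
    "\<Union>(arc_ends ` gaps C \<S>) = \<Union>(arc_ends ` \<S>)" "\<Union>(gaps C \<S>) = C - \<Union>(relint ` \<S>)"
    using G by auto
qed

subsection \<open>Extending boundary homeomorphisms over discs\<close>

lemma sphere_homeomorphism_extends:
  fixes \<kappa> :: "complex \<Rightarrow> complex"
  assumes h: "homeomorphism (sphere 0 1) (sphere 0 1) \<kappa> \<kappa>i"
  obtains K L where "homeomorphism (cball 0 1) (cball 0 1) K L" "\<And>z. z \<in> sphere 0 1 \<Longrightarrow> K z = \<kappa> z"
proof -
  define K where "K z = of_real (norm z) * \<kappa> (z / of_real (norm z))" for z
  have dir: "z / of_real (norm z) \<in> sphere 0 1" if "z \<noteq> 0" for z :: complex using that by (simp add: norm_divide)
  have k1: "norm (\<kappa> z) = 1" if "norm z = 1" for z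
  proof -
    have "\<kappa> z \<in> sphere 0 1" using that homeomorphism_image1[OF h] by (metis imageI mem_sphere_0)
    then show ?thesis by simp
  qed
  have nK: "norm (K z) = norm z" for z
    using k1[of "z / of_real (norm z)"] dir[of z] by (cases "z = 0") (auto simp: K_def norm_mult)
  have cont: "continuous_on (cball 0 1) K"
  proof -
    have "continuous (at z within cball 0 1) K" for z
    proof (cases "z = 0")
      case True
      have "((\<lambda>w. norm (K w)) \<longlongrightarrow> 0) (at 0 within cball 0 1)"
        unfolding nK by (intro tendsto_eq_intros) auto
      then have "(K \<longlongrightarrow> 0) (at 0 within cball 0 1)" by (rule tendsto_norm_zero_cancel)
      moreover have "K 0 = 0" using nK[of 0] by simp
      ultimately have "(K \<longlongrightarrow> K 0) (at 0 within cball 0 1)" by simp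
      then show ?thesis using True by (simp add: continuous_within)
    next
      case False
      have "continuous_on (- {0}) (\<lambda>w::complex. w / of_real (norm w))" by (intro continuous_intros) auto
      moreover have "(\<lambda>w::complex. w / of_real (norm w)) ` (- {0}) \<subseteq> sphere 0 1"
      proof
        fix u assume "u \<in> (\<lambda>w::complex. w / of_real (norm w)) ` (- {0})"
        then obtain w where "w \<noteq> 0" "u = w / of_real (norm w)" by blast
        then show "u \<in> sphere 0 1" using dir[of w] by blast
      qed
      ultimately have "continuous_on (- {0}) (\<lambda>w. \<kappa> (w / of_real (norm w)))"
        by (rule continuous_on_compose2[OF homeomorphism_cont1[OF h]])
      then have "continuous_on (- {0}) K" unfolding K_def by (intro continuous_intros)
      then have "continuous (at z) K" using False continuous_on_eq_continuous_at[of "- {0}" K] by auto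
      then show ?thesis using continuous_at_imp_continuous_within by blast
    qed
    then show ?thesis by (simp add: continuous_on_eq_continuous_within)
  qed
  have inj: "inj_on K (cball 0 1)"
  proof (rule inj_onI)
    fix z w assume eq: "K z = K w"
    then have n: "norm z = norm w" using nK by metis
    show "z = w"
    proof (cases "z = 0")
      case True then show ?thesis using n by auto
    next
      case False
      then have "w \<noteq> 0" using n by auto
      have "\<kappa> (z / of_real (norm z)) = \<kappa> (w / of_real (norm w))"
        using eq n False \<open>w \<noteq> 0\<close> unfolding K_def by simp
      then have "z / of_real (norm z) = w / of_real (norm w)"
        using dir[OF False] dir[OF \<open>w \<noteq> 0\<close>] homeomorphism_apply1[OF h] by metis
      then show ?thesis using n False \<open>w \<noteq> 0\<close> by simp
    qed
  qed
  have "K ` cball 0 1 = cball 0 1"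
  proof
    show "K ` cball 0 1 \<subseteq> cball 0 1" using nK by auto
    show "cball 0 1 \<subseteq> K ` cball 0 1"
    proof
      fix w :: complex assume w: "w \<in> cball 0 1"
      show "w \<in> K ` cball 0 1"
      proof (cases "w = 0")
        case True then show ?thesis by (intro image_eqI[of _ _ 0]) (auto simp: K_def)
      next
        case False
        obtain u where u: "u \<in> sphere 0 1" "\<kappa> u = w / of_real (norm w)"
          using dir[OF False] homeomorphism_image1[OF h] by (metis imageE)
        have "K (of_real (norm w) * u) = w" using u False by (simp add: K_def norm_mult)
        then show ?thesis using u w by (intro image_eqI[of _ _ "of_real (norm w) * u"]) (auto simp: norm_mult)
      qed
    qed
  qed
  then obtain L where "homeomorphism (cball 0 1) (cball 0 1) K L"
    using homeomorphism_compact[OF compact_cball cont _ inj] by blast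
  moreover have "K z = \<kappa> z" if "z \<in> sphere 0 1" for z using that by (simp add: K_def)
  ultimately show ?thesis using that by blast
qed

text \<open>Alexander's trick: a homeomorphism of the circle extends radially to the disc.\<close>

lemma disc_homeomorphism_extends:
  assumes D: "is_disc D" "is_disc d" and h: "homeomorphism (surface_boundary D) (surface_boundary d) h k"
  obtains H K where "homeomorphism D d H K" "\<And>x. x \<in> surface_boundary D \<Longrightarrow> H x = h x"
proof -
  obtain f g where f: "homeomorphism (cball (0::complex) 1) D f g" "surface_boundary D = f ` sphere 0 1"
    "homeomorphism (sphere 0 1) (surface_boundary D) f g" by (rule disc_param[OF D(1)])
  obtain p q where p: "homeomorphism (cball (0::complex) 1) d p q" "surface_boundary d = p ` sphere 0 1"
    "homeomorphism (sphere 0 1) (surface_boundary d) p q" by (rule disc_param[OF D(2)])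
  have "homeomorphism (sphere 0 1) (sphere 0 1) (q \<circ> (h \<circ> f)) ((g \<circ> k) \<circ> p)"
    using homeomorphism_compose[OF homeomorphism_compose[OF f(3) h] homeomorphism_symD[OF p(3)]] .
  then obtain L M where L: "homeomorphism (cball 0 1) (cball 0 1) L M" "\<And>z. z \<in> sphere 0 1 \<Longrightarrow> L z = (q \<circ> (h \<circ> f)) z"
    by (rule sphere_homeomorphism_extends) blast
  have "homeomorphism D d (p \<circ> (L \<circ> g)) ((f \<circ> M) \<circ> q)"
    using homeomorphism_compose[OF homeomorphism_compose[OF homeomorphism_symD[OF f(1)] L(1)] p(1)] .
  moreover have "(p \<circ> (L \<circ> g)) x = h x" if x: "x \<in> surface_boundary D" for x
  proof -
    have "g x \<in> sphere 0 1" using x homeomorphism_image2[OF f(3)] by blast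
    moreover have "f (g x) = x" using homeomorphism_apply2[OF f(3) x] .
    moreover have "h x \<in> surface_boundary d" using x homeomorphism_image1[OF h] by blast
    ultimately show ?thesis using L(2)[of "g x"] homeomorphism_apply2[OF p(3), of "h x"] by simp
  qed
  ultimately show ?thesis using that by blast
qed

text \<open>The standard disc, with two distinguished opposite sides on the vertical lines.\<close>

definition rectangle :: "complex set" where
  "rectangle = {z. 0 \<le> Re z \<and> Re z \<le> 1 \<and> -1 \<le> Im z \<and> Im z \<le> 1}"

lemma rectangle_cbox: "rectangle = cbox (Complex 0 (-1)) (Complex 1 1)"
  by (auto simp: rectangle_def in_cbox_complex_iff)

lemma rectangle_interior: "interior rectangle = {z. 0 < Re z \<and> Re z < 1 \<and> -1 < Im z \<and> Im z < 1}"
  unfolding rectangle_cbox interior_cbox by (auto simp: in_box_complex_iff)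

lemma rectangle_boundary:
  "surface_boundary rectangle = {z \<in> rectangle. Re z = 0 \<or> Re z = 1 \<or> Im z = -1 \<or> Im z = 1}"
  unfolding surface_boundary_planar rectangle_interior by (auto simp: rectangle_def)

lemma rectangle_disc: "is_disc rectangle"
proof -
  have "Complex (1/2) 0 \<in> interior rectangle" by (simp add: rectangle_interior)
  then have "interior rectangle \<noteq> {}" by blast
  then show ?thesis unfolding is_disc_def
    using homeomorphic_convex_compact_cball[of rectangle 1 0] by (simp add: rectangle_cbox)
qed

text \<open>Mapping the four sides of the rectangle to the four arcs gives a homeomorphism of the boundaries,
  which extends to the discs. Prescribing the parametrisations \<open>c1\<close> and \<open>c3\<close> makes
  it possible to glue several such rectangles.\<close>

lemma disc_rectangle:
  fixes d :: "'a::t2_space set"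
  assumes d: "is_disc d"
    and c1: "continuous_on {-1..1::real} c1" "inj_on c1 {-1..1}" "c1 ` {-1..1} = s1"
    and c3: "continuous_on {-1..1::real} c3" "inj_on c3 {-1..1}" "c3 ` {-1..1} = s3"
    and l: "is_arc l1" "is_arc l2" "arc_ends l1 = {c1 (-1), c3 (-1)}" "arc_ends l2 = {c1 1, c3 1}"
    and un: "s1 \<union> l1 \<union> s3 \<union> l2 = surface_boundary d"
    and meet: "s1 \<inter> s3 = {}" "l1 \<inter> l2 = {}" "s1 \<inter> l1 = {c1 (-1)}" "s1 \<inter> l2 = {c1 1}"
      "s3 \<inter> l1 = {c3 (-1)}" "s3 \<inter> l2 = {c3 1}"
  obtains H K where "homeomorphism rectangle d H K"
    "\<And>y. y \<in> {-1..1} \<Longrightarrow> H (Complex 0 y) = c1 y" "\<And>y. y \<in> {-1..1} \<Longrightarrow> H (Complex 1 y) = c3 y"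
proof -
  obtain p1 where p1: "arc p1" "path_image p1 = l1" "pathstart p1 = c1 (-1)" "arc_ends l1 = {c1 (-1), pathfinish p1}"
    using is_arcE'[OF l(1), of "c1 (-1)"] l(3) by auto
  obtain p2 where p2: "arc p2" "path_image p2 = l2" "pathstart p2 = c1 1" "arc_ends l2 = {c1 1, pathfinish p2}"
    using is_arcE'[OF l(2), of "c1 1"] l(4) by auto
  have fin: "pathfinish p1 = c3 (-1)" "pathfinish p2 = c3 1"
    using p1 p2 l(3,4) arc_distinct_ends[OF p1(1)] arc_distinct_ends[OF p2(1)] by (auto simp: doubleton_eq_iff)
  define B where "B z = (if Re z = 0 then c1 (Im z) else if Re z = 1 then c3 (Im z)
    else if Im z = -1 then p1 (Re z) else p2 (Re z))" for z
  define E1 where "E1 = {z::complex. Re z = 0 \<and> -1 \<le> Im z \<and> Im z \<le> 1}"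
  define E3 where "E3 = {z::complex. Re z = 1 \<and> -1 \<le> Im z \<and> Im z \<le> 1}"
  define F1 where "F1 = {z::complex. Im z = -1 \<and> 0 \<le> Re z \<and> Re z \<le> 1}"
  define F2 where "F2 = {z::complex. Im z = 1 \<and> 0 \<le> Re z \<and> Re z \<le> 1}"
  have bd: "surface_boundary rectangle = E1 \<union> F1 \<union> E3 \<union> F2"
    unfolding rectangle_boundary by (auto simp: rectangle_def E1_def E3_def F1_def F2_def)
  have e: "p1 0 = c1 (-1)" "p1 1 = c3 (-1)" "p2 0 = c1 1" "p2 1 = c3 1"
    using p1(3) p2(3) fin by (auto simp: pathstart_def pathfinish_def)
  have BE1: "B z = c1 (Im z)" if "z \<in> E1" for z using that by (simp add: B_def E1_def)
  have BE3: "B z = c3 (Im z)" if "z \<in> E3" for z using that by (simp add: B_def E3_def)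
  have BF1: "B z = p1 (Re z)" if "z \<in> F1" for z using that e by (auto simp: B_def F1_def)
  have BF2: "B z = p2 (Re z)" if "z \<in> F2" for z using that e by (auto simp: B_def F2_def)
  have cl: "closed E1" "closed E3" "closed F1" "closed F2"
    unfolding E1_def E3_def F1_def F2_def
    by (intro closed_Collect_conj closed_Collect_eq closed_Collect_le continuous_intros)+
  have p: "continuous_on {0..1} p1" "inj_on p1 {0..1}" "p1 ` {0..1} = l1"
    "continuous_on {0..1} p2" "inj_on p2 {0..1}" "p2 ` {0..1} = l2"
    using p1 p2 by (auto simp: arc_def path_def path_image_def)
  have cI: "continuous_on S Im" "continuous_on S Re" for S by (intro continuous_intros)+
  have co: "continuous_on E1 B" "continuous_on E3 B" "continuous_on F1 B" "continuous_on F2 B"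
  proof -
    have "continuous_on E1 (\<lambda>z. c1 (Im z))" by (rule continuous_on_compose2[OF c1(1) cI(1)]) (auto simp: E1_def)
    then show "continuous_on E1 B" by (rule continuous_on_eq) (simp add: BE1)
    have "continuous_on E3 (\<lambda>z. c3 (Im z))" by (rule continuous_on_compose2[OF c3(1) cI(1)]) (auto simp: E3_def)
    then show "continuous_on E3 B" by (rule continuous_on_eq) (simp add: BE3)
    have "continuous_on F1 (\<lambda>z. p1 (Re z))" by (rule continuous_on_compose2[OF p(1) cI(2)]) (auto simp: F1_def)
    then show "continuous_on F1 B" by (rule continuous_on_eq) (simp add: BF1)
    have "continuous_on F2 (\<lambda>z. p2 (Re z))" by (rule continuous_on_compose2[OF p(4) cI(2)]) (auto simp: F2_def)
    then show "continuous_on F2 B" by (rule continuous_on_eq) (simp add: BF2)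
  qed
  have cont: "continuous_on (E1 \<union> F1 \<union> E3 \<union> F2) B"
    by (intro continuous_on_closed_Un closed_Un cl co)
  have im: "B ` E1 = s1" "B ` E3 = s3" "B ` F1 = l1" "B ` F2 = l2"
  proof -
    have "B ` E1 = c1 ` Im ` E1" using BE1 by (simp add: image_image)
    moreover have "Im ` E1 = {-1..1}"
    proof
      show "Im ` E1 \<subseteq> {-1..1}" by (auto simp: E1_def)
      show "{-1..1} \<subseteq> Im ` E1"
      proof
        fix x :: real assume "x \<in> {-1..1}"
        then show "x \<in> Im ` E1" by (intro image_eqI[of _ _ "Complex 0 x"]) (auto simp: E1_def)
      qed
    qed
    ultimately show "B ` E1 = s1" using c1 by simp
    have "B ` E3 = c3 ` Im ` E3" using BE3 by (simp add: image_image)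
    moreover have "Im ` E3 = {-1..1}"
    proof
      show "Im ` E3 \<subseteq> {-1..1}" by (auto simp: E3_def)
      show "{-1..1} \<subseteq> Im ` E3"
      proof
        fix x :: real assume "x \<in> {-1..1}"
        then show "x \<in> Im ` E3" by (intro image_eqI[of _ _ "Complex 1 x"]) (auto simp: E3_def)
      qed
    qed
    ultimately show "B ` E3 = s3" using c3 by simp
    have "B ` F1 = p1 ` Re ` F1" using BF1 by (simp add: image_image)
    moreover have "Re ` F1 = {0..1}"
    proof
      show "Re ` F1 \<subseteq> {0..1}" by (auto simp: F1_def)
      show "{0..1} \<subseteq> Re ` F1"
      proof
        fix x :: real assume "x \<in> {0..1}"
        then show "x \<in> Re ` F1" by (intro image_eqI[of _ _ "Complex x (-1)"]) (auto simp: F1_def)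
      qed
    qed
    ultimately show "B ` F1 = l1" using p by simp
    have "B ` F2 = p2 ` Re ` F2" using BF2 by (simp add: image_image)
    moreover have "Re ` F2 = {0..1}"
    proof
      show "Re ` F2 \<subseteq> {0..1}" by (auto simp: F2_def)
      show "{0..1} \<subseteq> Re ` F2"
      proof
        fix x :: real assume "x \<in> {0..1}"
        then show "x \<in> Re ` F2" by (intro image_eqI[of _ _ "Complex x 1"]) (auto simp: F2_def)
      qed
    qed
    ultimately show "B ` F2 = l2" using p by simp
  qed
  have i: "inj_on B E1" "inj_on B E3" "inj_on B F1" "inj_on B F2"
  proof -
    show "inj_on B E1" using c1(2) BE1 by (auto simp: inj_on_def E1_def complex_eq_iff)
    show "inj_on B E3" using c3(2) BE3 by (auto simp: inj_on_def E3_def complex_eq_iff)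
    show "inj_on B F1" using p(2) BF1 by (auto simp: inj_on_def F1_def complex_eq_iff)
    show "inj_on B F2" using p(5) BF2 by (auto simp: inj_on_def F2_def complex_eq_iff)
  qed
  have corner: "Complex 0 (-1) \<in> E1 \<inter> F1" "Complex 0 1 \<in> E1 \<inter> F2" "Complex 1 (-1) \<in> E3 \<inter> F1" "Complex 1 1 \<in> E3 \<inter> F2"
    by (auto simp: E1_def E3_def F1_def F2_def)
  have Bc: "B (Complex 0 (-1)) = c1 (-1)" "B (Complex 0 1) = c1 1" "B (Complex 1 (-1)) = c3 (-1)" "B (Complex 1 1) = c3 1"
    by (auto simp: B_def)
  have j1: "inj_on B (E1 \<union> F1)"
  proof (rule inj_on_Un_meet[OF i(1,3)])
    show "B ` E1 \<inter> B ` F1 \<subseteq> B ` (E1 \<inter> F1)" unfolding im meet(3) using corner(1) Bc(1) by (metis empty_subsetI image_eqI insert_subset)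
  qed
  have j2: "inj_on B (E1 \<union> F1 \<union> E3)"
  proof (rule inj_on_Un_meet[OF j1 i(2)])
    have "B ` (E1 \<union> F1) \<inter> B ` E3 = {c3 (-1)}"
      unfolding image_Un im Int_Un_distrib2 using meet(1,5) by auto
    moreover have "c3 (-1) \<in> B ` ((E1 \<union> F1) \<inter> E3)" using corner(3) Bc(3) by (intro image_eqI[of _ _ "Complex 1 (-1)"]) auto
    ultimately show "B ` (E1 \<union> F1) \<inter> B ` E3 \<subseteq> B ` ((E1 \<union> F1) \<inter> E3)" by simp
  qed
  have j3: "inj_on B (E1 \<union> F1 \<union> E3 \<union> F2)"
  proof (rule inj_on_Un_meet[OF j2 i(4)])
    have "B ` (E1 \<union> F1 \<union> E3) \<inter> B ` F2 = {c1 1, c3 1}" unfolding image_Un im Int_Un_distrib2 meet by auto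
    moreover have "c1 1 \<in> B ` ((E1 \<union> F1 \<union> E3) \<inter> F2)" using corner(2) Bc(2) by (intro image_eqI[of _ _ "Complex 0 1"]) auto
    moreover have "c3 1 \<in> B ` ((E1 \<union> F1 \<union> E3) \<inter> F2)" using corner(4) Bc(4) by (intro image_eqI[of _ _ "Complex 1 1"]) auto
    ultimately show "B ` (E1 \<union> F1 \<union> E3) \<inter> B ` F2 \<subseteq> B ` ((E1 \<union> F1 \<union> E3) \<inter> F2)" by simp
  qed
  have "B ` (E1 \<union> F1 \<union> E3 \<union> F2) = surface_boundary d" unfolding image_Un im un ..
  moreover have "compact (E1 \<union> F1 \<union> E3 \<union> F2)"
    using circle_compact[of "surface_boundary rectangle"] disc_boundary_circle[OF rectangle_disc]
    unfolding bd[symmetric] is_circle_def by blast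
  ultimately obtain C where "homeomorphism (surface_boundary rectangle) (surface_boundary d) B C"
    using homeomorphism_compact[OF _ cont _ j3] unfolding bd by blast
  then obtain H K where H: "homeomorphism rectangle d H K" "\<And>z. z \<in> surface_boundary rectangle \<Longrightarrow> H z = B z"
    using disc_homeomorphism_extends[OF rectangle_disc d] by blast
  show ?thesis
  proof (rule that[OF H(1)])
    fix y :: real assume y: "y \<in> {-1..1}"
    have "Complex 0 y \<in> E1" "Complex 1 y \<in> E3" using y by (auto simp: E1_def E3_def)
    then show "H (Complex 0 y) = c1 y" "H (Complex 1 y) = c3 y" using H(2) bd BE1 BE3 by auto
  qed
qed

section \<open>Gluing two discs along an arc\<close>

lemma arc_param:
  assumes "is_arc s" "arc_ends s = {a, b}"
  obtains c where "continuous_on {-1..1::real} c" "inj_on c {-1..1}" "c ` {-1..1} = s" "c (-1) = a" "c 1 = b"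
proof -
  obtain g where g: "arc g" "path_image g = s" "pathstart g = a" "arc_ends s = {a, pathfinish g}"
    using is_arcE'[OF assms(1), of a] assms(2) by auto
  have fin: "pathfinish g = b" using g(3,4) assms(2) arc_distinct_ends[OF g(1)] by (auto simp: doubleton_eq_iff)
  define c where "c y = g ((y + 1) / 2)" for y
  have img: "(\<lambda>y::real. (y + 1) / 2) ` {-1..1} = {0..1}"
  proof
    show "{0..1} \<subseteq> (\<lambda>y::real. (y + 1) / 2) ` {-1..1}"
    proof
      fix x :: real assume "x \<in> {0..1}"
      then show "x \<in> (\<lambda>y::real. (y + 1) / 2) ` {-1..1}" by (intro image_eqI[of _ _ "2 * x - 1"]) auto
    qed
  qed auto
  show ?thesis
  proof (rule that[of c])
    show "continuous_on {-1..1} c" unfolding c_def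
      by (rule continuous_on_compose2[of "{0..1}" g]) (use g(1) in \<open>auto simp: arc_def path_def intro!: continuous_intros\<close>)
    show "inj_on c {-1..1}"
    proof (rule inj_onI)
      fix y z :: real assume "y \<in> {-1..1}" "z \<in> {-1..1}" "c y = c z"
      then have "(y + 1) / 2 = (z + 1) / 2"
        using g(1) unfolding arc_def c_def by (intro inj_onD[of g "{0..1}"]) auto
      then show "y = z" by simp
    qed
    show "c ` {-1..1} = s" unfolding c_def using img g(2)[unfolded path_image_def] by (metis image_image)
    show "c (-1) = a" "c 1 = b" using g(3) fin by (auto simp: c_def pathstart_def pathfinish_def)
  qed
qed

text \<open>The arc complementary to \<open>s\<close> is cut into thirds, and its middle third serves as the opposite side.\<close>

lemma disc_half_rectangle:
  fixes d :: "'a::t2_space set"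
  assumes d: "is_disc d" and c: "continuous_on {-1..1::real} c" "inj_on c {-1..1}" "c ` {-1..1} = s"
    and s: "s \<subseteq> surface_boundary d"
  obtains H K where "homeomorphism rectangle d H K" "\<And>y. y \<in> {-1..1} \<Longrightarrow> H (Complex 0 y) = c y"
proof -
  obtain k where k: "homeomorphism {-1..1} s c k" using homeomorphism_compact[OF _ c(1,3,2)] by auto
  have arc: "is_arc s" "arc_ends s = {c (-1), c 1}"
    using arc_homeomorphism[OF k order_refl] is_arc_interval[of "-1" 1] c(3) by auto
  obtain D where D: "is_arc D" "arc_ends D = arc_ends s" "s \<union> D = surface_boundary d" "s \<inter> D = arc_ends s"
    using circle_arc_complement[OF _ arc(1) s] disc_boundary_circle[OF d] unfolding is_circle_def by blast
  obtain h where h: "arc h" "path_image h = D" "pathstart h = c (-1)" "arc_ends D = {c (-1), pathfinish h}"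
    using is_arcE'[OF D(1), of "c (-1)"] D(2) arc(2) by auto
  have inj: "h x = h y \<longleftrightarrow> x = y" if "x \<in> {0..1}" "y \<in> {0..1}" for x y
    using h(1) that by (auto simp: arc_def inj_on_def)
  have h01: "h 0 = c (-1)" "h 1 = c 1"
    using h(3,4) D(2) arc(2) arc_distinct_ends[OF h(1)] by (auto simp: pathstart_def pathfinish_def doubleton_eq_iff)
  have cont: "continuous_on {0..1} h" using h(1) by (simp add: arc_def path_def)
  have hD: "h ` {0..1} = D" using h(2) by (simp add: path_image_def)
  obtain k' where k': "homeomorphism {0..1} D h k'"
    using homeomorphism_compact[OF _ cont hD] h(1) by (auto simp: arc_def)
  have sub: "{0..1/3} \<subseteq> {0..1::real}" "{1/3..2/3} \<subseteq> {0..1::real}" "{2/3..1} \<subseteq> {0..1::real}" by auto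
  let ?c3 = "\<lambda>y. h (1/2 + y/6)"
  have img: "(\<lambda>y::real. 1/2 + y/6) ` {-1..1} = {1/3..2/3}"
  proof
    show "{1/3..2/3} \<subseteq> (\<lambda>y::real. 1/2 + y/6) ` {-1..1}"
    proof
      fix x :: real assume "x \<in> {1/3..2/3}"
      then show "x \<in> (\<lambda>y::real. 1/2 + y/6) ` {-1..1}" by (intro image_eqI[of _ _ "6 * (x - 1/2)"]) (auto simp: field_simps)
    qed
  qed auto
  have sD: "s \<inter> D = {h 0, h 1}" using D(4) arc(2) h01 by simp
  have hs: "h x \<notin> s" if "0 < x" "x < 1" for x
  proof
    assume "h x \<in> s"
    then have "h x \<in> s \<inter> D" using hD that by auto
    then have "h x \<in> {h 0, h 1}" unfolding sD .
    then show False using inj[of x 0] inj[of x 1] that by auto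
  qed
  have h_in_s: "h 0 \<in> s" "h 1 \<in> s" using sD by auto
  show ?thesis
  proof (rule disc_rectangle[OF d c, of ?c3 "h ` {1/3..2/3}" "h ` {0..1/3}" "h ` {2/3..1}"])
    show "continuous_on {-1..1} ?c3"
      by (rule continuous_on_compose2[OF cont]) (auto intro!: continuous_intros)
    show "inj_on ?c3 {-1..1}"
    proof (rule inj_onI)
      fix x y :: real assume "x \<in> {-1..1}" "y \<in> {-1..1}" "?c3 x = ?c3 y"
      then show "x = y" using inj[of "1/2 + x/6" "1/2 + y/6"] by auto
    qed
    show "?c3 ` {-1..1} = h ` {1/3..2/3}" unfolding img[symmetric] image_image ..
    show "is_arc (h ` {0..1/3})" "is_arc (h ` {2/3..1})"
      using arc_homeomorphism(1)[OF k' sub(1)] arc_homeomorphism(1)[OF k' sub(3)] is_arc_interval by auto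
    show "arc_ends (h ` {0..1/3}) = {c (-1), ?c3 (-1)}" "arc_ends (h ` {2/3..1}) = {c 1, ?c3 1}"
      using arc_homeomorphism(2)[OF k' sub(1)] arc_homeomorphism(2)[OF k' sub(3)] is_arc_interval h01
      by (auto simp: insert_commute)
    have "{0..1/3} \<union> {1/3..2/3} \<union> {2/3..1} = {0..1::real}" by auto
    then have "h ` {0..1/3} \<union> h ` {1/3..2/3} \<union> h ` {2/3..1} = D" using hD by (simp add: image_Un[symmetric])
    then show "s \<union> h ` {0..1/3} \<union> h ` {1/3..2/3} \<union> h ` {2/3..1} = surface_boundary d"
      using D(3) by (simp add: Un_assoc)
    show "s \<inter> h ` {1/3..2/3} = {}" using hs by auto
    show "h ` {0..1/3} \<inter> h ` {2/3..1} = {}" using inj by auto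
    show "s \<inter> h ` {0..1/3} = {c (-1)}"
    proof
      show "s \<inter> h ` {0..1/3} \<subseteq> {c (-1)}"
      proof
        fix z assume "z \<in> s \<inter> h ` {0..1/3}"
        then obtain x where "x \<in> {0..1/3}" "z = h x" "h x \<in> s" by auto
        then show "z \<in> {c (-1)}" using hs[of x] h01(1) by (cases "x = 0") auto
      qed
      show "{c (-1)} \<subseteq> s \<inter> h ` {0..1/3}" using h_in_s(1) h01(1) by (auto intro!: image_eqI[of _ _ 0])
    qed
    show "s \<inter> h ` {2/3..1} = {c 1}"
    proof
      show "s \<inter> h ` {2/3..1} \<subseteq> {c 1}"
      proof
        fix z assume "z \<in> s \<inter> h ` {2/3..1}"
        then obtain x where "x \<in> {2/3..1}" "z = h x" "h x \<in> s" by auto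
        then show "z \<in> {c 1}" using hs[of x] h01(2) by (cases "x = 1") auto
      qed
      show "{c 1} \<subseteq> s \<inter> h ` {2/3..1}" using h_in_s(2) h01(2) by (auto intro!: image_eqI[of _ _ 1])
    qed
    show "h ` {1/3..2/3} \<inter> h ` {0..1/3} = {?c3 (-1)}" using inj by (auto intro!: image_eqI[of _ _ "1/3"])
    show "h ` {1/3..2/3} \<inter> h ` {2/3..1} = {?c3 1}" using inj by (auto intro!: image_eqI[of _ _ "2/3"])
  next
    fix H K assume "homeomorphism rectangle d H K" "\<And>y. y \<in> {-1..1} \<Longrightarrow> H (Complex 0 y) = c y"
    then show ?thesis by (rule that)
  qed
qed

lemma glued_rectangles_meet:
  fixes v e :: "'a::t2_space set"
  assumes Hv: "homeomorphism rectangle v Hv Kv" and He: "homeomorphism rectangle e He Ke"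
    and agree: "\<And>y. y \<in> {-1..1} \<Longrightarrow> Hv (Complex 0 y) = He (Complex 0 y)"
    and ve: "v \<inter> e \<subseteq> surface_boundary v"
    and w: "0 \<le> Re w" "Re w < 1" "\<bar>Im w\<bar> < 1" and r: "r \<in> rectangle" and eq: "Hv w = He r"
  shows "Re w = 0" "r = w"
proof -
  have wR: "w \<in> rectangle" using w by (auto simp: rectangle_def)
  have "Hv w \<in> v" "Hv w \<in> e"
    using homeomorphism_image1[OF Hv] homeomorphism_image1[OF He] wR r eq by (metis imageI)+
  then have "Hv w \<in> Hv ` surface_boundary rectangle"
    using ve surface_boundary_homeomorphism[OF Hv] by blast
  then obtain u where u: "u \<in> surface_boundary rectangle" "Hv u = Hv w" by (metis imageE)
  have "u = w" using homeomorphism_apply1[OF Hv] wR u surface_boundary_subset by (metis subsetD)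
  then show w0: "Re w = 0" using u(1) w unfolding rectangle_boundary by auto
  have ww: "Complex 0 (Im w) = w" using w0 by (simp add: complex_eq_iff)
  have "Im w \<in> {-1..1}" using w(3) by auto
  from agree[OF this] have "Hv w = He w" unfolding ww .
  then show "r = w" using eq homeomorphism_apply1[OF He] r wR by metis
qed

text \<open>With rectangle charts of \<open>v\<close> and \<open>e\<close> that agree on the common side \<open>s\<close>, reflecting one of them gives a chart
  of \<open>v \<union> e\<close> around \<open>x\<close>. Removing the closed set \<open>K\<close>, which meets neither disc in
  the interior nor in the relative interior of \<open>s\<close>, keeps the neighbourhood open in \<open>S\<close>.\<close>

lemma glued_discs_interior:
  fixes S :: "'a::t2_space set"
  assumes d: "is_disc v" "is_disc e" and s: "is_arc s" "s \<subseteq> surface_boundary v" "s \<subseteq> surface_boundary e"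
    and ve: "v \<inter> e \<subseteq> surface_boundary v" "v \<inter> e \<subseteq> surface_boundary e"
    and S: "S = v \<union> e \<union> K" "closed K" "K \<inter> v \<subseteq> surface_boundary v" "K \<inter> e \<subseteq> surface_boundary e"
      "K \<inter> relint s = {}"
    and x: "x \<in> relint s"
  shows "x \<notin> surface_boundary S"
proof -
  obtain g where g: "arc_ends s = {pathstart g, pathfinish g}" using is_arcE[OF s(1)] .
  obtain c where c: "continuous_on {-1..1::real} c" "inj_on c {-1..1}" "c ` {-1..1} = s"
    and c01: "c (-1) = pathstart g" "c 1 = pathfinish g" using arc_param[OF s(1) g] .
  have ends: "arc_ends s = {c (-1), c 1}" using g c01 by simp
  have crel: "c y \<in> relint s \<longleftrightarrow> -1 < y \<and> y < 1" if "y \<in> {-1..1}" for y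
  proof -
    have "c y \<in> s" using c(3) that by blast
    moreover have "c y = c (-1) \<longleftrightarrow> y = -1" "c y = c 1 \<longleftrightarrow> y = 1" using inj_on_eq_iff[OF c(2), of y] that by simp_all
    ultimately show ?thesis using that unfolding relint_def ends by auto
  qed
  obtain y0 where y0: "y0 \<in> {-1..1}" "x = c y0" using x unfolding relint_def c(3)[symmetric] by blast
  then have "-1 < y0 \<and> y0 < 1" using crel[OF y0(1)] x by blast
  then have y01: "\<bar>y0\<bar> < 1" by linarith
  define t where "t = (1 + \<bar>y0\<bar>) / 2"
  have t: "\<bar>y0\<bar> < t" "t < 1" "0 < t" using y01 by (auto simp: t_def)
  obtain Hv Kv where Hv: "homeomorphism rectangle v Hv Kv" "\<And>y. y \<in> {-1..1} \<Longrightarrow> Hv (Complex 0 y) = c y"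
    using disc_half_rectangle[OF d(1) c s(2)] by blast
  obtain He Ke where He: "homeomorphism rectangle e He Ke" "\<And>y. y \<in> {-1..1} \<Longrightarrow> He (Complex 0 y) = c y"
    using disc_half_rectangle[OF d(2) c s(3)] by blast
  note meet_v = glued_rectangles_meet[OF Hv(1) He(1) _ ve(1)]
  note meet_e = glued_rectangles_meet[OF He(1) Hv(1) _ ve(2)[unfolded Int_commute[of v]]]
  have agree: "Hv (Complex 0 y) = He (Complex 0 y)" if "y \<in> {-1..1}" for y using Hv(2) He(2) that by simp
  define J where "J z = (if Re z \<le> 0 then He (- cnj z) else Hv z)" for z
  define Q where "Q = {z. \<bar>Re z\<bar> \<le> 1/2 \<and> \<bar>Im z\<bar> \<le> t}"
  define U where "U = {z. \<bar>Re z\<bar> < 1/2 \<and> \<bar>Im z\<bar> < t}"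
  have UQ: "U \<subseteq> Q" by (auto simp: U_def Q_def)
  have opU: "open U" unfolding U_def by (intro open_Collect_conj open_Collect_less continuous_intros)
  have "Q = cbox (Complex (-1/2) (-t)) (Complex (1/2) t)"
    by (auto simp: Q_def in_cbox_complex_iff)
  then have compQ: "compact Q" by simp
  have flip: "- cnj z \<in> rectangle" if "z \<in> Q" "Re z \<le> 0" for z
    using that t by (auto simp: Q_def rectangle_def)
  have inR: "z \<in> rectangle" if "z \<in> Q" "0 \<le> Re z" for z
    using that t by (auto simp: Q_def rectangle_def)
  have J0: "J z = Hv z" if "z \<in> Q" "0 \<le> Re z" for z
  proof (cases "Re z = 0")
    case True
    then have z: "Complex 0 (Im z) = z" "- cnj z = z" by (auto simp: complex_eq_iff)
    have "Im z \<in> {-1..1}" using that t unfolding Q_def by auto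
    from agree[OF this] have "Hv z = He z" unfolding z(1) .
    then show ?thesis using z(2) by (simp add: J_def)
  qed (use that in \<open>auto simp: J_def\<close>)
  have contJ: "continuous_on Q J" unfolding J_def
  proof (rule continuous_on_cases_le)
    show "continuous_on {z \<in> Q. Re z \<le> 0} (\<lambda>z. He (- cnj z))"
      by (rule continuous_on_compose2[OF homeomorphism_cont1[OF He(1)]]) (use flip in \<open>auto intro!: continuous_intros\<close>)
    show "continuous_on {z \<in> Q. 0 \<le> Re z} Hv"
      by (rule continuous_on_subset[OF homeomorphism_cont1[OF Hv(1)]]) (use inR in auto)
    show "continuous_on Q Re" by (intro continuous_intros)
    show "He (- cnj z) = Hv z" if "z \<in> Q" "Re z = 0" for z using J0[OF that(1)] that by (simp add: J_def)
  qed
  have injv: "Hv z = Hv w \<longleftrightarrow> z = w" if "z \<in> rectangle" "w \<in> rectangle" for z w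
    using homeomorphism_apply1[OF Hv(1)] that by metis
  have inje: "He z = He w \<longleftrightarrow> z = w" if "z \<in> rectangle" "w \<in> rectangle" for z w
    using homeomorphism_apply1[OF He(1)] that by metis
  have injJ: "inj_on J Q"
  proof -
    have *: "z = w" if zw: "z \<in> Q" "w \<in> Q" "J z = J w" "Re z \<le> 0" "0 < Re w" for z w
    proof -
      have "Hv w = He (- cnj z)" using zw J0[of w] by (simp add: J_def)
      moreover have "Re w < 1" "\<bar>Im w\<bar> < 1" using zw t by (auto simp: Q_def)
      ultimately have "Re w = 0" using meet_v(1)[of w "- cnj z"] agree flip zw by auto
      then show ?thesis using zw by simp
    qed
    show ?thesis
    proof (rule inj_onI)
      fix z w assume zw: "z \<in> Q" "w \<in> Q" "J z = J w"
      consider "Re z \<le> 0" "Re w \<le> 0" | "0 < Re z" "0 < Re w" | "Re z \<le> 0" "0 < Re w" | "0 < Re z" "Re w \<le> 0"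
        by linarith
      then show "z = w"
      proof cases
        case 1
        then have "- cnj z = - cnj w" using zw inje[OF flip flip] by (simp add: J_def)
        then show ?thesis by simp
      next
        case 2 then show ?thesis using zw injv[OF inR inR] by (simp add: J_def)
      next
        case 3 then show ?thesis using * zw by blast
      next
        case 4 then show ?thesis using *[of w z] zw by metis
      qed
    qed
  qed
  obtain L where "homeomorphism Q (J ` Q) J L" using homeomorphism_compact[OF compQ contJ refl injJ] by blast
  then have hU: "homeomorphism U (J ` U) J L" by (rule homeomorphism_of_subsets[OF _ UQ order_refl refl])
  define A where "A = rectangle \<inter> {z. 1/2 \<le> Re z} \<union> rectangle \<inter> {z. t \<le> \<bar>Im z\<bar>}"
  have cR: "compact rectangle" unfolding rectangle_cbox by simp
  have compA: "compact A" unfolding A_def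
    by (intro compact_Un compact_Int_closed cR closed_Collect_le continuous_intros)
  have clA: "closed (Hv ` A)" "closed (He ` A)"
  proof -
    have sub: "A \<subseteq> rectangle" by (auto simp: A_def)
    have "compact (Hv ` A)" "compact (He ` A)"
      using compA continuous_on_subset[OF homeomorphism_cont1[OF Hv(1)] sub]
        continuous_on_subset[OF homeomorphism_cont1[OF He(1)] sub] by (simp_all add: compact_continuous_image)
    then show "closed (Hv ` A)" "closed (He ` A)" by (simp_all add: compact_imp_closed)
  qed
  have notK: "F w \<notin> K" if F: "homeomorphism rectangle d' F F'" "\<And>y. y \<in> {-1..1} \<Longrightarrow> F (Complex 0 y) = c y"
    "K \<inter> d' \<subseteq> surface_boundary d'" and w: "0 \<le> Re w" "Re w < 1" "\<bar>Im w\<bar> < 1" for F F' d' w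
  proof (cases "Re w = 0")
    case True
    then have ww: "Complex 0 (Im w) = w" by (simp add: complex_eq_iff)
    have iw: "Im w \<in> {-1..1}" using w(3) by auto
    then have "F w = c (Im w)" using F(2)[of "Im w"] unfolding ww by blast
    moreover have "c (Im w) \<in> relint s" using crel[OF iw] w(3) by linarith
    ultimately show ?thesis using S(5) by auto
  next
    case False
    have wR: "w \<in> rectangle" using w by (auto simp: rectangle_def)
    show ?thesis
    proof
      assume "F w \<in> K"
      then have "F w \<in> F ` surface_boundary rectangle"
        using F(3) homeomorphism_image1[OF F(1)] wR surface_boundary_homeomorphism[OF F(1)] by blast
      then obtain u where u: "u \<in> surface_boundary rectangle" "F u = F w" by (metis imageE)
      have "u = w" using homeomorphism_apply1[OF F(1)] wR u surface_boundary_subset by (metis subsetD)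
      then show False using u(1) w False unfolding rectangle_boundary by auto
    qed
  qed
  have JU: "J ` U = S - (K \<union> Hv ` A \<union> He ` A)"
  proof
    show "J ` U \<subseteq> S - (K \<union> Hv ` A \<union> He ` A)"
    proof
      fix y assume "y \<in> J ` U"
      then obtain z where z: "z \<in> U" "y = J z" by blast
      then have zQ: "z \<in> Q" using UQ by blast
      have U: "\<bar>Re z\<bar> < 1/2" "\<bar>Im z\<bar> < t" using z by (auto simp: U_def)
      show "y \<in> S - (K \<union> Hv ` A \<union> He ` A)"
      proof (cases "Re z \<le> 0")
        case True
        define w where "w = - cnj z"
        have w: "0 \<le> Re w" "Re w < 1" "\<bar>Im w\<bar> < 1" "Re w < 1/2" "\<bar>Im w\<bar> < t" "w \<in> rectangle"
          using True U t flip zQ by (auto simp: w_def)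
        have y: "y = He w" using z True by (simp add: J_def w_def)
        have "y \<in> e" using y w(6) homeomorphism_image1[OF He(1)] by blast
        moreover have "y \<notin> K" using notK[OF He S(4) w(1-3)] y by simp
        moreover have "y \<notin> He ` A"
        proof
          assume "y \<in> He ` A"
          then obtain r where "r \<in> A" "He w = He r" using y by auto
          then show False using inje[OF w(6), of r] w by (auto simp: A_def)
        qed
        moreover have "y \<notin> Hv ` A"
        proof
          assume "y \<in> Hv ` A"
          then obtain r where r: "r \<in> A" "He w = Hv r" using y by auto
          then have "r = w" using meet_e(2)[of w r] w agree by (auto simp: A_def)
          then show False using r w by (auto simp: A_def)
        qed
        ultimately show ?thesis using S(1) by blast
      next
        case False
        have w: "0 \<le> Re z" "Re z < 1" "\<bar>Im z\<bar> < 1" "z \<in> rectangle"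
          using False U t inR zQ by auto
        have y: "y = Hv z" using z False by (simp add: J_def)
        have "y \<in> v" using y w(4) homeomorphism_image1[OF Hv(1)] by blast
        moreover have "y \<notin> K" using notK[OF Hv S(3) w(1-3)] y by simp
        moreover have "y \<notin> Hv ` A"
        proof
          assume "y \<in> Hv ` A"
          then obtain r where "r \<in> A" "Hv z = Hv r" using y by auto
          then show False using injv[OF w(4), of r] U by (auto simp: A_def)
        qed
        moreover have "y \<notin> He ` A"
        proof
          assume "y \<in> He ` A"
          then obtain r where r: "r \<in> A" "Hv z = He r" using y by auto
          then have "r = z" using meet_v(2)[of z r] w agree by (auto simp: A_def)
          then show False using r U by (auto simp: A_def)
        qed
        ultimately show ?thesis using S(1) by blast
      qed
    qed
    show "S - (K \<union> Hv ` A \<union> He ` A) \<subseteq> J ` U"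
    proof
      fix y assume y: "y \<in> S - (K \<union> Hv ` A \<union> He ` A)"
      then consider "y \<in> v" | "y \<in> e" using S(1) by blast
      then show "y \<in> J ` U"
      proof cases
        case 1
        then obtain w where w: "w \<in> rectangle" "y = Hv w" using homeomorphism_image1[OF Hv(1)] by blast
        then have "w \<notin> A" using y by blast
        then have "0 \<le> Re w" "w \<in> U" using w(1) by (auto simp: A_def U_def rectangle_def)
        then have "w \<in> Q" using UQ by blast
        then have "y = J w" using J0[of w] w(2) \<open>0 \<le> Re w\<close> by simp
        then show ?thesis using \<open>w \<in> U\<close> by blast
      next
        case 2
        then obtain w where w: "w \<in> rectangle" "y = He w" using homeomorphism_image1[OF He(1)] by blast
        then have "w \<notin> A" using y by blast
        then have "- cnj w \<in> U" "Re (- cnj w) \<le> 0" using w(1) by (auto simp: A_def U_def rectangle_def)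
        then have "y = J (- cnj w)" using w(2) by (simp add: J_def)
        then show ?thesis using \<open>- cnj w \<in> U\<close> by blast
      qed
    qed
  qed
  have op: "openin (top_of_set S) (J ` U)" unfolding JU Diff_eq
    by (intro openin_open_Int open_Compl closed_Un clA S(2))
  have "surface_boundary (J ` U) = J ` surface_boundary U" by (rule surface_boundary_homeomorphism[OF hU])
  also have "surface_boundary U = {}" unfolding surface_boundary_planar using opU by (simp add: interior_open)
  finally have "surface_boundary S \<inter> J ` U = {}" using surface_boundary_openin[OF op] by simp
  moreover have "x \<in> J ` U"
  proof (rule image_eqI)
    show "Complex 0 y0 \<in> U" using t by (simp add: U_def)
    then show "x = J (Complex 0 y0)" using J0[of "Complex 0 y0"] UQ Hv(2) y0 by auto
  qed
  ultimately show ?thesis by blast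
qed

section \<open>The boundary of a ribbon surface\<close>

lemma openin_minus_closed: "closed K \<Longrightarrow> openin (top_of_set S) (S - K)"
  unfolding Diff_eq by (intro openin_open_Int open_Compl)

text \<open>The discs of a ribbon graph and the way they meet, in a form that passes to spanning subgraphs and to a
  loop together with its vertex.\<close>

locale ribbon_surface =
  fixes V E :: "'a::t2_space set set"
  assumes finV: "finite V" and finE: "finite E"
    and disc: "d \<in> V \<union> E \<Longrightarrow> is_disc d"
    and disjV: "pairwise disjnt V" and disjE: "pairwise disjnt E"
    and seg: "v \<in> V \<Longrightarrow> e \<in> E \<Longrightarrow> s \<in> components (v \<inter> e) \<Longrightarrow>
      is_arc s \<and> s \<subseteq> surface_boundary v \<and> s \<subseteq> surface_boundary e"
    and two: "e \<in> E \<Longrightarrow> card {s \<in> (\<Union>v\<in>V. components (v \<inter> e)). s \<subseteq> e} = 2"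
begin

definition segs :: "'a set set" where "segs = (\<Union>v\<in>V. \<Union>e\<in>E. components (v \<inter> e))"

definition segs_of :: "'a set \<Rightarrow> 'a set set" where "segs_of d = {s \<in> segs. s \<subseteq> d}"

definition S :: "'a set" where "S = \<Union>(V \<union> E)"

lemma V_eq: "v \<in> V \<Longrightarrow> v' \<in> V \<Longrightarrow> x \<in> v \<Longrightarrow> x \<in> v' \<Longrightarrow> v = v'"
  using disjV by (auto simp: pairwise_def disjnt_def)

lemma E_eq: "e \<in> E \<Longrightarrow> e' \<in> E \<Longrightarrow> x \<in> e \<Longrightarrow> x \<in> e' \<Longrightarrow> e = e'"
  using disjE by (auto simp: pairwise_def disjnt_def)

lemma segE:
  assumes "s \<in> segs"
  obtains v e where "v \<in> V" "e \<in> E" "s \<in> components (v \<inter> e)" "s \<subseteq> v" "s \<subseteq> e"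
    "is_arc s" "s \<subseteq> surface_boundary v" "s \<subseteq> surface_boundary e"
proof -
  obtain v e where ve: "v \<in> V" "e \<in> E" "s \<in> components (v \<inter> e)" using assms by (auto simp: segs_def)
  then show ?thesis using that seg[OF ve] in_components_subset[OF ve(3)] by blast
qed

lemma seg_arc: "s \<in> segs \<Longrightarrow> is_arc s" by (meson segE)

lemma seg_nonempty: "s \<in> segs \<Longrightarrow> s \<noteq> {}" using seg_arc arc_nonempty by blast

lemma seg_eq:
  assumes "s \<in> segs" "t \<in> segs" "x \<in> s" "x \<in> t" shows "s = t"
proof -
  obtain v e where s: "v \<in> V" "e \<in> E" "s \<in> components (v \<inter> e)" "s \<subseteq> v" "s \<subseteq> e" using assms(1) by (rule segE)
  obtain v' e' where t: "v' \<in> V" "e' \<in> E" "t \<in> components (v' \<inter> e')" "t \<subseteq> v'" "t \<subseteq> e'" using assms(2) by (rule segE)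
  have "v = v'" "e = e'" using V_eq[OF s(1) t(1)] E_eq[OF s(2) t(2)] s t assms(3,4) by blast+
  then show ?thesis using components_eq[OF s(3), of t] t(3) assms(3,4) by blast
qed

lemma disj_segs: "pairwise disjnt segs"
  using seg_eq by (auto simp: pairwise_def disjnt_def)

lemma seg_subset_disc:
  assumes "s \<in> segs" "d \<in> V \<union> E" "x \<in> s" "x \<in> d"
  shows "s \<subseteq> d" "s \<subseteq> surface_boundary d"
proof -
  obtain v e where s: "v \<in> V" "e \<in> E" "s \<subseteq> v" "s \<subseteq> e" "s \<subseteq> surface_boundary v" "s \<subseteq> surface_boundary e"
    using assms(1) by (rule segE)
  have "d = v \<or> d = e" using V_eq[of d v x] E_eq[of d e x] s assms(2-4) by blast
  then show "s \<subseteq> d" "s \<subseteq> surface_boundary d" using s by auto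
qed

lemma inter_segs: "v \<in> V \<Longrightarrow> e \<in> E \<Longrightarrow> v \<inter> e = \<Union>{s \<in> segs. s \<subseteq> v \<and> s \<subseteq> e}"
proof -
  assume ve: "v \<in> V" "e \<in> E"
  have "v \<inter> e = \<Union>(components (v \<inter> e))" by simp
  also have "\<dots> \<subseteq> \<Union>{s \<in> segs. s \<subseteq> v \<and> s \<subseteq> e}"
    using ve in_components_subset unfolding segs_def by fastforce
  finally show "v \<inter> e = \<Union>{s \<in> segs. s \<subseteq> v \<and> s \<subseteq> e}" by blast
qed

lemma inter_boundary: "v \<in> V \<Longrightarrow> e \<in> E \<Longrightarrow> v \<inter> e \<subseteq> surface_boundary v \<and> v \<inter> e \<subseteq> surface_boundary e"
  using seg by (metis Sup_le_iff Union_components)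

lemma discs_meet:
  assumes "d \<in> V \<union> E" "d' \<in> V \<union> E" "d \<noteq> d'" "x \<in> d" "x \<in> d'"
  shows "x \<in> \<Union>(segs_of d)" "x \<in> surface_boundary d"
proof -
  have "d \<in> V \<and> d' \<in> E \<or> d \<in> E \<and> d' \<in> V" using V_eq[of d d' x] E_eq[of d d' x] assms by blast
  then have "x \<in> \<Union>(segs_of d) \<and> x \<in> surface_boundary d"
  proof
    assume "d \<in> V \<and> d' \<in> E"
    then show ?thesis using inter_segs[of d d'] inter_boundary[of d d'] assms(4,5) unfolding segs_of_def by blast
  next
    assume "d \<in> E \<and> d' \<in> V"
    then show ?thesis using inter_segs[of d' d] inter_boundary[of d' d] assms(4,5) unfolding segs_of_def by blast
  qed
  then show "x \<in> \<Union>(segs_of d)" "x \<in> surface_boundary d" by auto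
qed

lemma segs_of_edge: "e \<in> E \<Longrightarrow> segs_of e = (\<Union>v\<in>V. components (v \<inter> e))"
proof
  assume e: "e \<in> E"
  show "segs_of e \<subseteq> (\<Union>v\<in>V. components (v \<inter> e))"
  proof
    fix s assume s: "s \<in> segs_of e"
    then have "s \<in> segs" "s \<subseteq> e" by (auto simp: segs_of_def)
    then obtain v e' where ve: "v \<in> V" "e' \<in> E" "s \<in> components (v \<inter> e')" "s \<subseteq> e'" by (meson segE)
    then have "e' = e" using E_eq[OF _ e, of e'] \<open>s \<subseteq> e\<close> seg_nonempty[OF \<open>s \<in> segs\<close>] by blast
    then show "s \<in> (\<Union>v\<in>V. components (v \<inter> e))" using ve by blast
  qed
  show "(\<Union>v\<in>V. components (v \<inter> e)) \<subseteq> segs_of e"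
    using e in_components_subset unfolding segs_of_def segs_def by fastforce
qed

lemma card_segs_of_edge: "e \<in> E \<Longrightarrow> card (segs_of e) = 2"
proof -
  assume e: "e \<in> E"
  have "{s \<in> (\<Union>v\<in>V. components (v \<inter> e)). s \<subseteq> e} = segs_of e"
    unfolding segs_of_edge[OF e] using in_components_subset by fastforce
  then show ?thesis using two[OF e] by simp
qed

lemma finite_segs: "finite segs"
proof -
  have "segs = (\<Union>e\<in>E. segs_of e)"
  proof
    show "segs \<subseteq> (\<Union>e\<in>E. segs_of e)"
    proof
      fix s assume s: "s \<in> segs"
      then obtain e where "e \<in> E" "s \<subseteq> e" by (rule segE)
      then show "s \<in> (\<Union>e\<in>E. segs_of e)" using s by (auto simp: segs_of_def)
    qed
  qed (auto simp: segs_of_def)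
  moreover have "finite (segs_of e)" if "e \<in> E" for e
    using card_segs_of_edge[OF that] card_ge_0_finite[of "segs_of e"] by simp
  ultimately show ?thesis using finE by simp
qed

lemma finite_segs_of: "finite (segs_of d)" using finite_segs by (simp add: segs_of_def)

lemma segs_of_boundary: "d \<in> V \<union> E \<Longrightarrow> s \<in> segs_of d \<Longrightarrow> is_arc s \<and> s \<subseteq> surface_boundary d"
  using seg_subset_disc(2) seg_nonempty seg_arc unfolding segs_of_def by blast

lemma disj_segs_of: "pairwise disjnt (segs_of d)"
  using disj_segs unfolding segs_of_def pairwise_def by blast

lemma circle: "d \<in> V \<union> E \<Longrightarrow> is_circle (surface_boundary d)"
  unfolding is_circle_def using disc_boundary_circle disc by blast

definition gaps_of :: "'a set \<Rightarrow> 'a set set" where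
  "gaps_of d = gaps (surface_boundary d) (segs_of d)"

lemma gaps_of:
  assumes "d \<in> V \<union> E" "segs_of d \<noteq> {}"
  shows "finite (gaps_of d)" "\<And>g. g \<in> gaps_of d \<Longrightarrow> is_arc g" "pairwise disjnt (gaps_of d)"
    "\<Union>(arc_ends ` gaps_of d) = \<Union>(arc_ends ` segs_of d)"
    "\<Union>(gaps_of d) = surface_boundary d - \<Union>(relint ` segs_of d)"
  using circle_gaps[OF circle[OF assms(1)] finite_segs_of assms(2) segs_of_boundary[OF assms(1)] disj_segs_of]
  unfolding gaps_of_def by blast+

lemma gap_seg_meet:
  assumes d: "d \<in> V \<union> E" "segs_of d \<noteq> {}" and g: "g \<in> gaps_of d" "x \<in> g" and s: "s \<in> segs" "x \<in> s"
  shows "x \<in> arc_ends g" "x \<in> arc_ends s"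
proof -
  have xd: "x \<in> surface_boundary d" using gaps_of(5)[OF d] g by blast
  then have sd: "s \<in> segs_of d"
    using seg_subset_disc(1)[OF s(1) d(1) s(2)] surface_boundary_subset s by (auto simp: segs_of_def)
  then have "x \<notin> relint s" using gaps_of(5)[OF d] g by blast
  then show "x \<in> arc_ends s" using s by (simp add: relint_def)
  then have "x \<in> \<Union>(arc_ends ` gaps_of d)" using sd gaps_of(4)[OF d] by blast
  then obtain g' where g': "g' \<in> gaps_of d" "x \<in> arc_ends g'" by blast
  then have "x \<in> g'" using arc_ends_subset by blast
  then have "g' = g" using gaps_of(3)[OF d] g g'(1) unfolding pairwise_def disjnt_def by blast
  then show "x \<in> arc_ends g" using g' by simp
qed

lemma closed_disc: "d \<in> V \<union> E \<Longrightarrow> closed d" using disc disc_closed by blast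

lemma closed_others: "A \<subseteq> V \<union> E \<Longrightarrow> closed (\<Union>A)"
  using finite_subset[OF _ finite_UnI[OF finV finE]] closed_disc by (intro closed_Union) blast+

lemma closed_S: "closed S" unfolding S_def by (rule closed_others) simp

lemma disc_interior_not_boundary:
  assumes d: "d \<in> V \<union> E" "x \<in> d" "x \<notin> surface_boundary d"
  shows "x \<notin> surface_boundary S"
proof -
  (* all other discs meet d in its boundary only *)
  let ?K = "\<Union>(V \<union> E - {d}) \<union> surface_boundary d"
  have "closed ?K" using closed_others circle_closed[OF circle[OF d(1)]] by (intro closed_Un) auto
  moreover have eq: "S - ?K = d - surface_boundary d"
    using d(1) discs_meet(2)[OF d(1)] unfolding S_def by blast
  ultimately have op: "openin (top_of_set S) (d - surface_boundary d)" using openin_minus_closed by metis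
  have op': "openin (top_of_set d) (d - surface_boundary d)"
    using openin_minus_closed circle_closed[OF circle[OF d(1)]] by blast
  have "surface_boundary (d - surface_boundary d) = {}" using surface_boundary_openin[OF op'] by blast
  then show ?thesis using surface_boundary_openin[OF op] d by blast
qed

lemma disc_boundary_in_boundary:
  assumes d: "d \<in> V \<union> E" "x \<in> surface_boundary d" "x \<notin> \<Union>segs"
  shows "x \<in> surface_boundary S"
proof -
  (* near x no other disc is present *)
  let ?K = "\<Union>(V \<union> E - {d})"
  have cl: "closed ?K" using closed_others by auto
  have eq: "S - ?K = d - ?K" using d(1) unfolding S_def by blast
  have xU: "x \<in> d - ?K"
    using d discs_meet(1)[OF d(1)] surface_boundary_subset unfolding segs_of_def by blast
  have "openin (top_of_set S) (d - ?K)" using openin_minus_closed[OF cl, of S] eq by simp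
  then have 1: "surface_boundary (d - ?K) = surface_boundary S \<inter> (d - ?K)" by (rule surface_boundary_openin)
  have 2: "surface_boundary (d - ?K) = surface_boundary d \<inter> (d - ?K)"
    by (rule surface_boundary_openin[OF openin_minus_closed[OF cl]])
  have "x \<in> surface_boundary (d - ?K)" unfolding 2 using xU d(2) by (rule IntI[rotated])
  then show ?thesis unfolding 1 by (rule IntD1)
qed

lemma seg_relint_not_boundary:
  assumes s: "s \<in> segs" "x \<in> relint s" shows "x \<notin> surface_boundary S"
proof -
  obtain v e where ve: "v \<in> V" "e \<in> E" "s \<subseteq> v" "s \<subseteq> e" "is_arc s" "s \<subseteq> surface_boundary v" "s \<subseteq> surface_boundary e"
    using s(1) by (rule segE)
  let ?K = "\<Union>(V \<union> E - {v, e})"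
  have vE: "v \<in> V \<union> E" "e \<in> V \<union> E" using ve by auto
  show ?thesis
  proof (rule glued_discs_interior[OF disc[OF vE(1)] disc[OF vE(2)] ve(5,6,7)])
    show "v \<inter> e \<subseteq> surface_boundary v" "v \<inter> e \<subseteq> surface_boundary e" using inter_boundary ve by blast+
    show "S = v \<union> e \<union> ?K" using ve unfolding S_def by blast
    show "closed ?K" using closed_others by auto
    show "?K \<inter> v \<subseteq> surface_boundary v" using discs_meet(2)[OF vE(1)] by blast
    show "?K \<inter> e \<subseteq> surface_boundary e" using discs_meet(2)[OF vE(2)] by blast
    show "?K \<inter> relint s = {}"
    proof (rule ccontr)
      assume "?K \<inter> relint s \<noteq> {}"
      then obtain y d where y: "d \<in> V \<union> E" "d \<noteq> v" "d \<noteq> e" "y \<in> d" "y \<in> s" by (auto simp: relint_def)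
      then have "y \<in> v" "y \<in> e" using ve by auto
      then show False using V_eq[of d v y] E_eq[of d e y] y ve by blast
    qed
    show "x \<in> relint s" by (rule s(2))
  qed
qed

text \<open>An end of a line segment is a limit of points of the adjacent gap, which are boundary points, and the
  boundary is closed.\<close>

lemma seg_end_in_boundary:
  assumes s: "s \<in> segs" "x \<in> arc_ends s" shows "x \<in> surface_boundary S"
proof -
  obtain v e where ve: "v \<in> V" "s \<subseteq> v" "s \<subseteq> surface_boundary v" using s(1) by (rule segE)
  have v: "v \<in> V \<union> E" using ve by auto
  have sv: "s \<in> segs_of v" using s ve by (simp add: segs_of_def)
  then have ne: "segs_of v \<noteq> {}" by auto
  have "x \<in> \<Union>(arc_ends ` gaps_of v)" using gaps_of(4)[OF v ne] sv s(2) by blast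
  then obtain g where g: "g \<in> gaps_of v" "x \<in> arc_ends g" by blast
  have "g - arc_ends g \<subseteq> surface_boundary S"
  proof
    fix y assume y: "y \<in> g - arc_ends g"
    have "y \<in> surface_boundary v" using gaps_of(5)[OF v ne] g y by blast
    moreover have "y \<notin> \<Union>segs" using gap_seg_meet(1)[OF v ne g(1)] y by blast
    ultimately show "y \<in> surface_boundary S" by (rule disc_boundary_in_boundary[OF v])
  qed
  moreover have "closed (surface_boundary S)" using closedin_surface_boundary closed_S closedin_closed_trans by blast
  ultimately have "g \<subseteq> surface_boundary S" using arc_subset_closed gaps_of(2)[OF v ne g(1)] by blast
  then show ?thesis using g(2) arc_ends_subset by blast
qed

theorem boundary_surface:
  "surface_boundary S = (\<Union>d\<in>V \<union> E. surface_boundary d) - \<Union>(relint ` segs)"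
proof
  show "surface_boundary S \<subseteq> (\<Union>d\<in>V \<union> E. surface_boundary d) - \<Union>(relint ` segs)"
  proof
    fix x assume x: "x \<in> surface_boundary S"
    then obtain d where d: "d \<in> V \<union> E" "x \<in> d" using surface_boundary_subset unfolding S_def by blast
    then have "x \<in> surface_boundary d" using disc_interior_not_boundary x by blast
    then show "x \<in> (\<Union>d\<in>V \<union> E. surface_boundary d) - \<Union>(relint ` segs)"
      using d x seg_relint_not_boundary by blast
  qed
  show "(\<Union>d\<in>V \<union> E. surface_boundary d) - \<Union>(relint ` segs) \<subseteq> surface_boundary S"
  proof
    fix x assume x: "x \<in> (\<Union>d\<in>V \<union> E. surface_boundary d) - \<Union>(relint ` segs)"
    then obtain d where d: "d \<in> V \<union> E" "x \<in> surface_boundary d" by blast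
    show "x \<in> surface_boundary S"
    proof (cases "x \<in> \<Union>segs")
      case True
      then obtain s where "s \<in> segs" "x \<in> s" "x \<notin> relint s" using x by blast
      then show ?thesis using seg_end_in_boundary by (auto simp: relint_def)
    next
      case False then show ?thesis using disc_boundary_in_boundary d by blast
    qed
  qed
qed

end

text \<open>Vertices may be dropped as long as no remaining edge meets them. This restricts the results
  on surfaces to spanning subgraphs and to a single loop with its vertex.\<close>

lemma sub_ribbon_surface:
  assumes "ribbon_surface V E" "V' \<subseteq> V" "E' \<subseteq> E"
    and "\<And>v e. v \<in> V \<Longrightarrow> e \<in> E' \<Longrightarrow> v \<inter> e \<noteq> {} \<Longrightarrow> v \<in> V'"
  shows "ribbon_surface V' E'"
proof -
  interpret ribbon_surface V E by (rule assms(1))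
  show ?thesis
  proof
    show "finite V'" "finite E'" using finV finE assms(2,3) finite_subset by blast+
    show "is_disc d" if "d \<in> V' \<union> E'" for d using disc that assms(2,3) by blast
    show "pairwise disjnt V'" "pairwise disjnt E'" using disjV disjE assms(2,3) pairwise_subset by blast+
    show "is_arc s \<and> s \<subseteq> surface_boundary v \<and> s \<subseteq> surface_boundary e"
      if "v \<in> V'" "e \<in> E'" "s \<in> components (v \<inter> e)" for v e s using seg[of v e s] that assms(2,3) by blast
    fix e assume e: "e \<in> E'"
    have "(\<Union>v\<in>V'. components (v \<inter> e)) = (\<Union>v\<in>V. components (v \<inter> e))"
    proof
      show "(\<Union>v\<in>V. components (v \<inter> e)) \<subseteq> (\<Union>v\<in>V'. components (v \<inter> e))"
      proof
        fix s assume "s \<in> (\<Union>v\<in>V. components (v \<inter> e))"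
        then obtain v where v: "v \<in> V" "s \<in> components (v \<inter> e)" by blast
        then have "v \<inter> e \<noteq> {}" by auto
        then show "s \<in> (\<Union>v\<in>V'. components (v \<inter> e))" using v assms(4)[OF v(1) e] by blast
      qed
    qed (use assms(2) in blast)
    then show "card {s \<in> (\<Union>v\<in>V'. components (v \<inter> e)). s \<subseteq> e} = 2" using two e assms(3) by auto
  qed
qed

lemma ribbon_graph_surface:
  assumes "ribbon_graph G" shows "ribbon_surface (verts G) (edges G)"
proof
  note G = assms[unfolded ribbon_graph_def]
  show "finite (verts G)" "finite (edges G)" "pairwise disjnt (verts G)" "pairwise disjnt (edges G)" using G by auto
  show "is_disc d" if "d \<in> verts G \<union> edges G" for d using G that by (simp add: is_disc_def)
  have dV: "d = d'" if "x \<in> d" "x \<in> d'" "d \<in> verts G" "d' \<in> verts G" for d d' x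
    using \<open>pairwise disjnt (verts G)\<close> that unfolding pairwise_def disjnt_def by blast
  have dE: "d = d'" if "x \<in> d" "x \<in> d'" "d \<in> edges G" "d' \<in> edges G" for d d' x
    using \<open>pairwise disjnt (edges G)\<close> that unfolding pairwise_def disjnt_def by blast
  have seg: "s homeomorphic {0..1::real} \<and> (\<exists>!v. v \<in> verts G \<and> s \<subseteq> surface_boundary v) \<and>
      (\<exists>!e. e \<in> edges G \<and> s \<subseteq> surface_boundary e)" if "s \<in> line_segments G" for s
    using G by (elim conjE) (rule bspec[OF _ that])
  show "is_arc s \<and> s \<subseteq> surface_boundary v \<and> s \<subseteq> surface_boundary e"
    if ve: "v \<in> verts G" "e \<in> edges G" "s \<in> components (v \<inter> e)" for v e s
  proof -
    have s: "s \<in> line_segments G" using ve by (auto simp: line_segments_def)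
    obtain v' where "v' \<in> verts G" "s \<subseteq> surface_boundary v'"
      using ex1_implies_ex[OF conjunct1[OF conjunct2[OF seg[OF s]]]] by (elim exE conjE)
    moreover obtain e' where "e' \<in> edges G" "s \<subseteq> surface_boundary e'"
      using ex1_implies_ex[OF conjunct2[OF conjunct2[OF seg[OF s]]]] by (elim exE conjE)
    ultimately have v': "v' \<in> verts G" "s \<subseteq> surface_boundary v'" "e' \<in> edges G" "s \<subseteq> surface_boundary e'"
      by auto
    obtain x where x: "x \<in> s" using in_components_nonempty[OF ve(3)] by blast
    have "x \<in> v" "x \<in> e" "x \<in> v'" "x \<in> e'"
      using x v' in_components_subset[OF ve(3)] surface_boundary_subset by blast+
    then have "v' = v" "e' = e" using dV ve(1) v'(1) dE ve(2) v'(3) by blast+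
    then show ?thesis using v' conjunct1[OF seg[OF s]] by (simp add: is_arc_iff)
  qed
  fix e assume e: "e \<in> edges G"
  have "{s \<in> (\<Union>v\<in>verts G. components (v \<inter> e)). s \<subseteq> e} = {s \<in> line_segments G. s \<subseteq> e}"
  proof
    show "{s \<in> (\<Union>v\<in>verts G. components (v \<inter> e)). s \<subseteq> e} \<subseteq> {s \<in> line_segments G. s \<subseteq> e}"
      using e by (auto simp: line_segments_def)
    show "{s \<in> line_segments G. s \<subseteq> e} \<subseteq> {s \<in> (\<Union>v\<in>verts G. components (v \<inter> e)). s \<subseteq> e}"
    proof
      fix s assume "s \<in> {s \<in> line_segments G. s \<subseteq> e}"
      then obtain v e' where s: "v \<in> verts G" "e' \<in> edges G" "s \<in> components (v \<inter> e')" "s \<subseteq> e"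
        by (auto simp: line_segments_def)
      obtain x where x: "x \<in> s" using in_components_nonempty[OF s(3)] by blast
      then have "x \<in> e" "x \<in> e'" using s in_components_subset[OF s(3)] by blast+
      then have "e' = e" using dE e s(2) by blast
      then show "s \<in> {s \<in> (\<Union>v\<in>verts G. components (v \<inter> e)). s \<subseteq> e}" using s by blast
    qed
  qed
  then show "card {s \<in> (\<Union>v\<in>verts G. components (v \<inter> e)). s \<subseteq> e} = 2" using G e by auto
qed

section \<open>Flags of a ribbon surface\<close>

text \<open>The other end of the arc in \<open>\<A>\<close> that ends at \<open>x\<close>.\<close>

definition opp :: "'a::t2_space set set \<Rightarrow> 'a \<Rightarrow> 'a" where
  "opp \<A> x = (THE y. y \<noteq> x \<and> (\<exists>a\<in>\<A>. x \<in> arc_ends a \<and> y \<in> arc_ends a))"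

lemma opp_ends:
  assumes arcs: "\<And>a. a \<in> \<A> \<Longrightarrow> is_arc a" and disj: "pairwise disjnt \<A>" and a: "a \<in> \<A>" "x \<in> arc_ends a"
  shows "arc_ends a = {x, opp \<A> x}" "opp \<A> x \<noteq> x"
proof -
  obtain p q where pq: "arc_ends a = {p, q}" "p \<noteq> q" using arc_ends_card[OF arcs[OF a(1)]] card_2_iff by metis
  obtain y where y: "arc_ends a = {x, y}" "y \<noteq> x"
  proof (cases "x = p")
    case True then show ?thesis using that[of q] pq by auto
  next
    case False then show ?thesis using that[of p] pq a(2) by auto
  qed
  have uniq: "b = a" if "b \<in> \<A>" "x \<in> arc_ends b" for b
  proof -
    have "x \<in> a" "x \<in> b" using a(2) that(2) arc_ends_subset by blast+
    then show ?thesis using disj a(1) that(1) unfolding pairwise_def disjnt_def by blast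
  qed
  have "opp \<A> x = y" unfolding opp_def
  proof (rule the_equality)
    show "y \<noteq> x \<and> (\<exists>a\<in>\<A>. x \<in> arc_ends a \<and> y \<in> arc_ends a)" using a y by auto
    fix z assume "z \<noteq> x \<and> (\<exists>a\<in>\<A>. x \<in> arc_ends a \<and> z \<in> arc_ends a)"
    then obtain b where "z \<noteq> x" "b \<in> \<A>" "x \<in> arc_ends b" "z \<in> arc_ends b" by blast
    then have "z \<in> arc_ends a" using uniq by blast
    then show "z = y" using y \<open>z \<noteq> x\<close> by auto
  qed
  then show "arc_ends a = {x, opp \<A> x}" "opp \<A> x \<noteq> x" using y by auto
qed

lemma opp_involution:
  assumes arcs: "\<And>a. a \<in> \<A> \<Longrightarrow> is_arc a" and disj: "pairwise disjnt \<A>" and x: "x \<in> \<Union>(arc_ends ` \<A>)"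
  shows "opp \<A> x \<in> \<Union>(arc_ends ` \<A>) \<and> opp \<A> (opp \<A> x) = x \<and> opp \<A> x \<noteq> x"
proof -
  obtain a where a: "a \<in> \<A>" "x \<in> arc_ends a" using x by blast
  note 1 = opp_ends[OF arcs disj a]
  have o: "opp \<A> x \<in> arc_ends a" using 1(1) by blast
  note 2 = opp_ends[OF arcs disj a(1) o]
  have "x \<in> {opp \<A> x, opp \<A> (opp \<A> x)}" using a(2) 2(1) by simp
  then show ?thesis using 1(2) o a(1) by auto
qed

lemma connected_clopen_split:
  assumes "connected C" "closed P" "closed Q" "C = P \<union> Q" "P \<inter> Q = {}" "P \<noteq> {}" "Q \<noteq> {}"
  shows False
  using connected_closedD[OF assms(1), of P Q] assms by blast

context ribbon_surface
begin

definition X :: "'a set" where "X = \<Union>(arc_ends ` segs)"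

text \<open>Discs without line segments are left out: their boundary is a circle, not a union of arcs.\<close>

definition arcs_of :: "'a set set \<Rightarrow> 'a set set" where
  "arcs_of D = (\<Union>d\<in>{d \<in> D. segs_of d \<noteq> {}}. gaps_of d)"

lemma X_seg: "s \<in> segs \<Longrightarrow> x \<in> arc_ends s \<Longrightarrow> x \<in> X" by (auto simp: X_def)

lemma X_segE:
  assumes "x \<in> X" obtains s where "s \<in> segs" "x \<in> arc_ends s" "x \<in> s"
  using assms arc_ends_subset unfolding X_def by blast

lemma seg_X: "s \<in> segs \<Longrightarrow> x \<in> s \<Longrightarrow> x \<in> X \<longleftrightarrow> x \<in> arc_ends s"
proof
  assume s: "s \<in> segs" "x \<in> s" and "x \<in> X"
  then obtain t where t: "t \<in> segs" "x \<in> arc_ends t" "x \<in> t" by (meson X_segE)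
  then show "x \<in> arc_ends s" using seg_eq[OF s(1) t(1) s(2) t(3)] by simp
qed (auto simp: X_def)

lemma arcs_of_gap:
  assumes "D = V \<or> D = E" "g \<in> arcs_of D"
  obtains d where "d \<in> D" "d \<in> V \<union> E" "segs_of d \<noteq> {}" "g \<in> gaps_of d" "g \<subseteq> surface_boundary d"
proof -
  obtain d where d: "d \<in> D" "segs_of d \<noteq> {}" "g \<in> gaps_of d" using assms(2) by (auto simp: arcs_of_def)
  then have "d \<in> V \<union> E" using assms(1) by auto
  moreover have "g \<subseteq> surface_boundary d" using gaps_of(5)[OF calculation d(2)] d(3) by blast
  ultimately show ?thesis using that d by blast
qed

lemma V_gap:
  assumes "g \<in> arcs_of V" shows "\<exists>v\<in>V. segs_of v \<noteq> {} \<and> g \<in> gaps_of v \<and> g \<subseteq> surface_boundary v"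
  by (rule arcs_of_gap[OF disjI1[OF refl] assms]) blast

lemma E_gap:
  assumes "g \<in> arcs_of E" shows "\<exists>e\<in>E. segs_of e \<noteq> {} \<and> g \<in> gaps_of e \<and> g \<subseteq> surface_boundary e"
  by (rule arcs_of_gap[OF disjI2[OF refl] assms]) blast

lemma arcs_of_arc: "D = V \<or> D = E \<Longrightarrow> g \<in> arcs_of D \<Longrightarrow> is_arc g"
  by (meson arcs_of_gap gaps_of(2))

lemma finite_arcs_of: "D = V \<or> D = E \<Longrightarrow> finite (arcs_of D)"
  unfolding arcs_of_def using finV finE gaps_of(1) by (intro finite_UN_I) auto

lemma D_eq: "D = V \<or> D = E \<Longrightarrow> d \<in> D \<Longrightarrow> d' \<in> D \<Longrightarrow> x \<in> d \<Longrightarrow> x \<in> d' \<Longrightarrow> d = d'"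
  using V_eq E_eq by blast

lemma arcs_of_eq:
  assumes D: "D = V \<or> D = E" and g: "g \<in> arcs_of D" "g' \<in> arcs_of D" "x \<in> g" "x \<in> g'"
  shows "g = g'"
proof -
  obtain d where d: "d \<in> D" "d \<in> V \<union> E" "segs_of d \<noteq> {}" "g \<in> gaps_of d" "g \<subseteq> surface_boundary d"
    using arcs_of_gap[OF D g(1)] .
  obtain d' where d': "d' \<in> D" "g' \<in> gaps_of d'" "g' \<subseteq> surface_boundary d'" using arcs_of_gap[OF D g(2)] .
  have "x \<in> d" "x \<in> d'" using d d' g surface_boundary_subset by blast+
  then have "d = d'" using D_eq[OF D d(1) d'(1)] by blast
  then show ?thesis using gaps_of(3)[OF d(2,3)] d(4) d'(2) g(3,4) unfolding pairwise_def disjnt_def by blast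
qed

lemma disj_arcs_of: "D = V \<or> D = E \<Longrightarrow> pairwise disjnt (arcs_of D)"
  using arcs_of_eq unfolding pairwise_def disjnt_def by blast

lemma seg_in_D:
  assumes D: "D = V \<or> D = E" and s: "s \<in> segs"
  obtains d where "d \<in> D" "s \<in> segs_of d"
proof -
  obtain v e where "v \<in> V" "e \<in> E" "s \<subseteq> v" "s \<subseteq> e" using s by (rule segE)
  then show ?thesis using that D s unfolding segs_of_def by blast
qed

lemma arcs_of_ends:
  assumes D: "D = V \<or> D = E" shows "\<Union>(arc_ends ` arcs_of D) = X"
proof
  show "\<Union>(arc_ends ` arcs_of D) \<subseteq> X"
  proof
    fix x assume "x \<in> \<Union>(arc_ends ` arcs_of D)"
    then obtain g where g: "g \<in> arcs_of D" "x \<in> arc_ends g" by blast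
    obtain d where d: "d \<in> V \<union> E" "segs_of d \<noteq> {}" "g \<in> gaps_of d" using arcs_of_gap[OF D g(1)] .
    then have "x \<in> \<Union>(arc_ends ` segs_of d)" using gaps_of(4)[OF d(1,2)] g(2) by blast
    then show "x \<in> X" unfolding X_def segs_of_def by blast
  qed
  show "X \<subseteq> \<Union>(arc_ends ` arcs_of D)"
  proof
    fix x assume "x \<in> X"
    then obtain s where s: "s \<in> segs" "x \<in> arc_ends s" by (meson X_segE)
    obtain d where d: "d \<in> D" "s \<in> segs_of d" using seg_in_D[OF D s(1)] .
    then have "d \<in> V \<union> E" "segs_of d \<noteq> {}" using D by auto
    from gaps_of(4)[OF this] d(2) s(2) obtain g where "g \<in> gaps_of d" "x \<in> arc_ends g" by blast
    then show "x \<in> \<Union>(arc_ends ` arcs_of D)" using d \<open>segs_of d \<noteq> {}\<close> unfolding arcs_of_def by blast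
  qed
qed

lemma arcs_of_X:
  assumes D: "D = V \<or> D = E" and g: "g \<in> arcs_of D" "x \<in> g" shows "x \<in> X \<longleftrightarrow> x \<in> arc_ends g"
proof
  assume "x \<in> X"
  then obtain s where s: "s \<in> segs" "x \<in> s" by (meson X_segE)
  obtain d where d: "d \<in> V \<union> E" "segs_of d \<noteq> {}" "g \<in> gaps_of d" using arcs_of_gap[OF D g(1)] .
  show "x \<in> arc_ends g" by (rule gap_seg_meet(1)[OF d g(2) s])
next
  assume "x \<in> arc_ends g"
  then show "x \<in> X" using arcs_of_ends[OF D] g(1) by blast
qed

definition \<alpha> where "\<alpha> = opp (arcs_of V)"
definition \<tau> where "\<tau> = opp segs"
definition \<sigma> where "\<sigma> = opp (arcs_of E)"
definition ed where "ed x = (THE e. e \<in> E \<and> x \<in> e)"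
definition vx where "vx x = (THE v. v \<in> V \<and> x \<in> v)"

lemma ed_eq: "e \<in> E \<Longrightarrow> x \<in> e \<Longrightarrow> ed x = e" unfolding ed_def by (rule the_equality) (simp, meson E_eq)
lemma vx_eq: "v \<in> V \<Longrightarrow> x \<in> v \<Longrightarrow> vx x = v" unfolding vx_def by (rule the_equality) (simp, meson V_eq)

lemma X_ed: "x \<in> X \<Longrightarrow> ed x \<in> E \<and> x \<in> ed x"
proof -
  assume "x \<in> X"
  then obtain s where s: "s \<in> segs" "x \<in> s" by (meson X_segE)
  obtain e where e: "e \<in> E" "s \<subseteq> e" using s(1) by (rule segE)
  then have "x \<in> e" using s by blast
  then show ?thesis using e ed_eq[OF e(1)] by simp
qed

lemma X_vx: "x \<in> X \<Longrightarrow> vx x \<in> V \<and> x \<in> vx x"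
proof -
  assume "x \<in> X"
  then obtain s where s: "s \<in> segs" "x \<in> s" by (meson X_segE)
  obtain v where v: "v \<in> V" "s \<subseteq> v" using s(1) by (rule segE)
  then have "x \<in> v" using s by blast
  then show ?thesis using v vx_eq[OF v(1)] by simp
qed

lemma tau_ends: "s \<in> segs \<Longrightarrow> x \<in> arc_ends s \<Longrightarrow> arc_ends s = {x, \<tau> x}"
  unfolding \<tau>_def by (rule opp_ends(1)[OF seg_arc disj_segs])

lemma alpha_ends: "g \<in> arcs_of V \<Longrightarrow> x \<in> arc_ends g \<Longrightarrow> arc_ends g = {x, \<alpha> x}"
  unfolding \<alpha>_def by (rule opp_ends(1)[OF arcs_of_arc disj_arcs_of]) auto

lemma sigma_ends: "g \<in> arcs_of E \<Longrightarrow> x \<in> arc_ends g \<Longrightarrow> arc_ends g = {x, \<sigma> x}"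
  unfolding \<sigma>_def by (rule opp_ends(1)[OF arcs_of_arc disj_arcs_of]) auto

lemma tau_X: "x \<in> X \<Longrightarrow> \<tau> x \<in> X \<and> \<tau> (\<tau> x) = x \<and> \<tau> x \<noteq> x"
  unfolding \<tau>_def X_def by (rule opp_involution[OF seg_arc disj_segs])

lemma alpha_X: "x \<in> X \<Longrightarrow> \<alpha> x \<in> X \<and> \<alpha> (\<alpha> x) = x \<and> \<alpha> x \<noteq> x"
  using opp_involution[of "arcs_of V" x, OF arcs_of_arc[of V] disj_arcs_of[of V]] arcs_of_ends[of V]
  unfolding \<alpha>_def by simp

lemma sigma_X: "x \<in> X \<Longrightarrow> \<sigma> x \<in> X \<and> \<sigma> (\<sigma> x) = x \<and> \<sigma> x \<noteq> x"
  using opp_involution[of "arcs_of E" x, OF arcs_of_arc[of E] disj_arcs_of[of E]] arcs_of_ends[of E]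
  unfolding \<sigma>_def by simp

lemma alpha_gap:
  assumes "x \<in> X" obtains g where "g \<in> gaps_of (vx x)" "g \<in> arcs_of V" "arc_ends g = {x, \<alpha> x}" "segs_of (vx x) \<noteq> {}"
proof -
  obtain g where g: "g \<in> arcs_of V" "x \<in> arc_ends g" using arcs_of_ends[of V] assms by blast
  obtain d where d: "d \<in> V" "segs_of d \<noteq> {}" "g \<in> gaps_of d" "g \<subseteq> surface_boundary d" using V_gap[OF g(1)] by blast
  have "x \<in> d" using g d arc_ends_subset surface_boundary_subset by blast
  then show ?thesis using that[of g] d g alpha_ends[OF g] vx_eq[OF d(1)] by simp
qed

lemma sigma_gap:
  assumes "x \<in> X" obtains g where "g \<in> gaps_of (ed x)" "g \<in> arcs_of E" "arc_ends g = {x, \<sigma> x}"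
proof -
  obtain g where g: "g \<in> arcs_of E" "x \<in> arc_ends g" using arcs_of_ends[of E] assms by blast
  obtain d where d: "d \<in> E" "g \<in> gaps_of d" "g \<subseteq> surface_boundary d" using E_gap[OF g(1)] by blast
  have "x \<in> d" using g d arc_ends_subset surface_boundary_subset by blast
  then show ?thesis using that[of g] d g sigma_ends[OF g] ed_eq[OF d(1)] by simp
qed

lemma alpha_vx: "x \<in> X \<Longrightarrow> vx (\<alpha> x) = vx x"
proof -
  assume x: "x \<in> X"
  obtain g where g: "g \<in> gaps_of (vx x)" "arc_ends g = {x, \<alpha> x}" "segs_of (vx x) \<noteq> {}" using alpha_gap[OF x] .
  have "\<alpha> x \<in> surface_boundary (vx x)"
    using gaps_of(5)[of "vx x"] X_vx[OF x] g arc_ends_subset[of g] by blast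
  then show ?thesis using vx_eq[of "vx x" "\<alpha> x"] X_vx[OF x] surface_boundary_subset by blast
qed

lemma segs_of_edge_nonempty: "e \<in> E \<Longrightarrow> segs_of e \<noteq> {}"
  using card_segs_of_edge by fastforce

lemma sigma_ed: "x \<in> X \<Longrightarrow> ed (\<sigma> x) = ed x"
proof -
  assume x: "x \<in> X"
  obtain g where g: "g \<in> gaps_of (ed x)" "arc_ends g = {x, \<sigma> x}" using sigma_gap[OF x] .
  have "\<sigma> x \<in> surface_boundary (ed x)"
    using gaps_of(5)[of "ed x"] segs_of_edge_nonempty[of "ed x"] X_ed[OF x] g arc_ends_subset[of g] by blast
  then show ?thesis using ed_eq[of "ed x" "\<sigma> x"] X_ed[OF x] surface_boundary_subset by blast
qed

lemma tau_ed_vx: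
  assumes x: "x \<in> X" shows "ed (\<tau> x) = ed x" "vx (\<tau> x) = vx x"
proof -
  obtain s where s: "s \<in> segs" "x \<in> arc_ends s" "x \<in> s" using x by (rule X_segE)
  have "\<tau> x \<in> s" using tau_ends[OF s(1,2)] arc_ends_subset[of s] by blast
  moreover have "s \<subseteq> ed x" "s \<subseteq> vx x" using seg_subset_disc(1)[OF s(1) _ s(3)] X_ed[OF x] X_vx[OF x] by blast+
  ultimately show "ed (\<tau> x) = ed x" "vx (\<tau> x) = vx x"
    using ed_eq[of "ed x" "\<tau> x"] vx_eq[of "vx x" "\<tau> x"] X_ed[OF x] X_vx[OF x] by blast+
qed

lemma edge_segs:
  assumes e: "e \<in> E" and s: "s \<in> segs_of e"
  obtains s' where "s' \<in> segs_of e" "s' \<noteq> s" "segs_of e = {s, s'}"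
proof -
  obtain a b where ab: "segs_of e = {a, b}" "a \<noteq> b" using card_segs_of_edge[OF e] card_2_iff by metis
  show ?thesis
  proof (cases "s = a")
    case True then show ?thesis using that[of b] ab by auto
  next
    case False then show ?thesis using that[of a] ab s by auto
  qed
qed

lemma X_in_edge:
  assumes "e \<in> E" "x \<in> X" "x \<in> e" obtains s where "s \<in> segs_of e" "x \<in> arc_ends s"
proof -
  obtain s where s: "s \<in> segs" "x \<in> arc_ends s" "x \<in> s" using assms(2) by (rule X_segE)
  then show ?thesis using that[of s] seg_subset_disc(1)[OF s(1) _ s(3), of e] assms by (auto simp: segs_of_def)
qed

lemma boundary_gaps_segs:
  assumes d: "d \<in> V \<union> E" "segs_of d \<noteq> {}"
  shows "surface_boundary d = \<Union>(gaps_of d) \<union> \<Union>(segs_of d)"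
proof
  show "surface_boundary d \<subseteq> \<Union>(gaps_of d) \<union> \<Union>(segs_of d)"
    unfolding gaps_of(5)[OF d] relint_def by blast
  show "\<Union>(gaps_of d) \<union> \<Union>(segs_of d) \<subseteq> surface_boundary d"
    unfolding gaps_of(5)[OF d] using segs_of_boundary[OF d(1)] by blast
qed

text \<open>Otherwise a gap and a line segment of the edge with the same ends would close up to a circle, and the
  rest of the connected edge boundary would be separated from it.\<close>

lemma sigma_other_seg:
  assumes x: "x \<in> X" and s: "s \<in> segs" "x \<in> arc_ends s"
  shows "\<sigma> x \<notin> s"
proof
  assume "\<sigma> x \<in> s"
  then have "\<sigma> x \<in> arc_ends s" using seg_X[OF s(1)] sigma_X[OF x] by blast
  define e where "e = ed x"
  have e: "e \<in> E" "x \<in> e" "e \<in> V \<union> E" using X_ed[OF x] by (auto simp: e_def)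
  have xs: "x \<in> s" using s arc_ends_subset by blast
  have se: "s \<in> segs_of e" using seg_subset_disc(1)[OF s(1) e(3) xs e(2)] s by (simp add: segs_of_def)
  obtain s' where s': "s' \<in> segs_of e" "s' \<noteq> s" "segs_of e = {s, s'}" using edge_segs[OF e(1) se] .
  have ne: "segs_of e \<noteq> {}" using se by blast
  obtain g where g: "g \<in> gaps_of e" "arc_ends g = {x, \<sigma> x}" using sigma_gap[OF x] unfolding e_def by blast
  have "arc_ends s = {x, \<tau> x}" using tau_ends[OF s] .
  then have eq: "arc_ends g = arc_ends s" using g(2) \<open>\<sigma> x \<in> arc_ends s\<close> sigma_X[OF x] by auto
  let ?P = "s \<union> g" and ?Q = "s' \<union> \<Union>(gaps_of e - {g})"
  have S': "s' \<in> segs" using s' by (simp add: segs_of_def)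
  have arcs: "is_arc s" "is_arc s'" "\<And>g. g \<in> gaps_of e \<Longrightarrow> is_arc g" using seg_arc s S' gaps_of(2)[OF e(3) ne] by blast+
  have ss': "s \<inter> s' = {}" using seg_eq[OF s(1) S'] s'(2) by blast
  show False
  proof (rule connected_clopen_split[of "surface_boundary e" ?P ?Q])
    show "connected (surface_boundary e)" using circle_connected[OF circle[OF e(3)]] .
    show "closed ?P" using arcs g by (intro closed_Un arc_closed) auto
    show "closed ?Q" using arcs gaps_of(1)[OF e(3) ne] by (intro closed_Un closed_Union arc_closed ballI) (auto intro: arc_closed)
    show "surface_boundary e = ?P \<union> ?Q" unfolding boundary_gaps_segs[OF e(3) ne] s'(3) using g(1) by blast
    show "?P \<noteq> {}" "?Q \<noteq> {}" using xs arc_nonempty[OF arcs(2)] by auto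
    show "?P \<inter> ?Q = {}"
    proof -
      have gg: "g \<inter> g' = {}" if "g' \<in> gaps_of e - {g}" for g'
        using gaps_of(3)[OF e(3) ne] g(1) that unfolding pairwise_def disjnt_def by blast
      have "s \<inter> g' = {}" if g': "g' \<in> gaps_of e - {g}" for g'
      proof (rule ccontr)
        assume "s \<inter> g' \<noteq> {}"
        then obtain y where y: "y \<in> s" "y \<in> g'" by blast
        then have "y \<in> arc_ends s" using gap_seg_meet(2)[OF e(3) ne _ y(2) s(1) y(1)] g' by blast
        then have "y \<in> g" using eq arc_ends_subset[of g] by blast
        then show False using gg[OF g'] y by blast
      qed
      moreover have "g \<inter> s' = {}"
      proof (rule ccontr)
        assume "g \<inter> s' \<noteq> {}"
        then obtain y where y: "y \<in> s'" "y \<in> g" by blast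
        then have "y \<in> arc_ends g" using gap_seg_meet(1)[OF e(3) ne g(1) y(2) S' y(1)] by blast
        then have "y \<in> s" using eq arc_ends_subset[of s] by blast
        then show False using ss' y by blast
      qed
      ultimately show ?thesis using ss' gg by blast
    qed
  qed
qed

lemma sigma_seg:
  assumes x: "x \<in> X" and s: "s \<in> segs_of (ed x)" "s' \<in> segs_of (ed x)" "s' \<noteq> s" and xs: "x \<in> arc_ends s"
  shows "\<sigma> x \<in> arc_ends s'"
proof -
  have e: "ed x \<in> E" using X_ed[OF x] by blast
  have s1: "s \<in> segs" using s by (simp add: segs_of_def)
  have "\<sigma> x \<in> X" "\<sigma> x \<in> ed x" using sigma_X[OF x] X_ed[of "\<sigma> x"] sigma_ed[OF x] by auto
  then obtain t where t: "t \<in> segs_of (ed x)" "\<sigma> x \<in> arc_ends t" using X_in_edge[OF e] by blast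
  have "t \<noteq> s" using sigma_other_seg[OF x s1 xs] t(2) arc_ends_subset by blast
  moreover obtain r where "segs_of (ed x) = {s, r}" using edge_segs[OF e s(1)] by blast
  ultimately have "t = s'" using t(1) s(2,3) by blast
  then show ?thesis using t(2) by simp
qed

sublocale flags: flag_system X \<alpha> \<tau> \<sigma> ed
proof
  show "finite X" unfolding X_def using finite_segs arc_ends_card[OF seg_arc]
    by (intro finite_UN_I) (auto intro: card_ge_0_finite)
next
  fix x assume x: "x \<in> X"
  show "\<alpha> x \<in> X \<and> \<alpha> (\<alpha> x) = x \<and> \<alpha> x \<noteq> x" using alpha_X[OF x] .
  show "\<tau> x \<in> X \<and> \<tau> (\<tau> x) = x \<and> \<tau> x \<noteq> x \<and> ed (\<tau> x) = ed x" using tau_X[OF x] tau_ed_vx[OF x] by simp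
  show "\<sigma> x \<in> X \<and> \<sigma> (\<sigma> x) = x \<and> \<sigma> x \<noteq> x \<and> ed (\<sigma> x) = ed x" using sigma_X[OF x] sigma_ed[OF x] by simp
  have e: "ed x \<in> E" "x \<in> ed x" using X_ed[OF x] by auto
  obtain s where s: "s \<in> segs_of (ed x)" "x \<in> arc_ends s" using X_in_edge[OF e(1) x e(2)] .
  obtain s' where s': "s' \<in> segs_of (ed x)" "s' \<noteq> s" "segs_of (ed x) = {s, s'}" using edge_segs[OF e(1) s(1)] .
  have ss: "s \<in> segs" "s' \<in> segs" using s s' by (auto simp: segs_of_def)
  have es: "arc_ends s = {x, \<tau> x}" using tau_ends[OF ss(1) s(2)] .
  have sx: "\<sigma> x \<in> arc_ends s'" using sigma_seg[OF x s(1) s'(1,2) s(2)] .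
  have es': "arc_ends s' = {\<sigma> x, \<tau> (\<sigma> x)}" using tau_ends[OF ss(2) sx] .
  have tx: "\<tau> x \<in> X" "ed (\<tau> x) = ed x" using tau_X[OF x] tau_ed_vx[OF x] by auto
  have "\<sigma> (\<tau> x) \<in> arc_ends s'" using sigma_seg[OF tx(1), of s s'] tx(2) s s' es by simp
  moreover have "\<sigma> (\<tau> x) \<noteq> \<sigma> x" using sigma_X[OF x] sigma_X[OF tx(1)] tau_X[OF x] by metis
  ultimately have "\<sigma> (\<tau> x) = \<tau> (\<sigma> x)" using es' by blast
  moreover have "\<sigma> x \<noteq> \<tau> x" using sigma_other_seg[OF x ss(1) s(2)] es arc_ends_subset[of s] by auto
  ultimately show "\<tau> (\<sigma> x) = \<sigma> (\<tau> x) \<and> \<sigma> x \<noteq> \<tau> x" by simp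
  fix y assume y: "y \<in> X" "ed x = ed y"
  have "y \<in> ed x" using X_ed[OF y(1)] y(2) by simp
  then obtain t where t: "t \<in> segs_of (ed x)" "y \<in> arc_ends t" using X_in_edge[OF e(1) y(1)] by blast
  then show "y \<in> {x, \<tau> x, \<sigma> x, \<tau> (\<sigma> x)}" using s'(3) es es' by auto
qed

lemma ed_X: "ed ` X = E"
proof
  show "ed ` X \<subseteq> E" using X_ed by blast
  show "E \<subseteq> ed ` X"
  proof
    fix e assume e: "e \<in> E"
    then obtain s where s: "s \<in> segs_of e" using segs_of_edge_nonempty by blast
    then have s': "s \<in> segs" "s \<subseteq> e" by (auto simp: segs_of_def)
    then obtain x where x: "x \<in> arc_ends s" using arc_ends_card[OF seg_arc[OF s'(1)]] by fastforce
    then have "ed x = e" using ed_eq[OF e] s'(2) arc_ends_subset by blast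
    then show "e \<in> ed ` X" using X_seg[OF s'(1) x] by blast
  qed
qed

section \<open>Walks along arcs\<close>

definition all_arcs :: "'a set set" where "all_arcs = arcs_of V \<union> segs \<union> arcs_of E"

lemma all_arcs_arc: "P \<in> all_arcs \<Longrightarrow> is_arc P"
  unfolding all_arcs_def using arcs_of_arc seg_arc by blast

lemma all_arcs_X: "P \<in> all_arcs \<Longrightarrow> x \<in> P \<Longrightarrow> x \<in> X \<longleftrightarrow> x \<in> arc_ends P"
  unfolding all_arcs_def using arcs_of_X seg_X by blast

lemma gap_meets_seg:
  assumes D: "D = V \<or> D = E" and "g \<in> arcs_of D" "x \<in> g" "s \<in> segs" "x \<in> s" shows "x \<in> X"
proof -
  obtain d where d: "d \<in> V \<union> E" "segs_of d \<noteq> {}" "g \<in> gaps_of d" using arcs_of_gap[OF D assms(2)] .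
  show ?thesis using X_seg[OF assms(4)] gap_seg_meet(2)[OF d assms(3,4,5)] by blast
qed

lemma all_arcs_meet:
  assumes "P \<in> all_arcs" "Q \<in> all_arcs" "P \<noteq> Q" "x \<in> P" "x \<in> Q" shows "x \<in> X"
proof -
  have VE: "x \<in> X" if g: "g \<in> arcs_of V" "h \<in> arcs_of E" "x \<in> g" "x \<in> h" for g h
  proof -
    obtain v where v: "v \<in> V" "g \<subseteq> surface_boundary v" using V_gap[OF g(1)] by blast
    obtain e where e: "e \<in> E" "h \<subseteq> surface_boundary e" using E_gap[OF g(2)] by blast
    have "x \<in> v \<inter> e" using v e g surface_boundary_subset by blast
    then obtain s where "s \<in> segs" "x \<in> s" using inter_segs[OF v(1) e(1)] by blast
    then show ?thesis using gap_meets_seg[OF _ g(1,3)] by blast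
  qed
  consider "P \<in> arcs_of V" "Q \<in> arcs_of V" | "P \<in> arcs_of E" "Q \<in> arcs_of E" | "P \<in> segs" "Q \<in> segs"
    | D where "D = V \<or> D = E" "P \<in> arcs_of D" "Q \<in> segs" | D where "D = V \<or> D = E" "Q \<in> arcs_of D" "P \<in> segs"
    | "P \<in> arcs_of V" "Q \<in> arcs_of E" | "Q \<in> arcs_of V" "P \<in> arcs_of E"
    using assms(1,2) unfolding all_arcs_def by blast
  then show ?thesis
  proof cases
    case 1 then show ?thesis using arcs_of_eq[of V P Q x] assms by simp
  next
    case 2 then show ?thesis using arcs_of_eq[of E P Q x] assms by simp
  next
    case 3 then show ?thesis using seg_eq[of P Q x] assms by simp
  next
    case (4 D) then show ?thesis using gap_meets_seg[of D P x Q] assms by simp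
  next
    case (5 D) then show ?thesis using gap_meets_seg[of D Q x P] assms by simp
  next
    case 6 then show ?thesis using VE assms by blast
  next
    case 7 then show ?thesis using VE assms by blast
  qed
qed

text \<open>Isolated vertices carry no flags; their boundaries contribute whole components.\<close>

definition circles :: "'a set set" where "circles = surface_boundary ` {v \<in> V. segs_of v = {}}"

lemma finite_all: "finite (all_arcs \<union> circles)"
  unfolding all_arcs_def circles_def using finite_arcs_of finite_segs finV by auto

lemma isolated_disjoint:
  assumes v: "v \<in> V" "segs_of v = {}" and d: "d \<in> V \<union> E" "d \<noteq> v" shows "d \<inter> v = {}"
  using discs_meet(1)[of v d] v d by auto

lemma arc_in_disc:
  assumes "P \<in> all_arcs"
  obtains d where "d \<in> V \<union> E" "segs_of d \<noteq> {}" "P \<subseteq> surface_boundary d"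
proof -
  consider D where "D = V \<or> D = E" "P \<in> arcs_of D" | "P \<in> segs" using assms unfolding all_arcs_def by blast
  then show ?thesis
  proof cases
    case (1 D)
    obtain d where "d \<in> V \<union> E" "segs_of d \<noteq> {}" "P \<subseteq> surface_boundary d" using arcs_of_gap[OF 1] by metis
    then show ?thesis using that by blast
  next
    case 2
    then obtain v where v: "v \<in> V" "P \<subseteq> v" "P \<subseteq> surface_boundary v" by (rule segE)
    then have "P \<in> segs_of v" using 2 by (simp add: segs_of_def)
    then show ?thesis using that[of v] v by blast
  qed
qed

lemma circle_meets_nothing:
  assumes C: "C \<in> circles" and P: "P \<in> all_arcs \<union> circles" "P \<noteq> C" shows "P \<inter> C = {}"
proof -
  obtain v where v: "v \<in> V" "segs_of v = {}" "C = surface_boundary v" using C unfolding circles_def by blast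
  obtain d where d: "d \<in> V \<union> E" "P \<subseteq> surface_boundary d" "d \<noteq> v"
  proof (cases "P \<in> all_arcs")
    case True
    obtain d where d: "d \<in> V \<union> E" "segs_of d \<noteq> {}" "P \<subseteq> surface_boundary d" using arc_in_disc[OF True] .
    then have "d \<noteq> v" using v(2) by blast
    then show ?thesis using that d by blast
  next
    case False
    then obtain w where "w \<in> V" "P = surface_boundary w" using P(1) unfolding circles_def by blast
    then show ?thesis using that[of w] P(2) v(3) by blast
  qed
  have "d \<inter> v = {}" by (rule isolated_disjoint[OF v(1,2) d(1,3)])
  then show ?thesis using d(2) v(3) surface_boundary_subset by blast
qed

lemma piece_closed_connected: "P \<in> all_arcs \<union> circles \<Longrightarrow> closed P \<and> connected P"
  using all_arcs_arc arc_closed arc_connected circle circle_closed circle_connected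
  unfolding circles_def by blast

text \<open>Distinct arcs meet in common ends only, and the circles meet no other piece.\<close>

lemma pieces_connect:
  assumes P: "\<P> \<subseteq> all_arcs \<union> circles" and x: "x \<in> X" "x \<in> \<Union>\<P>" and y: "y \<in> X"
  shows "connected_component (\<Union>\<P>) x y \<longleftrightarrow> (x, y) \<in> {(u, w). \<exists>P\<in>\<P> \<inter> all_arcs. arc_ends P = {u, w}}\<^sup>*"
proof -
  let ?R = "{(u, w). u \<in> X \<and> w \<in> X \<and> (\<exists>P\<in>\<P>. u \<in> P \<and> w \<in> P)}"
  let ?T = "{(u, w). \<exists>P\<in>\<P> \<inter> all_arcs. arc_ends P = {u, w}}"
  have noX: "C \<inter> X = {}" if C: "C \<in> circles" for C
  proof (rule ccontr)
    assume "C \<inter> X \<noteq> {}"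
    then obtain z where z: "z \<in> C" "z \<in> X" by blast
    then obtain s where s: "s \<in> segs" "z \<in> s" by (meson X_segE)
    then have "s \<in> all_arcs" by (simp add: all_arcs_def)
    moreover have "s \<noteq> C"
    proof
      assume "s = C"
      obtain v where v: "v \<in> V" "segs_of v = {}" "C = surface_boundary v" using C unfolding circles_def by blast
      then have "s \<in> segs_of v" using s \<open>s = C\<close> surface_boundary_subset by (auto simp: segs_of_def)
      then show False using v by blast
    qed
    ultimately show False using circle_meets_nothing[OF C, of s] s z by blast
  qed
  have 1: "connected_component (\<Union>\<P>) x y \<longleftrightarrow> (x, y) \<in> ?R\<^sup>*"
  proof (rule connected_component_Union_iff[OF _ _ _ x y])
    show "finite \<P>" using P finite_all finite_subset by blast
    show "closed Q \<and> connected Q" if "Q \<in> \<P>" for Q using piece_closed_connected that P by blast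
    show "Q \<inter> Q' \<inter> X \<noteq> {}" if Q: "Q \<in> \<P>" "Q' \<in> \<P>" "Q \<inter> Q' \<noteq> {}" "Q \<noteq> Q'" for Q Q'
    proof -
      have "Q \<notin> circles" "Q' \<notin> circles"
        using circle_meets_nothing[of Q Q'] circle_meets_nothing[of Q' Q] Q P by blast+
      then have "Q \<in> all_arcs" "Q' \<in> all_arcs" using Q P by blast+
      then show ?thesis using all_arcs_meet[of Q Q'] Q by blast
    qed
  qed
  have sub: "?R \<subseteq> ?T\<^sup>="
  proof
    fix p assume "p \<in> ?R"
    then obtain u w Q where p: "p = (u, w)" "u \<in> X" "w \<in> X" "Q \<in> \<P>" "u \<in> Q" "w \<in> Q" by blast
    then have Q: "Q \<in> all_arcs" using noX P by blast
    then have "u \<in> arc_ends Q" "w \<in> arc_ends Q" using all_arcs_X p by blast+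
    moreover obtain a b where "arc_ends Q = {a, b}" using arc_ends_card[OF all_arcs_arc[OF Q]] card_2_iff by metis
    ultimately have "u = w \<or> arc_ends Q = {u, w}" by auto
    then show "p \<in> ?T\<^sup>=" using p Q by auto
  qed
  have sub2: "?T \<subseteq> ?R"
  proof
    fix p assume "p \<in> ?T"
    then obtain u w Q where p: "p = (u, w)" "Q \<in> \<P>" "Q \<in> all_arcs" "arc_ends Q = {u, w}" by blast
    then have "u \<in> Q" "w \<in> Q" using arc_ends_subset[of Q] by auto
    then have "u \<in> X" "w \<in> X" using all_arcs_X[OF p(3)] p(4) by auto
    then show "p \<in> ?R" using p \<open>u \<in> Q\<close> \<open>w \<in> Q\<close> by blast
  qed
  have "?R\<^sup>* = ?T\<^sup>*" using rtrancl_mono[OF sub] rtrancl_mono[OF sub2] unfolding rtrancl_reflcl by (rule subset_antisym)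
  then show ?thesis using 1 by simp
qed

end

section \<open>Feasible sets and loops in terms of flags\<close>

text \<open>Every component of \<open>S\<close> contains a component of \<open>B\<close>, so inclusion is a map of the finitely many components
  of \<open>B\<close> onto those of \<open>S\<close>. The numbers agree exactly if this map is injective.\<close>

lemma card_components_eq_iff:
  fixes B S :: "'a::topological_space set"
  assumes sub: "B \<subseteq> S" and fin: "finite (components B)"
    and meet: "\<And>C. C \<in> components S \<Longrightarrow> C \<inter> B \<noteq> {}"
  shows "card (components B) = card (components S) \<longleftrightarrow>
    (\<forall>x\<in>B. \<forall>y\<in>B. connected_component S x y \<longrightarrow> connected_component B x y)"
proof -
  define \<Phi> where "\<Phi> C = \<Union>(connected_component_set S ` C)" for C
  have mono: "connected_component S x y" if "connected_component B x y" for x y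
    using that sub by (rule connected_component_of_subset)
  have Phi: "\<Phi> (connected_component_set B x) = connected_component_set S x" if x: "x \<in> B" for x
  proof
    show "\<Phi> (connected_component_set B x) \<subseteq> connected_component_set S x"
      unfolding \<Phi>_def using mono connected_component_trans by blast
    have "x \<in> connected_component_set B x" using x by (simp add: connected_component_refl)
    then show "connected_component_set S x \<subseteq> \<Phi> (connected_component_set B x)" unfolding \<Phi>_def by blast
  qed
  have surj: "\<Phi> ` components B = components S"
  proof
    show "\<Phi> ` components B \<subseteq> components S"
    proof
      fix D assume "D \<in> \<Phi> ` components B"
      then obtain x where "x \<in> B" "D = connected_component_set S x" using Phi unfolding components_def by auto
      then show "D \<in> components S" using sub unfolding components_def by blast
    qed
    show "components S \<subseteq> \<Phi> ` components B"
    proof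
      fix D assume D: "D \<in> components S"
      then obtain x where x: "x \<in> D" "x \<in> B" using meet by blast
      obtain z where z: "D = connected_component_set S z" using D unfolding components_def by blast
      have "D = connected_component_set S x" using connected_component_eq[of x S z] x(1) unfolding z by simp
      then have "D = \<Phi> (connected_component_set B x)" using Phi x by simp
      then show "D \<in> \<Phi> ` components B" using x unfolding components_def by blast
    qed
  qed
  have eq: "connected_component_set B x = connected_component_set B y \<longleftrightarrow> connected_component B x y"
    if "x \<in> B" "y \<in> B" for x y using connected_component_eq_eq[of B x y] that by simp
  have eqS: "connected_component_set S x = connected_component_set S y \<longleftrightarrow> connected_component S x y"
    if "x \<in> B" "y \<in> B" for x y using connected_component_eq_eq[of S x y] that sub by auto
  have "card (components B) = card (components S) \<longleftrightarrow> inj_on \<Phi> (components B)"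
    using fin surj card_image[of \<Phi> "components B"] eq_card_imp_inj_on[OF fin, of \<Phi>] by auto
  also have "\<dots> \<longleftrightarrow> (\<forall>x\<in>B. \<forall>y\<in>B. connected_component S x y \<longrightarrow> connected_component B x y)"
    unfolding inj_on_def components_def ball_simps
    using Phi eq eqS by simp
  finally show ?thesis .
qed

context ribbon_surface
begin

lemma pair_ends:
  assumes "P \<in> all_arcs" "arc_ends P = {u, w}"
  shows "u \<in> X" "u \<noteq> w" "P \<in> arcs_of V \<Longrightarrow> w = \<alpha> u" "P \<in> segs \<Longrightarrow> w = \<tau> u" "P \<in> arcs_of E \<Longrightarrow> w = \<sigma> u"
proof -
  have u: "u \<in> arc_ends P" using assms(2) by simp
  then have "u \<in> P" using arc_ends_subset by blast
  then show X: "u \<in> X" using all_arcs_X[OF assms(1)] u by blast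
  show "u \<noteq> w" using arc_ends_card[OF all_arcs_arc[OF assms(1)]] assms(2) by auto
  then show "P \<in> arcs_of V \<Longrightarrow> w = \<alpha> u" "P \<in> segs \<Longrightarrow> w = \<tau> u" "P \<in> arcs_of E \<Longrightarrow> w = \<sigma> u"
    using alpha_ends[of P u] tau_ends[of P u] sigma_ends[of P u] u assms(2) by (auto simp: doubleton_eq_iff)
qed

lemma pieces_step:
  assumes P: "\<P> \<subseteq> all_arcs \<union> circles"
    and seg: "\<And>s u. s \<in> \<P> \<Longrightarrow> s \<in> segs \<Longrightarrow> u \<in> arc_ends s \<Longrightarrow> Seg \<in> st (ed u)"
    and side: "\<And>s u. s \<in> \<P> \<Longrightarrow> s \<in> arcs_of E \<Longrightarrow> u \<in> arc_ends s \<Longrightarrow> Side \<in> st (ed u)"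
  shows "{(u, w). \<exists>P\<in>\<P> \<inter> all_arcs. arc_ends P = {u, w}} \<subseteq> flags.step st"
proof
  fix p assume "p \<in> {(u, w). \<exists>P\<in>\<P> \<inter> all_arcs. arc_ends P = {u, w}}"
  then obtain u w P where p: "p = (u, w)" "P \<in> \<P>" "P \<in> all_arcs" "arc_ends P = {u, w}" by blast
  note pe = pair_ends[OF p(3,4)]
  have u: "u \<in> arc_ends P" using p(4) by simp
  consider "P \<in> arcs_of V" | "P \<in> segs" | "P \<in> arcs_of E" using p(3) unfolding all_arcs_def by blast
  then show "p \<in> flags.step st"
  proof cases
    case 1 then show ?thesis using p(1) pe(1,3) by (auto simp: flags.step_def)
  next
    case 2
    then have "w = flags.act Seg u" "Seg \<in> st (ed u)" using pe(4) seg[OF p(2) _ u] by auto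
    then show ?thesis using p(1) pe(1) unfolding flags.step_def by blast
  next
    case 3
    then have "w = flags.act Side u" "Side \<in> st (ed u)" using pe(5) side[OF p(2) _ u] by auto
    then show ?thesis using p(1) pe(1) unfolding flags.step_def by blast
  qed
qed

lemma X_boundary: "x \<in> X \<Longrightarrow> d \<in> V \<union> E \<Longrightarrow> x \<in> d \<Longrightarrow> x \<in> surface_boundary d \<and> segs_of d \<noteq> {}"
proof -
  assume x: "x \<in> X" "d \<in> V \<union> E" "x \<in> d"
  obtain s where s: "s \<in> segs" "x \<in> s" using x(1) by (meson X_segE)
  show ?thesis using seg_subset_disc[OF s(1) x(2) s(2) x(3)] s by (auto simp: segs_of_def)
qed

lemma gaps_of_V: "v \<in> V \<Longrightarrow> segs_of v \<noteq> {} \<Longrightarrow> gaps_of v \<subseteq> arcs_of V"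
  and gaps_of_E: "e \<in> E \<Longrightarrow> gaps_of e \<subseteq> arcs_of E"
  using segs_of_edge_nonempty unfolding arcs_of_def by blast+

lemma seg_not_gap: "P \<in> segs \<Longrightarrow> P \<in> arcs_of D \<Longrightarrow> D = V \<or> D = E \<Longrightarrow> False"
proof -
  assume PD: "P \<in> segs" "P \<in> arcs_of D" "D = V \<or> D = E"
  obtain z where z: "z \<in> P" "z \<notin> arc_ends P" using arc_relint_connected(2)[OF seg_arc[OF PD(1)]] by blast
  then show False using gap_meets_seg[OF PD(3,2) z(1) PD(1) z(1)] seg_X[OF PD(1) z(1)] by blast
qed

lemma gap_V_not_E: "P \<in> arcs_of V \<Longrightarrow> P \<in> arcs_of E \<Longrightarrow> False"
proof -
  assume P: "P \<in> arcs_of V" "P \<in> arcs_of E"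
  obtain v where v: "v \<in> V" "P \<subseteq> surface_boundary v" using V_gap[OF P(1)] by blast
  obtain e where e: "e \<in> E" "P \<subseteq> surface_boundary e" using E_gap[OF P(2)] by blast
  obtain z where z: "z \<in> P" "z \<notin> arc_ends P" using arc_relint_connected(2)[OF arcs_of_arc[OF _ P(1)]] by blast
  have "z \<in> v \<inter> e" using z v e surface_boundary_subset by blast
  then obtain t where "t \<in> segs" "z \<in> t" using inter_segs[OF v(1) e(1)] by blast
  then have "z \<in> X" using gap_meets_seg[OF _ P(1) z(1)] by blast
  then show False using arcs_of_X[OF _ P(1) z(1)] z(2) by blast
qed

text \<open>The boundary of a vertex is connected and made of gaps and line segments, along which \<open>\<alpha>\<close> and
  \<open>\<tau>\<close> move.\<close>

lemma vertex_joined: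
  assumes x: "x \<in> X" "y \<in> X" "vx x = vx y"
  shows "(x, y) \<in> flags.joined flags.seg_state"
proof -
  define v where "v = vx x"
  have v: "v \<in> V" "x \<in> v" "y \<in> v" using X_vx[OF x(1)] X_vx[OF x(2)] x(3) by (auto simp: v_def)
  then have vE: "v \<in> V \<union> E" by simp
  have xv: "x \<in> surface_boundary v" "y \<in> surface_boundary v" "segs_of v \<noteq> {}"
    using X_boundary[OF x(1) vE v(2)] X_boundary[OF x(2) vE v(3)] by auto
  let ?P = "gaps_of v \<union> segs_of v"
  have bd: "\<Union>?P = surface_boundary v" using boundary_gaps_segs[OF vE xv(3)] by (simp add: Union_Un_distrib)
  have sub: "?P \<subseteq> all_arcs \<union> circles"
    using gaps_of_V[OF v(1) xv(3)] unfolding all_arcs_def segs_of_def by blast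
  have "connected_component (\<Union>?P) x y"
    unfolding bd using xv circle_connected[OF circle[OF vE]] by (intro connected_componentI) auto
  then have "(x, y) \<in> {(u, w). \<exists>P\<in>?P \<inter> all_arcs. arc_ends P = {u, w}}\<^sup>*"
    using pieces_connect[OF sub x(1) _ x(2)] xv(1) unfolding bd by blast
  moreover have "{(u, w). \<exists>P\<in>?P \<inter> all_arcs. arc_ends P = {u, w}} \<subseteq> flags.step flags.seg_state"
  proof (rule pieces_step[OF sub])
    fix s u assume s: "s \<in> ?P" "s \<in> arcs_of E" "u \<in> arc_ends s"
    have "s \<in> arcs_of V \<or> s \<in> segs" using s(1) gaps_of_V[OF v(1) xv(3)] by (auto simp: segs_of_def)
    then show "Side \<in> flags.seg_state (ed u)" using gap_V_not_E[OF _ s(2)] seg_not_gap[OF _ s(2)] by blast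
  qed (simp add: flags.seg_state_def)
  ultimately show ?thesis using rtrancl_mono by blast
qed

lemma joined_vx:
  assumes "(x, y) \<in> flags.joined flags.seg_state" "x \<in> X" shows "vx x = vx y"
  using assms(1)
proof induction
  case (step y z)
  have y: "y \<in> X" using flags.step_X[OF step(2)] by blast
  moreover have "z = \<alpha> y \<or> z = \<tau> y" using step(2) by (auto simp: flags.step_def flags.seg_state_def)
  ultimately show ?case using step.IH alpha_vx[OF y] tau_ed_vx(2)[OF y] by auto
qed simp

lemma loop_iff_vx:
  "flags.all_joined flags.seg_state e \<longleftrightarrow> (\<forall>x\<in>X. \<forall>y\<in>X. ed x = e \<longrightarrow> ed y = e \<longrightarrow> vx x = vx y)"
proof -
  have "(x, y) \<in> flags.joined flags.seg_state \<longleftrightarrow> vx x = vx y" if "x \<in> X" "y \<in> X" for x y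
    using vertex_joined[OF that] joined_vx[OF _ that(1)] by metis
  then show ?thesis unfolding flags.all_joined_def by simp
qed

lemma ends_flags:
  assumes e: "e \<in> E" shows "{v \<in> V. v \<inter> e \<noteq> {}} = vx ` {x \<in> X. ed x = e}"
proof
  show "{v \<in> V. v \<inter> e \<noteq> {}} \<subseteq> vx ` {x \<in> X. ed x = e}"
  proof
    fix v assume "v \<in> {v \<in> V. v \<inter> e \<noteq> {}}"
    then have v: "v \<in> V" "v \<inter> e \<noteq> {}" by auto
    then obtain s where s: "s \<in> segs" "s \<subseteq> v" "s \<subseteq> e" using inter_segs[OF v(1) e] by blast
    obtain x where x: "x \<in> arc_ends s" using arc_ends_card[OF seg_arc[OF s(1)]] by fastforce
    then have "x \<in> v" "x \<in> e" using s arc_ends_subset by blast+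
    then show "v \<in> vx ` {x \<in> X. ed x = e}"
      using X_seg[OF s(1) x] vx_eq[OF v(1)] ed_eq[OF e] by (intro image_eqI[of _ _ x]) auto
  qed
  show "vx ` {x \<in> X. ed x = e} \<subseteq> {v \<in> V. v \<inter> e \<noteq> {}}"
  proof
    fix v assume "v \<in> vx ` {x \<in> X. ed x = e}"
    then obtain x where x: "x \<in> X" "ed x = e" "v = vx x" by blast
    have "v \<in> V" "x \<in> v" "x \<in> e" using X_vx[OF x(1)] X_ed[OF x(1)] x(2,3) by simp_all
    then show "v \<in> {v \<in> V. v \<inter> e \<noteq> {}}" by blast
  qed
qed

lemma loop_iff_card_ends:
  assumes e: "e \<in> E"
  shows "card {v \<in> V. v \<inter> e \<noteq> {}} = 1 \<longleftrightarrow> flags.all_joined flags.seg_state e"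
proof -
  have "e \<in> ed ` X" using e ed_X by simp
  then obtain x where x: "x \<in> X" "ed x = e" by blast
  have "card (vx ` {x \<in> X. ed x = e}) = 1 \<longleftrightarrow> (\<forall>y\<in>{x \<in> X. ed x = e}. vx y = vx x)"
  proof
    assume "card (vx ` {x \<in> X. ed x = e}) = 1"
    then obtain v where v: "vx ` {x \<in> X. ed x = e} = {v}" by (rule card_1_singletonE)
    have vv: "vx y = v" if "y \<in> {x \<in> X. ed x = e}" for y using imageI[OF that, of vx] unfolding v by simp
    show "\<forall>y\<in>{x \<in> X. ed x = e}. vx y = vx x" using vv x by simp
  next
    assume "\<forall>y\<in>{x \<in> X. ed x = e}. vx y = vx x"
    then have "vx ` {x \<in> X. ed x = e} = (\<lambda>_. vx x) ` {x \<in> X. ed x = e}" by (intro image_cong) simp_all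
    moreover have "{x \<in> X. ed x = e} \<noteq> {}" using x by blast
    ultimately have "vx ` {x \<in> X. ed x = e} = {vx x}" by (simp add: image_constant_conv)
    then show "card (vx ` {x \<in> X. ed x = e}) = 1" by simp
  qed
  moreover have "(\<forall>y\<in>{x \<in> X. ed x = e}. vx y = vx x) \<longleftrightarrow>
      (\<forall>x\<in>X. \<forall>y\<in>X. ed x = e \<longrightarrow> ed y = e \<longrightarrow> vx x = vx y)"
    using x by (simp; metis)
  ultimately show ?thesis unfolding ends_flags[OF e] loop_iff_vx by blast
qed

lemma S_connected_iff:
  assumes x: "x \<in> X" "y \<in> X"
  shows "connected_component S x y \<longleftrightarrow> (x, y) \<in> flags.joined flags.graph_state"
proof -
  let ?R = "{(u, w). u \<in> X \<and> w \<in> X \<and> (\<exists>P\<in>V \<union> E. u \<in> P \<and> w \<in> P)}"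
  have "connected_component (\<Union>(V \<union> E)) x y \<longleftrightarrow> (x, y) \<in> ?R\<^sup>*"
  proof (rule connected_component_Union_iff)
    show "finite (V \<union> E)" using finV finE by simp
    show "closed P \<and> connected P" if "P \<in> V \<union> E" for P using closed_disc[OF that] disc_connected[OF disc[OF that]] by simp
    show "x \<in> X" "y \<in> X" using x by auto
    show "x \<in> \<Union>(V \<union> E)" using X_vx[OF x(1)] by blast
    show "P \<inter> Q \<inter> X \<noteq> {}" if PQ: "P \<in> V \<union> E" "Q \<in> V \<union> E" "P \<inter> Q \<noteq> {}" "P \<noteq> Q" for P Q
    proof -
      obtain z where z: "z \<in> P" "z \<in> Q" using PQ(3) by blast
      obtain s where s: "s \<in> segs" "z \<in> s" "s \<subseteq> P" using discs_meet(1)[OF PQ(1,2,4) z] by (auto simp: segs_of_def)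
      have "s \<subseteq> Q" using seg_subset_disc(1)[OF s(1) PQ(2) s(2) z(2)] .
      moreover obtain u where "u \<in> arc_ends s" using arc_ends_card[OF seg_arc[OF s(1)]] by fastforce
      ultimately show ?thesis using X_seg[OF s(1)] s(3) arc_ends_subset by blast
    qed
  qed
  moreover have "?R\<^sup>* = flags.joined flags.graph_state"
  proof
    have "?R \<subseteq> flags.joined flags.graph_state"
    proof
      fix p assume "p \<in> ?R"
      then obtain u w P where p: "p = (u, w)" "u \<in> X" "w \<in> X" "P \<in> V \<union> E" "u \<in> P" "w \<in> P" by blast
      show "p \<in> flags.joined flags.graph_state"
      proof (cases "P \<in> V")
        case True
        then have "vx u = vx w" using vx_eq p by simp
        then show ?thesis using vertex_joined[OF p(2,3)] flags.joined_le_graph p(1) by blast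
      next
        case False
        then have "ed u = ed w" using ed_eq p by simp
        then show ?thesis using flags.all_joined_graph[of "ed u"] p unfolding flags.all_joined_def by simp
      qed
    qed
    then show "?R\<^sup>* \<subseteq> flags.joined flags.graph_state" by (rule rtrancl_subset_rtrancl)
    have "flags.step flags.graph_state \<subseteq> ?R"
    proof
      fix p assume "p \<in> flags.step flags.graph_state"
      then consider u where "p = (u, \<alpha> u)" "u \<in> X" | u m where "p = (u, flags.act m u)" "u \<in> X"
        unfolding flags.step_def by blast
      then show "p \<in> ?R"
      proof cases
        case (1 u)
        then have "u \<in> vx u \<and> \<alpha> u \<in> vx u \<and> vx u \<in> V" using X_vx[of u] X_vx[of "\<alpha> u"] alpha_X[of u] alpha_vx[of u] by auto
        then show ?thesis using 1 alpha_X[of u] by blast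
      next
        case (2 u m)
        have "flags.act m u \<in> X" "ed (flags.act m u) = ed u" using flags.act_props[OF 2(2), of m] by auto
        then have "u \<in> ed u \<and> flags.act m u \<in> ed u \<and> ed u \<in> E" using X_ed[of u] X_ed[of "flags.act m u"] 2(2) by auto
        then show ?thesis using 2 \<open>flags.act m u \<in> X\<close> by blast
      qed
    qed
    then show "flags.joined flags.graph_state \<subseteq> ?R\<^sup>*" by (rule rtrancl_mono)
  qed
  ultimately show ?thesis unfolding S_def by simp
qed

text \<open>The boundary of \<open>(V, A)\<close>, cut at the flags of all edges: line segments of edges outside \<open>A\<close> are
  boundary arcs of their vertices.\<close>

definition bd_pieces :: "'a set set \<Rightarrow> 'a set set" where
  "bd_pieces A = arcs_of V \<union> circles \<union> {s \<in> segs. \<exists>e\<in>E - A. s \<subseteq> e} \<union> (\<Union>e\<in>A. gaps_of e)"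

lemma seg_edge:
  assumes "s \<in> segs" "e \<in> E" "e' \<in> E" "s \<subseteq> e" "s \<subseteq> e'" shows "e = e'"
  using E_eq[OF assms(2,3)] seg_nonempty[OF assms(1)] assms(4,5) by blast

lemma bd_pieces_boundary:
  assumes A: "A \<subseteq> E"
  shows "surface_boundary (\<Union>(V \<union> A)) = \<Union>(bd_pieces A)"
proof -
  have B: "ribbon_surface V A" by (rule sub_ribbon_surface[OF ribbon_surface_axioms order_refl A])
  have Bs: "ribbon_surface.segs V A = {s \<in> segs. \<exists>e\<in>A. s \<subseteq> e}"
  proof
    show "ribbon_surface.segs V A \<subseteq> {s \<in> segs. \<exists>e\<in>A. s \<subseteq> e}"
    proof
      fix s assume "s \<in> ribbon_surface.segs V A"
      then obtain v e where ve: "v \<in> V" "e \<in> A" "s \<in> components (v \<inter> e)"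
        unfolding ribbon_surface.segs_def[OF B] by (elim UN_E)
      then have "s \<in> segs" "s \<subseteq> e" using A in_components_subset[OF ve(3)] unfolding segs_def by blast+
      then show "s \<in> {s \<in> segs. \<exists>e\<in>A. s \<subseteq> e}" using ve(2) by blast
    qed
    show "{s \<in> segs. \<exists>e\<in>A. s \<subseteq> e} \<subseteq> ribbon_surface.segs V A"
    proof
      fix s assume "s \<in> {s \<in> segs. \<exists>e\<in>A. s \<subseteq> e}"
      then obtain e where e: "s \<in> segs" "e \<in> A" "s \<subseteq> e" by blast
      obtain v e' where ve: "v \<in> V" "e' \<in> E" "s \<in> components (v \<inter> e')" "s \<subseteq> e'" using e(1) by (rule segE)
      have "e \<in> E" using e(2) A by blast
      then have "e' = e" by (rule seg_edge[OF e(1) ve(2) _ ve(4) e(3)])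
      then show "s \<in> ribbon_surface.segs V A" unfolding ribbon_surface.segs_def[OF B] using ve e by blast
    qed
  qed
  have bd: "surface_boundary (\<Union>(V \<union> A)) = (\<Union>d\<in>V \<union> A. surface_boundary d) - \<Union>(relint ` {s \<in> segs. \<exists>e\<in>A. s \<subseteq> e})"
    using ribbon_surface.boundary_surface[OF B] unfolding ribbon_surface.S_def[OF B] Bs .
  show ?thesis unfolding bd
  proof
    show "(\<Union>d\<in>V \<union> A. surface_boundary d) - \<Union>(relint ` {s \<in> segs. \<exists>e\<in>A. s \<subseteq> e}) \<subseteq> \<Union>(bd_pieces A)"
    proof
      fix x assume x: "x \<in> (\<Union>d\<in>V \<union> A. surface_boundary d) - \<Union>(relint ` {s \<in> segs. \<exists>e\<in>A. s \<subseteq> e})"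
      have rel: "x \<notin> relint s" if "s \<in> segs" "e \<in> A" "s \<subseteq> e" for s e
      proof
        assume "x \<in> relint s"
        moreover have "s \<in> {s \<in> segs. \<exists>e\<in>A. s \<subseteq> e}" using that by blast
        ultimately have "x \<in> \<Union>(relint ` {s \<in> segs. \<exists>e\<in>A. s \<subseteq> e})" by (rule UN_I[rotated])
        then show False using DiffD2[OF x] by simp
      qed
      obtain d where d: "d \<in> V \<union> A" "x \<in> surface_boundary d" using DiffD1[OF x] by (elim UN_E)
      then have dE: "d \<in> V \<union> E" using A by blast
      show "x \<in> \<Union>(bd_pieces A)"
      proof (cases "segs_of d = {}")
        case True
        then have "d \<in> V" using segs_of_edge_nonempty d(1) A by blast
        then show ?thesis using True d(2) unfolding bd_pieces_def circles_def by blast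
      next
        case False
        show ?thesis
        proof (cases "x \<in> \<Union>(gaps_of d)")
          case True
          then obtain g where g: "g \<in> gaps_of d" "x \<in> g" by blast
          have "g \<in> bd_pieces A" using d(1) g(1) gaps_of_V[OF _ False] unfolding bd_pieces_def by blast
          then show ?thesis using g(2) by blast
        next
          case F: False
          then obtain s where s: "s \<in> segs_of d" "x \<in> relint s" using gaps_of(5)[OF dE False] d(2) by blast
          then have s': "s \<in> segs" "x \<in> s" by (auto simp: segs_of_def relint_def)
          obtain e where e: "e \<in> E" "s \<subseteq> e" using s'(1) by (meson segE)
          then have "e \<in> E - A" using rel[OF s'(1) _ e(2)] s(2) by blast
          then show ?thesis using s' e(2) unfolding bd_pieces_def by blast
        qed
      qed
    qed
    show "\<Union>(bd_pieces A) \<subseteq> (\<Union>d\<in>V \<union> A. surface_boundary d) - \<Union>(relint ` {s \<in> segs. \<exists>e\<in>A. s \<subseteq> e})"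
    proof
      fix x assume "x \<in> \<Union>(bd_pieces A)"
      then obtain P where P: "P \<in> bd_pieces A" "x \<in> P" by blast
      have gap: "x \<in> (\<Union>d\<in>V \<union> A. surface_boundary d) \<and> (\<forall>s\<in>segs. x \<notin> relint s)"
        if d: "d \<in> V \<union> A" "segs_of d \<noteq> {}" "P \<in> gaps_of d" for d
      proof -
        have dE: "d \<in> V \<union> E" using d(1) A by blast
        have "x \<in> surface_boundary d" using gaps_of(5)[OF dE d(2)] d(3) P(2) by blast
        moreover have "x \<notin> relint s" if "s \<in> segs" for s
          using gap_seg_meet(2)[OF dE d(2,3) P(2) that] unfolding relint_def by blast
        ultimately show ?thesis using d(1) by blast
      qed
      consider "P \<in> arcs_of V" | "P \<in> circles" | "P \<in> segs" "\<exists>e\<in>E - A. P \<subseteq> e" | e where "e \<in> A" "P \<in> gaps_of e"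
        using P(1) unfolding bd_pieces_def by blast
      then show "x \<in> (\<Union>d\<in>V \<union> A. surface_boundary d) - \<Union>(relint ` {s \<in> segs. \<exists>e\<in>A. s \<subseteq> e})"
      proof cases
        case 1
        obtain d where "d \<in> V" "segs_of d \<noteq> {}" "P \<in> gaps_of d" using V_gap[OF 1] by blast
        then show ?thesis using gap[of d] by blast
      next
        case 2
        obtain v where v: "v \<in> V" "segs_of v = {}" "P = surface_boundary v" using 2 unfolding circles_def by blast
        have "x \<notin> relint s" if s: "s \<in> segs" for s
        proof
          assume "x \<in> relint s"
          then have "x \<in> s" "x \<in> v" using P(2) v(3) surface_boundary_subset by (auto simp: relint_def)
          then have "s \<in> segs_of v" using seg_subset_disc(1)[OF s, of v x] v(1) s by (auto simp: segs_of_def)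
          then show False using v(2) by blast
        qed
        then show ?thesis using v P(2) by blast
      next
        case 3
        then obtain e where e: "e \<in> E" "e \<notin> A" "P \<subseteq> e" by blast
        obtain v where v: "v \<in> V" "P \<subseteq> surface_boundary v" using 3(1) by (meson segE)
        have "x \<notin> relint s" if s: "s \<in> segs" "e' \<in> A" "s \<subseteq> e'" for s e'
        proof
          assume "x \<in> relint s"
          then have "s = P" using seg_eq[OF s(1) 3(1) _ P(2)] by (simp add: relint_def)
          then show False using seg_edge[OF 3(1) e(1), of e'] s e A by blast
        qed
        then show ?thesis using v P(2) by blast
      next
        case (4 e)
        then show ?thesis using gap[of e] segs_of_edge_nonempty[of e] A by blast
      qed
    qed
  qed
qed

lemma bd_pieces_sub: "A \<subseteq> E \<Longrightarrow> bd_pieces A \<subseteq> all_arcs \<union> circles"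
  using gaps_of_E unfolding bd_pieces_def all_arcs_def by blast

lemma flag_in_bd: "x \<in> X \<Longrightarrow> x \<in> \<Union>(bd_pieces A)"
proof -
  assume "x \<in> X"
  then obtain g where "g \<in> arcs_of V" "x \<in> arc_ends g" using arcs_of_ends[of V] by blast
  then show ?thesis using arc_ends_subset unfolding bd_pieces_def by blast
qed

lemma boundary_connected_iff:
  assumes A: "A \<subseteq> E" and x: "x \<in> X" "y \<in> X"
  shows "connected_component (\<Union>(bd_pieces A)) x y \<longleftrightarrow>
    (x, y) \<in> flags.joined (flags.take_sides flags.seg_state A)"
proof -
  let ?T = "{(u, w). \<exists>P\<in>bd_pieces A \<inter> all_arcs. arc_ends P = {u, w}}"
  let ?st = "flags.take_sides flags.seg_state A"
  have seg_state: "Seg \<in> ?st g \<longleftrightarrow> g \<notin> A" "Side \<in> ?st g \<longleftrightarrow> g \<in> A" "Diag \<notin> ?st g" for g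
    by (auto simp: flags.take_sides_def flags.seg_state_def)
  have not_circle: False if P: "P \<in> all_arcs" "P \<in> circles" for P
  proof -
    obtain v where v: "v \<in> V" "segs_of v = {}" "P = surface_boundary v" using P(2) unfolding circles_def by blast
    obtain u where u: "u \<in> arc_ends P" using arc_ends_card[OF all_arcs_arc[OF P(1)]] by fastforce
    then have "u \<in> P" using arc_ends_subset by blast
    then have "u \<in> X" "u \<in> v" using all_arcs_X[OF P(1)] u v(3) surface_boundary_subset by blast+
    then show False using X_boundary[of u v] v by blast
  qed
  have "?T \<subseteq> flags.step ?st"
  proof (rule pieces_step[OF bd_pieces_sub[OF A]])
    fix s u assume s: "s \<in> bd_pieces A" "s \<in> segs" "u \<in> arc_ends s"
    have "s \<in> all_arcs" using s(2) by (simp add: all_arcs_def)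
    then have "s \<notin> circles" using not_circle by blast
    moreover have "s \<notin> arcs_of V" using seg_not_gap[OF s(2)] by blast
    moreover have "s \<notin> gaps_of e" if "e \<in> A" for e using seg_not_gap[OF s(2), of E] gaps_of_E[of e] that A by blast
    ultimately obtain e where e: "e \<in> E" "e \<notin> A" "s \<subseteq> e" using s(1) unfolding bd_pieces_def by blast
    then have "ed u = e" using ed_eq[OF e(1)] s(3) arc_ends_subset by blast
    then show "Seg \<in> ?st (ed u)" using seg_state e by simp
  next
    fix s u assume s: "s \<in> bd_pieces A" "s \<in> arcs_of E" "u \<in> arc_ends s"
    have "s \<in> all_arcs" using s(2) by (simp add: all_arcs_def)
    then have "s \<notin> circles" using not_circle by blast
    moreover have "s \<notin> arcs_of V" using gap_V_not_E[OF _ s(2)] by blast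
    moreover have "s \<notin> segs" using seg_not_gap[OF _ s(2)] by blast
    ultimately obtain e where e: "e \<in> A" "s \<in> gaps_of e" using s(1) unfolding bd_pieces_def by blast
    have eE: "e \<in> E" using e A by blast
    have "s \<subseteq> surface_boundary e" using gaps_of(5)[of e] segs_of_edge_nonempty[OF eE] eE e(2) by blast
    then have "u \<in> e" using s(3) arc_ends_subset surface_boundary_subset by blast
    then show "Side \<in> ?st (ed u)" using seg_state e ed_eq[OF eE] by simp
  qed
  moreover have "flags.step ?st \<subseteq> ?T"
  proof
    fix p assume "p \<in> flags.step ?st"
    then consider u where "p = (u, \<alpha> u)" "u \<in> X" | u m where "p = (u, flags.act m u)" "u \<in> X" "m \<in> ?st (ed u)"
      unfolding flags.step_def by blast
    then show "p \<in> ?T"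
    proof cases
      case (1 u)
      obtain g where g: "g \<in> arcs_of V" "arc_ends g = {u, \<alpha> u}" using alpha_gap[OF 1(2)] by blast
      then have "g \<in> bd_pieces A \<inter> all_arcs" unfolding bd_pieces_def all_arcs_def by blast
      then show ?thesis using g 1(1) by blast
    next
      case (2 u m)
      have e: "ed u \<in> E" "u \<in> ed u" using X_ed[OF 2(2)] by auto
      show ?thesis
      proof (cases m)
        case Seg
        then have nA: "ed u \<notin> A" using 2(3) seg_state by simp
        obtain s where s: "s \<in> segs" "u \<in> arc_ends s" "u \<in> s" using 2(2) by (rule X_segE)
        have "s \<subseteq> ed u" using seg_subset_disc(1)[OF s(1) _ s(3) e(2)] e(1) by blast
        then have "s \<in> bd_pieces A \<inter> all_arcs" using s(1) e(1) nA unfolding bd_pieces_def all_arcs_def by blast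
        moreover have "arc_ends s = {u, flags.act m u}" using tau_ends[OF s(1,2)] Seg by simp
        ultimately show ?thesis using 2(1) by blast
      next
        case Side
        then have inA: "ed u \<in> A" using 2(3) seg_state by simp
        obtain g where g: "g \<in> gaps_of (ed u)" "g \<in> arcs_of E" "arc_ends g = {u, \<sigma> u}" using sigma_gap[OF 2(2)] .
        then have "g \<in> bd_pieces A \<inter> all_arcs" using inA unfolding bd_pieces_def all_arcs_def by blast
        moreover have "arc_ends g = {u, flags.act m u}" using g(3) Side by simp
        ultimately show ?thesis using 2(1) by blast
      next
        case Diag then show ?thesis using 2(3) seg_state by simp
      qed
    qed
  qed
  ultimately have "?T = flags.step ?st" by (rule subset_antisym)
  then show ?thesis using pieces_connect[OF bd_pieces_sub[OF A] x(1) flag_in_bd[OF x(1)] x(2)] by simp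
qed

text \<open>Flags in the same class of the graph must be in the same boundary class. An isolated vertex is one
  component, and so is its boundary.\<close>

theorem feasible_iff_card_components:
  assumes A: "A \<subseteq> E"
  shows "card (components (surface_boundary (\<Union>(V \<union> A)))) = card (components S) \<longleftrightarrow> flags.feasible A"
proof -
  let ?B = "\<Union>(bd_pieces A)"
  have piece: "closed P \<and> connected P" if "P \<in> bd_pieces A" for P
    using piece_closed_connected bd_pieces_sub[OF A] that by blast
  have finP: "finite (bd_pieces A)" using finite_all bd_pieces_sub[OF A] finite_subset by blast
  have disc_sub: "d \<subseteq> S" if "d \<in> V \<union> E" for d using that unfolding S_def by blast
  have BS: "?B \<subseteq> S"
  proof -
    have "?B \<subseteq> \<Union>(V \<union> A)" unfolding bd_pieces_boundary[OF A, symmetric] by (rule surface_boundary_subset)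
    then show ?thesis using A unfolding S_def by blast
  qed
  have fin: "finite (components ?B)"
  proof -
    have "components ?B \<subseteq> (\<lambda>P. connected_component_set ?B (SOME x. x \<in> P)) ` bd_pieces A"
    proof
      fix C assume C: "C \<in> components ?B"
      then obtain x where x: "x \<in> ?B" "C = connected_component_set ?B x" unfolding components_def by blast
      then obtain P where P: "P \<in> bd_pieces A" "x \<in> P" by blast
      define z where "z = (SOME x. x \<in> P)"
      have "z \<in> P" unfolding z_def using P(2) by (rule someI)
      then have "connected_component ?B x z" using piece[OF P(1)] P by (intro connected_componentI[of P]) auto
      then have "C = connected_component_set ?B z" using x(2) by (simp add: connected_component_eq)
      then show "C \<in> (\<lambda>P. connected_component_set ?B (SOME x. x \<in> P)) ` bd_pieces A" using P(1) z_def by blast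
    qed
    then show ?thesis using finP finite_surj by blast
  qed
  have meet: "C \<inter> ?B \<noteq> {}" if C: "C \<in> components S" for C
  proof -
    obtain z where z: "z \<in> C" "z \<in> S" using in_components_nonempty[OF C] in_components_subset[OF C] by blast
    then obtain d where d: "d \<in> V \<union> E" "z \<in> d" unfolding S_def by blast
    have dC: "d \<subseteq> C" by (rule components_maximal[OF C disc_connected[OF disc[OF d(1)]] disc_sub[OF d(1)]]) (use z d in blast)
    have "d \<inter> ?B \<noteq> {}"
    proof (cases "segs_of d = {}")
      case True
      then have "d \<in> V" using segs_of_edge_nonempty d(1) by blast
      then have "surface_boundary d \<in> bd_pieces A" using True unfolding bd_pieces_def circles_def by blast
      moreover have "surface_boundary d \<noteq> {}" using circle_nonempty[OF circle[OF d(1)]] .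
      ultimately show ?thesis using surface_boundary_subset by blast
    next
      case False
      then obtain s where s: "s \<in> segs" "s \<subseteq> d" unfolding segs_of_def by blast
      obtain u where u: "u \<in> arc_ends s" using arc_ends_card[OF seg_arc[OF s(1)]] by fastforce
      then have "u \<in> d" using s arc_ends_subset by blast
      then show ?thesis using flag_in_bd[OF X_seg[OF s(1) u]] by blast
    qed
    then show ?thesis using dC by blast
  qed
  have card: "card (components ?B) = card (components S) \<longleftrightarrow>
      (\<forall>x\<in>?B. \<forall>y\<in>?B. connected_component S x y \<longrightarrow> connected_component ?B x y)"
    by (rule card_components_eq_iff[OF BS fin meet])
  also have "\<dots> \<longleftrightarrow> flags.feasible A"
  proof
    assume L: "\<forall>x\<in>?B. \<forall>y\<in>?B. connected_component S x y \<longrightarrow> connected_component ?B x y"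
    have "flags.joined flags.graph_state \<subseteq> flags.joined (flags.take_sides flags.seg_state A)"
    proof (rule flags.joined_subset)
      fix x m assume x: "x \<in> X" "m \<in> flags.graph_state (ed x)"
      have ax: "flags.act m x \<in> X" using flags.act_props[OF x(1)] by blast
      have "(x, flags.act m x) \<in> flags.joined flags.graph_state" by (rule flags.joined_act) (use x in simp_all)
      then have "connected_component S x (flags.act m x)" using S_connected_iff[OF x(1) ax] by simp
      then have "connected_component ?B x (flags.act m x)" by (rule L[rule_format, OF flag_in_bd[OF x(1)] flag_in_bd[OF ax]])
      then show "(x, flags.act m x) \<in> flags.joined (flags.take_sides flags.seg_state A)"
        using boundary_connected_iff[OF A x(1) ax] by simp
    qed
    then show "flags.feasible A" using A ed_X by (intro flags.feasibleI) simp
  next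
    assume F: "flags.feasible A"
    have flag: "\<exists>u\<in>X. connected_component ?B x u" if xP: "x \<in> P" "P \<in> bd_pieces A" "P \<notin> circles" for x P
    proof -
      have P: "P \<in> all_arcs" using bd_pieces_sub[OF A] xP by blast
      obtain u where u: "u \<in> arc_ends P" using arc_ends_card[OF all_arcs_arc[OF P]] by fastforce
      have uP: "u \<in> P" using u arc_ends_subset by blast
      have "u \<in> X" using all_arcs_X[OF P uP] u by simp
      moreover have "connected_component ?B x u" using piece[OF xP(2)] xP(1,2) uP by (intro connected_componentI[of P]) auto
      ultimately show ?thesis by blast
    qed
    have isolated: "y \<in> P" if xy: "x \<in> P" "P \<in> circles" "y \<in> ?B" "connected_component S x y" for x y P
    proof -
      obtain v where v: "v \<in> V" "segs_of v = {}" "P = surface_boundary v" using xy(2) unfolding circles_def by blast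
      have vE: "v \<in> V \<union> E" using v by simp
      obtain T where T: "connected T" "T \<subseteq> S" "x \<in> T" "y \<in> T" using xy(4) by (auto simp: connected_component_def)
      have "T \<inter> \<Union>(V \<union> E - {v}) = {}"
      proof (rule ccontr)
        assume ne: "T \<inter> \<Union>(V \<union> E - {v}) \<noteq> {}"
        have "v \<inter> \<Union>(V \<union> E - {v}) = {}" using isolated_disjoint[OF v(1,2)] by blast
        moreover have "T \<subseteq> v \<union> \<Union>(V \<union> E - {v})" using T(2) unfolding S_def by blast
        moreover have "x \<in> v" using xy(1) v(3) surface_boundary_subset by blast
        ultimately show False
          using connected_closedD[OF T(1), of v "\<Union>(V \<union> E - {v})"] closed_disc[OF vE] closed_others[of "V \<union> E - {v}"] T(3) ne
          by blast
      qed
      then have yv: "y \<in> v" using T(2,4) unfolding S_def by blast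
      obtain Q where Q: "Q \<in> bd_pieces A" "y \<in> Q" using xy(3) by blast
      have "Q \<notin> all_arcs"
      proof
        assume "Q \<in> all_arcs"
        then obtain d where d: "d \<in> V \<union> E" "segs_of d \<noteq> {}" "Q \<subseteq> surface_boundary d" by (rule arc_in_disc)
        then have "y \<in> d" using Q(2) surface_boundary_subset by blast
        moreover have "d \<noteq> v" using d(2) v(2) by blast
        ultimately show False using isolated_disjoint[OF v(1,2) d(1)] yv by blast
      qed
      then have "Q \<in> circles" using Q(1) bd_pieces_sub[OF A] by blast
      then obtain w where w: "w \<in> V" "Q = surface_boundary w" unfolding circles_def by blast
      then have "w = v" using V_eq[OF w(1) v(1), of y] yv Q(2) surface_boundary_subset by blast
      then show "y \<in> P" using v w Q by simp
    qed
    show "\<forall>x\<in>?B. \<forall>y\<in>?B. connected_component S x y \<longrightarrow> connected_component ?B x y"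
    proof (intro ballI impI)
      fix x y assume x: "x \<in> ?B" and y: "y \<in> ?B" and xy: "connected_component S x y"
      obtain P where P: "P \<in> bd_pieces A" "x \<in> P" using x by blast
      obtain Q where Q: "Q \<in> bd_pieces A" "y \<in> Q" using y by blast
      have yx: "connected_component S y x" using xy connected_component_sym by blast
      consider "P \<in> circles" | "Q \<in> circles" | "P \<notin> circles" "Q \<notin> circles" by blast
      then show "connected_component ?B x y"
      proof cases
        case 1
        then have "y \<in> P" using isolated[OF P(2) 1 y xy] by blast
        then show ?thesis using piece[OF P(1)] P by (intro connected_componentI[of P]) auto
      next
        case 2
        then have "x \<in> Q" using isolated[OF Q(2) 2 x yx] by blast
        then show ?thesis using piece[OF Q(1)] Q by (intro connected_componentI[of Q]) auto
      next
        case 3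
        obtain u where u: "u \<in> X" "connected_component ?B x u" using flag[OF P(2,1) 3(1)] by blast
        obtain w where w: "w \<in> X" "connected_component ?B y w" using flag[OF Q(2,1) 3(2)] by blast
        have "connected_component S u w"
          using xy connected_component_of_subset[OF u(2) BS] connected_component_of_subset[OF w(2) BS]
            connected_component_trans connected_component_sym by metis
        then have "(u, w) \<in> flags.joined flags.graph_state" using S_connected_iff[OF u(1) w(1)] by simp
        then have "(u, w) \<in> flags.joined (flags.take_sides flags.seg_state A)" using F by (simp add: flags.feasible_def)
        then have "connected_component ?B u w" using boundary_connected_iff[OF A u(1) w(1)] by simp
        then show ?thesis using u w connected_component_trans connected_component_sym by metis
      qed
    qed
  qed
  finally show ?thesis unfolding bd_pieces_boundary[OF A] .
qed

end

section \<open>The Moebius band\<close>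

text \<open>Coordinates in which the band is \<open>[0, 1] \<times> [-1, 1]\<close> with \<open>(0, y)\<close> and \<open>(1, -y)\<close> identified.\<close>

definition moebius_point :: "real \<Rightarrow> real \<Rightarrow> complex \<times> complex" where
  "moebius_point x y = (cis (2 * pi * x), of_real y * cis (pi * x))"

lemma moebius_band_eq: "moebius_band = {moebius_point x y | x y. x \<in> {0..1} \<and> y \<in> {-1..1}}"
proof -
  have "(\<lambda>(x, y). (cis (2 * pi * x), of_real y * cis (pi * x))) = (\<lambda>(x, y). moebius_point x y)"
    by (simp add: moebius_point_def)
  then have "moebius_band = (\<lambda>(x, y). moebius_point x y) ` ({0..1} \<times> {-1..1})" by (simp add: moebius_band_def)
  also have "\<dots> = {moebius_point x y | x y. x \<in> {0..1} \<and> y \<in> {-1..1}}"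
  proof
    show "(\<lambda>(x, y). moebius_point x y) ` ({0..1} \<times> {-1..1}) \<subseteq> {moebius_point x y | x y. x \<in> {0..1} \<and> y \<in> {-1..1}}"
    proof
      fix p assume "p \<in> (\<lambda>(x, y). moebius_point x y) ` ({0..1} \<times> {-1..1})"
      then obtain x y where "x \<in> {0..1}" "y \<in> {-1..1}" "p = moebius_point x y" by (elim imageE SigmaE) simp
      then show "p \<in> {moebius_point x y | x y. x \<in> {0..1} \<and> y \<in> {-1..1}}" by blast
    qed
    show "{moebius_point x y | x y. x \<in> {0..1} \<and> y \<in> {-1..1}} \<subseteq> (\<lambda>(x, y). moebius_point x y) ` ({0..1} \<times> {-1..1})"
    proof
      fix p assume "p \<in> {moebius_point x y | x y. x \<in> {0..1} \<and> y \<in> {-1..1}}"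
      then obtain x y where "x \<in> {0..1}" "y \<in> {-1..1}" "p = moebius_point x y" by blast
      then show "p \<in> (\<lambda>(x, y). moebius_point x y) ` ({0..1} \<times> {-1..1})"
        by (intro image_eqI[of _ _ "(x, y)"]) auto
    qed
  qed
  finally show ?thesis .
qed

lemma moebius_pointI: "x \<in> {0..1} \<Longrightarrow> y \<in> {-1..1} \<Longrightarrow> moebius_point x y \<in> moebius_band"
  unfolding moebius_band_eq by blast

lemma cis_shift_pi: "cis (a - pi) = - cis a" "cis (a + pi) = - cis a"
  by (simp_all add: complex_eq_iff cos_diff sin_diff)

lemma moebius_point_eq:
  assumes x: "x \<in> {0..1}" "x' \<in> {0..1}" and eq: "moebius_point x y = moebius_point x' y'"
  shows "x = x' \<and> y = y' \<or> x = 0 \<and> x' = 1 \<and> y' = - y \<or> x = 1 \<and> x' = 0 \<and> y' = - y"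
proof -
  have e1: "cis (2 * pi * x) = cis (2 * pi * x')" and e2: "of_real y * cis (pi * x) = of_real y' * cis (pi * x')"
    using eq by (auto simp: moebius_point_def)
  from cis_2pi_eq[OF x e1] consider "x = x'" | "x = 0" "x' = 1" | "x = 1" "x' = 0" by blast
  then show ?thesis
  proof cases
    case 1
    have "cis (pi * x) \<noteq> 0" by simp
    then have "complex_of_real y = of_real y'" using e2 1 by (metis mult_cancel_right)
    then have "y = y'" by (simp only: of_real_eq_iff)
    then show ?thesis using 1 by simp
  next
    case 2
    then have "complex_of_real y = of_real (- y')" using e2 by simp
    then have "y = - y'" by (simp only: of_real_eq_iff)
    then show ?thesis using 2 by simp
  next
    case 3
    then have "complex_of_real (- y) = of_real y'" using e2 by simp
    then have "- y = y'" by (simp only: of_real_eq_iff)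
    then show ?thesis using 3 by simp
  qed
qed

lemma moebius_point_ends: "moebius_point 0 y = moebius_point 1 (- y)"
  by (simp add: moebius_point_def)

lemma continuous_on_moebius_point [continuous_intros]:
  "continuous_on S f \<Longrightarrow> continuous_on S g \<Longrightarrow> continuous_on S (\<lambda>x. moebius_point (f x) (g x))"
  unfolding moebius_point_def cis_conv_exp by (intro continuous_intros)

lemma moebius_point_norm: "norm (fst (moebius_point x y)) = 1" "norm (snd (moebius_point x y)) = \<bar>y\<bar>"
  by (simp_all add: moebius_point_def norm_mult)

text \<open>A half turn around the core circle, which moves the seam away from any given point.\<close>

lemma moebius_rotation:
  "p \<in> moebius_band \<Longrightarrow> (- fst p, \<i> * snd p) \<in> moebius_band"
proof -
  assume "p \<in> moebius_band"
  then obtain x y where xy: "x \<in> {0..1}" "y \<in> {-1..1}" "p = moebius_point x y" by (auto simp: moebius_band_eq)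
  show ?thesis
  proof (cases "x \<le> 1/2")
    case True
    have "cis (2 * pi * (x + 1/2)) = - cis (2 * pi * x)"
      using cis_mult[of "2 * pi * x" pi] by (simp add: algebra_simps)
    moreover have "cis (pi * (x + 1/2)) = \<i> * cis (pi * x)"
      using cis_mult[of "pi * x" "pi/2"] by (simp add: algebra_simps)
    ultimately have "(- fst p, \<i> * snd p) = moebius_point (x + 1/2) y"
      unfolding xy(3) moebius_point_def by simp
    then show ?thesis using True xy unfolding moebius_band_eq by force
  next
    case False
    have "cis (2 * pi * (x - 1/2)) = - cis (2 * pi * x)"
      using cis_shift_pi(1)[of "2 * pi * x"] by (simp add: algebra_simps)
    moreover have "cis (pi * (x - 1/2)) = - \<i> * cis (pi * x)"
      using cis_mult[of "pi * x" "- pi/2"] by (simp add: algebra_simps complex_eq_iff)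
    ultimately have "(- fst p, \<i> * snd p) = moebius_point (x - 1/2) (- y)"
      unfolding xy(3) moebius_point_def by simp
    then show ?thesis using False xy unfolding moebius_band_eq by force
  qed
qed

text \<open>Away from the seam the coordinates are a homeomorphism onto a planar strip, whose boundary is known.\<close>

lemma moebius_strip_boundary:
  assumes "p \<in> moebius_band" "fst p \<noteq> 1"
  shows "p \<in> surface_boundary moebius_band \<longleftrightarrow> norm (snd p) = 1"
proof -
  define P where "P = {z. 0 < Re z \<and> Re z < 1 \<and> -1 \<le> Im z \<and> Im z \<le> 1}"
  define U where "U = {p \<in> moebius_band. fst p \<noteq> 1}"
  define m where "m z = moebius_point (Re z) (Im z)" for z
  define x where "x p = (Im (Ln (- fst p)) + pi) / (2 * pi)" for p :: "complex \<times> complex"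
  define k where "k p = Complex (x p) (Re (snd p * cis (- pi * x p)))" for p
  have xm: "x (moebius_point t y) = t" if "0 < t" "t < 1" for t y
  proof -
    have "- fst (moebius_point t y) = exp (\<i> * of_real (2 * pi * t - pi))"
      unfolding cis_conv_exp[symmetric] by (simp add: moebius_point_def cis_shift_pi)
    moreover have "Ln (exp (\<i> * of_real (2 * pi * t - pi))) = \<i> * of_real (2 * pi * t - pi)"
      using that by (intro Ln_exp) (auto simp: field_simps)
    ultimately have L: "Ln (- fst (moebius_point t y)) = \<i> * of_real (2 * pi * t - pi)" by (simp only:)
    have "Im (Ln (- fst (moebius_point t y))) = 2 * pi * t - pi" unfolding L by simp
    then show ?thesis by (simp add: x_def)
  qed
  have km: "k (m z) = z" if "z \<in> P" for z
  proof -
    have z: "0 < Re z" "Re z < 1" using that by (auto simp: P_def)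
    have "cis (pi * Re z) * cis (- (pi * Re z)) = 1" by (simp add: cis_mult)
    then have "snd (m z) * cis (- pi * Re z) = of_real (Im z)" by (simp add: m_def moebius_point_def)
    then show ?thesis using xm[OF z, of "Im z"] by (simp add: k_def m_def[symmetric] complex_eq_iff)
  qed
  have mU: "m ` P = U"
  proof
    show "m ` P \<subseteq> U"
    proof
      fix q assume "q \<in> m ` P"
      then obtain z where z: "z \<in> P" "q = m z" by blast
      have "fst q \<noteq> 1"
      proof
        assume "fst q = 1"
        then have "cis (2 * pi * Re z) = cis (2 * pi * 0)" using z(2) by (simp add: m_def moebius_point_def)
        then show False using cis_2pi_eq[of "Re z" 0] z(1) by (auto simp: P_def)
      qed
      moreover have "q \<in> moebius_band" using z unfolding m_def moebius_band_eq P_def by force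
      ultimately show "q \<in> U" by (simp add: U_def)
    qed
    show "U \<subseteq> m ` P"
    proof
      fix q assume q: "q \<in> U"
      then obtain t y where ty: "t \<in> {0..1}" "y \<in> {-1..1}" "q = moebius_point t y" by (auto simp: U_def moebius_band_eq)
      have "fst q \<noteq> 1" using q by (simp add: U_def)
      then have "t \<noteq> 0" "t \<noteq> 1" using ty(3) by (auto simp: moebius_point_def)
      then have "Complex t y \<in> P" "q = m (Complex t y)" using ty by (auto simp: P_def m_def)
      then show "q \<in> m ` P" by blast
    qed
  qed
  have cm: "continuous_on P m" unfolding m_def by (intro continuous_intros)
  have ck: "continuous_on U k"
  proof -
    have "- fst q \<notin> \<real>\<^sub>\<le>\<^sub>0" if q: "q \<in> U" for q
    proof
      assume "- fst q \<in> \<real>\<^sub>\<le>\<^sub>0"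
      then obtain r where r: "- fst q = of_real r" "r \<le> 0" by (rule nonpos_Reals_cases)
      then have f: "fst q = of_real (- r)" by (metis minus_minus of_real_minus)
      have "norm (fst q) = 1" using q moebius_point_norm by (auto simp: U_def moebius_band_eq)
      then have "r = -1" using r(2) unfolding f by (simp only: norm_of_real)
      then show False using f q by (simp add: U_def)
    qed
    then have "continuous_on U x" unfolding x_def by (intro continuous_intros) auto
    then show ?thesis unfolding k_def Complex_eq cis_conv_exp by (intro continuous_intros)
  qed
  have hom: "homeomorphism P U m k"
    using km mU cm ck by (intro homeomorphismI) (auto simp: image_iff)
  have op: "openin (top_of_set moebius_band) U"
  proof -
    have "open {p::complex \<times> complex. fst p \<noteq> 1}" by (intro open_Collect_neq continuous_intros)
    then have "openin (top_of_set moebius_band) (moebius_band \<inter> {p. fst p \<noteq> 1})" by (rule openin_open_Int)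
    moreover have "moebius_band \<inter> {p. fst p \<noteq> 1} = U" by (auto simp: U_def)
    ultimately show ?thesis by simp
  qed
  have intP: "interior P = {z. 0 < Re z \<and> Re z < 1 \<and> -1 < Im z \<and> Im z < 1}"
  proof
    have "P \<subseteq> rectangle" by (auto simp: P_def rectangle_def)
    then show "interior P \<subseteq> {z. 0 < Re z \<and> Re z < 1 \<and> -1 < Im z \<and> Im z < 1}"
      using interior_mono rectangle_interior by blast
    have "open {z. 0 < Re z \<and> Re z < 1 \<and> -1 < Im z \<and> Im z < 1}"
      unfolding rectangle_interior[symmetric] by (rule open_interior)
    then show "{z. 0 < Re z \<and> Re z < 1 \<and> -1 < Im z \<and> Im z < 1} \<subseteq> interior P"
      by (intro interior_maximal) (auto simp: P_def)
  qed
  have pU: "p \<in> U" using assms by (simp add: U_def)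
  have "surface_boundary U = m ` (P - interior P)"
    using surface_boundary_homeomorphism[OF hom] by (simp add: surface_boundary_planar)
  moreover have "surface_boundary U = surface_boundary moebius_band \<inter> U" by (rule surface_boundary_openin[OF op])
  ultimately have "p \<in> surface_boundary moebius_band \<longleftrightarrow> p \<in> m ` (P - interior P)" using pU by blast
  also have "\<dots> \<longleftrightarrow> norm (snd p) = 1"
  proof
    assume "p \<in> m ` (P - interior P)"
    then obtain z where "z \<in> P - interior P" "p = m z" by blast
    then have "\<bar>Im z\<bar> = 1" unfolding intP by (auto simp: P_def)
    then show "norm (snd p) = 1" using \<open>p = m z\<close> moebius_point_norm(2) by (simp add: m_def)
  next
    assume n: "norm (snd p) = 1"
    obtain z where z: "z \<in> P" "p = m z" using pU mU by blast
    then have "\<bar>Im z\<bar> = 1" using n moebius_point_norm(2) by (simp add: m_def)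
    then have "z \<in> P - interior P" using z(1) unfolding intP by auto
    then show "p \<in> m ` (P - interior P)" using z(2) by blast
  qed
  finally show ?thesis .
qed

lemma moebius_boundary: "surface_boundary moebius_band = {p \<in> moebius_band. norm (snd p) = 1}"
proof -
  define r :: "complex \<times> complex \<Rightarrow> complex \<times> complex" where "r p = (- fst p, \<i> * snd p)" for p
  define r' :: "complex \<times> complex \<Rightarrow> complex \<times> complex" where "r' p = (- fst p, - \<i> * snd p)" for p
  have rr: "r (r' p) = p" "r' (r p) = p" for p by (simp_all add: r_def r'_def)
  have rM: "r p \<in> moebius_band" if "p \<in> moebius_band" for p using moebius_rotation[OF that] by (simp add: r_def)
  have "r' p = r (r (r p))" for p by (simp add: r_def r'_def)
  then have r'M: "r' p \<in> moebius_band" if "p \<in> moebius_band" for p using rM that by simp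
  have "homeomorphism moebius_band moebius_band r r'"
  proof (rule homeomorphismI)
    show "continuous_on moebius_band r" "continuous_on moebius_band r'"
      unfolding r_def r'_def by (intro continuous_intros)+
  qed (use rM r'M rr in auto)
  then have im: "surface_boundary moebius_band = r ` surface_boundary moebius_band" by (rule surface_boundary_homeomorphism)
  have inv: "p \<in> surface_boundary moebius_band \<longleftrightarrow> r p \<in> surface_boundary moebius_band" for p
  proof
    assume "r p \<in> surface_boundary moebius_band"
    then obtain q where "q \<in> surface_boundary moebius_band" "r p = r q" using im by blast
    then show "p \<in> surface_boundary moebius_band" using rr(2) by metis
  next
    assume "p \<in> surface_boundary moebius_band"
    then have "r p \<in> r ` surface_boundary moebius_band" by (rule imageI)
    then show "r p \<in> surface_boundary moebius_band" using im by simp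
  qed
  have "p \<in> surface_boundary moebius_band \<longleftrightarrow> norm (snd p) = 1" if p: "p \<in> moebius_band" for p
  proof (cases "fst p = 1")
    case False then show ?thesis using moebius_strip_boundary[OF p] by simp
  next
    case True
    have "fst (r p) \<noteq> 1" using True by (simp add: r_def)
    then have "r p \<in> surface_boundary moebius_band \<longleftrightarrow> norm (snd (r p)) = 1"
      by (rule moebius_strip_boundary[OF rM[OF p]])
    then show ?thesis using inv[of p] by (simp add: r_def norm_mult)
  qed
  then show ?thesis using surface_boundary_subset[of moebius_band] by blast
qed

text \<open>The coordinate lines \<open>y = 1\<close> and \<open>y = -1\<close> run into each other at the seam, so the boundary is a single curve
  that goes around the core circle twice.\<close>

lemma moebius_boundary_connected: "connected (surface_boundary moebius_band)"
proof -
  let ?c = "\<lambda>t::real. (cis (2 * pi * t), cis (pi * t))"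
  have "surface_boundary moebius_band = ?c ` {0..2}"
  proof
    show "surface_boundary moebius_band \<subseteq> ?c ` {0..2}"
    proof
      fix p assume "p \<in> surface_boundary moebius_band"
      then have "p \<in> moebius_band" and n: "norm (snd p) = 1" using moebius_boundary by auto
      then obtain x y where xy: "x \<in> {0..1}" "y \<in> {-1..1}" "p = moebius_point x y" "norm (snd p) = 1"
        unfolding moebius_band_eq by blast
      then have "y = 1 \<or> y = -1" using moebius_point_norm(2)[of x y] by auto
      then show "p \<in> ?c ` {0..2}"
      proof
        assume "y = 1"
        then show ?thesis using xy by (intro image_eqI[of _ _ x]) (auto simp: moebius_point_def)
      next
        assume "y = -1"
        moreover have "cis (2 * pi * (x + 1)) = cis (2 * pi * x)"
          using cis_mult[of "2 * pi * x" "2 * pi"] by (simp add: algebra_simps complex_eq_iff)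
        moreover have "cis (pi * (x + 1)) = - cis (pi * x)"
          using cis_mult[of "pi * x" pi] by (simp add: algebra_simps)
        ultimately show ?thesis using xy by (intro image_eqI[of _ _ "x + 1"]) (auto simp: moebius_point_def)
      qed
    qed
    show "?c ` {0..2} \<subseteq> surface_boundary moebius_band"
    proof
      fix p assume "p \<in> ?c ` {0..2}"
      then obtain t where t: "t \<in> {0..2}" "p = ?c t" by blast
      have "p \<in> moebius_band"
      proof (cases "t \<le> 1")
        case True
        then have "p = moebius_point t 1" using t by (simp add: moebius_point_def)
        then show ?thesis using t True moebius_pointI[of t 1] by auto
      next
        case False
        have "cis (2 * pi * (t - 1)) = cis (2 * pi * t)"
          using cis_mult[of "2 * pi * (t - 1)" "2 * pi"] by (simp add: algebra_simps complex_eq_iff)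
        moreover have "cis (pi * (t - 1)) = - cis (pi * t)"
          using cis_shift_pi(1)[of "pi * t"] by (simp add: algebra_simps)
        ultimately have "p = moebius_point (t - 1) (- 1)" using t by (simp add: moebius_point_def)
        then show ?thesis using t False moebius_pointI[of "t - 1" "- 1"] by auto
      qed
      then show "p \<in> surface_boundary moebius_band" unfolding moebius_boundary using t(2) by simp
    qed
  qed
  moreover have "continuous_on {0..2} ?c" unfolding cis_conv_exp by (intro continuous_intros)
  ultimately show ?thesis by (metis connected_continuous_image connected_Icc)
qed

text \<open>The first rectangle is placed on the left half of the coordinate square and the second one on the
  right half. The two maps agree on the common sides: on \<open>c3\<close> in the middle of the square, and
  on \<open>c1\<close>, which one of the rectangles traverses backwards, at the twisted seam.\<close>

lemma two_rectangles_moebius: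
  fixes v e :: "'a::t2_space set"
  assumes He: "homeomorphism rectangle e He Ke" and Hv: "homeomorphism rectangle v Hv Kv"
    and c1: "\<And>y. y \<in> {-1..1} \<Longrightarrow> He (Complex 0 y) = c1 y" "\<And>y. y \<in> {-1..1} \<Longrightarrow> Hv (Complex 1 y) = c1 (- y)"
    and c3: "\<And>y. y \<in> {-1..1} \<Longrightarrow> He (Complex 1 y) = c3 y" "\<And>y. y \<in> {-1..1} \<Longrightarrow> Hv (Complex 0 y) = c3 y"
    and ve: "v \<inter> e = c1 ` {-1..1} \<union> c3 ` {-1..1}" and cl: "closed v" "closed e"
  shows "v \<union> e homeomorphic moebius_band"
proof -
  define fe where "fe p = moebius_point (Re (Ke p) / 2) (Im (Ke p))" for p
  define fv where "fv p = moebius_point ((1 + Re (Kv p)) / 2) (Im (Kv p))" for p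
  define F where "F p = (if p \<in> e then fe p else fv p)" for p
  have KR: "Ke p \<in> rectangle" "He (Ke p) = p" if "p \<in> e" for p
    using homeomorphism_image2[OF He] homeomorphism_apply2[OF He] that by blast+
  have KvR: "Kv p \<in> rectangle" "Hv (Kv p) = p" if "p \<in> v" for p
    using homeomorphism_image2[OF Hv] homeomorphism_apply2[OF Hv] that by blast+
  have KH: "Ke (He z) = z" "Kv (Hv z) = z" "He z \<in> e" "Hv z \<in> v" if "z \<in> rectangle" for z
    using homeomorphism_apply1[OF He that] homeomorphism_apply1[OF Hv that]
      homeomorphism_image1[OF He] homeomorphism_image1[OF Hv] that by blast+
  have side: "Complex 0 y \<in> rectangle" "Complex 1 y \<in> rectangle" if "y \<in> {-1..1}" for y
    using that by (auto simp: rectangle_def)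
  have agree: "fe p = fv p" if p: "p \<in> v" "p \<in> e" for p
  proof -
    from p ve consider y where "y \<in> {-1..1}" "p = c1 y" | y where "y \<in> {-1..1}" "p = c3 y" by blast
    then show ?thesis
    proof cases
      case (1 y)
      have y': "- y \<in> {-1..1}" using 1(1) by auto
      have "Ke p = Complex 0 y" using KH(1)[OF side(1)[OF 1(1)]] c1(1)[OF 1(1)] 1(2) by simp
      moreover have "Kv p = Complex 1 (- y)" using KH(2)[OF side(2)[OF y']] c1(2)[OF y'] 1(2) by simp
      ultimately show ?thesis using moebius_point_ends[of y] by (simp add: fe_def fv_def)
    next
      case (2 y)
      have "Ke p = Complex 1 y" using KH(1)[OF side(2)[OF 2(1)]] c3(1)[OF 2(1)] 2(2) by simp
      moreover have "Kv p = Complex 0 y" using KH(2)[OF side(1)[OF 2(1)]] c3(2)[OF 2(1)] 2(2) by simp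
      ultimately show ?thesis by (simp add: fe_def fv_def)
    qed
  qed
  have Fe: "F p = fe p" if "p \<in> e" for p using that by (simp add: F_def)
  have Fv: "F p = fv p" if "p \<in> v" for p using that agree by (simp add: F_def)
  have "continuous_on e fe" unfolding fe_def using homeomorphism_cont2[OF He] by (intro continuous_intros) auto
  then have ce: "continuous_on e F" by (rule continuous_on_eq) (simp add: Fe)
  have "continuous_on v fv" unfolding fv_def using homeomorphism_cont2[OF Hv] by (intro continuous_intros) auto
  then have cv: "continuous_on v F" by (rule continuous_on_eq) (simp add: Fv)
  have cont: "continuous_on (v \<union> e) F" by (rule continuous_on_closed_Un[OF cl cv ce])
  have ie: "inj_on F e"
  proof (rule inj_onI)
    fix p q assume pq: "p \<in> e" "q \<in> e" "F p = F q"
    have R: "Ke p \<in> rectangle" "Ke q \<in> rectangle" using KR pq by auto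
    have "moebius_point (Re (Ke p) / 2) (Im (Ke p)) = moebius_point (Re (Ke q) / 2) (Im (Ke q))"
      using pq Fe by (simp add: fe_def)
    from moebius_point_eq[OF _ _ this] R have "Re (Ke p) = Re (Ke q)" "Im (Ke p) = Im (Ke q)"
      by (auto simp: rectangle_def)
    then have "Ke p = Ke q" by (simp add: complex_eq_iff)
    then show "p = q" using KR(2) pq by metis
  qed
  have iv: "inj_on F v"
  proof (rule inj_onI)
    fix p q assume pq: "p \<in> v" "q \<in> v" "F p = F q"
    have R: "Kv p \<in> rectangle" "Kv q \<in> rectangle" using KvR pq by auto
    have "moebius_point ((1 + Re (Kv p)) / 2) (Im (Kv p)) = moebius_point ((1 + Re (Kv q)) / 2) (Im (Kv q))"
      using pq Fv by (simp add: fv_def)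
    from moebius_point_eq[OF _ _ this] R have "Re (Kv p) = Re (Kv q)" "Im (Kv p) = Im (Kv q)"
      by (auto simp: rectangle_def)
    then have "Kv p = Kv q" by (simp add: complex_eq_iff)
    then show "p = q" using KvR(2) pq by metis
  qed
  have meet: "F ` v \<inter> F ` e \<subseteq> F ` (v \<inter> e)"
  proof
    fix m assume "m \<in> F ` v \<inter> F ` e"
    then obtain q where q: "q \<in> v" "m = F q" by blast
    obtain p where p: "p \<in> e" "m = F p" using \<open>m \<in> F ` v \<inter> F ` e\<close> by blast
    have pq: "p \<in> e" "q \<in> v" "m = F p" "F p = F q" using p q by simp_all
    have R: "Ke p \<in> rectangle" "Kv q \<in> rectangle" using KR KvR pq by auto
    have "moebius_point (Re (Ke p) / 2) (Im (Ke p)) = moebius_point ((1 + Re (Kv q)) / 2) (Im (Kv q))"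
      using pq Fe Fv by (simp add: fe_def fv_def)
    from moebius_point_eq[OF _ _ this] R have "Re (Ke p) = 1 \<or> Re (Ke p) = 0"
      by (auto simp: rectangle_def)
    moreover have I: "Im (Ke p) \<in> {-1..1}" using R by (auto simp: rectangle_def)
    ultimately have "p = c3 (Im (Ke p)) \<or> p = c1 (Im (Ke p))"
      using c3(1)[OF I] c1(1)[OF I] KR(2)[OF pq(1)] by (metis complex_surj)
    then have "p \<in> v \<inter> e" using ve I by blast
    then show "m \<in> F ` (v \<inter> e)" using pq(3) by blast
  qed
  have inj: "inj_on F (v \<union> e)" by (rule inj_on_Un_meet[OF iv ie meet])
  have im: "F ` (v \<union> e) = moebius_band"
  proof
    show "F ` (v \<union> e) \<subseteq> moebius_band"
    proof
      fix m assume "m \<in> F ` (v \<union> e)"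
      then consider p where "p \<in> e" "m = fe p" | p where "p \<in> v" "m = fv p" using Fe Fv by blast
      then show "m \<in> moebius_band"
      proof cases
        case (1 p) then show ?thesis using KR(1)[of p] unfolding fe_def moebius_band_eq rectangle_def by force
      next
        case (2 p) then show ?thesis using KvR(1)[of p] unfolding fv_def moebius_band_eq rectangle_def by force
      qed
    qed
    show "moebius_band \<subseteq> F ` (v \<union> e)"
    proof
      fix m assume "m \<in> moebius_band"
      then obtain x y where xy: "x \<in> {0..1}" "y \<in> {-1..1}" "m = moebius_point x y" by (auto simp: moebius_band_eq)
      show "m \<in> F ` (v \<union> e)"
      proof (cases "x \<le> 1/2")
        case True
        have R: "Complex (2 * x) y \<in> rectangle" using xy True by (auto simp: rectangle_def)
        have "F (He (Complex (2 * x) y)) = m" using Fe[OF KH(3)[OF R]] KH(1)[OF R] xy(3) by (simp add: fe_def)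
        then show ?thesis using KH(3)[OF R] by blast
      next
        case False
        have R: "Complex (2 * x - 1) y \<in> rectangle" using xy False by (auto simp: rectangle_def)
        have "F (Hv (Complex (2 * x - 1) y)) = m" using Fv[OF KH(4)[OF R]] KH(2)[OF R] xy(3) by (simp add: fv_def)
        then show ?thesis using KH(4)[OF R] by blast
      qed
    qed
  qed
  have cR: "compact rectangle" unfolding rectangle_cbox by simp
  have "compact (Hv ` rectangle)" "compact (He ` rectangle)"
    using cR homeomorphism_cont1[OF Hv] homeomorphism_cont1[OF He] by (simp_all add: compact_continuous_image)
  then have "compact (v \<union> e)" using homeomorphism_image1[OF Hv] homeomorphism_image1[OF He] by auto
  then show ?thesis using homeomorphism_compact[OF _ cont im inj] homeomorphic_def by blast
qed

section \<open>A loop at its vertex\<close>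

context ribbon_surface
begin

definition loop_at :: "'a set \<Rightarrow> 'a set \<Rightarrow> bool" where
  "loop_at e v \<longleftrightarrow> e \<in> E \<and> {w \<in> V. w \<inter> e \<noteq> {}} = {v}"

lemma loop_atD:
  assumes "loop_at e v"
  shows "e \<in> E" "v \<in> V" "w \<in> V \<Longrightarrow> w \<inter> e \<noteq> {} \<Longrightarrow> w = v" "x \<in> X \<Longrightarrow> ed x = e \<Longrightarrow> vx x = v"
    "flags.all_joined flags.seg_state e"
proof -
  show e: "e \<in> E" "v \<in> V" using assms unfolding loop_at_def by blast+
  show w: "w \<in> V \<Longrightarrow> w \<inter> e \<noteq> {} \<Longrightarrow> w = v" for w using assms unfolding loop_at_def by blast
  show "x \<in> X \<Longrightarrow> ed x = e \<Longrightarrow> vx x = v" using w[of "vx x"] X_vx[of x] X_ed[of x] by blast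
  have "card {w \<in> V. w \<inter> e \<noteq> {}} = 1" using assms unfolding loop_at_def by simp
  then show "flags.all_joined flags.seg_state e" using loop_iff_card_ends[OF e(1)] by simp
qed

lemma loop_ribbon_surface: "loop_at e v \<Longrightarrow> ribbon_surface {v} {e}"
  by (rule sub_ribbon_surface[OF ribbon_surface_axioms]) (use loop_atD in auto)

text \<open>A loop together with its vertex is a ribbon surface of its own, and its flags are those of \<open>e\<close>.\<close>

lemma loop_segs:
  assumes L: "loop_at e v"
  shows "ribbon_surface.segs {v} {e} = segs_of e" "segs_of e = components (v \<inter> e)" "s \<in> segs_of e \<Longrightarrow> s \<subseteq> v"
    "ribbon_surface.segs_of {v} {e} v = segs_of e" "ribbon_surface.segs_of {v} {e} e = segs_of e"
    "ribbon_surface.X {v} {e} = {x \<in> X. ed x = e}"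
proof -
  interpret B: ribbon_surface "{v}" "{e}" by (rule loop_ribbon_surface[OF L])
  have e: "e \<in> E" and v: "v \<in> V" using loop_atD[OF L] by auto
  show c: "segs_of e = components (v \<inter> e)"
  proof
    show "segs_of e \<subseteq> components (v \<inter> e)"
    proof
      fix s assume "s \<in> segs_of e"
      then obtain w where w: "w \<in> V" "s \<in> components (w \<inter> e)" unfolding segs_of_edge[OF e] by blast
      then have "w \<inter> e \<noteq> {}" by auto
      then have "w = v" using loop_atD(3)[OF L w(1)] by blast
      then show "s \<in> components (v \<inter> e)" using w by simp
    qed
    show "components (v \<inter> e) \<subseteq> segs_of e" unfolding segs_of_edge[OF e] using v by blast
  qed
  show Bs: "B.segs = segs_of e" unfolding B.segs_def c by simp
  show sv: "s \<in> segs_of e \<Longrightarrow> s \<subseteq> v" for s unfolding c using in_components_subset by blast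
  show "B.segs_of v = segs_of e" "B.segs_of e = segs_of e"
    unfolding B.segs_of_def Bs using sv by (auto simp: segs_of_def)
  show "B.X = {x \<in> X. ed x = e}"
  proof
    show "B.X \<subseteq> {x \<in> X. ed x = e}"
    proof
      fix x assume "x \<in> B.X"
      then obtain s where s: "s \<in> segs_of e" "x \<in> arc_ends s" unfolding B.X_def Bs by blast
      then have s': "s \<in> segs" "s \<subseteq> e" by (auto simp: segs_of_def)
      have "x \<in> e" using s(2) s'(2) arc_ends_subset by blast
      then show "x \<in> {x \<in> X. ed x = e}" using X_seg[OF s'(1) s(2)] ed_eq[OF e] by simp
    qed
    show "{x \<in> X. ed x = e} \<subseteq> B.X"
    proof
      fix x assume "x \<in> {x \<in> X. ed x = e}"
      then have x: "x \<in> X" "x \<in> e" using X_ed[of x] by auto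
      obtain s where "s \<in> segs_of e" "x \<in> arc_ends s" using X_in_edge[OF e x] .
      then show "x \<in> B.X" unfolding B.X_def Bs by blast
    qed
  qed
qed

lemma loop_tau_sigma:
  assumes L: "loop_at e v" and x: "x \<in> X" "ed x = e"
  shows "ribbon_surface.\<tau> {v} {e} x = \<tau> x" "ribbon_surface.\<sigma> {v} {e} x = \<sigma> x"
proof -
  interpret B: ribbon_surface "{v}" "{e}" by (rule loop_ribbon_surface[OF L])
  have xB: "x \<in> B.X" using x loop_segs(6)[OF L] by blast
  obtain s where s: "s \<in> B.segs" "x \<in> arc_ends s" using xB by (rule B.X_segE)
  then have "s \<in> segs" using loop_segs(1)[OF L] by (simp add: segs_of_def)
  then have "{x, B.\<tau> x} = {x, \<tau> x}" using B.tau_ends[OF s] tau_ends[OF _ s(2)] by simp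
  then show "B.\<tau> x = \<tau> x" using tau_X[OF x(1)] B.tau_X[OF xB] by (auto simp: doubleton_eq_iff)
  obtain g where g: "g \<in> B.gaps_of (B.ed x)" "arc_ends g = {x, B.\<sigma> x}" using B.sigma_gap[OF xB] .
  have "B.ed x = e" using B.X_ed[OF xB] by simp
  then have "g \<in> gaps_of e" using g(1) loop_segs(5)[OF L] by (simp add: B.gaps_of_def gaps_of_def)
  then have "g \<in> arcs_of E" using gaps_of_E loop_atD(1)[OF L] by blast
  then have "{x, B.\<sigma> x} = {x, \<sigma> x}" using sigma_ends[of g x] g(2) by simp
  then show "B.\<sigma> x = \<sigma> x" using sigma_X[OF x(1)] B.sigma_X[OF xB] by (auto simp: doubleton_eq_iff)
qed

text \<open>The line segments of the other edges subdivide the two gaps that \<open>e\<close> leaves on the boundary of its vertex.\<close>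

lemma loop_gap_pieces:
  assumes L: "loop_at e v" and g: "g \<in> ribbon_surface.gaps_of {v} {e} v"
  shows "g = \<Union>{P \<in> gaps_of v \<union> (segs_of v - segs_of e). P \<subseteq> g}"
    "\<And>P. P \<in> gaps_of v \<union> (segs_of v - segs_of e) \<Longrightarrow> P \<inter> g \<noteq> {} \<Longrightarrow> P \<subseteq> g"
proof -
  interpret B: ribbon_surface "{v}" "{e}" by (rule loop_ribbon_surface[OF L])
  have v: "v \<in> V" "v \<in> V \<union> E" using loop_atD[OF L] by auto
  let ?K = "surface_boundary v - \<Union>(relint ` segs_of e)"
  have gK: "g \<in> components ?K" using g unfolding B.gaps_of_def gaps_def loop_segs(4)[OF L] .
  have sub: "segs_of e \<subseteq> segs_of v" using loop_segs(3)[OF L] by (auto simp: segs_of_def)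
  have "segs_of e \<noteq> {}" using segs_of_edge_nonempty loop_atD(1)[OF L] by blast
  then have ne: "segs_of v \<noteq> {}" using sub by blast
  have PK: "P \<subseteq> ?K \<and> connected P" if P: "P \<in> gaps_of v \<union> (segs_of v - segs_of e)" for P
    using P
  proof
    assume P: "P \<in> gaps_of v"
    have "P \<subseteq> surface_boundary v - \<Union>(relint ` segs_of v)" using gaps_of(5)[OF v(2) ne] P by blast
    moreover have "\<Union>(relint ` segs_of e) \<subseteq> \<Union>(relint ` segs_of v)" using sub by blast
    ultimately show ?thesis using arc_connected gaps_of(2)[OF v(2) ne P] by blast
  next
    assume P: "P \<in> segs_of v - segs_of e"
    then have Ps: "P \<in> segs" by (simp add: segs_of_def)
    have "P \<inter> relint s = {}" if s: "s \<in> segs_of e" for s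
    proof -
      have "s \<in> segs" "s \<noteq> P" using s P by (auto simp: segs_of_def)
      then show ?thesis using seg_eq[OF Ps, of s] by (auto simp: relint_def)
    qed
    then show ?thesis using segs_of_boundary[OF v(2), of P] P arc_connected by blast
  qed
  show meet: "P \<subseteq> g" if "P \<in> gaps_of v \<union> (segs_of v - segs_of e)" "P \<inter> g \<noteq> {}" for P
    using components_maximal[OF gK, of P] PK[OF that(1)] that(2) by blast
  show "g = \<Union>{P \<in> gaps_of v \<union> (segs_of v - segs_of e). P \<subseteq> g}"
  proof
    show "g \<subseteq> \<Union>{P \<in> gaps_of v \<union> (segs_of v - segs_of e). P \<subseteq> g}"
    proof
      fix y assume y: "y \<in> g"
      have yK: "y \<in> ?K" using y in_components_subset[OF gK] by blast
      have "\<exists>P\<in>gaps_of v \<union> (segs_of v - segs_of e). y \<in> P"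
      proof (cases "\<exists>s\<in>segs_of e. y \<in> s")
        case True
        then obtain s where s: "s \<in> segs_of e" "y \<in> s" by blast
        have "y \<notin> relint s" using yK s(1) by blast
        then have "y \<in> arc_ends s" using s(2) by (simp add: relint_def)
        then have "y \<in> \<Union>(arc_ends ` gaps_of v)" using gaps_of(4)[OF v(2) ne] s(1) sub by blast
        then show ?thesis using arc_ends_subset by blast
      next
        case False
        have "y \<in> \<Union>(gaps_of v) \<union> \<Union>(segs_of v)"
          using DiffD1[OF yK] unfolding boundary_gaps_segs[OF v(2) ne] .
        then show ?thesis using False by blast
      qed
      then obtain P where P: "P \<in> gaps_of v \<union> (segs_of v - segs_of e)" "y \<in> P" by blast
      then have "P \<subseteq> g" using meet[OF P(1)] y by blast
      then show "y \<in> \<Union>{P \<in> gaps_of v \<union> (segs_of v - segs_of e). P \<subseteq> g}" using P by blast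
    qed
    show "\<Union>{P \<in> gaps_of v \<union> (segs_of v - segs_of e). P \<subseteq> g} \<subseteq> g" by blast
  qed
qed

lemma loop_gap_joined:
  assumes L: "loop_at e v" and g: "g \<in> ribbon_surface.gaps_of {v} {e} v"
    and x: "x \<in> X" "x \<in> g" "y \<in> X" "y \<in> g"
  shows "(x, y) \<in> flags.joined (flags.seg_state(e := {}))"
proof -
  interpret B: ribbon_surface "{v}" "{e}" by (rule loop_ribbon_surface[OF L])
  let ?P = "{P \<in> gaps_of v \<union> (segs_of v - segs_of e). P \<subseteq> g}"
  have gU: "\<Union>?P = g" using loop_gap_pieces(1)[OF L g] by simp
  have v: "v \<in> V" "v \<in> V \<union> E" using loop_atD[OF L] by auto
  have "segs_of e \<noteq> {}" using segs_of_edge_nonempty loop_atD(1)[OF L] by blast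
  moreover have "segs_of e \<subseteq> segs_of v" using loop_segs(3)[OF L] by (auto simp: segs_of_def)
  ultimately have ne: "segs_of v \<noteq> {}" by blast
  have sub: "?P \<subseteq> all_arcs \<union> circles"
    using gaps_of_V[OF v(1) ne] unfolding all_arcs_def segs_of_def by blast
  have "connected g" using g in_components_connected unfolding B.gaps_of_def gaps_def by blast
  then have "connected_component (\<Union>?P) x y" unfolding gU using x by (intro connected_componentI[of g]) auto
  then have "(x, y) \<in> {(u, w). \<exists>P\<in>?P \<inter> all_arcs. arc_ends P = {u, w}}\<^sup>*"
    using pieces_connect[OF sub x(1) _ x(3)] x(2) unfolding gU by blast
  moreover have "{(u, w). \<exists>P\<in>?P \<inter> all_arcs. arc_ends P = {u, w}} \<subseteq> flags.step (flags.seg_state(e := {}))"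
  proof (rule pieces_step[OF sub])
    fix s u assume s: "s \<in> ?P" "s \<in> segs" "u \<in> arc_ends s"
    have "s \<notin> gaps_of v" using seg_not_gap[OF s(2)] gaps_of_V[OF v(1) ne] by blast
    then have "s \<notin> segs_of e" using s(1) by blast
    have "ed u \<noteq> e"
    proof
      assume "ed u = e"
      then have "u \<in> e" using X_ed[OF X_seg[OF s(2,3)]] by simp
      moreover have "u \<in> s" using s(3) arc_ends_subset by blast
      ultimately have "s \<subseteq> e" using seg_subset_disc(1)[OF s(2)] loop_atD(1)[OF L] by blast
      then show False using \<open>s \<notin> segs_of e\<close> s(2) by (simp add: segs_of_def)
    qed
    then show "Seg \<in> (flags.seg_state(e := {})) (ed u)" by (simp add: flags.seg_state_def)
  next
    fix s u assume s: "s \<in> ?P" "s \<in> arcs_of E" "u \<in> arc_ends s"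
    have "s \<notin> gaps_of v" using gap_V_not_E[OF _ s(2)] gaps_of_V[OF v(1) ne] by blast
    moreover have "s \<notin> segs_of v" using seg_not_gap[OF _ s(2)] by (auto simp: segs_of_def)
    ultimately show "Side \<in> (flags.seg_state(e := {})) (ed u)" using s(1) by blast
  qed
  ultimately show ?thesis using rtrancl_mono by blast
qed

text \<open>A gap of the loop is a walk along the vertex boundary that does not pass \<open>e\<close> and ends in two flags
  of \<open>e\<close>; this is what the matching of the empty edge set records.\<close>

lemma loop_gap_matching:
  assumes L: "loop_at e v" and x: "x \<in> X" "ed x = e"
  shows "ribbon_surface.\<alpha> {v} {e} x = flags.act (flags.matching flags.seg_state e) x"
    and "\<exists>g\<in>ribbon_surface.gaps_of {v} {e} v. arc_ends g = {x, flags.act (flags.matching flags.seg_state e) x}"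
proof -
  interpret B: ribbon_surface "{v}" "{e}" by (rule loop_ribbon_surface[OF L])
  have xB: "x \<in> B.X" using x loop_segs(6)[OF L] by blast
  obtain g where g: "g \<in> B.gaps_of (B.vx x)" "arc_ends g = {x, B.\<alpha> x}" using B.alpha_gap[OF xB] .
  have gv: "g \<in> B.gaps_of v" using g(1) B.X_vx[OF xB] by simp
  have y: "B.\<alpha> x \<in> X" "ed (B.\<alpha> x) = e" "B.\<alpha> x \<noteq> x"
    using B.alpha_X[OF xB] loop_segs(6)[OF L] by auto
  have "(x, B.\<alpha> x) \<in> flags.joined (flags.seg_state(e := {}))"
    by (rule loop_gap_joined[OF L gv x(1) _ y(1)]) (use g(2) arc_ends_subset[of g] in auto)
  moreover obtain m where m: "B.\<alpha> x = flags.act m x" using flags.same_edge[OF x(1) y(1)] x(2) y(2,3) by metis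
  ultimately have "m = flags.matching flags.seg_state e" using flags.matching[OF flags.smooth_seg x] by simp
  then show "B.\<alpha> x = flags.act (flags.matching flags.seg_state e) x" using m by simp
  then show "\<exists>g\<in>B.gaps_of v. arc_ends g = {x, flags.act (flags.matching flags.seg_state e) x}" using gv g(2) by auto
qed

text \<open>The boundary of a disc with two line segments is made of these and of the two gaps, so the disc can
  be parametrised by the rectangle as soon as the gaps connect corresponding ends.\<close>

lemma two_seg_rectangle:
  assumes D: "D = V \<or> D = E" and d: "d \<in> D" and segs: "segs_of d = {s1, s3}" "s1 \<noteq> s3"
    and ends: "arc_ends s1 = {a, b}" "arc_ends s3 = {p, q}"
    and g: "g1 \<in> gaps_of d" "g2 \<in> gaps_of d" "arc_ends g1 = {a, p}" "arc_ends g2 = {b, q}"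
    and c1: "continuous_on {-1..1::real} c1" "inj_on c1 {-1..1}" "c1 ` {-1..1} = s1" "c1 (-1) = a" "c1 1 = b"
    and c3: "continuous_on {-1..1::real} c3" "inj_on c3 {-1..1}" "c3 ` {-1..1} = s3" "c3 (-1) = p" "c3 1 = q"
  obtains H K where "homeomorphism rectangle d H K"
    "\<And>y. y \<in> {-1..1} \<Longrightarrow> H (Complex 0 y) = c1 y" "\<And>y. y \<in> {-1..1} \<Longrightarrow> H (Complex 1 y) = c3 y"
proof -
  have dE: "d \<in> V \<union> E" using D d by blast
  have ne: "segs_of d \<noteq> {}" using segs by simp
  have ss: "s1 \<in> segs" "s3 \<in> segs" using segs by (auto simp: segs_of_def)
  have arcs: "is_arc g1" "is_arc g2" using gaps_of(2)[OF dE ne] g by blast+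
  have ab: "a \<noteq> b" "p \<noteq> q" using arc_ends_card[OF seg_arc[OF ss(1)]] arc_ends_card[OF seg_arc[OF ss(2)]] ends by auto
  have dis: "s1 \<inter> s3 = {}" using seg_eq[OF ss] segs(2) by blast
  have "{a, b} \<subseteq> s1" "{p, q} \<subseteq> s3" using arc_ends_subset[of s1] arc_ends_subset[of s3] ends by auto
  then have diff: "a \<noteq> p" "a \<noteq> q" "b \<noteq> p" "b \<noteq> q" and "a \<in> s1" "b \<in> s1" "p \<in> s3" "q \<in> s3" using dis by auto
  have gg: "g1 \<noteq> g2" using g(3,4) ab diff by (metis insert_iff singletonD)
  have gin: "{a, p} \<subseteq> g1" "{b, q} \<subseteq> g2" using arc_ends_subset[of g1] arc_ends_subset[of g2] g(3,4) by auto
  have gdis: "g1 \<inter> g2 = {}" using gaps_of(3)[OF dE ne] g(1,2) gg unfolding pairwise_def disjnt_def by blast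
  have all: "gaps_of d = {g1, g2}"
  proof
    show "gaps_of d \<subseteq> {g1, g2}"
    proof
      fix h assume h: "h \<in> gaps_of d"
      obtain z where z: "z \<in> arc_ends h" using arc_ends_card[OF gaps_of(2)[OF dE ne h]] by fastforce
      then have "z \<in> {a, b, p, q}" using gaps_of(4)[OF dE ne] h segs(1) ends by auto
      then have "z \<in> g1 \<or> z \<in> g2" using gin by auto
      moreover have "z \<in> h" using z arc_ends_subset by blast
      ultimately show "h \<in> {g1, g2}" using gaps_of(3)[OF dE ne] h g(1,2) unfolding pairwise_def disjnt_def by blast
    qed
  qed (use g in auto)
  have meet: "s \<inter> h = arc_ends s \<inter> arc_ends h" if "s \<in> {s1, s3}" "h \<in> gaps_of d" for s h
  proof
    show "s \<inter> h \<subseteq> arc_ends s \<inter> arc_ends h"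
      using gap_seg_meet[OF dE ne that(2)] ss that(1) by blast
    show "arc_ends s \<inter> arc_ends h \<subseteq> s \<inter> h" using arc_ends_subset by blast
  qed
  show ?thesis
  proof (rule disc_rectangle[OF disc[OF dE] c1(1-3) c3(1-3) arcs])
    show "arc_ends g1 = {c1 (- 1), c3 (- 1)}" "arc_ends g2 = {c1 1, c3 1}" using g c1 c3 by auto
    show "s1 \<union> g1 \<union> s3 \<union> g2 = surface_boundary d" unfolding boundary_gaps_segs[OF dE ne] all segs(1) by auto
    show "s1 \<inter> s3 = {}" "g1 \<inter> g2 = {}" by (rule dis, rule gdis)
    show "s1 \<inter> g1 = {c1 (- 1)}" "s1 \<inter> g2 = {c1 1}" "s3 \<inter> g1 = {c3 (- 1)}" "s3 \<inter> g2 = {c3 1}"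
      using meet g ends ab diff c1(4,5) c3(4,5) by auto
    fix H K assume "homeomorphism rectangle d H K" "\<And>y. y \<in> {-1..1} \<Longrightarrow> H (Complex 0 y) = c1 y"
      "\<And>y. y \<in> {-1..1} \<Longrightarrow> H (Complex 1 y) = c3 y"
    then show thesis by (rule that)
  qed
qed

text \<open>If the matching were along the sides, \<open>\<alpha>\<close> and \<open>\<sigma>\<close> would agree on the flags of \<open>e\<close>, and the boundary of
  \<open>v \<union> e\<close> would be disconnected, unlike that of the Moebius band. If it is diagonal, the flags
  \<open>a\<close>, \<open>\<tau> a\<close>, \<open>\<sigma> a\<close> and \<open>\<tau> (\<sigma> a)\<close> are the corners of two rectangles, and the gaps of the vertex
  connect them crosswise.\<close>

theorem loop_moebius_iff:
  assumes L: "loop_at e v"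
  shows "v \<union> e homeomorphic moebius_band \<longleftrightarrow> flags.matching flags.seg_state e = Diag"
proof
  interpret B: ribbon_surface "{v}" "{e}" by (rule loop_ribbon_surface[OF L])
  have e: "e \<in> E" "e \<in> ed ` X" using loop_atD(1)[OF L] ed_X by auto
  obtain x where x: "x \<in> X" "ed x = e" using e(2) by blast
  have xB: "x \<in> B.X" "\<tau> x \<in> B.X" using x tau_X[OF x(1)] tau_ed_vx[OF x(1)] loop_segs(6)[OF L] by auto
  assume hom: "v \<union> e homeomorphic moebius_band"
  show "flags.matching flags.seg_state e = Diag"
  proof (rule ccontr)
    assume "flags.matching flags.seg_state e \<noteq> Diag"
    then have M: "flags.matching flags.seg_state e = Side"
      using flags.matching_seg_loop[OF loop_atD(5)[OF L] e(2)] by (cases "flags.matching flags.seg_state e") auto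
    have a: "B.\<alpha> y = \<sigma> y" "B.\<sigma> y = \<sigma> y" if "y \<in> X" "ed y = e" for y
      using loop_gap_matching(1)[OF L that] loop_tau_sigma(2)[OF L that] M by simp_all
    obtain f g where fg: "homeomorphism moebius_band (v \<union> e) f g" using homeomorphicD(2)[OF hom] by blast
    have "surface_boundary (v \<union> e) = f ` surface_boundary moebius_band" by (rule surface_boundary_homeomorphism[OF fg])
    moreover have "continuous_on (surface_boundary moebius_band) f"
      using homeomorphism_cont1[OF fg] surface_boundary_subset continuous_on_subset by blast
    ultimately have con: "connected (surface_boundary (v \<union> e))"
      using moebius_boundary_connected connected_continuous_image by simp
    have bd: "surface_boundary (v \<union> e) = \<Union>(B.bd_pieces {e})"
      using B.bd_pieces_boundary[of "{e}"] by (simp add: Un_commute[of v e])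
    have "connected_component (\<Union>(B.bd_pieces {e})) x (\<tau> x)"
      using con B.flag_in_bd[OF xB(1)] B.flag_in_bd[OF xB(2)] unfolding bd
      by (intro connected_componentI[of "\<Union>(B.bd_pieces {e})"]) auto
    then have j: "(x, \<tau> x) \<in> B.flags.joined (B.flags.take_sides B.flags.seg_state {e})"
      using B.boundary_connected_iff[of "{e}" x "\<tau> x"] xB by simp
    have "z = x \<or> z = \<sigma> x" if "(x, z) \<in> B.flags.joined (B.flags.take_sides B.flags.seg_state {e})" for z
      using that
    proof induction
      case (step y z)
      have y: "y \<in> B.X" using B.flags.step_X[OF step(2)] by blast
      then have yX: "y \<in> X" "ed y = e" using loop_segs(6)[OF L] by auto
      have ey: "B.ed y = e" using B.X_ed[OF y] by simp
      from step(2) consider "z = B.\<alpha> y" | m where "z = B.flags.act m y" "m \<in> B.flags.take_sides B.flags.seg_state {e} (B.ed y)"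
        unfolding B.flags.step_def by blast
      then have "z = \<sigma> y"
      proof cases
        case 1 then show ?thesis using a(1)[OF yX] by simp
      next
        case (2 m)
        then have "m = Side" unfolding ey by (simp add: B.flags.take_sides_def)
        then show ?thesis using 2(1) a(2)[OF yX] by simp
      qed
      then show ?case using step.IH sigma_X[OF x(1)] by auto
    qed simp
    from this[OF j] show False using tau_X[OF x(1)] flags.tau_sigma[OF x(1)] by auto
  qed
next
  interpret B: ribbon_surface "{v}" "{e}" by (rule loop_ribbon_surface[OF L])
  have e: "e \<in> E" "e \<in> ed ` X" using loop_atD(1)[OF L] ed_X by auto
  assume M: "flags.matching flags.seg_state e = Diag"
  obtain a where a: "a \<in> X" "ed a = e" using e(2) by blast
  define b c d where "b = \<tau> a" and "c = \<sigma> a" and "d = \<tau> (\<sigma> a)"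
  have X: "b \<in> X" "c \<in> X" "d \<in> X" "ed b = e" "ed c = e" "ed d = e"
    using flags.act_props[OF a(1), of Seg] flags.act_props[OF a(1), of Side] flags.act_props[OF a(1), of Diag] a(2)
    by (auto simp: b_def c_def d_def)
  have t: "\<tau> a = b" "\<tau> c = d" "\<sigma> a = c" "\<sigma> b = d" "\<tau> (\<sigma> c) = b" "\<tau> (\<sigma> d) = a"
    using tau_X[OF a(1)] sigma_X[OF a(1)] flags.tau_sigma[OF a(1)] flags.act_props(2)[OF a(1), of Diag]
    by (auto simp: b_def c_def d_def)
  have inB: "a \<in> B.X" "b \<in> B.X" "c \<in> B.X" "d \<in> B.X" using a X loop_segs(6)[OF L] by auto
  have st: "B.\<tau> a = b" "B.\<tau> c = d" "B.\<sigma> a = c" "B.\<sigma> b = d"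
    using loop_tau_sigma[OF L] a X t by auto
  have al: "B.\<alpha> c = b" "B.\<alpha> d = a"
    using loop_gap_matching(1)[OF L X(2,5)] loop_gap_matching(1)[OF L X(3,6)] M t by auto
  have eE: "e \<in> {e}" "v \<in> {v}" by auto
  obtain s1 where s1: "s1 \<in> B.segs" "a \<in> arc_ends s1" using inB(1) by (rule B.X_segE)
  obtain s3 where s3: "s3 \<in> B.segs" "c \<in> arc_ends s3" using inB(3) by (rule B.X_segE)
  have ends: "arc_ends s1 = {a, b}" "arc_ends s3 = {c, d}" using B.tau_ends[OF s1] B.tau_ends[OF s3] st by auto
  have "c \<notin> s1" using B.sigma_other_seg[OF inB(1) s1] st by simp
  then have ne: "s1 \<noteq> s3" using s3(2) arc_ends_subset by blast
  have sin: "s1 \<in> segs_of e" "s3 \<in> segs_of e" using s1(1) s3(1) loop_segs(1)[OF L] by simp_all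
  obtain s' where s': "segs_of e = {s1, s'}" using edge_segs[OF e(1) sin(1)] .
  then have segs: "segs_of e = {s1, s3}" using sin(2) ne by auto
  then have Bsegs: "B.segs_of e = {s1, s3}" "B.segs_of v = {s3, s1}"
    unfolding loop_segs(4,5)[OF L] by auto
  have e1: "arc_ends s1 = {b, a}" using ends by auto
  obtain c1 where c1: "continuous_on {-1..1::real} c1" "inj_on c1 {-1..1}" "c1 ` {-1..1} = s1" "c1 (-1) = a" "c1 1 = b"
    using arc_param[OF B.seg_arc[OF s1(1)] ends(1)] .
  obtain c3 where c3: "continuous_on {-1..1::real} c3" "inj_on c3 {-1..1}" "c3 ` {-1..1} = s3" "c3 (-1) = c" "c3 1 = d"
    using arc_param[OF B.seg_arc[OF s3(1)] ends(2)] .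
  let ?c = "\<lambda>y. c1 (- y)"
  have r: "uminus ` {-1..1::real} = {-1..1}" by simp
  have c1': "continuous_on {-1..1::real} ?c" "inj_on ?c {-1..1}" "?c ` {-1..1} = s1" "?c (-1) = b" "?c 1 = a"
  proof -
    show "continuous_on {-1..1::real} ?c" by (rule continuous_on_compose2[OF c1(1)]) (auto intro!: continuous_intros)
    show "inj_on ?c {-1..1}"
    proof (rule inj_onI)
      fix y z :: real assume "y \<in> {-1..1}" "z \<in> {-1..1}" "c1 (- y) = c1 (- z)"
      then have "- y = - z" by (intro inj_onD[OF c1(2)]) auto
      then show "y = z" by simp
    qed
    have "?c ` {-1..1} = c1 ` uminus ` {-1..1::real}" by (simp only: image_image)
    then show "?c ` {-1..1} = s1" using c1(3) r by simp
  qed (use c1 in auto)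
  obtain N1 where N1: "N1 \<in> B.gaps_of e" "arc_ends N1 = {a, c}"
  proof -
    obtain g where "g \<in> B.gaps_of (B.ed a)" "arc_ends g = {a, B.\<sigma> a}" using B.sigma_gap[OF inB(1)] .
    then show thesis using that[of g] B.X_ed[OF inB(1)] st by simp
  qed
  obtain N2 where N2: "N2 \<in> B.gaps_of e" "arc_ends N2 = {b, d}"
  proof -
    obtain g where "g \<in> B.gaps_of (B.ed b)" "arc_ends g = {b, B.\<sigma> b}" using B.sigma_gap[OF inB(2)] .
    then show thesis using that[of g] B.X_ed[OF inB(2)] st by simp
  qed
  obtain L1 where L1: "L1 \<in> B.gaps_of v" "arc_ends L1 = {c, b}"
  proof -
    obtain g where "g \<in> B.gaps_of (B.vx c)" "arc_ends g = {c, B.\<alpha> c}" using B.alpha_gap[OF inB(3)] .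
    then show thesis using that[of g] B.X_vx[OF inB(3)] al by simp
  qed
  obtain L2 where L2: "L2 \<in> B.gaps_of v" "arc_ends L2 = {d, a}"
  proof -
    obtain g where "g \<in> B.gaps_of (B.vx d)" "arc_ends g = {d, B.\<alpha> d}" using B.alpha_gap[OF inB(4)] .
    then show thesis using that[of g] B.X_vx[OF inB(4)] al by simp
  qed
  obtain He Ke where He: "homeomorphism rectangle e He Ke"
    "\<And>y. y \<in> {-1..1} \<Longrightarrow> He (Complex 0 y) = c1 y" "\<And>y. y \<in> {-1..1} \<Longrightarrow> He (Complex 1 y) = c3 y"
    by (rule B.two_seg_rectangle[OF disjI2[OF refl] eE(1) Bsegs(1) ne ends N1(1) N2(1) N1(2) N2(2) c1 c3]) blast
  obtain Hv Kv where Hv: "homeomorphism rectangle v Hv Kv"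
    "\<And>y. y \<in> {-1..1} \<Longrightarrow> Hv (Complex 0 y) = c3 y" "\<And>y. y \<in> {-1..1} \<Longrightarrow> Hv (Complex 1 y) = ?c y"
    by (rule B.two_seg_rectangle[OF disjI1[OF refl] eE(2) Bsegs(2) ne[symmetric] ends(2) e1 L1(1) L2(1) L1(2) L2(2) c3 c1']) blast
  have ve: "v \<inter> e = c1 ` {-1..1} \<union> c3 ` {-1..1}"
  proof -
    have "v \<inter> e = \<Union>(components (v \<inter> e))" by simp
    then show ?thesis unfolding loop_segs(2)[OF L, symmetric] segs c1(3) c3(3) by simp
  qed
  show "v \<union> e homeomorphic moebius_band"
    by (rule two_rectangles_moebius[OF He(1) Hv(1) He(2) Hv(3) He(3) Hv(2) ve]) (use closed_disc loop_atD[OF L] in auto)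
qed

end

section \<open>Cycles interlaced with a loop\<close>

text \<open>Two points cut a simple closed curve into two arcs, which meet in these points only; a connected set
  that avoids both points lies in one of the arcs.\<close>

lemma simple_loop_separates:
  fixes \<gamma> :: "real \<Rightarrow> 'a::t2_space"
  assumes \<gamma>: "simple_path \<gamma>" and ab: "0 \<le> a" "a < b" "b \<le> 1"
    and T: "connected T" "T \<subseteq> path_image \<gamma>" "\<gamma> a \<notin> T" "\<gamma> b \<notin> T" and x: "x \<in> T" "x \<in> \<gamma> ` {a<..<b}"
  shows "T \<subseteq> \<gamma> ` {a<..<b}"
proof -
  have cont: "continuous_on {0..1} \<gamma>" and lf: "loop_free \<gamma>" using \<gamma> by (auto simp: simple_path_def path_def)
  let ?A = "\<gamma> ` {a..b}" and ?B = "\<gamma> ` ({0..a} \<union> {b..1})"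
  have "compact ?A" "compact ?B"
    using ab by (intro compact_continuous_image continuous_on_subset[OF cont] compact_Un; auto)+
  then have cl: "closed ?A" "closed ?B" by (simp_all add: compact_imp_closed)
  have cover: "T \<subseteq> ?A \<union> ?B"
  proof
    fix y assume "y \<in> T"
    then obtain t where "t \<in> {0..1}" "y = \<gamma> t" using T(2) by (auto simp: path_image_def)
    then show "y \<in> ?A \<union> ?B" by (cases "t \<in> {a..b}") auto
  qed
  have disj: "?A \<inter> ?B \<inter> T = {}"
  proof (rule ccontr)
    assume "?A \<inter> ?B \<inter> T \<noteq> {}"
    then obtain y where y: "y \<in> ?A" "y \<in> ?B" "y \<in> T" by blast
    obtain s where s: "s \<in> {a..b}" "y = \<gamma> s" using y(1) by blast
    obtain t where t: "t \<in> {0..a} \<union> {b..1}" "y = \<gamma> t" using y(2) by blast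
    have "s \<in> {0..1}" "t \<in> {0..1}" using s t ab by auto
    then have "s = t \<or> s = 0 \<and> t = 1 \<or> s = 1 \<and> t = 0" using lf s(2) t(2) unfolding loop_free_def by metis
    then have "s = a \<or> s = b" using s(1) t(1) ab by auto
    then show False using s(2) y(3) T(3,4) by auto
  qed
  have "x \<in> ?A" using x(2) by auto
  then have "?B \<inter> T = {}" using connected_closedD[OF T(1) _ cover cl] disj x(1) by blast
  then have "T \<subseteq> ?A" using cover by blast
  then show ?thesis
  proof (intro subsetI)
    fix y assume y: "y \<in> T" and "T \<subseteq> ?A"
    then obtain s where "s \<in> {a..b}" "y = \<gamma> s" by blast
    moreover have "s \<noteq> a" "s \<noteq> b" using calculation y T(3,4) by auto
    ultimately show "y \<in> \<gamma> ` {a<..<b}" by auto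
  qed
qed

lemma circle_path_from:
  fixes C :: "'a::t2_space set"
  assumes "is_circle C" "p \<in> C"
  obtains \<gamma> where "simple_path \<gamma>" "pathfinish \<gamma> = pathstart \<gamma>" "path_image \<gamma> = C" "pathstart \<gamma> = p"
proof -
  obtain f g where h: "homeomorphism (sphere (0::complex) 1) C f g"
    using assms homeomorphicD(2) unfolding is_circle_def by blast
  obtain \<gamma> where \<gamma>: "simple_path \<gamma>" "pathfinish \<gamma> = pathstart \<gamma>" "path_image \<gamma> = sphere (0::complex) 1"
    using unit_circle_path .
  define z where "z = g p / pathstart \<gamma>"
  have "g p \<in> sphere 0 1" "pathstart \<gamma> \<in> sphere 0 1"
    using homeomorphism_image2[OF h] assms(2) \<gamma>(3) pathstart_in_path_image[of \<gamma>] by auto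
  then have n: "norm (g p) = 1" "norm (pathstart \<gamma>) = 1" by auto
  then have z: "norm z = 1" "z * pathstart \<gamma> = g p" by (auto simp: z_def norm_divide)
  have rot: "(\<lambda>w. z * w) ` sphere 0 1 = sphere 0 1"
  proof
    show "(\<lambda>w. z * w) ` sphere 0 1 \<subseteq> sphere 0 1" using z by (auto simp: norm_mult)
    show "sphere 0 1 \<subseteq> (\<lambda>w. z * w) ` sphere 0 1"
    proof
      fix w :: complex assume "w \<in> sphere 0 1"
      then have "w / z \<in> sphere 0 1" using z by (simp add: norm_divide)
      moreover have "z * (w / z) = w" using z(1) by auto
      ultimately show "w \<in> (\<lambda>w. z * w) ` sphere 0 1" by (metis imageI)
    qed
  qed
  have inj: "inj_on (\<lambda>w. f (z * w)) (sphere 0 1)"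
  proof (rule inj_onI)
    fix u w assume uw: "u \<in> sphere 0 1" "w \<in> sphere 0 1" "f (z * u) = f (z * w)"
    have "z * u \<in> sphere 0 1" "z * w \<in> sphere 0 1" using uw z by (auto simp: norm_mult)
    then have "z * u = z * w" using uw(3) homeomorphism_apply1[OF h] by metis
    then show "u = w" using z(1) by auto
  qed
  have cont: "continuous_on (sphere 0 1) (\<lambda>w. f (z * w))"
    by (rule continuous_on_compose2[OF homeomorphism_cont1[OF h]]) (use rot in \<open>auto intro!: continuous_intros\<close>)
  have img: "(\<lambda>w. f (z * w)) ` sphere 0 1 = C"
  proof -
    have "(\<lambda>w. f (z * w)) ` sphere 0 1 = f ` (\<lambda>w. z * w) ` sphere 0 1" by (simp only: image_image)
    then show ?thesis unfolding rot using homeomorphism_image1[OF h] by simp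
  qed
  show ?thesis
  proof (rule that[of "(\<lambda>w. f (z * w)) \<circ> \<gamma>"])
    show "simple_path ((\<lambda>w. f (z * w)) \<circ> \<gamma>)"
      by (rule simple_path_continuous_image[OF \<gamma>(1)]) (use cont inj \<gamma>(3) in simp_all)
    show "pathfinish ((\<lambda>w. f (z * w)) \<circ> \<gamma>) = pathstart ((\<lambda>w. f (z * w)) \<circ> \<gamma>)"
      using \<gamma>(2) by (simp add: pathfinish_def pathstart_def)
    show "path_image ((\<lambda>w. f (z * w)) \<circ> \<gamma>) = C" using img \<gamma>(3) by (simp add: path_image_compose)
    show "pathstart ((\<lambda>w. f (z * w)) \<circ> \<gamma>) = p"
      using z(2) homeomorphism_apply2[OF h assms(2)] by (simp add: pathstart_compose)
  qed
qed

text \<open>Along a path of minimal length no point is repeated.\<close>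

lemma shortest_path_inj:
  assumes "(a, b) \<in> R\<^sup>*"
  obtains n :: nat and f where "f 0 = a" "f n = b" "\<And>i. i < n \<Longrightarrow> (f i, f (Suc i)) \<in> R" "inj_on f {..n}"
proof -
  define n where "n = (LEAST n. (a, b) \<in> R ^^ n)"
  have ex: "\<exists>n. (a, b) \<in> R ^^ n" using assms rtrancl_imp_relpow by blast
  have n: "(a, b) \<in> R ^^ n" unfolding n_def using ex by (rule LeastI_ex)
  have least: "n \<le> m" if "(a, b) \<in> R ^^ m" for m unfolding n_def using that by (rule Least_le)
  obtain f where f: "f 0 = a" "f n = b" "\<forall>i<n. (f i, f (Suc i)) \<in> R" using n unfolding relpow_fun_conv by blast
  have ne: "f i \<noteq> f j" if ij: "i < j" "j \<le> n" for i j
  proof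
    assume eq: "f i = f j"
    have "(a, f i) \<in> R ^^ i" unfolding relpow_fun_conv using f ij by (intro exI[of _ f]) auto
    moreover have "(f j, b) \<in> R ^^ (n - j)"
      unfolding relpow_fun_conv using f ij by (intro exI[of _ "\<lambda>k. f (j + k)"]) auto
    ultimately have "(a, b) \<in> R ^^ (i + (n - j))" unfolding relpow_add using eq by auto
    then show False using least ij by fastforce
  qed
  have "inj_on f {..n}"
  proof (rule inj_onI)
    fix i j assume "i \<in> {..n}" "j \<in> {..n}" "f i = f j"
    then show "i = j" using ne[of i j] ne[of j i] by (cases i j rule: linorder_cases) auto
  qed
  then show ?thesis using that f by blast
qed

context ribbon_surface
begin

abbreviation avoiding :: "'a set \<Rightarrow> ('a \<times> 'a) set" where
  "avoiding e \<equiv> flags.joined (flags.graph_state(e := {}))"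

lemma seg_components_of_edges:
  assumes v: "v \<in> V" and A: "A \<subseteq> E"
  shows "components (v \<inter> \<Union>A) = {s \<in> segs_of v. \<exists>g\<in>A. s \<subseteq> g}"
proof -
  let ?S = "{s \<in> segs_of v. \<exists>g\<in>A. s \<subseteq> g}"
  have "v \<inter> \<Union>A = \<Union>?S"
  proof
    show "v \<inter> \<Union>A \<subseteq> \<Union>?S"
    proof
      fix x assume "x \<in> v \<inter> \<Union>A"
      then obtain g where g: "g \<in> A" "x \<in> v \<inter> g" by blast
      then have "g \<in> E" using A by blast
      then obtain s where "s \<in> segs" "s \<subseteq> v" "s \<subseteq> g" "x \<in> s" using inter_segs[OF v] g(2) by blast
      then show "x \<in> \<Union>?S" using g(1) unfolding segs_of_def by blast
    qed
    show "\<Union>?S \<subseteq> v \<inter> \<Union>A" unfolding segs_of_def by blast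
  qed
  moreover have "components (\<Union>?S) = ?S"
  proof (rule components_arcs)
    show "finite ?S" using finite_segs_of by simp
    show "is_arc s" if "s \<in> ?S" for s using that seg_arc by (simp add: segs_of_def)
    show "pairwise disjnt ?S" using disj_segs_of[of v] by (rule pairwise_subset) blast
  qed
  ultimately show ?thesis by simp
qed

lemma vertex_avoiding:
  assumes L: "loop_at e v" and x: "x \<in> X" "y \<in> X" "vx x = vx y" "vx x \<noteq> v"
  shows "(x, y) \<in> avoiding e"
proof -
  have "(x, z) \<in> avoiding e" if "(x, z) \<in> flags.joined flags.seg_state" for z
    using that
  proof induction
    case (step y z)
    have y: "y \<in> X" using flags.step_X[OF step(2)] by blast
    have "vx y \<noteq> v" using joined_vx[OF step(1) x(1)] x(4) by simp
    then have "ed y \<noteq> e" using loop_atD(4)[OF L y] by blast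
    from step(2) have "(y, z) \<in> avoiding e"
    proof (cases "z = \<alpha> y")
      case True then show ?thesis using flags.joined_alpha[OF y] by simp
    next
      case False
      then have "z = flags.act Seg y" using step(2) by (auto simp: flags.step_def flags.seg_state_def)
      moreover have "Seg \<in> (flags.graph_state(e := {})) (ed y)" using \<open>ed y \<noteq> e\<close> by (simp add: flags.graph_state_def)
      ultimately show ?thesis using flags.joined_act[OF y, of Seg "flags.graph_state(e := {})"] by simp
    qed
    then show ?case using step.IH flags.joined_trans by blast
  qed simp
  then show ?thesis using vertex_joined[OF x(1,2,3)] by blast
qed

lemma edge_avoiding:
  assumes x: "x \<in> X" "y \<in> X" "ed x = ed y" "ed x \<noteq> e"
  shows "(x, y) \<in> avoiding e"
proof -
  have "flags.all_joined (flags.graph_state(e := {})) (ed x)"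
  proof (rule flags.all_joinedI2[OF x(1), of Seg Side])
    show "(z, flags.act Seg z) \<in> avoiding e" if "z \<in> X" "ed z = ed x" for z
      using that x(4) by (intro flags.joined_act) (auto simp: flags.graph_state_def)
    show "(x, flags.act Side x) \<in> avoiding e"
      using x(1,4) by (intro flags.joined_act) (auto simp: flags.graph_state_def)
  qed simp
  then show ?thesis using x(1,2,3) unfolding flags.all_joined_def by simp
qed

lemma seg_state_avoiding: "flags.joined (flags.seg_state(e := {})) \<subseteq> avoiding e"
  by (rule flags.joined_mono) (auto simp: flags.seg_state_def flags.graph_state_def)

lemma loop_gaps:
  assumes L: "loop_at e v"
  shows "\<And>g. g \<in> ribbon_surface.gaps_of {v} {e} v \<Longrightarrow> is_arc g"
    "pairwise disjnt (ribbon_surface.gaps_of {v} {e} v)"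
    "\<Union>(ribbon_surface.gaps_of {v} {e} v) = surface_boundary v - \<Union>(relint ` segs_of e)"
    "g \<in> ribbon_surface.gaps_of {v} {e} v \<Longrightarrow> \<exists>x\<in>X. ed x = e \<and>
       arc_ends g = {x, flags.act (flags.matching flags.seg_state e) x}"
    "g \<in> ribbon_surface.gaps_of {v} {e} v \<Longrightarrow> s \<in> segs_of e \<Longrightarrow> g \<inter> s \<subseteq> arc_ends g"
    "g \<in> ribbon_surface.gaps_of {v} {e} v \<Longrightarrow> x \<in> X \<Longrightarrow> ed x = e \<Longrightarrow> x \<in> g \<Longrightarrow> x \<in> arc_ends g"
proof -
  interpret B: ribbon_surface "{v}" "{e}" by (rule loop_ribbon_surface[OF L])
  have vB: "v \<in> {v} \<union> {e}" by simp
  have ne: "B.segs_of v \<noteq> {}" unfolding loop_segs(4)[OF L] using segs_of_edge_nonempty loop_atD(1)[OF L] by blast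
  note G = B.gaps_of[OF vB ne]
  show arc: "\<And>g. g \<in> B.gaps_of v \<Longrightarrow> is_arc g" by (rule G(2))
  show "pairwise disjnt (B.gaps_of v)" by (rule G(3))
  show "\<Union>(B.gaps_of v) = surface_boundary v - \<Union>(relint ` segs_of e)" using G(5) unfolding loop_segs(4)[OF L] .
  have meet: "g \<inter> s \<subseteq> arc_ends g" if "g \<in> B.gaps_of v" "s \<in> segs_of e" for g s
    using B.gap_seg_meet(1)[OF vB ne that(1)] that(2) loop_segs(1)[OF L] by blast
  then show "g \<in> B.gaps_of v \<Longrightarrow> s \<in> segs_of e \<Longrightarrow> g \<inter> s \<subseteq> arc_ends g" .
  show "x \<in> arc_ends g" if g: "g \<in> B.gaps_of v" and x: "x \<in> X" "ed x = e" "x \<in> g" for g x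
  proof -
    have "x \<in> e" using X_ed[OF x(1)] x(2) by simp
    then obtain s where "s \<in> segs_of e" "x \<in> arc_ends s" using X_in_edge[OF loop_atD(1)[OF L] x(1)] by blast
    then show ?thesis using meet[OF g, of s] x(3) arc_ends_subset[of s] by blast
  qed
  assume g: "g \<in> B.gaps_of v"
  obtain x where x: "x \<in> arc_ends g" using arc_ends_card[OF arc[OF g]] by fastforce
  have "x \<in> \<Union>(arc_ends ` B.gaps_of v)" using g x by blast
  then have "x \<in> \<Union>(arc_ends ` segs_of e)" unfolding G(4) loop_segs(4)[OF L] .
  then have xB: "x \<in> B.X" unfolding B.X_def loop_segs(1)[OF L] .
  then have xX: "x \<in> X" "ed x = e" using loop_segs(6)[OF L] by auto
  have gB: "g \<in> B.arcs_of {v}" using B.gaps_of_V[OF _ ne] g by blast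
  have "arc_ends g = {x, B.\<alpha> x}" by (rule B.alpha_ends[OF gB x])
  then show "\<exists>x\<in>X. ed x = e \<and> arc_ends g = {x, flags.act (flags.matching flags.seg_state e) x}"
    using loop_gap_matching(1)[OF L xX] xX by auto
qed

text \<open>The segment is connected and disjoint from the two segments of \<open>e\<close>.\<close>

lemma seg_in_loop_gap:
  assumes L: "loop_at e v" and s: "s \<in> segs_of v" "s \<notin> segs_of e"
  obtains g where "g \<in> ribbon_surface.gaps_of {v} {e} v" "s \<subseteq> g" "s \<inter> arc_ends g = {}"
proof -
  interpret B: ribbon_surface "{v}" "{e}" by (rule loop_ribbon_surface[OF L])
  have sS: "s \<in> segs" using s by (simp add: segs_of_def)
  have dis: "s \<inter> t = {}" if "t \<in> segs_of e" for t
    using seg_eq[OF sS, of t] that s(2) by (auto simp: segs_of_def)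
  obtain y where y: "y \<in> s" using seg_nonempty[OF sS] by blast
  have "y \<in> surface_boundary v" using segs_of_boundary[of v s] s(1) loop_atD(2)[OF L] y by blast
  moreover have "y \<notin> \<Union>(relint ` segs_of e)" using dis y by (auto simp: relint_def)
  ultimately obtain g where g: "g \<in> B.gaps_of v" "y \<in> g" using loop_gaps(3)[OF L] by blast
  have "s \<subseteq> g" using loop_gap_pieces(2)[OF L g(1), of s] s y g(2) by blast
  moreover have "s \<inter> arc_ends g = {}"
  proof -
    obtain x where x: "x \<in> X" "ed x = e" "arc_ends g = {x, flags.act (flags.matching flags.seg_state e) x}"
      using loop_gaps(4)[OF L g(1)] by blast
    have "z \<notin> s" if z: "z \<in> X" "ed z = e" for z
    proof
      assume "z \<in> s"
      have "z \<in> e" using X_ed[OF z(1)] z(2) by simp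
      then have "s \<subseteq> e" using seg_subset_disc(1)[OF sS _ \<open>z \<in> s\<close>, of e] loop_atD(1)[OF L] by blast
      then show False using s(2) sS by (simp add: segs_of_def)
    qed
    then show ?thesis using x flags.act_props(1,4)[OF x(1)] by auto
  qed
  ultimately show ?thesis using that g(1) by blast
qed

lemma gap_flag_avoiding:
  assumes L: "loop_at e v" and g: "g \<in> ribbon_surface.gaps_of {v} {e} v" "x \<in> X" "x \<in> g" "y \<in> X" "y \<in> g"
  shows "(x, y) \<in> avoiding e"
  using loop_gap_joined[OF L g] seg_state_avoiding by blast

text \<open>All flags in a gap are joined to the flags of \<open>e\<close> at its ends by walks that avoid \<open>e\<close>. A walk between
  the two gaps therefore joins all flags of \<open>e\<close>.\<close>

lemma crossing_gaps:
  assumes L: "loop_at e v"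
    and g: "g \<in> ribbon_surface.gaps_of {v} {e} v" "h \<in> ribbon_surface.gaps_of {v} {e} v" "g \<noteq> h"
    and xy: "x \<in> X" "x \<in> g" "y \<in> X" "y \<in> h" "(x, y) \<in> avoiding e"
  shows "\<exists>x\<in>X. ed x = e \<and> (x, \<tau> x) \<in> avoiding e"
proof -
  let ?M = "flags.matching flags.seg_state e"
  have e: "e \<in> ed ` X" using loop_atD(1)[OF L] ed_X by simp
  obtain a where a: "a \<in> X" "ed a = e" "arc_ends g = {a, flags.act ?M a}" using loop_gaps(4)[OF L g(1)] by blast
  obtain b where b: "b \<in> X" "ed b = e" "arc_ends h = {b, flags.act ?M b}" using loop_gaps(4)[OF L g(2)] by blast
  have in_gap: "a \<in> g" "b \<in> h" using a b arc_ends_subset by blast+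
  have "b \<notin> g" using loop_gaps(2)[OF L] g in_gap(2) unfolding pairwise_def disjnt_def by blast
  then have ba: "b \<noteq> a" "b \<noteq> flags.act ?M a" using a(3) arc_ends_subset[of g] by auto
  have "(a, b) \<in> avoiding e"
    by (rule flags.joined_trans[OF flags.joined_trans[OF gap_flag_avoiding[OF L g(1) a(1) in_gap(1) xy(1,2)] xy(5)]
          gap_flag_avoiding[OF L g(2) xy(3,4) b(1) in_gap(2)]])
  moreover obtain m where m: "b = flags.act m a" using flags.same_edge[OF a(1) b(1)] a(2) b(2) ba(1) by metis
  ultimately have am: "(a, flags.act m a) \<in> avoiding e" by simp
  have "m \<noteq> ?M" using m ba(2) by auto
  have "flags.all_joined (flags.graph_state(e := {})) (ed a)"
  proof (rule flags.all_joinedI2[OF a(1) \<open>m \<noteq> ?M\<close>[symmetric] _ am])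
    fix z assume z: "z \<in> X" "ed z = ed a"
    then have "(z, flags.act ?M z) \<in> flags.joined (flags.seg_state(e := {}))"
      using flags.matching[OF flags.smooth_seg z(1), of e ?M] a(2) by simp
    then show "(z, flags.act ?M z) \<in> avoiding e" using seg_state_avoiding by blast
  qed
  then have "(a, \<tau> a) \<in> avoiding e" using tau_X[OF a(1)] tau_ed_vx(1)[OF a(1)] a(1) unfolding flags.all_joined_def by simp
  then show ?thesis using a by blast
qed

text \<open>Starting with the edge that leaves \<open>v\<close>, the cycle can be followed to each of its edges without
  returning to \<open>v\<close>, because its vertices are distinct. At the other vertices all flags are joined without
  using \<open>e\<close>.\<close>

lemma cycle_avoiding:
  assumes L: "loop_at e v"
    and vs: "length es = length vs" "distinct vs" "set vs \<subseteq> V" "set es \<subseteq> E"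
    and ends: "\<And>i. i < length vs \<Longrightarrow> {w \<in> V. w \<inter> es ! i \<noteq> {}} = {vs ! i, vs ! (Suc i mod length vs)}"
    and k: "k < length vs" "vs ! k = v" and e: "e \<notin> set es"
    and xy: "x \<in> X" "ed x \<in> set es" "y \<in> X" "ed y \<in> set es"
  shows "(x, y) \<in> avoiding e"
proof -
  let ?n = "length vs"
  have n: "0 < ?n" using k by auto
  have fl: "\<exists>z\<in>X. ed z = es ! i \<and> vx z = w" if "i < ?n" "w = vs ! i \<or> w = vs ! (Suc i mod ?n)" for i w
  proof -
    have "es ! i \<in> E" using that(1) vs(1,4) by (metis nth_mem subsetD)
    then have "w \<in> vx ` {x \<in> X. ed x = es ! i}" using ends_flags[of "es ! i"] ends[OF that(1)] that(2) by auto
    then show ?thesis by auto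
  qed
  have notv: "es ! i \<noteq> e" if "i < ?n" for i using that e vs(1) by (metis nth_mem)
  have walk: "(z, w) \<in> avoiding e"
    if "j < ?n" "z \<in> X" "ed z = es ! k" "w \<in> X" "ed w = es ! ((k + j) mod ?n)" for j z w
    using that
  proof (induction j arbitrary: w)
    case 0
    then have "ed z = ed w" using k(1) by simp
    have "ed z \<noteq> e" using 0(3) notv[OF k(1)] by simp
    then show ?case using edge_avoiding[OF 0(2,4), of e] \<open>ed z = ed w\<close> by (simp del: fun_upd_apply)
  next
    case (Suc j)
    let ?i = "(k + j) mod ?n" and ?i' = "(k + Suc j) mod ?n"
    have i: "?i < ?n" "?i' < ?n" using n by auto
    have ii: "Suc ?i mod ?n = ?i'" by (simp add: mod_Suc_eq)
    let ?u = "vs ! ?i'"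
    (* after j + 1 < n steps the cycle has not come back to v *)
    have "?i' \<noteq> k"
    proof
      assume eq: "?i' = k"
      show False
      proof (cases "k + Suc j < ?n")
        case True then show False using eq by simp
      next
        case False
        then have "?i' = k + Suc j - ?n" using Suc.prems(1) k(1) by (simp add: mod_if)
        then show False using eq Suc.prems(1) False by linarith
      qed
    qed
    then have uv: "?u \<noteq> v" using vs(2) i(2) k nth_eq_iff_index_eq by metis
    obtain p where p: "p \<in> X" "ed p = es ! ?i" "vx p = ?u" using fl[OF i(1), of ?u] ii by auto
    obtain q where q: "q \<in> X" "ed q = es ! ?i'" "vx q = ?u" using fl[OF i(2), of ?u] by auto
    have "(z, p) \<in> avoiding e" by (rule Suc.IH) (use Suc.prems p in auto)
    moreover have "(p, q) \<in> avoiding e" by (rule vertex_avoiding[OF L p(1) q(1)]) (use p(3) q(3) uv in simp_all)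
    moreover have "(q, w) \<in> avoiding e" by (rule edge_avoiding[OF q(1) Suc.prems(4)]) (use q(2) Suc.prems(5) notv[OF i(2)] in simp_all)
    ultimately show ?case using flags.joined_trans by metis
  qed
  obtain z where z: "z \<in> X" "ed z = es ! k" using fl[OF k(1)] by blast
  have reach: "(z, w) \<in> avoiding e" if w: "w \<in> X" "ed w \<in> set es" for w
  proof -
    obtain i where i: "i < ?n" "ed w = es ! i" using w(2) vs(1) by (metis in_set_conv_nth)
    define j where "j = (if k \<le> i then i - k else i + ?n - k)"
    have "j < ?n" "(k + j) mod ?n = i" using i(1) k(1) by (auto simp: j_def)
    then show ?thesis by (intro walk[of j z w]) (use z w i in simp_all)
  qed
  show ?thesis using reach[OF xy(1,2)] reach[OF xy(3,4)] flags.joined_sym flags.joined_trans by metis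
qed

end

definition alternating :: "'b::t2_space set \<Rightarrow> 'b set set \<Rightarrow> 'b set set \<Rightarrow> bool" where
  "alternating v A B \<longleftrightarrow>
     (\<exists>\<gamma> t1 t2 t3 t4 s1 s2 s3 s4.
        simple_path \<gamma> \<and> pathfinish \<gamma> = pathstart \<gamma> \<and> path_image \<gamma> = surface_boundary v \<and>
        0 \<le> t1 \<and> t1 < t2 \<and> t2 < t3 \<and> t3 < t4 \<and> t4 < 1 \<and>
        s1 \<in> components (v \<inter> \<Union>A) \<and> s3 \<in> components (v \<inter> \<Union>A) \<and>
        s2 \<in> components (v \<inter> \<Union>B) \<and> s4 \<in> components (v \<inter> \<Union>B) \<and>
        distinct [s1, s2, s3, s4] \<and>
        \<gamma> t1 \<in> s1 \<and> \<gamma> t2 \<in> s2 \<and> \<gamma> t3 \<in> s3 \<and> \<gamma> t4 \<in> s4)"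

lemma interlaced_alternating:
  "interlaced C1 C2 \<longleftrightarrow> (\<exists>v. verts C1 \<inter> verts C2 = {v} \<and> alternating v (edges C1) (edges C2))"
  unfolding interlaced_def alternating_def by (rule refl)

lemma alternatingI:
  assumes "simple_path \<gamma>" "pathfinish \<gamma> = pathstart \<gamma>" "path_image \<gamma> = surface_boundary v"
    and "0 \<le> t1" "t1 < t2" "t2 < t3" "t3 < t4" "t4 < 1"
    and "s1 \<in> components (v \<inter> \<Union>A)" "s3 \<in> components (v \<inter> \<Union>A)"
    and "s2 \<in> components (v \<inter> \<Union>B)" "s4 \<in> components (v \<inter> \<Union>B)"
    and "distinct [s1, s2, s3, s4]" "\<gamma> t1 \<in> s1" "\<gamma> t2 \<in> s2" "\<gamma> t3 \<in> s3" "\<gamma> t4 \<in> s4"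
  shows "alternating v A B"
  unfolding alternating_def
  by (rule exI[of _ \<gamma>], rule exI[of _ t1], rule exI[of _ t2], rule exI[of _ t3], rule exI[of _ t4],
      rule exI[of _ s1], rule exI[of _ s2], rule exI[of _ s3], rule exI[of _ s4], intro conjI) (rule assms)+

context ribbon_surface
begin

definition cyclic_edges :: "'a set list \<Rightarrow> 'a set list \<Rightarrow> bool" where
  "cyclic_edges vs es \<longleftrightarrow> length es = length vs \<and> vs \<noteq> [] \<and> distinct vs \<and> distinct es \<and> set vs \<subseteq> V \<and> set es \<subseteq> E \<and>
     (\<forall>i<length vs. {w \<in> V. w \<inter> es ! i \<noteq> {}} = {vs ! i, vs ! (Suc i mod length vs)})"

text \<open>The two segments of the cycle at \<open>v\<close> lie in different gaps of \<open>e\<close>, because on the circle they are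
  separated by the segments of \<open>e\<close>; and the cycle itself is a walk between them.\<close>

lemma alternating_imp_crossing:
  assumes L: "loop_at e v" and C: "cyclic_edges vs es" "v \<in> set vs" and alt: "alternating v {e} (set es)"
  shows "\<exists>x\<in>X. ed x = e \<and> (x, \<tau> x) \<in> avoiding e"
proof -
  note C' = C(1)[unfolded cyclic_edges_def]
  have len: "length es = length vs" and dv: "distinct vs" and sub: "set vs \<subseteq> V" "set es \<subseteq> E"
    and ends: "\<And>i. i < length vs \<Longrightarrow> {w \<in> V. w \<inter> es ! i \<noteq> {}} = {vs ! i, vs ! (Suc i mod length vs)}"
    using C' by auto
  obtain \<gamma> t1 t2 t3 t4 s1 s2 s3 s4 where \<gamma>: "simple_path \<gamma>" "path_image \<gamma> = surface_boundary v"
    and t: "0 \<le> t1" "t1 < t2" "t2 < t3" "t3 < t4" "t4 < 1"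
    and s: "s1 \<in> components (v \<inter> \<Union>{e})" "s3 \<in> components (v \<inter> \<Union>{e})" "s2 \<in> components (v \<inter> \<Union>(set es))" "s4 \<in> components (v \<inter> \<Union>(set es))"
    and dist: "distinct [s1, s2, s3, s4]" and pts: "\<gamma> t1 \<in> s1" "\<gamma> t2 \<in> s2" "\<gamma> t3 \<in> s3" "\<gamma> t4 \<in> s4"
    using alt unfolding alternating_def by (elim exE conjE)
  have e: "e \<in> E" "v \<in> V" using loop_atD[OF L] by auto
  have se: "s1 \<in> segs_of e" "s3 \<in> segs_of e" using s(1,2) by (simp_all add: loop_segs(2)[OF L])
  have sv: "s2 \<in> segs_of v" "s4 \<in> segs_of v" using s(3,4) unfolding seg_components_of_edges[OF e(2) sub(2)] by blast+
  obtain g2 where g2: "g2 \<in> set es" "s2 \<subseteq> g2" using s(3) unfolding seg_components_of_edges[OF e(2) sub(2)] by blast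
  obtain g4 where g4: "g4 \<in> set es" "s4 \<subseteq> g4" using s(4) unfolding seg_components_of_edges[OF e(2) sub(2)] by blast
  have segs: "segs_of e = {s1, s3}"
  proof -
    obtain s' where "segs_of e = {s1, s'}" using edge_segs[OF e(1) se(1)] .
    then show ?thesis using se(2) dist by auto
  qed
  have not_e: "s2 \<notin> segs_of e" "s4 \<notin> segs_of e" using segs dist by auto
  have S: "s2 \<in> segs" "s4 \<in> segs" using sv by (auto simp: segs_of_def)
  have e_out: "e \<notin> set es"
  proof
    assume "e \<in> set es"
    then obtain i where i: "i < length vs" "es ! i = e" using len by (metis in_set_conv_nth)
    have "{w \<in> V. w \<inter> e \<noteq> {}} = {v}" using L by (simp add: loop_at_def)
    then have "vs ! i = vs ! (Suc i mod length vs)" using ends[OF i(1)] i(2) by (metis doubleton_eq_iff insert_absorb2)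
    moreover have lt: "Suc i mod length vs < length vs" using i(1) by (intro mod_less_divisor) auto
    ultimately have ii: "i = Suc i mod length vs" using dv i(1) nth_eq_iff_index_eq by blast
    (* consecutive equal vertices force a cycle of length 1, which is e itself, so that s2 would be a segment of e *)
    have "length vs = 1"
    proof (cases "Suc i < length vs")
      case True then show ?thesis using ii by simp
    next
      case False
      then have "Suc i = length vs" using i(1) by simp
      then show ?thesis using ii by simp
    qed
    then have "length es = 1" "i = 0" using len i(1) by auto
    then have "set es = {e}" using i(2) by (cases es) auto
    then have "s2 \<subseteq> e" using g2 by simp
    then show False using not_e(1) S(1) by (simp add: segs_of_def)
  qed
  obtain g where g: "g \<in> ribbon_surface.gaps_of {v} {e} v" "s2 \<subseteq> g" "s2 \<inter> arc_ends g = {}"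
    using seg_in_loop_gap[OF L sv(1) not_e(1)] .
  obtain h where h: "h \<in> ribbon_surface.gaps_of {v} {e} v" "s4 \<subseteq> h" "s4 \<inter> arc_ends h = {}"
    using seg_in_loop_gap[OF L sv(2) not_e(2)] .
  have gh: "g \<noteq> h"
  proof
    assume gh: "g = h"
    let ?T = "g - arc_ends g"
    have "?T \<subseteq> surface_boundary v" using loop_gaps(3)[OF L] g(1) by blast
    then have T: "connected ?T" "?T \<subseteq> path_image \<gamma>"
      using arc_relint_connected(1)[OF loop_gaps(1)[OF L g(1)]] \<gamma>(2) by auto
    have "\<gamma> t1 \<notin> ?T" "\<gamma> t3 \<notin> ?T" using loop_gaps(5)[OF L g(1)] se pts(1,3) by blast+
    moreover have "\<gamma> t2 \<in> ?T" "\<gamma> t4 \<in> ?T" using g h gh pts(2,4) by blast+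
    moreover have "\<gamma> t2 \<in> \<gamma> ` {t1<..<t3}" using t by auto
    ultimately have "?T \<subseteq> \<gamma> ` {t1<..<t3}"
      using simple_loop_separates[OF \<gamma>(1) t(1), of t3 ?T "\<gamma> t2"] T t by auto
    then obtain u where u: "u \<in> {t1<..<t3}" "\<gamma> t4 = \<gamma> u" using \<open>\<gamma> t4 \<in> ?T\<close> by blast
    have "t4 \<in> {0..1}" "u \<in> {0..1}" using t u by auto
    then have "t4 = u \<or> t4 = 0 \<and> u = 1 \<or> t4 = 1 \<and> u = 0"
      using \<gamma>(1) u(2) unfolding simple_path_def loop_free_def by blast
    then show False using u(1) t by auto
  qed
  obtain x where x: "x \<in> arc_ends s2" using arc_ends_card[OF seg_arc[OF S(1)]] by fastforce
  obtain y where y: "y \<in> arc_ends s4" using arc_ends_card[OF seg_arc[OF S(2)]] by fastforce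
  have xy: "x \<in> X" "x \<in> s2" "y \<in> X" "y \<in> s4" using X_seg S x y arc_ends_subset by blast+
  have "x \<in> g2" "y \<in> g4" "g2 \<in> E" "g4 \<in> E" using xy g2 g4 sub(2) by blast+
  then have exy: "ed x \<in> set es" "ed y \<in> set es" using ed_eq g2(1) g4(1) by simp_all
  obtain k where k: "k < length vs" "vs ! k = v" using C(2) by (metis in_set_conv_nth)
  have "(x, y) \<in> avoiding e"
    by (rule cycle_avoiding[OF L len dv sub ends k e_out xy(1) exy(1) xy(3) exy(2)])
  then show ?thesis using crossing_gaps[OF L g(1) h(1) gh xy(1) _ xy(3)] xy g(2) h(2) by blast
qed

text \<open>Consider the graph without \<open>e\<close> in which \<open>v\<close> is split into its two gaps \<open>g1\<close> and \<open>g2\<close>. The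
  walk yields a shortest path in it from \<open>g1\<close> to \<open>g2\<close>, whose nodes are distinct. Identifying the gaps with
  \<open>v\<close> again turns the path into a cycle, which meets \<open>v\<close> in a segment in each of the gaps.\<close>

lemma crossing_imp_alternating:
  assumes L: "loop_at e v" and x0: "x0 \<in> X" "ed x0 = e" "(x0, \<tau> x0) \<in> avoiding e"
  shows "\<exists>vs es. cyclic_edges vs es \<and> v \<in> set vs \<and> alternating v {e} (set es)"
proof -
  let ?M = "flags.matching flags.seg_state e"
  let ?G = "ribbon_surface.gaps_of {v} {e} v"
  have e: "e \<in> E" "v \<in> V" "e \<in> ed ` X" using loop_atD[OF L] ed_X by auto
  have MS: "?M \<noteq> Seg" by (rule flags.matching_seg_loop[OF loop_atD(5)[OF L] e(3)])
  have gap_eq: "g = h" if "g \<in> ?G" "h \<in> ?G" "y \<in> g" "y \<in> h" for g h y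
    using loop_gaps(2)[OF L] that unfolding pairwise_def disjnt_def by blast
  have gap_v: "g \<subseteq> v" "g \<noteq> {}" if "g \<in> ?G" for g
  proof -
    have "g \<subseteq> surface_boundary v" using loop_gaps(3)[OF L] that by blast
    then show "g \<subseteq> v" using surface_boundary_subset by blast
    show "g \<noteq> {}" using arc_nonempty[OF loop_gaps(1)[OF L that]] .
  qed
  have at_v: "\<exists>g\<in>?G. y \<in> g" if y: "y \<in> X" "vx y = v" for y
  proof -
    have "y \<in> v" using X_vx[OF y(1)] y(2) by simp
    then have "y \<in> surface_boundary v" using X_boundary[OF y(1), of v] e(2) by blast
    moreover have "y \<notin> relint s" if "s \<in> segs_of e" for s
      using seg_X[of s y] that y(1) by (auto simp: segs_of_def relint_def)
    ultimately show ?thesis using loop_gaps(3)[OF L] by blast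
  qed
  (* N y is the node of the split graph at the flag y *)
  define N where "N y = (if vx y = v then (SOME g. g \<in> ?G \<and> y \<in> g) else vx y)" for y
  have Nv: "N y \<in> ?G" "y \<in> N y" if y: "y \<in> X" "vx y = v" for y
  proof -
    have "\<exists>g. g \<in> ?G \<and> y \<in> g" using at_v[OF y] by blast
    then have "(SOME g. g \<in> ?G \<and> y \<in> g) \<in> ?G \<and> y \<in> (SOME g. g \<in> ?G \<and> y \<in> g)" by (rule someI_ex)
    then show "N y \<in> ?G" "y \<in> N y" using y(2) by (simp_all add: N_def)
  qed
  have Nnv: "N y = vx y" if "vx y \<noteq> v" for y using that by (simp add: N_def)
  have N_gap: "vx y = v" if y: "y \<in> X" "N y \<in> ?G" for y
  proof (rule ccontr)
    assume n: "vx y \<noteq> v"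
    then have "vx y \<in> ?G" using Nnv y(2) by simp
    then have "vx y \<subseteq> v" by (rule gap_v(1))
    then show False using X_vx[OF y(1)] V_eq[of "vx y" v y] e(2) n by blast
  qed
  have piece: "N z = N y" if y: "y \<in> X" "z \<in> X" "vx z = vx y"
    and P: "vx y = v \<Longrightarrow> \<exists>P \<in> gaps_of v \<union> (segs_of v - segs_of e). y \<in> P \<and> z \<in> P" for y z
  proof (cases "vx y = v")
    case True
    obtain P where P': "P \<in> gaps_of v \<union> (segs_of v - segs_of e)" "y \<in> P" "z \<in> P" using P[OF True] by blast
    have "P \<subseteq> N y" using loop_gap_pieces(2)[OF L Nv(1)[OF y(1) True] P'(1)] P'(2) Nv(2)[OF y(1) True] by blast
    then have "z \<in> N y" using P'(3) by blast
    have zv: "vx z = v" using True y(3) by simp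
    show ?thesis by (rule gap_eq[OF Nv(1)[OF y(2) zv] Nv(1)[OF y(1) True] Nv(2)[OF y(2) zv] \<open>z \<in> N y\<close>])
  next
    case False then show ?thesis using y(3) Nnv by simp
  qed
  have N_alpha: "N (\<alpha> y) = N y" if y: "y \<in> X" for y
  proof (rule piece[OF y])
    show "\<alpha> y \<in> X" "vx (\<alpha> y) = vx y" using alpha_X[OF y] alpha_vx[OF y] by auto
    assume "vx y = v"
    moreover obtain g where "g \<in> gaps_of (vx y)" "arc_ends g = {y, \<alpha> y}" using alpha_gap[OF y] .
    ultimately show "\<exists>P\<in>gaps_of v \<union> (segs_of v - segs_of e). y \<in> P \<and> \<alpha> y \<in> P"
      using arc_ends_subset[of g] by (intro bexI[of _ g]) auto
  qed
  have own_seg: "\<exists>s\<in>segs_of (vx y) - segs_of e. y \<in> s \<and> \<tau> y \<in> s \<and> s \<subseteq> ed y" if y: "y \<in> X" "ed y \<noteq> e" for y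
  proof -
    obtain s where s: "s \<in> segs" "y \<in> arc_ends s" "y \<in> s" using y(1) by (rule X_segE)
    have "s \<subseteq> vx y" "s \<subseteq> ed y" using seg_subset_disc(1)[OF s(1) _ s(3)] X_vx[OF y(1)] X_ed[OF y(1)] by blast+
    moreover have "s \<notin> segs_of e"
    proof
      assume "s \<in> segs_of e"
      then have "y \<in> e" using s(3) by (auto simp: segs_of_def)
      then show False using ed_eq[OF e(1)] y(2) by simp
    qed
    moreover have "\<tau> y \<in> s" using tau_ends[OF s(1,2)] arc_ends_subset[of s] by blast
    ultimately show ?thesis using s by (auto simp: segs_of_def)
  qed
  have N_tau: "N (\<tau> y) = N y" if y: "y \<in> X" "ed y \<noteq> e" for y
  proof (rule piece[OF y(1)])
    show "\<tau> y \<in> X" "vx (\<tau> y) = vx y" using tau_X[OF y(1)] tau_ed_vx[OF y(1)] by auto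
    assume "vx y = v"
    then show "\<exists>P\<in>gaps_of v \<union> (segs_of v - segs_of e). y \<in> P \<and> \<tau> y \<in> P" using own_seg[OF y] by auto
  qed
  define g1 g2 where "g1 = N x0" and "g2 = N (\<tau> x0)"
  have x0v: "vx x0 = v" "\<tau> x0 \<in> X" "ed (\<tau> x0) = e" "vx (\<tau> x0) = v"
    using loop_atD(4)[OF L x0(1,2)] tau_X[OF x0(1)] tau_ed_vx[OF x0(1)] x0(2) by auto
  have g1: "g1 \<in> ?G" "x0 \<in> g1" and g2: "g2 \<in> ?G" "\<tau> x0 \<in> g2"
    using Nv[OF x0(1) x0v(1)] Nv[OF x0v(2,4)] by (auto simp: g1_def g2_def)
  have gap_ends: "arc_ends h = {y, flags.act ?M y}" if h: "h \<in> ?G" and y: "y \<in> X" "ed y = e" "y \<in> h" for h y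
  proof -
    obtain a where a: "a \<in> X" "arc_ends h = {a, flags.act ?M a}" using loop_gaps(4)[OF L h] by blast
    have "y \<in> arc_ends h" by (rule loop_gaps(6)[OF L h y])
    then show ?thesis using a flags.act_props(2)[OF a(1), of ?M] by auto
  qed
  note ends1 = gap_ends[OF g1(1) x0(1,2) g1(2)] and ends2 = gap_ends[OF g2(1) x0v(2,3) g2(2)]
  have g12: "g1 \<noteq> g2"
  proof
    assume "g1 = g2"
    then have "\<tau> x0 \<in> {x0, flags.act ?M x0}" using ends1 ends2 by auto
    then have "flags.act Seg x0 = flags.act ?M x0" using tau_X[OF x0(1)] by auto
    then have "Seg = ?M" by (rule flags.act_props(5)[OF x0(1), THEN iffD1])
    then show False using MS by simp
  qed
  have two_gaps: "h = g1 \<or> h = g2" if h: "h \<in> ?G" for h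
  proof -
    obtain b where b: "b \<in> X" "ed b = e" "arc_ends h = {b, flags.act ?M b}" using loop_gaps(4)[OF L h] by blast
    have bh: "b \<in> h" using b(3) arc_ends_subset[of h] by blast
    have "b \<in> arc_ends g1 \<or> b \<in> arc_ends g2"
    proof (rule flags.same_edge[OF x0(1) b(1)])
      show "ed x0 = ed b" using x0 b by simp
      show "b = x0 \<Longrightarrow> ?thesis" using ends1 by simp
      fix m assume m: "b = flags.act m x0"
      show ?thesis
      proof (cases "m = ?M \<or> m = Seg")
        case True then show ?thesis using m ends1 ends2 by auto
      next
        case False
        then have "flags.act ?M (flags.act Seg x0) = flags.act m x0" using flags.act_third[OF x0(1), of ?M Seg m] MS by auto
        then show ?thesis using m ends2 by simp
      qed
    qed
    then show ?thesis using gap_eq[OF h g1(1) bh] gap_eq[OF h g2(1) bh] arc_ends_subset by blast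
  qed
  (* the edges of the split graph, each given by a side from y to \<sigma> y *)
  define R where "R = {(N y, N (\<sigma> y)) | y. y \<in> X \<and> ed y \<noteq> e}"
  have "(N x0, N z) \<in> R\<^sup>*" if "(x0, z) \<in> avoiding e" for z
    using that
  proof induction
    case (step y z)
    have y: "y \<in> X" using flags.step_X[OF step(2)] by blast
    from step(2) consider "z = \<alpha> y" | m where "z = flags.act m y" "m \<in> (flags.graph_state(e := {})) (ed y)"
      unfolding flags.step_def by blast
    then show ?case
    proof cases
      case 1 then show ?thesis using step.IH N_alpha[OF y] by simp
    next
      case (2 m)
      then have ye: "ed y \<noteq> e" and m: "m = Seg \<or> m = Side" by (auto simp: flags.graph_state_def split: if_splits)
      from m show ?thesis
      proof
        assume "m = Seg"
        then show ?thesis using step.IH N_tau[OF y ye] 2(1) by simp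
      next
        assume "m = Side"
        then have "(N y, N z) \<in> R" using 2(1) y ye unfolding R_def by auto
        then show ?thesis using step.IH by (rule rtrancl.rtrancl_into_rtrancl[rotated])
      qed
    qed
  qed simp
  from this[OF x0(3)] have "(g1, g2) \<in> R\<^sup>*" unfolding g1_def g2_def .
  then have "\<exists>f n. f 0 = g1 \<and> f n = g2 \<and> (\<forall>i<n. (f i, f (Suc i)) \<in> R) \<and> inj_on f {..n}"
  proof (rule shortest_path_inj)
    fix n and f assume "f 0 = g1" "f n = g2" "\<And>i. i < n \<Longrightarrow> (f i, f (Suc i)) \<in> R" "inj_on f {..n}"
    then show ?thesis by (intro exI[of _ f] exI[of _ n]) simp
  qed
  then obtain f n where f: "f 0 = g1" "f n = g2" "\<And>i. i < n \<Longrightarrow> (f i, f (Suc i)) \<in> R" "inj_on f {..n}"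
    by (elim exE conjE) simp
  have n: "0 < n" using f(1,2) g12 by (cases n) auto
  have finj: "f i = f j \<longleftrightarrow> i = j" if "i \<le> n" "j \<le> n" for i j using inj_on_eq_iff[OF f(4)] that by simp
  have "\<forall>i. \<exists>y. i < n \<longrightarrow> y \<in> X \<and> ed y \<noteq> e \<and> N y = f i \<and> N (\<sigma> y) = f (Suc i)"
  proof
    fix i show "\<exists>y. i < n \<longrightarrow> y \<in> X \<and> ed y \<noteq> e \<and> N y = f i \<and> N (\<sigma> y) = f (Suc i)"
    proof (cases "i < n")
      case True
      then obtain y where "f i = N y" "f (Suc i) = N (\<sigma> y)" "y \<in> X" "ed y \<noteq> e" using f(3) unfolding R_def by blast
      then show ?thesis by auto
    qed simp
  qed
  then obtain Y where "\<forall>i. i < n \<longrightarrow> Y i \<in> X \<and> ed (Y i) \<noteq> e \<and> N (Y i) = f i \<and> N (\<sigma> (Y i)) = f (Suc i)"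
    by (rule choice[THEN exE])
  then have Y: "Y i \<in> X" "ed (Y i) \<noteq> e" "N (Y i) = f i" "N (\<sigma> (Y i)) = f (Suc i)" if "i < n" for i
    using that by blast+
  define u where "u i = (if i = 0 \<or> i = n then v else f i)" for i
  have vxu: "vx y = u i" if y: "y \<in> X" "N y = f i" "i \<le> n" for y i
  proof (cases "i = 0 \<or> i = n")
    case True
    then have "N y \<in> ?G" using y(2) f(1,2) g1(1) g2(1) by auto
    then show ?thesis using N_gap[OF y(1)] True by (simp add: u_def)
  next
    case False
    have "vx y \<noteq> v"
    proof
      assume "vx y = v"
      then have "N y = g1 \<or> N y = g2" using two_gaps Nv(1)[OF y(1)] by blast
      then have "f i = f 0 \<or> f i = f n" using y(2) f(1,2) by simp
      then show False using finj[of i 0] finj[of i n] y(3) False by auto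
    qed
    then show ?thesis using Nnv y(2) False by (simp add: u_def)
  qed
  have sY: "\<sigma> (Y i) \<in> X" "ed (\<sigma> (Y i)) = ed (Y i)" if "i < n" for i using sigma_X sigma_ed Y(1)[OF that] by auto
  have vxY: "vx (Y i) = u i" "vx (\<sigma> (Y i)) = u (Suc i)" if "i < n" for i
    using vxu[OF Y(1)[OF that] Y(3)[OF that]] vxu[OF sY(1)[OF that] Y(4)[OF that]] that by auto
  define vs where "vs = map u [0..<n]"
  define es where "es = map (\<lambda>i. ed (Y i)) [0..<n]"
  have u_int: "u i \<noteq> v" if "0 < i" "i < n" for i
  proof
    assume "u i = v"
    then have "vx (Y i) = v" using vxY(1)[OF that(2)] by simp
    then have "f i = g1 \<or> f i = g2" using two_gaps Nv(1)[OF Y(1)[OF that(2)]] Y(3)[OF that(2)] by simp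
    then show False using finj[of i 0] finj[of i n] f(1,2) that by auto
  qed
  have dvs: "distinct vs"
  proof -
    have "inj_on u {0..<n}"
    proof (rule inj_onI)
      fix i j assume ij: "i \<in> {0..<n}" "j \<in> {0..<n}" "u i = u j"
      show "i = j"
      proof (cases "i = 0 \<or> j = 0")
        case True
        then have "u i = v \<or> u j = v" by (auto simp: u_def)
        then show ?thesis using u_int[of i] u_int[of j] ij True by auto
      next
        case False
        then have "f i = f j" using ij by (simp add: u_def)
        then show ?thesis using finj[of i j] ij by simp
      qed
    qed
    then show ?thesis unfolding vs_def by (simp add: distinct_map)
  qed
  have des: "distinct es"
  proof -
    have ne: "ed (Y i) \<noteq> ed (Y j)" if ij: "i < j" "j < n" for i j
    proof
      assume eq: "ed (Y i) = ed (Y j)"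
      have i: "i < n" using ij by simp
      have f_ij: "f i \<noteq> f j" "f i \<noteq> f (Suc j)" using finj[of i j] finj[of i "Suc j"] ij by auto
      have ts: "\<tau> (\<sigma> (Y i)) \<in> X" "ed (\<tau> (Y i)) = ed (Y i)" using tau_X[OF sY(1)[OF i]] tau_ed_vx(1)[OF Y(1)[OF i]] by auto
      show False
      proof (rule flags.same_edge[OF Y(1)[OF i] Y(1)[OF ij(2)] eq])
        assume "Y j = Y i"
        then show False using Y(3)[OF i] Y(3)[OF ij(2)] f_ij(1) by simp
      next
        fix m assume m: "Y j = flags.act m (Y i)"
        show False
        proof (cases m)
          case Seg
          then show False using m N_tau[OF Y(1,2)[OF i]] Y(3)[OF i] Y(3)[OF ij(2)] f_ij(1) by simp
        next
          case Side
          then have "\<sigma> (Y j) = Y i" using m sigma_X[OF Y(1)[OF i]] by simp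
          then show False using Y(3)[OF i] Y(4)[OF ij(2)] f_ij(2) by simp
        next
          case Diag
          then have "Y j = \<sigma> (\<tau> (Y i))" using m flags.tau_sigma[OF Y(1)[OF i]] by simp
          then have "\<sigma> (Y j) = \<tau> (Y i)" using sigma_X tau_X[OF Y(1)[OF i]] by simp
          then show False using N_tau[OF Y(1,2)[OF i]] Y(3)[OF i] Y(4)[OF ij(2)] f_ij(2) by simp
        qed
      qed
    qed
    have "inj_on (\<lambda>i. ed (Y i)) {0..<n}"
    proof (rule inj_onI)
      fix i j assume "i \<in> {0..<n}" "j \<in> {0..<n}" "ed (Y i) = ed (Y j)"
      then show "i = j" using ne[of i j] ne[of j i] by (cases i j rule: linorder_cases) auto
    qed
    then show ?thesis unfolding es_def by (simp add: distinct_map)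
  qed
  have ends: "{w \<in> V. w \<inter> es ! i \<noteq> {}} = {vs ! i, vs ! (Suc i mod n)}" if i: "i < n" for i
  proof -
    have eE: "ed (Y i) \<in> E" using X_ed[OF Y(1)[OF i]] by blast
    have "vx ` {x \<in> X. ed x = ed (Y i)} = {vx (Y i), vx (\<sigma> (Y i))}"
    proof
      show "vx ` {x \<in> X. ed x = ed (Y i)} \<subseteq> {vx (Y i), vx (\<sigma> (Y i))}"
      proof
        fix w assume "w \<in> vx ` {x \<in> X. ed x = ed (Y i)}"
        then obtain x where x: "x \<in> X" "ed (Y i) = ed x" "w = vx x" by auto
        have "x \<in> {Y i, \<tau> (Y i), \<sigma> (Y i), \<tau> (\<sigma> (Y i))}" by (rule flags.ed_eq[OF Y(1)[OF i] x(1,2)])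
        then show "w \<in> {vx (Y i), vx (\<sigma> (Y i))}"
          using x(3) tau_ed_vx(2)[OF Y(1)[OF i]] tau_ed_vx(2)[OF sY(1)[OF i]] by auto
      qed
      show "{vx (Y i), vx (\<sigma> (Y i))} \<subseteq> vx ` {x \<in> X. ed x = ed (Y i)}" using Y(1)[OF i] sY[OF i] by auto
    qed
    moreover have "vs ! i = u i" "es ! i = ed (Y i)" using i by (simp_all add: vs_def es_def)
    moreover have "vs ! (Suc i mod n) = u (Suc i)"
    proof (cases "Suc i < n")
      case True then show ?thesis by (simp add: vs_def)
    next
      case False
      then have "Suc i = n" using i by simp
      then show ?thesis using n by (simp add: vs_def u_def)
    qed
    ultimately show ?thesis using ends_flags[OF eE] vxY[OF i] by simp
  qed
  have es_E: "set es \<subseteq> E" unfolding es_def using X_ed Y(1) by auto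
  have vs_V: "set vs \<subseteq> V"
  proof
    fix w assume "w \<in> set vs"
    then obtain i where i: "i < n" "w = u i" unfolding vs_def by auto
    then show "w \<in> V" using vxY(1)[OF i(1)] X_vx[OF Y(1)[OF i(1)]] by auto
  qed
  have cyc: "cyclic_edges vs es" unfolding cyclic_edges_def
    using dvs des ends es_E vs_V n by (auto simp: vs_def es_def)
  have "vs ! 0 = v" using n by (simp add: vs_def u_def)
  then have v_in: "v \<in> set vs" using n nth_mem[of 0 vs] by (simp add: vs_def)
  (* the cycle leaves v through the gap g1 and returns through the gap g2 *)
  define y2 y4 where "y2 = Y 0" and "y4 = \<sigma> (Y (n - 1))"
  have n1: "n - 1 < n" "Suc (n - 1) = n" using n by auto
  have y2: "y2 \<in> X" "ed y2 \<noteq> e" "ed y2 \<in> set es" "vx y2 = v" "y2 \<in> g1"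
    using Y(1,2)[OF n] vxY(1)[OF n] Nv(2)[OF Y(1)[OF n]] Y(3)[OF n] f(1) n by (auto simp: y2_def es_def u_def)
  have y4: "y4 \<in> X" "ed y4 \<noteq> e" "ed y4 \<in> set es" "vx y4 = v" "y4 \<in> g2"
    using sY[OF n1(1)] Y(2)[OF n1(1)] vxY(2)[OF n1(1)] Nv(2)[OF sY(1)[OF n1(1)]] Y(4)[OF n1(1)] f(2) n1
    by (auto simp: y4_def es_def u_def)
  obtain s2 where s2: "s2 \<in> segs_of v" "s2 \<notin> segs_of e" "y2 \<in> s2" "s2 \<subseteq> ed y2" using own_seg[OF y2(1,2)] y2(4) by auto
  obtain s4 where s4: "s4 \<in> segs_of v" "s4 \<notin> segs_of e" "y4 \<in> s4" "s4 \<subseteq> ed y4" using own_seg[OF y4(1,2)] y4(4) by auto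
  have s24: "s2 \<in> components (v \<inter> \<Union>(set es))" "s4 \<in> components (v \<inter> \<Union>(set es))"
    unfolding seg_components_of_edges[OF e(2) es_E] using s2 s4 y2(3) y4(3) by blast+
  have "s2 \<subseteq> g1" "s4 \<subseteq> g2"
    using loop_gap_pieces(2)[OF L g1(1), of s2] loop_gap_pieces(2)[OF L g2(1), of s4] s2 s4 y2(5) y4(5) by blast+
  moreover have g_dis: "g1 \<inter> g2 = {}" using gap_eq[OF g1(1) g2(1)] g12 by blast
  ultimately have s2_4: "s2 \<noteq> s4" using s2(3) by blast
  obtain s1 where s1: "s1 \<in> segs_of e" using segs_of_edge_nonempty[OF e(1)] by blast
  obtain s3 where s3: "s3 \<in> segs_of e" "s3 \<noteq> s1" "segs_of e = {s1, s3}" using edge_segs[OF e(1) s1] .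
  have S: "s1 \<in> segs" "s2 \<in> segs" "s3 \<in> segs" "s4 \<in> segs" using s1 s2 s3 s4 by (auto simp: segs_of_def)
  have dis: "s \<inter> s2 = {} \<and> s \<inter> s4 = {}" if "s \<in> segs_of e" for s
  proof -
    have "s \<in> segs" "s \<noteq> s2" "s \<noteq> s4" using that s2(2) s4(2) by (auto simp: segs_of_def)
    then show ?thesis using seg_eq[of s s2] seg_eq[of s s4] S by blast
  qed
  have s13: "s1 \<in> components (v \<inter> \<Union>{e})" "s3 \<in> components (v \<inter> \<Union>{e})"
    using s1 s3(1) by (simp_all add: loop_segs(2)[OF L])
  obtain p1 where p1: "p1 \<in> s1" using seg_nonempty[OF S(1)] by blast
  obtain p3 where p3: "p3 \<in> s3" using seg_nonempty[OF S(3)] by blast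
  have vE: "v \<in> V \<union> E" using e by simp
  have bd: "s1 \<subseteq> surface_boundary v" "s2 \<subseteq> surface_boundary v" "s3 \<subseteq> surface_boundary v" "s4 \<subseteq> surface_boundary v"
    using segs_of_boundary[OF vE] s2(1) s4(1) s1 s3(1) loop_segs(3)[OF L] S by (auto simp: segs_of_def)
  obtain \<gamma> where \<gamma>: "simple_path \<gamma>" "pathfinish \<gamma> = pathstart \<gamma>" "path_image \<gamma> = surface_boundary v" "pathstart \<gamma> = p1"
    using circle_path_from[OF circle[OF vE], of p1] p1 bd(1) by blast
  have \<gamma>01: "\<gamma> 0 = p1" "\<gamma> 1 = p1" using \<gamma>(2,4) by (auto simp: pathstart_def pathfinish_def)
  have lf: "a = b \<or> a = 0 \<and> b = 1 \<or> a = 1 \<and> b = 0" if "a \<in> {0..1}" "b \<in> {0..1}" "\<gamma> a = \<gamma> b" for a b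
    using \<gamma>(1) that unfolding simple_path_def loop_free_def by blast
  have param: "\<exists>t. 0 < t \<and> t < 1 \<and> \<gamma> t = p" if p: "p \<in> surface_boundary v" "p \<noteq> p1" for p
  proof -
    obtain t where t: "t \<in> {0..1}" "p = \<gamma> t" using p(1) unfolding \<gamma>(3)[symmetric] path_image_def by blast
    then have "t \<noteq> 0" "t \<noteq> 1" using p(2) \<gamma>01 by auto
    then show ?thesis using t by (intro exI[of _ t]) auto
  qed
  have s1_3: "s1 \<inter> s3 = {}" using seg_eq[OF S(1,3)] s3(2) by blast
  have "p3 \<noteq> p1" "y2 \<noteq> p1" "y4 \<noteq> p1" using s1_3 dis[OF s1] p1 p3 s2(3) s4(3) by blast+
  then obtain t2 t3 t4 where t2: "0 < t2" "t2 < 1" "\<gamma> t2 = y2" and t3: "0 < t3" "t3 < 1" "\<gamma> t3 = p3"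
    and t4: "0 < t4" "t4 < 1" "\<gamma> t4 = y4"
    using param[of p3] param[of y2] param[of y4] bd p3 s2(3) s4(3) by blast
  have K: "g1 \<in> components (surface_boundary v - \<Union>(relint ` segs_of e))"
    using g1(1) unfolding ribbon_surface.gaps_of_def[OF loop_ribbon_surface[OF L]] gaps_def loop_segs(4)[OF L] .
  (* both segments of e must be crossed, one on either side, when moving from g1 to g2 *)
  have between: "a < t3 \<and> t3 < b" if ab: "0 < a" "a < b" "b < 1"
    and pts: "\<gamma> a = y2 \<and> \<gamma> b = y4 \<or> \<gamma> a = y4 \<and> \<gamma> b = y2" for a b
  proof (rule ccontr)
    assume out: "\<not> (a < t3 \<and> t3 < b)"
    have avoid: "s \<inter> \<gamma> ` {a..b} = {}" if s: "s \<in> segs_of e" and r: "r \<notin> {a<..<b}" "r \<in> {0..1}" "\<gamma> r \<in> s" for s r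
    proof (rule ccontr)
      assume "s \<inter> \<gamma> ` {a..b} \<noteq> {}"
      then obtain z where z: "z \<in> s" "z \<in> \<gamma> ` {a..b}" by blast
      have nab: "\<gamma> a \<notin> s" "\<gamma> b \<notin> s" using pts dis[OF s] s2(3) s4(3) by auto
      obtain c where c: "c \<in> {a..b}" "z = \<gamma> c" using z(2) by (rule imageE)
      have "c \<noteq> a" "c \<noteq> b" using c(2) z(1) nab by auto
      then have zc: "z \<in> \<gamma> ` {a<..<b}" using c by (intro image_eqI[of _ _ c]) auto
      have "s = s1 \<or> s = s3" using s s3(3) by simp
      then have sp: "s \<subseteq> path_image \<gamma>" and "s \<in> segs" using bd(1,3) S(1,3) unfolding \<gamma>(3) by blast+
      then have sc: "connected s" by (intro arc_connected seg_arc)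
      have "s \<subseteq> \<gamma> ` {a<..<b}"
        by (rule simple_loop_separates[OF \<gamma>(1) _ ab(2) _ sc sp nab z(1) zc]) (use ab in simp_all)
      then have "\<gamma> r \<in> \<gamma> ` {a<..<b}" using r(3) by (rule subsetD)
      then obtain q where q: "q \<in> {a<..<b}" "\<gamma> r = \<gamma> q" by (elim imageE)
      then have "r = q \<or> r = 0 \<and> q = 1 \<or> r = 1 \<and> q = 0" by (intro lf r(2) q(2)) (use q(1) ab in simp)
      then show False using q(1) r(1) ab by auto
    qed
    have "s1 \<inter> \<gamma> ` {a..b} = {}" by (rule avoid[OF s1, of 0]) (use \<gamma>01(1) p1 ab in simp_all)
    moreover have "s3 \<inter> \<gamma> ` {a..b} = {}" by (rule avoid[OF s3(1), of t3]) (use out t3 p3 in simp_all)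
    moreover have "\<gamma> ` {a..b} \<subseteq> surface_boundary v" unfolding \<gamma>(3)[symmetric] path_image_def using ab by auto
    ultimately have sub: "\<gamma> ` {a..b} \<subseteq> surface_boundary v - \<Union>(relint ` segs_of e)"
      unfolding s3(3) relint_def by blast
    have "continuous_on {a..b} \<gamma>"
      using \<gamma>(1) ab by (auto simp: simple_path_def path_def intro: continuous_on_subset)
    then have "connected (\<gamma> ` {a..b})" by (intro connected_continuous_image) auto
    moreover have y24: "y2 \<in> \<gamma> ` {a..b}" "y4 \<in> \<gamma> ` {a..b}" using pts ab by (auto intro: image_eqI[of _ _ a] image_eqI[of _ _ b])
    ultimately have "\<gamma> ` {a..b} \<subseteq> g1" using components_maximal[OF K _ sub] y2(5) by blast
    then show False using y24(2) y4(5) g_dis by blast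
  qed
  have dist: "distinct [s1, s2, s3, s4]" "distinct [s1, s4, s3, s2]"
    using s1 s2(2) s3 s4(2) s2_4 by auto
  have "alternating v {e} (set es)"
  proof (cases "t2 < t4")
    case True
    then have ord: "t2 < t3" "t3 < t4" using between[of t2 t4] t2 t4 by auto
    show ?thesis
      by (rule alternatingI[of \<gamma> v 0 t2 t3 t4 s1 "{e}" s3 s2 "set es" s4, OF \<gamma>(1-3) order_refl _ _ _ _ s13 s24 dist(1)])
         (simp_all add: t2 t3 t4 \<gamma>01(1) p1 p3 s2(3) s4(3) ord)
  next
    case False
    have "t2 \<noteq> t4" using t2(3) t4(3) y2(5) y4(5) g_dis by auto
    then have "t4 < t2" using False by simp
    then have ord: "t4 < t3" "t3 < t2" using between[of t4 t2] t2 t4 by auto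
    show ?thesis
      by (rule alternatingI[of \<gamma> v 0 t4 t3 t2 s1 "{e}" s3 s4 "set es" s2, OF \<gamma>(1-3) order_refl _ _ _ _ s13 s24(2,1) dist(2)])
         (simp_all add: t2 t3 t4 \<gamma>01(1) p1 p3 s2(3) s4(3) ord)
  qed
  then show ?thesis using cyc v_in by blast
qed

end

section \<open>Loops and ribbon loops\<close>

theorem proposition5p8:
  fixes G :: "'a::t2_space ribbon_rep" and e :: "'a set"
  assumes "ribbon_graph G" and "e \<in> edges G"
  shows "(loop_in G e \<longleftrightarrow> ribbon_loop (delta_matroid_of G) e) \<and>
         (orientable_loop G e \<longleftrightarrow> orientable_ribbon_loop (delta_matroid_of G) e) \<and>
         (trivial_loop G e \<longleftrightarrow> trivial_ribbon_loop (delta_matroid_of G) e)"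
proof -
  interpret ribbon_surface "verts G" "edges G" by (rule ribbon_graph_surface[OF assms(1)])
  let ?D = "delta_matroid_of G"
  have e: "e \<in> ed ` X" using ed_X assms(2) by simp
  have D: "?D = flags.set_system"
  proof -
    have "num_boundary_components (spanning_subgraph G A) = num_components G \<longleftrightarrow> flags.feasible A" if "A \<subseteq> edges G" for A
      using feasible_iff_card_components[OF that]
      by (simp add: num_boundary_components_def num_components_def spanning_subgraph_def surface_of_def S_def)
    moreover have "A \<subseteq> edges G" if "flags.feasible A" for A using that ed_X by (simp add: flags.feasible_def)
    ultimately show ?thesis unfolding delta_matroid_of_def using ed_X by auto
  qed
  have loop: "loop_in G e \<longleftrightarrow> flags.all_joined flags.seg_state e"
    using loop_iff_card_ends[OF assms(2)] assms(2) by (simp add: loop_in_def ends_def)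
  have rloop: "ribbon_loop ?D e \<longleftrightarrow> flags.all_joined flags.seg_state e"
    unfolding D by (rule flags.ribbon_loop_iff[OF e])
  show ?thesis
  proof (cases "loop_in G e")
    case False
    then have "\<not> ribbon_loop ?D e" using loop rloop by simp
    then show ?thesis using False
      by (simp add: orientable_loop_def trivial_loop_def orientable_ribbon_loop_def
          nonorientable_ribbon_loop_def trivial_ribbon_loop_def)
  next
    case True
    then have al: "flags.all_joined flags.seg_state e" using loop by simp
    obtain v where v: "ends G e = {v}" using True card_1_singletonE unfolding loop_in_def by blast
    then have L: "loop_at e v" using assms(2) by (simp add: loop_at_def ends_def)
    have "surface_of (loop_subgraph G e) = v \<union> e" using v by (simp add: surface_of_def loop_subgraph_def Un_commute)
    then have non: "nonorientable_loop G e \<longleftrightarrow> nonorientable_ribbon_loop ?D e"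
      unfolding D flags.nonorientable_ribbon_loop_iff[OF al e] nonorientable_loop_def
      using True loop_moebius_iff[OF L] by simp
    have inter: "interlaced (loop_subgraph G e) C \<longleftrightarrow> v \<in> verts C \<and> alternating v {e} (edges C)" for C
    proof -
      have "{v} \<inter> verts C = {w} \<longleftrightarrow> w = v \<and> v \<in> verts C" for w by auto
      then show ?thesis by (simp add: interlaced_alternating loop_subgraph_def v)
    qed
    have cyc: "cycle_of G C \<longleftrightarrow> (\<exists>vs es. cyclic_edges vs es \<and> set vs = verts C \<and> set es = edges C)" for C
      unfolding cycle_of_def cyclic_edges_def ends_def by (rule iff_exI, rule iff_exI) auto
    have "(\<exists>C. cycle_of G C \<and> interlaced (loop_subgraph G e) C) \<longleftrightarrow>
        (\<exists>x\<in>X. ed x = e \<and> (x, \<tau> x) \<in> avoiding e)"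
    proof
      assume "\<exists>C. cycle_of G C \<and> interlaced (loop_subgraph G e) C"
      then obtain C where C: "cycle_of G C" "interlaced (loop_subgraph G e) C" by blast
      obtain vs es where vs: "cyclic_edges vs es" "set vs = verts C" "set es = edges C" using C(1) cyc by blast
      have "v \<in> set vs" "alternating v {e} (set es)" using C(2) inter vs by auto
      then show "\<exists>x\<in>X. ed x = e \<and> (x, \<tau> x) \<in> avoiding e" by (rule alternating_imp_crossing[OF L vs(1)])
    next
      assume "\<exists>x\<in>X. ed x = e \<and> (x, \<tau> x) \<in> avoiding e"
      then obtain x where x: "x \<in> X" "ed x = e" "(x, \<tau> x) \<in> avoiding e" by blast
      obtain vs es where vs: "cyclic_edges vs es" "v \<in> set vs" "alternating v {e} (set es)"
        using crossing_imp_alternating[OF L x] by blast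
      define C where "C = \<lparr>verts = set vs, edges = set es\<rparr>"
      have "cycle_of G C" using cyc[of C] vs(1) by (auto simp: C_def)
      moreover have "interlaced (loop_subgraph G e) C" using inter[of C] vs(2,3) by (auto simp: C_def)
      ultimately show "\<exists>C. cycle_of G C \<and> interlaced (loop_subgraph G e) C" by blast
    qed
    then have "trivial_loop G e \<longleftrightarrow> trivial_ribbon_loop ?D e"
      unfolding D flags.trivial_ribbon_loop_iff[OF al e] trivial_loop_def using True by blast
    moreover have "orientable_loop G e \<longleftrightarrow> orientable_ribbon_loop ?D e"
      using non True al rloop by (simp add: orientable_loop_def orientable_ribbon_loop_def)
    ultimately show ?thesis using True al rloop by blast
  qed
qed

end
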